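(* Let $1<p<\infty$ and let $X=\mathbf{R}^n$ be equipped with a measure $d\mu=w\,dx$, where $w$ is a $p$-admissible weight. Let $\mathrm{cap}_{p,\mu}$ be the condenser capacity defined by Heinonen, Kilpeläinen and Martio through the three-step procedure (compact, open, arbitrary sets). If $\Omega\subset\mathbf{R}^n$ is a nonempty open set and $E\subset\Omega$, then $$\mathrm{cap}_p(E,\Omega)=\mathrm{cap}_{p,\mu}(E,\Omega).$$
   Context: $p$-admissible weights: a weight $w$ on $\mathbf{R}^n$ (nonnegative, locally integrable, $0<w<\infty$ a.e.) is $p$-admissible if $d\mu=w\,dx$ is globally doubling and supports a global $p$-Poincaré inequality, i.e. there are $C>0$, $\lambda\ge1$ such that $\mu(2B)\le C\mu(B)$ for all balls $B$ and $\frac1{\mu(B)}\int_B|u-u_B|\,d\mu\le Cr_B\bigl(\frac1{\mu(\lambda B)}\int_{\lambda B}g^p\,d\mu\bigr)^{1/p}$ for all balls $B$ with radius $r_B$, all integrable $u$ on $\lambda B$ and all $p$-weak upper gradients $g$ of $u$ in $\lambda B$, where $u_B=\frac1{\mu(B)}\int_Bu\,d\mu$ (for $1<p<\infty$ this is equivalent to the original definition of Heinonen–Kilpeläinen–Martio). Balls are open, and $\lambda B(x,r)=B(x,\lambda r)$; $\mu$ is taken as a complete Borel measure. The capacity $\mathrm{cap}_{p,\mu}$: for compact $K\subset\Omega$, $\mathrm{cap}_{p,\mu}(K,\Omega)=\inf_u\int_\Omega|\nabla u|^p\,d\mu$, infimum over $u\in C_0^\infty(\Omega)$ with $u\ge1$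 on $K$; for open $G\subset\Omega$, $\mathrm{cap}_{p,\mu}(G,\Omega)=\sup\{\mathrm{cap}_{p,\mu}(K,\Omega):K\subset G\text{ compact}\}$; and for arbitrary $E\subset\Omega$, $\mathrm{cap}_{p,\mu}(E,\Omega)=\inf\{\mathrm{cap}_{p,\mu}(G,\Omega):G\text{ open},\ E\subset G\subset\Omega\}$. Upper gradients (with $X=\mathbf{R}^n$, Euclidean metric, measure $\mu$). A curve is a nonconstant compact rectifiable curve, parameterized by arc length $ds$. A property holds for $p$-almost every curve if there is a nonnegative $\rho\in L^p(X)$ with $\int_\gamma\rho\,ds=\infty$ for every curve $\gamma$ for which it fails. A measurable $g:X\to[0,\infty]$ is a $p$-weak upper gradient of $f:X\to[-\infty,\infty]$ if for $p$-almost all curves $\gamma:[0,l_\gamma]\to X$, $|f(\gamma(0))-f(\gamma(l_\gamma))|\le\int_\gamma g\,ds$, where the left-hand side is $\infty$ if at least one of the terms is infinite. If $f$ has a $p$-weak upper gradient in $L^p_{\rm loc}(X)$, then $g_f$ denotes its minimal $p$-weak upper gradient ($g_f\le g$ a.e. for every $p$-weak upper gradient $g\in L^p_{\rm loc}(X)$ of $f$). $N^{1,p}(X)$ is the space of measurable $f$, defined everywhere with values in $[-\infty,\infty]$, with $\int_X|f|^p\,d\mu+\inf_g\int_X g^p\,d\mu<\infty$, infimum over all $p$-weak upper gradients $g$ of $f$. For measurable subsets these notions are defined by regarding the subset as a metric space. The capacity $\mathrm{cap}_p$: for bounded $E\subset\Omega$, $\mathrm{cap}_p(E,\Omega)=\inf_u\int_\Omega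 g_u^p\,d\mu$ over $u\in N^{1,p}(X)$ with $\chi_E\le u\le\chi_\Omega$ ($=\infty$ if there is no such $u$), where $\chi_A$ is the characteristic function of $A$; for unbounded $E\subset\Omega$, $\mathrm{cap}_p(E,\Omega)=\lim_{j\to\infty}\mathrm{cap}_p(E\cap B(x_0,j),\Omega)$, where $x_0\in X$ is any fixed point. *)

theory Defs
  imports "HOL-Analysis.Analysis"
begin

section \<open>Powers of extended nonnegative reals\<close>

text \<open>Only used with exponents \<open>a > 0\<close>, so that \<open>0\<^sup>a = 0\<close> and \<open>\<infinity>\<^sup>a = \<infinity>\<close>.\<close>

definition ennreal_powr :: "ennreal \<Rightarrow> real \<Rightarrow> ennreal"  (infixr \<open>epowr\<close> 80) where
  "x epowr a = (if x = \<infinity> then \<infinity> else ennreal (enn2real x powr a))"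


section \<open>Curves\<close>

definition curve_length :: "(real \<Rightarrow> 'a::metric_space) \<Rightarrow> real \<Rightarrow> real \<Rightarrow> ennreal" where
  "curve_length \<gamma> a b =
     (SUP ts\<in>{ts. sorted ts \<and> set ts \<subseteq> {a..b}}.
        \<Sum>i<length ts - 1. ennreal (dist (\<gamma> (ts ! i)) (\<gamma> (ts ! Suc i))))"

text \<open>
  A nonconstant compact rectifiable curve in \<open>A\<close>, parameterized by arc length on \<open>[0, l]\<close>;
  it is nonconstant iff its length \<open>l\<close> is positive. Values of \<open>\<gamma>\<close> outside \<open>[0, l]\<close> are irrelevant.
\<close>

definition arc_length_curve :: "'a::metric_space set \<Rightarrow> real \<Rightarrow> (real \<Rightarrow> 'a) \<Rightarrow> bool" where
  "arc_length_curve A l \<gamma> \<longleftrightarrow>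
     0 < l \<and> continuous_on {0..l} \<gamma> \<and> \<gamma> ` {0..l} \<subseteq> A \<and>
     (\<forall>t\<in>{0..l}. curve_length \<gamma> 0 t = ennreal t)"

text \<open>
  If \<open>\<rho> \<circ> \<gamma>\<close> is not measurable on \<open>[0, l]\<close>, this is a lower integral. This does not affect the
  notions below: for Lebesgue measurable \<open>\<rho>\<close> and a measure with the null sets of Lebesgue measure,
  \<open>\<rho> \<circ> \<gamma>\<close> is measurable for \<open>p\<close>-almost every \<open>\<gamma>\<close>; and \<open>\<rho>\<close> has a Borel majorant
  to which it is equal almost everywhere, so that exceptional families can always be witnessed
  by Borel functions.
\<close>

definition line_integral :: "real \<Rightarrow> (real \<Rightarrow> 'a) \<Rightarrow> ('a \<Rightarrow> ennreal) \<Rightarrow> ennreal" where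
  "line_integral l \<gamma> \<rho> = (\<integral>\<^sup>+t\<in>{0..l}. \<rho> (\<gamma> t) \<partial>lebesgue)"


section \<open>Weak upper gradients and Newtonian functions\<close>

text \<open>
  The argument \<open>A\<close> is a measurable subset of the space, regarded as a metric measure space in its
  own right; the values outside \<open>A\<close> of the functions involved are irrelevant.
\<close>

definition almost_every_curve ::
    "real \<Rightarrow> 'a::metric_space measure \<Rightarrow> 'a set \<Rightarrow> (real \<Rightarrow> (real \<Rightarrow> 'a) \<Rightarrow> bool) \<Rightarrow> bool" where
  "almost_every_curve p M A P \<longleftrightarrow>
     (\<exists>\<rho>::'a \<Rightarrow> ennreal.
        \<rho> \<in> borel_measurable (restrict_space M A) \<and>
        (\<integral>\<^sup>+x\<in>A. \<rho> x epowr p \<partial>M) < \<infinity> \<and>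
        (\<forall>l \<gamma>. arc_length_curve A l \<gamma> \<and> \<not> P l \<gamma> \<longrightarrow> line_integral l \<gamma> \<rho> = \<infinity>))"

definition endpoint_diff :: "ereal \<Rightarrow> ereal \<Rightarrow> ennreal" where
  "endpoint_diff a b =
     (if \<bar>a\<bar> = \<infinity> \<or> \<bar>b\<bar> = \<infinity> then \<infinity> else ennreal \<bar>real_of_ereal a - real_of_ereal b\<bar>)"

definition weak_upper_gradient ::
    "real \<Rightarrow> 'a::metric_space measure \<Rightarrow> 'a set \<Rightarrow> ('a \<Rightarrow> ereal) \<Rightarrow> ('a \<Rightarrow> ennreal) \<Rightarrow> bool" where
  "weak_upper_gradient p M A f g \<longleftrightarrow>
     g \<in> borel_measurable (restrict_space M A) \<and>
     almost_every_curve p M A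
       (\<lambda>l \<gamma>. endpoint_diff (f (\<gamma> 0)) (f (\<gamma> l)) \<le> line_integral l \<gamma> g)"

definition Lp_loc :: "real \<Rightarrow> 'a::metric_space measure \<Rightarrow> ('a \<Rightarrow> ennreal) set" where
  "Lp_loc p M =
     {g. g \<in> borel_measurable M \<and> (\<forall>x. \<exists>r>0. (\<integral>\<^sup>+y\<in>ball x r. g y epowr p \<partial>M) < \<infinity>)}"

definition is_minimal_weak_upper_gradient ::
    "real \<Rightarrow> 'a::metric_space measure \<Rightarrow> ('a \<Rightarrow> ereal) \<Rightarrow> ('a \<Rightarrow> ennreal) \<Rightarrow> bool" where
  "is_minimal_weak_upper_gradient p M f g \<longleftrightarrow>
     weak_upper_gradient p M UNIV f g \<and> g \<in> Lp_loc p M \<and>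
     (\<forall>h. weak_upper_gradient p M UNIV f h \<and> h \<in> Lp_loc p M \<longrightarrow> (AE x in M. g x \<le> h x))"

text \<open>By minimality, the choice is unique up to a null set.\<close>

definition minimal_weak_upper_gradient ::
    "real \<Rightarrow> 'a::metric_space measure \<Rightarrow> ('a \<Rightarrow> ereal) \<Rightarrow> 'a \<Rightarrow> ennreal" where
  "minimal_weak_upper_gradient p M f = (SOME g. is_minimal_weak_upper_gradient p M f g)"

definition newtonian_space :: "real \<Rightarrow> 'a::metric_space measure \<Rightarrow> ('a \<Rightarrow> ereal) set" where
  "newtonian_space p M =
     {f. f \<in> borel_measurable M \<and>
         (\<integral>\<^sup>+x. e2ennreal \<bar>f x\<bar> epowr p \<partial>M)
           + (INF g\<in>{g. weak_upper_gradient p M UNIV f g}. \<integral>\<^sup>+x. g x epowr p \<partial>M) < \<infinity>}"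


section \<open>Admissible weights\<close>

definition weight :: "('a::euclidean_space \<Rightarrow> ennreal) \<Rightarrow> bool" where
  "weight w \<longleftrightarrow>
     w \<in> borel_measurable lebesgue \<and>
     (\<forall>K. compact K \<longrightarrow> (\<integral>\<^sup>+x\<in>K. w x \<partial>lebesgue) < \<infinity>) \<and>
     (AE x in lebesgue. 0 < w x \<and> w x < \<infinity>)"

text \<open>
  For a weight \<open>w\<close>, the measure \<open>w dx\<close> has the same null sets as Lebesgue measure, so that it is
  complete and its \<open>\<sigma>\<close>-algebra is the completion of the Borel \<open>\<sigma>\<close>-algebra.
\<close>

definition weighted_measure :: "('a::euclidean_space \<Rightarrow> ennreal) \<Rightarrow> 'a measure" where
  "weighted_measure w = density lebesgue w"

definition globally_doubling :: "real \<Rightarrow> 'a::metric_space measure \<Rightarrow> bool" where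
  "globally_doubling C M \<longleftrightarrow>
     (\<forall>x r. 0 < r \<longrightarrow> emeasure M (ball x (2 * r)) \<le> ennreal C * emeasure M (ball x r))"

definition integrable_ereal_on :: "'a measure \<Rightarrow> 'a set \<Rightarrow> ('a \<Rightarrow> ereal) \<Rightarrow> bool" where
  "integrable_ereal_on M A u \<longleftrightarrow>
     u \<in> borel_measurable (restrict_space M A) \<and> (\<integral>\<^sup>+x\<in>A. e2ennreal \<bar>u x\<bar> \<partial>M) < \<infinity>"

text \<open>The infinite values of an integrable function lie in a null set and may be replaced by \<open>0\<close>.\<close>

definition mean_value :: "'a measure \<Rightarrow> 'a set \<Rightarrow> ('a \<Rightarrow> ereal) \<Rightarrow> real" where
  "mean_value M B u = (LINT x:B|M. real_of_ereal (u x)) / measure M B"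

definition poincare_inequality :: "real \<Rightarrow> real \<Rightarrow> real \<Rightarrow> 'a::metric_space measure \<Rightarrow> bool" where
  "poincare_inequality p C \<kappa> M \<longleftrightarrow>
     (\<forall>x r u g. 0 < r \<and> integrable_ereal_on M (ball x (\<kappa> * r)) u \<and>
        weak_upper_gradient p M (ball x (\<kappa> * r)) u g \<longrightarrow>
        (\<integral>\<^sup>+y\<in>ball x r. e2ennreal \<bar>u y - ereal (mean_value M (ball x r) u)\<bar> \<partial>M)
            / emeasure M (ball x r)
          \<le> ennreal (C * r) *
            ((\<integral>\<^sup>+y\<in>ball x (\<kappa> * r). g y epowr p \<partial>M) / emeasure M (ball x (\<kappa> * r))) epowr (1 / p))"

definition p_admissible :: "real \<Rightarrow> ('a::euclidean_space \<Rightarrow> ennreal) \<Rightarrow> bool" where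
  "p_admissible p w \<longleftrightarrow>
     weight w \<and>
     (\<exists>C>0. \<exists>\<kappa>\<ge>1. globally_doubling C (weighted_measure w) \<and>
        poincare_inequality p C \<kappa> (weighted_measure w))"


section \<open>The Newtonian capacity\<close>

text \<open>The infimum of the empty set is \<open>\<infinity>\<close> in \<^typ>\<open>ennreal\<close>.\<close>

definition cap_bounded :: "real \<Rightarrow> 'a::metric_space measure \<Rightarrow> 'a set \<Rightarrow> 'a set \<Rightarrow> ennreal" where
  "cap_bounded p M E \<Omega> =
     (INF u\<in>{u \<in> newtonian_space p M. \<forall>x. indicator E x \<le> u x \<and> u x \<le> indicator \<Omega> x}.
        \<integral>\<^sup>+x\<in>\<Omega>. minimal_weak_upper_gradient p M u x epowr p \<partial>M)"

text \<open>The point \<open>x\<^sub>0\<close> is only relevant for unbounded \<open>E\<close>.\<close>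

definition newtonian_cap ::
    "real \<Rightarrow> 'a::metric_space measure \<Rightarrow> 'a \<Rightarrow> 'a set \<Rightarrow> 'a set \<Rightarrow> ennreal" where
  "newtonian_cap p M x\<^sub>0 E \<Omega> =
     (if bounded E then cap_bounded p M E \<Omega>
      else lim (\<lambda>j::nat. cap_bounded p M (E \<inter> ball x\<^sub>0 (real j)) \<Omega>))"


section \<open>The Heinonen--Kilpelainen--Martio capacity\<close>

definition partial_derivative ::
    "'a::euclidean_space \<Rightarrow> ('a \<Rightarrow> real) \<Rightarrow> 'a \<Rightarrow> real" where
  "partial_derivative i f x = frechet_derivative f (at x) i"

primrec Ck_smooth :: "nat \<Rightarrow> ('a::euclidean_space \<Rightarrow> real) \<Rightarrow> bool" where
  "Ck_smooth 0 f \<longleftrightarrow> continuous_on UNIV f"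
| "Ck_smooth (Suc k) f \<longleftrightarrow>
     f differentiable_on UNIV \<and> (\<forall>i\<in>Basis. Ck_smooth k (partial_derivative i f))"

definition grad :: "('a::euclidean_space \<Rightarrow> real) \<Rightarrow> 'a \<Rightarrow> 'a" where
  "grad f x = (\<Sum>i\<in>Basis. partial_derivative i f x *\<^sub>R i)"

text \<open>Functions in \<open>C\<^sub>0\<^sup>\<infinity>(\<Omega>)\<close>, with \<open>\<Omega>\<close> open, are extended by zero to the whole space.\<close>

definition test_functions :: "'a::euclidean_space set \<Rightarrow> ('a \<Rightarrow> real) set" where
  "test_functions \<Omega> =
     {u. (\<forall>k. Ck_smooth k u) \<and> compact (closure {x. u x \<noteq> 0}) \<and> closure {x. u x \<noteq> 0} \<subseteq> \<Omega>}"

definition cap_compact :: "real \<Rightarrow> 'a::euclidean_space measure \<Rightarrow> 'a set \<Rightarrow> 'a set \<Rightarrow> ennreal" where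
  "cap_compact p M K \<Omega> =
     (INF u\<in>{u \<in> test_functions \<Omega>. \<forall>x\<in>K. 1 \<le> u x}. \<integral>\<^sup>+x\<in>\<Omega>. ennreal (norm (grad u x) powr p) \<partial>M)"

definition cap_open :: "real \<Rightarrow> 'a::euclidean_space measure \<Rightarrow> 'a set \<Rightarrow> 'a set \<Rightarrow> ennreal" where
  "cap_open p M G \<Omega> = (SUP K\<in>{K. compact K \<and> K \<subseteq> G}. cap_compact p M K \<Omega>)"

text \<open>
  The lemmas \<open>hkm_cap_open\<close> and \<open>hkm_cap_compact\<close> below show that this agrees with the values
  already assigned to open and to compact sets.
\<close>

definition hkm_cap :: "real \<Rightarrow> 'a::euclidean_space measure \<Rightarrow> 'a set \<Rightarrow> 'a set \<Rightarrow> ennreal" where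
  "hkm_cap p M E \<Omega> = (INF G\<in>{G. open G \<and> E \<subseteq> G \<and> G \<subseteq> \<Omega>}. cap_open p M G \<Omega>)"

lemma GDERIV_grad:
  assumes "f differentiable (at x)"
  shows "GDERIV f x :> grad f x"
proof -
  let ?D = "frechet_derivative f (at x)"
  have D: "(f has_derivative ?D) (at x)"
    using assms by (simp add: frechet_derivative_works)
  then have lin: "linear ?D"
    by (simp add: has_derivative_linear)
  have "?D h = inner h (grad f x)" for h
  proof -
    have "?D h = ?D (\<Sum>i\<in>Basis. inner h i *\<^sub>R i)"
      by (simp add: euclidean_representation)
    also have "\<dots> = (\<Sum>i\<in>Basis. inner h i * ?D i)"
      using lin by (simp add: linear_sum linear_scale)
    also have "\<dots> = inner h (grad f x)"
      by (simp add: grad_def partial_derivative_def inner_sum_right mult.commute)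
    finally show ?thesis .
  qed
  then have "?D = (\<lambda>h. inner h (grad f x))"
    by auto
  with D show ?thesis
    by (simp add: gderiv_def)
qed

lemma hkm_cap_open:
  assumes "open G" "G \<subseteq> \<Omega>"
  shows "hkm_cap p M G \<Omega> = cap_open p M G \<Omega>"
proof (rule antisym)
  show "hkm_cap p M G \<Omega> \<le> cap_open p M G \<Omega>"
    unfolding hkm_cap_def using assms by (intro INF_lower) auto
  show "cap_open p M G \<Omega> \<le> hkm_cap p M G \<Omega>"
    unfolding hkm_cap_def cap_open_def by (intro INF_greatest SUP_subset_mono) auto
qed

lemma partial_derivative_cmult:
  assumes "f differentiable_on UNIV"
  shows "partial_derivative i (\<lambda>x. c * f x) = (\<lambda>x. c * partial_derivative i f x)"
proof
  fix x
  have "(f has_derivative frechet_derivative f (at x)) (at x)"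
    using assms by (auto simp: differentiable_on_def frechet_derivative_works)
  then have "((\<lambda>x. c * f x) has_derivative (\<lambda>h. c * frechet_derivative f (at x) h)) (at x)"
    by (rule has_derivative_mult_right)
  then show "partial_derivative i (\<lambda>x. c * f x) x = c * partial_derivative i f x"
    by (simp add: partial_derivative_def frechet_derivative_at[symmetric])
qed

lemma Ck_smooth_cmult: "Ck_smooth k f \<Longrightarrow> Ck_smooth k (\<lambda>x. c * f x)"
proof (induction k arbitrary: f)
  case 0
  then show ?case by (auto intro!: continuous_intros)
next
  case (Suc k)
  then show ?case
    by (auto simp: partial_derivative_cmult differentiable_on_def intro!: differentiable_mult)
qed

lemma Ck_smooth_1_continuous:
  assumes "Ck_smooth 1 f"
  shows "continuous_on UNIV f" "continuous_on UNIV (grad f)"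
proof -
  show "continuous_on UNIV f"
    using assms by (simp add: differentiable_imp_continuous_on)
  show "continuous_on UNIV (grad f)"
    using assms unfolding grad_def[abs_def] by (intro continuous_intros) simp
qed

lemma hkm_cap_compact:
  assumes K: "compact K" "K \<subseteq> \<Omega>" and \<Omega>: "open \<Omega>" and p: "0 < p"
    and M: "sets M = sets lebesgue"
  shows "hkm_cap p M K \<Omega> = cap_compact p M K \<Omega>"
proof (rule antisym)
  show "cap_compact p M K \<Omega> \<le> hkm_cap p M K \<Omega>"
    unfolding hkm_cap_def cap_open_def using K by (auto intro!: INF_greatest SUP_upper)
  show "hkm_cap p M K \<Omega> \<le> cap_compact p M K \<Omega>"
    unfolding cap_compact_def
  proof (rule INF_greatest)
    fix u assume "u \<in> {u \<in> test_functions \<Omega>. \<forall>x\<in>K. 1 \<le> u x}"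
    then have u: "u \<in> test_functions \<Omega>" "\<And>x. x \<in> K \<Longrightarrow> 1 \<le> u x" by auto
    then have C1: "Ck_smooth 1 u" by (simp add: test_functions_def del: One_nat_def)
    have cont: "continuous_on UNIV u" "continuous_on UNIV (grad u)"
      using Ck_smooth_1_continuous[OF C1] by auto
    define I where "I = (\<integral>\<^sup>+x\<in>\<Omega>. ennreal (norm (grad u x) powr p) \<partial>M)"
    have meas: "(\<lambda>x. ennreal (norm (grad u x) powr p) * indicator \<Omega> x) \<in> borel_measurable M"
    proof -
      note [measurable] = borel_measurable_continuous_onI[OF cont(2)] borel_open[OF \<Omega>]
      have "(\<lambda>x. ennreal (norm (grad u x) powr p) * indicator \<Omega> x) \<in> borel_measurable borel"
        by measurable
      then have "(\<lambda>x. ennreal (norm (grad u x) powr p) * indicator \<Omega> x) \<in> borel_measurable lebesgue"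
        by (simp add: measurable_completion)
      then show ?thesis
        using M by (simp cong: measurable_cong_sets)
    qed
    have le: "hkm_cap p M K \<Omega> \<le> ennreal (1 + e) * I" if e: "0 < e" for e :: real
    proof -
      define c where "c = (1 + e) powr (1 / p)"
      have c1: "1 < c" using e p by (simp add: c_def)
      have cp: "c powr p = 1 + e" using e p by (simp add: c_def powr_powr)
      define G where "G = {x. 1 < c * u x} \<inter> \<Omega>"
      have "open G"
        unfolding G_def using cont(1) \<Omega>
        by (intro open_Int open_Collect_less continuous_intros) auto
      have "K \<subseteq> G"
        using u(2) c1 K unfolding G_def by (fastforce intro: less_le_trans mult_left_mono)
      have cu: "(\<lambda>x. c * u x) \<in> test_functions \<Omega>"
        using u(1) c1 by (auto simp: test_functions_def Ck_smooth_cmult)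
      have grad_cu: "grad (\<lambda>x. c * u x) x = c *\<^sub>R grad u x" for x
        using C1 by (simp add: grad_def partial_derivative_cmult scaleR_sum_right)
      have "hkm_cap p M K \<Omega> \<le> cap_open p M G \<Omega>"
        unfolding hkm_cap_def using \<open>open G\<close> \<open>K \<subseteq> G\<close>
        by (intro INF_lower) (auto simp: G_def)
      also have "\<dots> \<le> (\<integral>\<^sup>+x\<in>\<Omega>. ennreal (norm (grad (\<lambda>x. c * u x) x) powr p) \<partial>M)"
        unfolding cap_open_def cap_compact_def using cu
        by (intro SUP_least INF_lower) (auto simp: G_def intro: less_imp_le)
      also have "\<dots> = (\<integral>\<^sup>+x. ennreal (1 + e) *
          (ennreal (norm (grad u x) powr p) * indicator \<Omega> x) \<partial>M)"
        using c1 e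
        by (intro nn_integral_cong)
          (simp add: grad_cu powr_mult cp ennreal_mult mult.assoc)
      also have "\<dots> = ennreal (1 + e) * I"
        unfolding I_def by (rule nn_integral_cmult[OF meas])
      finally show ?thesis .
    qed
    show "hkm_cap p M K \<Omega> \<le> (\<integral>\<^sup>+x\<in>\<Omega>. ennreal (norm (grad u x) powr p) \<partial>M)"
      unfolding I_def[symmetric]
    proof (cases "I = \<infinity>")
      case False
      have "((\<lambda>e. ennreal (1 + e) * I) \<longlongrightarrow> ennreal (1 + 0) * I) (at_right 0)"
        using False by (intro tendsto_mult_ennreal tendsto_ennrealI tendsto_intros) auto
      then have "((\<lambda>e. ennreal (1 + e) * I) \<longlongrightarrow> I) (at_right 0)" by simp
      then show "hkm_cap p M K \<Omega> \<le> I"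
        by (rule tendsto_lowerbound) (auto intro!: eventually_at_rightI[of 0 1] le simp del: ennreal_plus)
    qed auto
  qed
qed

end

theory Submission
  imports Defs "HOL-Complex_Analysis.Great_Picard" "HOL-Real_Asymp.Real_Asymp"
begin

text \<open>
  If smooth functions that are at least \<open>1\<close> on compact sets exhausting an open set \<open>G\<close> almost
  minimize the energy, uniform convexity makes their gradients a Cauchy sequence in \<open>L\<^sup>p\<close>.
  Along a fast subsequence \<open>u\<^sub>i\<close>, the function \<open>\<bar>u\<^sub>0\<bar> + \<Sum>\<^sub>i \<eta> \<bar>u\<^sub>i\<^sub>+\<^sub>1 - u\<^sub>i\<bar>\<close>, with a cutoff \<open>\<eta>\<close>,
  is at least \<open>1\<close> on the part of \<open>G\<close> where \<open>\<eta> \<ge> 1\<close>, and its upper gradient has hardly more energy.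
  This bounds the Newtonian capacity of bounded sets by the capacity of \<open>G\<close>.

  Conversely, a Newtonian competitor yields a lower semicontinuous \<open>q\<close> of almost the same energy
  whose integral is at least \<open>1\<close> along every curve from \<open>E\<close> to the complement of \<open>\<Omega>\<close> (or to
  infinity; unbounded \<open>E\<close> are again exhausted by means of uniform convexity). By compactness of
  families of curves of bounded length, the points from which every such curve has \<open>q\<close>-length
  greater than \<open>1 - \<epsilon>\<close> form an open set \<open>G \<supseteq> E\<close>, and for compact \<open>K \<subseteq> G\<close> the same bound holds for
  some continuous \<open>f \<le> q\<close>. The \<open>f\<close>-distance to the complement of \<open>\<Omega>\<close> is locally Lipschitz with
  constant \<open>f\<close>, and mollifying it gives a test function for \<open>K\<close>.
\<close>

section \<open>Curves and arc length\<close>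

text \<open>Two features of the definitions shape the proof.
  \<open>minimal_weak_upper_gradient\<close> is a choice that says something only once a minimal
  weak upper gradient is known to exist; this rests on the minimum of two weak upper gradients being
  one again. And upper gradient inequalities hold only for \<open>p\<close>-almost every curve,
  while the geometric argument needs all curves. Exceptional families are therefore absorbed into
  the density: a function of tiny energy, with infinite integral along every exceptional curve, is
  added to it. Semicontinuity of the density then makes the costs of paths lower semicontinuous, and
  a small positive continuous summand keeps cheap paths short in bounded sets. Uniform convexity
  enters because neither direction has one competitor for all compact or bounded parts. Competitors
  for one part form a convex set, so the midpoint of two near-minimizers cannot have much less
  energy than they have, which forces them to be close. A rapidly convergent sequence can then be
  dominated by a single function of almost the same energy.\<close>

fun chain_length :: "(real \<Rightarrow> 'a::metric_space) \<Rightarrow> real list \<Rightarrow> real" where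
  "chain_length \<gamma> (s # t # ts) = dist (\<gamma> s) (\<gamma> t) + chain_length \<gamma> (t # ts)"
| "chain_length \<gamma> [s] = 0"
| "chain_length \<gamma> [] = 0"

lemma chain_length_nonneg: "0 \<le> chain_length \<gamma> ts"
  by (induction \<gamma> ts rule: chain_length.induct) auto

text \<open>Recursion over the list replaces the sum over indices, so that refining and splitting a
  partition become inductions on lists.\<close>

lemma sum_dist_eq_chain_length:
  "(\<Sum>i<length ts - 1. ennreal (dist (\<gamma> (ts ! i)) (\<gamma> (ts ! Suc i)))) = ennreal (chain_length \<gamma> ts)"
proof (induction \<gamma> ts rule: chain_length.induct)
  case (1 \<gamma> s t ts)
  have "length (s # t # ts) - 1 = Suc (length (t # ts) - 1)" by simp
  then show ?case using 1
    by (simp only: sum.lessThan_Suc_shift) (simp add: chain_length_nonneg)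
qed auto

lemma chain_length_le_curve_length:
  "sorted ts \<Longrightarrow> set ts \<subseteq> {a..b} \<Longrightarrow> ennreal (chain_length \<gamma> ts) \<le> curve_length \<gamma> a b"
  unfolding curve_length_def sum_dist_eq_chain_length by (rule SUP_upper) auto

lemma curve_length_leI:
  "(\<And>ts. sorted ts \<Longrightarrow> set ts \<subseteq> {a..b} \<Longrightarrow> ennreal (chain_length \<gamma> ts) \<le> c) \<Longrightarrow> curve_length \<gamma> a b \<le> c"
  unfolding curve_length_def sum_dist_eq_chain_length by (rule SUP_least) auto

lemma chain_length_append:
  "chain_length \<gamma> (xs @ [a]) + chain_length \<gamma> (a # ys) = chain_length \<gamma> (xs @ a # ys)"
proof (induction xs)
  case (Cons x xs)
  then show ?case by (cases xs) auto
qed simp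

lemma chain_length_insert: "chain_length \<gamma> (xs @ ys) \<le> chain_length \<gamma> (xs @ a # ys)"
proof (induction xs)
  case Nil
  show ?case by (cases ys) auto
next
  case (Cons x xs)
  show ?case
  proof (cases xs)
    case Nil
    then show ?thesis
      by (cases ys) (auto simp: dist_triangle)
  next
    case (Cons z zs)
    then show ?thesis using Cons.IH by simp
  qed
qed

lemma chain_length_le_increment:
  assumes "\<And>s t. s \<in> {a..b} \<Longrightarrow> t \<in> {a..b} \<Longrightarrow> s \<le> t \<Longrightarrow> dist (\<gamma> s) (\<gamma> t) \<le> f t - (f s :: real)"
    and "sorted ts" "set ts \<subseteq> {a..b}" "ts \<noteq> []"
  shows "chain_length \<gamma> ts \<le> f (last ts) - f (hd ts)"
  using assms(2-4)
proof (induction ts rule: induct_list012)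
  case (3 s t ts)
  then show ?case using assms(1)[of s t] by auto
qed auto

lemma curve_length_le_increment:
  assumes "\<And>s t. s \<in> {a..b} \<Longrightarrow> t \<in> {a..b} \<Longrightarrow> s \<le> t \<Longrightarrow> dist (\<gamma> s) (\<gamma> t) \<le> t - s" "a \<le> b"
  shows "curve_length \<gamma> a b \<le> ennreal (b - a)"
proof (rule curve_length_leI)
  fix ts assume ts: "sorted ts" "set ts \<subseteq> {a..b}"
  show "ennreal (chain_length \<gamma> ts) \<le> ennreal (b - a)"
  proof (cases "ts = []")
    case False
    then have "chain_length \<gamma> ts \<le> last ts - hd ts"
      using chain_length_le_increment[where f="\<lambda>t. t" and \<gamma>=\<gamma>] assms ts by blast
    moreover have "last ts \<in> {a..b}" "hd ts \<in> {a..b}"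
      using subsetD[OF ts(2) last_in_set[OF False]] subsetD[OF ts(2) hd_in_set[OF False]] by simp_all
    ultimately show ?thesis by (auto intro!: ennreal_leI)
  qed auto
qed

text \<open>To cut a partition of \<open>{a..c}\<close> at \<open>b\<close>, the point
  \<open>b\<close> is inserted first, which by the triangle inequality cannot shorten the
  polygon.\<close>

lemma curve_length_split:
  assumes "a \<le> b" "b \<le> c"
  shows "curve_length \<gamma> a c \<le> curve_length \<gamma> a b + curve_length \<gamma> b c"
proof (rule curve_length_leI)
  fix ts assume ts: "sorted ts" "set ts \<subseteq> {a..c}"
  define xs where "xs = takeWhile (\<lambda>t. t \<le> b) ts"
  define ys where "ys = dropWhile (\<lambda>t. t \<le> b) ts"
  have eq: "ts = xs @ ys" by (simp add: xs_def ys_def)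
  have xs: "\<And>x. x \<in> set xs \<Longrightarrow> x \<le> b" unfolding xs_def by (meson set_takeWhileD)
  have ys: "\<And>y. y \<in> set ys \<Longrightarrow> b \<le> y"
  proof -
    fix y assume y: "y \<in> set ys"
    then have "ys \<noteq> []" by auto
    then have "b \<le> hd ys" using hd_dropWhile[of "\<lambda>t. t \<le> b" ts] by (simp add: ys_def)
    moreover have "sorted ys" using ts(1) eq by (simp add: sorted_append)
    ultimately show "b \<le> y" using y \<open>ys \<noteq> []\<close> by (cases ys) auto
  qed
  have "chain_length \<gamma> ts \<le> chain_length \<gamma> (xs @ [b]) + chain_length \<gamma> (b # ys)"
    unfolding eq chain_length_append by (rule chain_length_insert)
  then have "ennreal (chain_length \<gamma> ts) \<le> ennreal (chain_length \<gamma> (xs @ [b])) + ennreal (chain_length \<gamma> (b # ys))"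
    by (simp add: ennreal_leI chain_length_nonneg flip: ennreal_plus)
  also have "\<dots> \<le> curve_length \<gamma> a b + curve_length \<gamma> b c"
    using ts xs ys assms unfolding eq
    by (intro add_mono chain_length_le_curve_length) (auto simp: sorted_append)
  finally show "ennreal (chain_length \<gamma> ts) \<le> curve_length \<gamma> a b + curve_length \<gamma> b c" .
qed

text \<open>Append \<open>b\<close> and \<open>c\<close> to a partition of \<open>{a..b}\<close>.
  For a curve whose length on \<open>{0..t}\<close> is \<open>t\<close>, this is the reason why it
  is 1-Lipschitz, see \<open>arc_length_curve_dist\<close>.\<close>

lemma curve_length_add_dist:
  assumes "a \<le> b" "b \<le> c"
  shows "curve_length \<gamma> a b + ennreal (dist (\<gamma> b) (\<gamma> c)) \<le> curve_length \<gamma> a c"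
proof -
  have "curve_length \<gamma> a b + ennreal (dist (\<gamma> b) (\<gamma> c)) =
      (SUP ts\<in>{ts. sorted ts \<and> set ts \<subseteq> {a..b}}. ennreal (chain_length \<gamma> ts) + ennreal (dist (\<gamma> b) (\<gamma> c)))"
    unfolding curve_length_def sum_dist_eq_chain_length
    by (rule ennreal_SUP_add_left[symmetric]) (auto intro: exI[of _ "[]"])
  also have "\<dots> \<le> curve_length \<gamma> a c"
  proof (rule SUP_least, clarify)
    fix ts assume ts: "sorted ts" "set ts \<subseteq> {a..b}"
    have "chain_length \<gamma> ts + dist (\<gamma> b) (\<gamma> c) \<le> chain_length \<gamma> (ts @ [b]) + chain_length \<gamma> (b # [c])"
      using chain_length_insert[of \<gamma> ts "[]" b] by simp
    also have "\<dots> = chain_length \<gamma> (ts @ [b, c])" unfolding chain_length_append by simp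
    finally have "ennreal (chain_length \<gamma> ts) + ennreal (dist (\<gamma> b) (\<gamma> c)) \<le> ennreal (chain_length \<gamma> (ts @ [b, c]))"
      by (simp add: ennreal_leI chain_length_nonneg flip: ennreal_plus)
    also have "\<dots> \<le> curve_length \<gamma> a c"
      using ts assms by (intro chain_length_le_curve_length) (auto simp: sorted_append)
    finally show "ennreal (chain_length \<gamma> ts) + ennreal (dist (\<gamma> b) (\<gamma> c)) \<le> curve_length \<gamma> a c" .
  qed
  finally show ?thesis .
qed

lemma curve_length_translate: "curve_length (\<lambda>t. \<gamma> (a + t)) b c = curve_length \<gamma> (a + b) (a + c)"
proof (rule antisym)
  have ch: "chain_length (\<lambda>t. \<gamma> (a + t)) ts = chain_length \<gamma> (map (\<lambda>t. a + t) ts)" for a ts and \<gamma> :: "real \<Rightarrow> 'a"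
    by (induction "\<lambda>t. \<gamma> (a + t)" ts rule: chain_length.induct) auto
  show "curve_length (\<lambda>t. \<gamma> (a + t)) b c \<le> curve_length \<gamma> (a + b) (a + c)"
    by (rule curve_length_leI, unfold ch, rule chain_length_le_curve_length) (auto simp: sorted_map)
  show "curve_length \<gamma> (a + b) (a + c) \<le> curve_length (\<lambda>t. \<gamma> (a + t)) b c"
  proof (rule curve_length_leI)
    fix ts assume ts: "sorted ts" "set ts \<subseteq> {a + b..a + c}"
    have "ts = map (\<lambda>t. a + t) (map (\<lambda>t. t - a) ts)" by (simp add: o_def)
    then have "ennreal (chain_length \<gamma> ts) = ennreal (chain_length (\<lambda>t. \<gamma> (a + t)) (map (\<lambda>t. t - a) ts))"
      unfolding ch by simp
    also have "\<dots> \<le> curve_length (\<lambda>t. \<gamma> (a + t)) b c"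
      using ts by (intro chain_length_le_curve_length) (auto simp: sorted_map)
    finally show "ennreal (chain_length \<gamma> ts) \<le> curve_length (\<lambda>t. \<gamma> (a + t)) b c" .
  qed
qed

lemma arc_length_curve_dist:
  assumes "arc_length_curve A l \<gamma>" "0 \<le> s" "s \<le> t" "t \<le> l"
  shows "dist (\<gamma> s) (\<gamma> t) \<le> t - s"
proof -
  have "ennreal s + ennreal (dist (\<gamma> s) (\<gamma> t)) \<le> ennreal t"
    using curve_length_add_dist[of 0 s t \<gamma>] assms by (auto simp: arc_length_curve_def)
  then show ?thesis using assms by (simp flip: ennreal_plus)
qed

text \<open>Upper gradient inequalities are later used on all subcurves, so these must again be
  parameterized by arc length. Their length is bounded below by splitting and above by the Lipschitz
  property.\<close>

lemma arc_length_curve_subcurve: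
  assumes \<gamma>: "arc_length_curve A l \<gamma>" and ab: "0 \<le> a" "a < b" "b \<le> l"
  shows "arc_length_curve A (b - a) (\<lambda>t. \<gamma> (a + t))"
  unfolding arc_length_curve_def
proof (intro conjI ballI)
  show "0 < b - a" using ab by simp
  have "continuous_on {0..l} \<gamma>" using \<gamma> by (simp add: arc_length_curve_def)
  then show "continuous_on {0..b - a} (\<lambda>t. \<gamma> (a + t))"
    by (rule continuous_on_compose2) (use ab in \<open>auto intro!: continuous_intros\<close>)
  show "(\<lambda>t. \<gamma> (a + t)) ` {0..b - a} \<subseteq> A"
    using \<gamma> ab unfolding arc_length_curve_def by force
  fix t assume t: "t \<in> {0..b - a}"
  have len: "curve_length \<gamma> 0 s = ennreal s" if "0 \<le> s" "s \<le> l" for s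
    using that \<gamma> by (auto simp: arc_length_curve_def)
  have "ennreal (a + t) \<le> ennreal a + curve_length \<gamma> a (a + t)"
    using curve_length_split[of 0 a "a + t" \<gamma>] t ab by (simp add: len)
  then have "ennreal t \<le> curve_length \<gamma> a (a + t)"
    using t ab by (simp add: ennreal_plus) 
  moreover have "curve_length \<gamma> a (a + t) \<le> ennreal (a + t - a)"
    using t ab by (intro curve_length_le_increment arc_length_curve_dist[OF \<gamma>]) auto
  ultimately show "curve_length (\<lambda>t. \<gamma> (a + t)) 0 t = ennreal t"
    by (simp add: curve_length_translate)
qed

text \<open>Takes the place of a fundamental theorem of calculus: \<open>F\<close> may lack any
  derivative, and only its increments over intervals of length at most \<delta> are compared with
  those of \<open>I\<close>.\<close>

lemma local_increment_bound:
  fixes F I :: "real \<Rightarrow> real"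
  assumes "0 < \<delta>" "c \<le> d"
    and loc: "\<And>a b. c \<le> a \<Longrightarrow> a \<le> b \<Longrightarrow> b \<le> d \<Longrightarrow> b - a \<le> \<delta> \<Longrightarrow> \<bar>F b - F a\<bar> \<le> I b - I a"
  shows "\<bar>F d - F c\<bar> \<le> I d - I c"
proof -
  have "\<bar>F b - F c\<bar> \<le> I b - I c" if "c \<le> b" "b \<le> d" "b - c \<le> real n * \<delta>" for b n
    using that
  proof (induction n arbitrary: b)
    case 0
    then have "b = c" by simp
    then show ?case by simp
  next
    case (Suc n)
    define a where "a = max c (b - \<delta>)"
    have a: "c \<le> a" "a \<le> b" "b - a \<le> \<delta>" "a \<le> d" "a - c \<le> real n * \<delta>"
      using Suc.prems assms(1) by (auto simp: a_def max_def algebra_simps)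
    show ?case using Suc.IH[of a] loc[of a b] a Suc.prems by simp
  qed
  moreover obtain n where "d - c \<le> real n * \<delta>"
    using reals_Archimedean3[OF assms(1)] by (meson less_imp_le)
  ultimately show ?thesis using assms(2) by blast
qed

section \<open>Line integrals and their restriction to subintervals\<close>

lemma line_integral_lborel: "line_integral l \<gamma> f = (\<integral>\<^sup>+t\<in>{0..l}. f (\<gamma> t) \<partial>lborel)"
  unfolding line_integral_def by (rule nn_integral_completion)

lemma line_integral_mono:
  "(\<And>t. 0 \<le> t \<Longrightarrow> t \<le> l \<Longrightarrow> f (\<gamma> t) \<le> g (\<gamma> t)) \<Longrightarrow> line_integral l \<gamma> f \<le> line_integral l \<gamma> g"
  unfolding line_integral_def by (intro nn_integral_mono) (auto split: split_indicator)

lemma line_integral_cong: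
  "(\<And>t. 0 \<le> t \<Longrightarrow> t \<le> l \<Longrightarrow> f (\<gamma> t) = g (\<eta> t)) \<Longrightarrow> line_integral l \<gamma> f = line_integral l \<eta> g"
  unfolding line_integral_def by (intro nn_integral_cong) (auto split: split_indicator)

text \<open>Unlike arc length curves, these paths may slow down or stop. The class is therefore
  closed under pointwise limits and concatenation, on which the compactness argument and the exit
  costs rely.\<close>

definition lip1 :: "(real \<Rightarrow> 'a::metric_space) \<Rightarrow> bool" where
  "lip1 \<gamma> \<longleftrightarrow> (\<forall>s t. dist (\<gamma> s) (\<gamma> t) \<le> \<bar>s - t\<bar>)"

lemma lip1_continuous: "lip1 \<gamma> \<Longrightarrow> continuous_on S \<gamma>"
  unfolding lip1_def continuous_on_iff dist_real_def by (meson le_less_trans)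

lemma lip1_measurable[measurable_dest]: "lip1 \<gamma> \<Longrightarrow> \<gamma> \<in> borel_measurable borel"
  by (intro borel_measurable_continuous_onI lip1_continuous)

text \<open>Constant extension beyond \<open>{0..l}\<close> turns an arc length curve into a
  1-Lipschitz, hence Borel, map on the whole line, with which line integrals can be
  computed.\<close>

definition clamp_curve :: "real \<Rightarrow> (real \<Rightarrow> 'a) \<Rightarrow> real \<Rightarrow> 'a" where
  "clamp_curve l \<gamma> t = \<gamma> (max 0 (min l t))"

lemma clamp_curve_eq: "0 \<le> t \<Longrightarrow> t \<le> l \<Longrightarrow> clamp_curve l \<gamma> t = \<gamma> t"
  by (simp add: clamp_curve_def)

lemma lip1_clamp_curve:
  assumes "arc_length_curve A l \<gamma>"
  shows "lip1 (clamp_curve l \<gamma>)"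
proof -
  have l: "0 < l" using assms by (simp add: arc_length_curve_def)
  have *: "dist (\<gamma> (max 0 (min l s))) (\<gamma> (max 0 (min l t))) \<le> t - s" if "s \<le> t" for s t
    using arc_length_curve_dist[OF assms, of "max 0 (min l s)" "max 0 (min l t)"] that l
    by (auto simp: max_def min_def split: if_splits)
  show ?thesis unfolding lip1_def clamp_curve_def
  proof (intro allI)
    fix s t show "dist (\<gamma> (max 0 (min l s))) (\<gamma> (max 0 (min l t))) \<le> \<bar>s - t\<bar>"
      using *[of s t] *[of t s] by (cases "s \<le> t") (auto simp: dist_commute)
  qed
qed

lemma line_integral_clamp: "line_integral l \<gamma> f = (\<integral>\<^sup>+t\<in>{0..l}. f (clamp_curve l \<gamma> t) \<partial>lborel)"
  unfolding line_integral_lborel by (intro nn_integral_cong) (auto simp: clamp_curve_eq split: split_indicator)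

lemma line_integral_subcurve:
  assumes "lip1 \<gamma>" and [measurable]: "f \<in> borel_measurable borel" and "a \<le> b"
  shows "line_integral (b - a) (\<lambda>t. \<gamma> (a + t)) f = (\<integral>\<^sup>+t\<in>{a..b}. f (\<gamma> t) \<partial>lborel)"
proof -
  note [measurable] = lip1_measurable[OF assms(1)]
  have "(\<integral>\<^sup>+t\<in>{a..b}. f (\<gamma> t) \<partial>lborel) = (\<integral>\<^sup>+t. f (\<gamma> t) * indicator {a..b} t \<partial>distr lborel borel ((+) a))"
    using lborel_distr_plus[of a] by simp
  also have "\<dots> = (\<integral>\<^sup>+t. f (\<gamma> (a + t)) * indicator {a..b} (a + t) \<partial>lborel)"
    by (subst nn_integral_distr) auto
  also have "\<dots> = line_integral (b - a) (\<lambda>t. \<gamma> (a + t)) f"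
    unfolding line_integral_lborel
    by (intro nn_integral_cong) (auto split: split_indicator)
  finally show ?thesis by simp
qed

lemma nn_integral_Icc_add:
  fixes f :: "real \<Rightarrow> ennreal"
  assumes [measurable]: "f \<in> borel_measurable borel" and "a \<le> b" "b \<le> c"
  shows "(\<integral>\<^sup>+t\<in>{a..c}. f t \<partial>lborel) = (\<integral>\<^sup>+t\<in>{a..b}. f t \<partial>lborel) + (\<integral>\<^sup>+t\<in>{b..c}. f t \<partial>lborel)"
proof -
  have "(\<integral>\<^sup>+t\<in>{a..c}. f t \<partial>lborel) = (\<integral>\<^sup>+t. f t * indicator {a..b} t + f t * indicator {b..c} t \<partial>lborel)"
    using AE_lborel_singleton[of b] assms(2,3)
    by (intro nn_integral_cong_AE) (auto split: split_indicator elim!: eventually_mono)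
  also have "\<dots> = (\<integral>\<^sup>+t\<in>{a..b}. f t \<partial>lborel) + (\<integral>\<^sup>+t\<in>{b..c}. f t \<partial>lborel)"
    by (intro nn_integral_add) auto
  finally show ?thesis .
qed

lemma enn2real_Icc_diff:
  fixes f :: "real \<Rightarrow> ennreal"
  assumes "f \<in> borel_measurable borel" and "a \<le> b" "b \<le> c" and "(\<integral>\<^sup>+t\<in>{a..c}. f t \<partial>lborel) < \<infinity>"
  shows "ennreal (enn2real (\<integral>\<^sup>+t\<in>{a..c}. f t \<partial>lborel) - enn2real (\<integral>\<^sup>+t\<in>{a..b}. f t \<partial>lborel)) = (\<integral>\<^sup>+t\<in>{b..c}. f t \<partial>lborel)"
  and "enn2real (\<integral>\<^sup>+t\<in>{a..b}. f t \<partial>lborel) \<le> enn2real (\<integral>\<^sup>+t\<in>{a..c}. f t \<partial>lborel)"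
  using assms(4) unfolding nn_integral_Icc_add[OF assms(1-3)]
  by (auto simp: ennreal_enn2real_if enn2real_plus)

lemma nn_integral_Icc_continuous:
  fixes f :: "real \<Rightarrow> real"
  assumes "continuous_on UNIV f" "\<And>x. 0 \<le> f x"
  shows "(\<integral>\<^sup>+t\<in>{a..b}. ennreal (f t) \<partial>lborel) = ennreal (integral {a..b} f)"
proof -
  have c: "continuous_on {a..b} f" using assms(1) continuous_on_subset by blast
  have "(\<integral>\<^sup>+t\<in>{a..b}. ennreal (f t) \<partial>lborel) = (\<integral>\<^sup>+t. ennreal (indicator {a..b} t * f t) \<partial>lborel)"
    by (intro nn_integral_cong) (auto split: split_indicator)
  also have "\<dots> = ennreal (integral {a..b} f)"
    using assms(2) integrable_continuous_interval[OF c]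
    by (intro nn_integral_has_integral_lebesgue) (auto simp: has_integral_integral)
  finally show ?thesis .
qed

text \<open>Inverting the length function \<open>s\<close> turns the path into an arc length curve.
  Since \<open>s\<close> grows with slope at most 1, waiting and slow motion are removed, and
  integrals of nonnegative functions can only decrease. Different end points make the new length
  positive.\<close>

lemma lip1_reparametrization:
  fixes \<gamma> :: "real \<Rightarrow> 'a::metric_space"
  assumes \<gamma>: "lip1 \<gamma>" and L: "0 \<le> L" and ne: "\<gamma> 0 \<noteq> \<gamma> L"
  shows "\<exists>l \<eta>. arc_length_curve UNIV l \<eta> \<and> \<eta> 0 = \<gamma> 0 \<and> \<eta> l = \<gamma> L \<and>
    (\<forall>q::'a \<Rightarrow> real. continuous_on UNIV q \<longrightarrow> (\<forall>x. 0 \<le> q x) \<longrightarrow>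
       line_integral l \<eta> (\<lambda>x. ennreal (q x)) \<le> (\<integral>\<^sup>+t\<in>{0..L}. ennreal (q (\<gamma> t)) \<partial>lborel))"
proof -
  have lip: "dist (\<gamma> s) (\<gamma> t) \<le> t - s" if "s \<le> t" for s t
    using \<gamma> that unfolding lip1_def by (metis abs_minus_commute abs_of_nonneg diff_ge_0_iff_ge)
  have cl: "curve_length \<gamma> a b \<le> ennreal (b - a)" if "a \<le> b" for a b
    by (rule curve_length_le_increment[OF lip that]) auto
  define s where "s t = enn2real (curve_length \<gamma> 0 t)" for t
  have es: "ennreal (s t) = curve_length \<gamma> 0 t" if "0 \<le> t" for t
    unfolding s_def using cl[OF that] by (simp add: ennreal_enn2real_if) (metis ennreal_less_top leD top.not_eq_extremum)
  have s_nonneg: "0 \<le> s t" for t by (simp add: s_def)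
  have s0: "s 0 = 0" using cl[of 0 0] by (simp add: s_def)
  have s_up: "s b - s a \<le> b - a" if "0 \<le> a" "a \<le> b" for a b
  proof -
    have "ennreal (s b) \<le> ennreal (s a) + ennreal (b - a)"
      using curve_length_split[of 0 a b \<gamma>] cl[of a b] that
      by (simp add: es) (meson add_left_mono order_trans)
    then have "s b \<le> s a + (b - a)"
      using that s_nonneg by (simp flip: ennreal_plus)
    then show ?thesis by simp
  qed
  have s_lo: "dist (\<gamma> a) (\<gamma> b) \<le> s b - s a" if "0 \<le> a" "a \<le> b" for a b
  proof -
    have "ennreal (s a) + ennreal (dist (\<gamma> a) (\<gamma> b)) \<le> ennreal (s b)"
      using curve_length_add_dist[of 0 a b \<gamma>] that by (simp add: es)
    then have "s a + dist (\<gamma> a) (\<gamma> b) \<le> s b"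
      using that s_nonneg by (simp flip: ennreal_plus)
    then show ?thesis by simp
  qed
  have s_mono: "s a \<le> s b" if "0 \<le> a" "a \<le> b" for a b
    using s_lo[OF that] zero_le_dist[of "\<gamma> a" "\<gamma> b"] by linarith
  have s_cont: "continuous_on {0..} s"
    unfolding continuous_on_iff
  proof (intro ballI allI impI)
    fix x e :: real assume "x \<in> {0..}" "0 < e"
    moreover have "dist (s y) (s x) \<le> dist y x" if "y \<in> {0..}" for y
      using s_up[of x y] s_up[of y x] s_mono[of x y] s_mono[of y x] that \<open>x \<in> {0..}\<close>
      unfolding dist_real_def by (cases "x \<le> y") auto
    ultimately show "\<exists>d>0. \<forall>x'\<in>{0..}. dist x' x < d \<longrightarrow> dist (s x') (s x) < e"
      by (meson le_less_trans)
  qed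
  have s_ivt: "\<exists>t. a \<le> t \<and> t \<le> b \<and> s t = y" if "0 \<le> a" "a \<le> b" "s a \<le> y" "y \<le> s b" for a b y
    using IVT'[of s a y b] that continuous_on_subset[OF s_cont, of "{a..b}"] by auto
  define l where "l = s L"
  have l: "0 < l"
    using s_lo[of 0 L] L ne s0 by (auto simp: l_def) (smt (verit) zero_less_dist_iff)
  \<comment> \<open>\<open>s\<close> need not be injective, but two parameters with the same value
    of \<open>s\<close> have the same image under \<gamma>, so any choice of a preimage
    serves.\<close>
  define \<eta> where "\<eta> y = \<gamma> (SOME t. t \<in> {0..L} \<and> s t = y)" for y
  have eta: "\<eta> (s t) = \<gamma> t" if "0 \<le> t" "t \<le> L" for t
  proof -
    define t' where "t' = (SOME t'. t' \<in> {0..L} \<and> s t' = s t)"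
    have "t' \<in> {0..L} \<and> s t' = s t"
      unfolding t'_def by (rule someI[of _ t]) (use that in auto)
    then have "dist (\<gamma> t') (\<gamma> t) \<le> 0"
      using s_lo[of t t'] s_lo[of t' t] that by (cases "t \<le> t'") (auto simp: dist_commute)
    then show ?thesis by (simp add: \<eta>_def t'_def)
  qed
  have eta_lip: "dist (\<eta> a) (\<eta> b) \<le> b - a" if ab: "0 \<le> a" "a \<le> b" "b \<le> l" for a b
  proof -
    obtain t where t: "0 \<le> t" "t \<le> L" "s t = a"
      using s_ivt[of 0 L a] ab L s0 by (auto simp: l_def)
    obtain t' where t': "t \<le> t'" "t' \<le> L" "s t' = b"
      using s_ivt[of t L b] ab L t by (auto simp: l_def)
    show ?thesis using s_lo[of t t'] eta[of t] eta[of t'] t t' by simp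
  qed
  have arc: "arc_length_curve UNIV l \<eta>"
    unfolding arc_length_curve_def
  proof (intro conjI ballI)
    show "0 < l" by fact
    show "continuous_on {0..l} \<eta>"
      unfolding continuous_on_iff
    proof (intro ballI allI impI)
      fix x e :: real assume "x \<in> {0..l}" "0 < e"
      moreover have "dist (\<eta> y) (\<eta> x) \<le> dist y x" if "y \<in> {0..l}" for y
        using eta_lip[of x y] eta_lip[of y x] that \<open>x \<in> {0..l}\<close>
        unfolding dist_real_def by (cases "x \<le> y") (auto simp: dist_commute)
      ultimately show "\<exists>d>0. \<forall>x'\<in>{0..l}. dist x' x < d \<longrightarrow> dist (\<eta> x') (\<eta> x) < e"
        by (meson le_less_trans)
    qed
    fix y assume y: "y \<in> {0..l}"
    obtain t where t: "0 \<le> t" "t \<le> L" "s t = y"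
      using s_ivt[of 0 L y] y L s0 by (auto simp: l_def)
    have "curve_length \<eta> 0 y \<le> ennreal (y - 0)"
      using y by (intro curve_length_le_increment eta_lip) auto
    \<comment> \<open>The images under \<open>s\<close> of the points of a partition give \<eta> the
      same polygon.\<close>
    moreover have "curve_length \<gamma> 0 t \<le> curve_length \<eta> 0 y"
    proof (rule curve_length_leI)
      fix ts assume ts: "sorted ts" "set ts \<subseteq> {0..t}"
      have "chain_length \<eta> (map s ts) = chain_length \<gamma> ts"
        using ts(2) t
      proof (induction ts rule: induct_list012)
        case (3 a b ts)
        then show ?case using eta[of a] eta[of b] by auto
      qed auto
      moreover have "sorted (map s ts)"
        using ts unfolding sorted_map
        by (elim sorted_wrt_mono_rel[rotated]) (auto intro!: s_mono)
      moreover have "set (map s ts) \<subseteq> {0..y}"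
        using ts t s_mono s_nonneg by fastforce
      ultimately show "ennreal (chain_length \<gamma> ts) \<le> curve_length \<eta> 0 y"
        using chain_length_le_curve_length[of "map s ts" 0 y \<eta>] by simp
    qed
    ultimately show "curve_length \<eta> 0 y = ennreal y"
      using es[of t] t by simp
  qed auto
  have integ: "line_integral l \<eta> (\<lambda>x. ennreal (q x)) \<le> (\<integral>\<^sup>+t\<in>{0..L}. ennreal (q (\<gamma> t)) \<partial>lborel)"
    if q: "continuous_on UNIV q" "\<forall>x. 0 \<le> q x" for q :: "'a \<Rightarrow> real"
  proof -
    define f where "f y = q (clamp_curve l \<eta> y)" for y
    have f_cont: "continuous_on S f" for S
      unfolding f_def
      by (rule continuous_on_compose2[OF q(1) lip1_continuous[OF lip1_clamp_curve[OF arc]]]) auto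
    have fs: "f (s t) = q (\<gamma> t)" if "0 \<le> t" "t \<le> L" for t
      using that eta[of t] s_mono[of t L] s_nonneg[of t] by (simp add: f_def clamp_curve_eq l_def)
    define h where "h t = q (\<gamma> t)" for t
    have h_cont: "continuous_on S h" for S
      unfolding h_def by (rule continuous_on_compose2[OF q(1) lip1_continuous[OF \<gamma>]]) auto
    have int_f: "f integrable_on {a..b}" and int_h: "h integrable_on {a..b}" for a b
      by (auto intro!: integrable_continuous_interval f_cont h_cont)
    define F where "F t = integral {0..s t} f" for t
    define I where "I e t = integral {0..t} h + 2 * e * t" for e t
    \<comment> \<open>The slack is \<open>2 * e\<close> per unit of time: on a short interval
      \<open>f\<close> stays below \<open>h a + e\<close> and \<open>h\<close> above
      \<open>h a - e\<close>, while \<open>s\<close> advances by at most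
      \<open>b - a\<close>.\<close>
    have key: "integral {0..l} f \<le> integral {0..L} h + 2 * e * L" if e: "0 < e" for e
    proof -
      have "uniformly_continuous_on {0..L} h"
        by (intro compact_uniformly_continuous h_cont) auto
      then obtain d where d: "0 < d" "\<And>x y. x \<in> {0..L} \<Longrightarrow> y \<in> {0..L} \<Longrightarrow> dist y x < d \<Longrightarrow> dist (h y) (h x) < e"
        using e unfolding uniformly_continuous_on_def by metis
      have "\<bar>F L - F 0\<bar> \<le> I e L - I e 0"
      proof (rule local_increment_bound[where \<delta>="d/2"])
        fix a b assume ab: "0 \<le> a" "a \<le> b" "b \<le> L" "b - a \<le> d / 2"
        have near: "\<bar>h t - h a\<bar> \<le> e" if "a \<le> t" "t \<le> b" for t
          using d(2)[of a t] ab that d(1) by (auto simp: dist_real_def)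
        have "F b - F a = integral {s a..s b} f"
          unfolding F_def using Henstock_Kurzweil_Integration.integral_combine[of 0 "s a" "s b" f] s_mono[of a b] s_nonneg[of a] ab int_f
          by auto
        moreover have "0 \<le> integral {s a..s b} f"
          using q(2) by (intro integral_nonneg int_f) (auto simp: f_def)
        moreover have "integral {s a..s b} f \<le> integral {s a..s b} (\<lambda>_. h a + e)"
        proof (rule integral_le)
          fix y assume y: "y \<in> {s a..s b}"
          then obtain t where "a \<le> t" "t \<le> b" "s t = y" using s_ivt[of a b y] ab by auto
          then show "f y \<le> h a + e" using near[of t] fs[of t] ab by (auto simp: h_def)
        qed (auto intro: int_f)
        moreover have "integral {s a..s b} (\<lambda>_. h a + e) = (s b - s a) * (h a + e)"
          using s_mono[of a b] ab by simp
        moreover have "\<dots> \<le> (b - a) * (h a + e)"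
          using s_up[of a b] ab q(2) e by (intro mult_right_mono) (auto simp: h_def)
        moreover have "(b - a) * (h a + e) = integral {a..b} (\<lambda>_. h a - e) + 2 * e * (b - a)"
          using ab by (simp add: algebra_simps)
        moreover have "integral {a..b} (\<lambda>_. h a - e) \<le> integral {a..b} h"
        proof (rule integral_le)
          show "h a - e \<le> h t" if "t \<in> {a..b}" for t using near[of t] that by auto
        qed (auto intro: int_h)
        moreover have "integral {0..a} h + integral {a..b} h = integral {0..b} h"
          using ab int_h by (intro Henstock_Kurzweil_Integration.integral_combine) auto
        ultimately show "\<bar>F b - F a\<bar> \<le> I e b - I e a"
          unfolding I_def by (simp add: algebra_simps)
      qed (use d L in auto)
      then show ?thesis by (simp add: F_def I_def s0 l_def)
    qed
    have "integral {0..l} f \<le> integral {0..L} h"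
    proof (rule field_le_epsilon)
      fix e :: real assume "0 < e"
      then have "integral {0..l} f \<le> integral {0..L} h + 2 * (e / (2 * (L + 1))) * L"
        using key[of "e / (2 * (L + 1))"] L by simp
      also have "2 * (e / (2 * (L + 1))) * L \<le> e"
        using L \<open>0 < e\<close> by (simp add: field_simps)
      finally show "integral {0..l} f \<le> integral {0..L} h + e" by simp
    qed
    then have "ennreal (integral {0..l} f) \<le> ennreal (integral {0..L} h)"
      by (rule ennreal_leI)
    moreover have "line_integral l \<eta> (\<lambda>x. ennreal (q x)) = ennreal (integral {0..l} f)"
      unfolding line_integral_clamp f_def[symmetric]
      using q(2) by (intro nn_integral_Icc_continuous f_cont) (auto simp: f_def)
    moreover have "(\<integral>\<^sup>+t\<in>{0..L}. ennreal (q (\<gamma> t)) \<partial>lborel) = ennreal (integral {0..L} h)"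
      unfolding h_def[symmetric]
      using q(2) by (intro nn_integral_Icc_continuous h_cont) (auto simp: h_def)
    ultimately show ?thesis by simp
  qed
  have "\<eta> 0 = \<gamma> 0" "\<eta> l = \<gamma> L" using eta[of 0] eta[of L] L s0 by (auto simp: l_def)
  then show ?thesis using arc integ by blast
qed

section \<open>Powers and lower semicontinuous majorants\<close>

lemma epowr_ennreal: "0 \<le> x \<Longrightarrow> ennreal x epowr a = ennreal (x powr a)"
  by (simp add: ennreal_powr_def)

lemma epowr_top[simp]: "\<infinity> epowr a = \<infinity>" "top epowr a = top"
  by (auto simp: ennreal_powr_def)

lemma epowr_zero[simp]: "0 epowr a = 0"
  by (simp add: ennreal_powr_def)

lemma epowr_mono: "0 < a \<Longrightarrow> x \<le> y \<Longrightarrow> x epowr a \<le> y epowr a"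
  by (cases x; cases y) (auto simp: epowr_ennreal top_unique intro!: ennreal_leI powr_mono2)

lemma epowr_epowr: "0 < a \<Longrightarrow> 0 < b \<Longrightarrow> (x epowr a) epowr b = x epowr (a * b)"
  by (cases x) (auto simp: epowr_ennreal powr_powr)

lemma epowr_one[simp]: "x epowr 1 = x"
  by (cases x) (auto simp: epowr_ennreal)

lemma epowr_le_iff: "0 < a \<Longrightarrow> x epowr a \<le> y \<longleftrightarrow> x \<le> y epowr (1 / a)"
  using epowr_mono[of a x "y epowr (1/a)"] epowr_mono[of "1/a" "x epowr a" y]
  by (auto simp: epowr_epowr)

lemma epowr_SUP: "0 < a \<Longrightarrow> (SUP i. f i) epowr a = (SUP i. f i epowr a)"
proof (rule order.antisym)
  assume a: "0 < a"
  have "f i \<le> (SUP i. f i epowr a) epowr (1 / a)" for i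
  proof -
    have "f i = (f i epowr a) epowr (1 / a)" using a by (simp add: epowr_epowr)
    also have "\<dots> \<le> (SUP i. f i epowr a) epowr (1 / a)"
      using a by (intro epowr_mono SUP_upper) auto
    finally show ?thesis .
  qed
  then show "(SUP i. f i) epowr a \<le> (SUP i. f i epowr a)"
    using a by (simp add: epowr_le_iff SUP_le_iff)
  show "(SUP i. f i epowr a) \<le> (SUP i. f i) epowr a"
    using a by (intro SUP_least epowr_mono SUP_upper) auto
qed

lemma epowr_mult: "0 < a \<Longrightarrow> (x * y) epowr a = x epowr a * y epowr a"
  by (cases x; cases y) (auto simp: epowr_ennreal powr_mult ennreal_mult_top ennreal_top_mult simp flip: ennreal_mult)

lemma epowr_measurable[measurable (raw)]:
  assumes [measurable]: "f \<in> borel_measurable M"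
  shows "(\<lambda>x. f x epowr a) \<in> borel_measurable M"
proof -
  have "(\<lambda>x. if f x = \<infinity> then \<infinity> else ennreal (enn2real (f x) powr a)) \<in> borel_measurable M"
    by measurable
  then show ?thesis by (simp only: ennreal_powr_def)
qed

text \<open>Convexity of \<open>t powr p\<close> at \<open>x / (1 - s)\<close> and
  \<open>y / s\<close>, whose weighted mean is \<open>x + y\<close>. For small \<open>s\<close> the
  factor of \<open>x powr p\<close> is close to 1, whereas the other one is large but fixed.\<close>

lemma powr_convex_combination:
  fixes x y :: real
  assumes "1 < p" "0 \<le> x" "0 \<le> y" "0 < s" "s < 1"
  shows "(x + y) powr p \<le> (1 - s) powr (1 - p) * x powr p + s powr (1 - p) * y powr p"
proof -
  have *: "(x + y) powr p \<le> (1 - s) powr (1 - p) * x powr p + s powr (1 - p) * y powr p" if "0 < x" "0 < y" for x y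
  proof -
    have "((1 - s) *\<^sub>R (x / (1 - s)) + s *\<^sub>R (y / s)) powr p \<le> (1 - s) * (x / (1 - s)) powr p + s * (y / s) powr p"
      using convex_onD[OF powr_convex[of p], of s "x / (1 - s)" "y / s"] assms that by simp
    moreover have "(1 - s) * (x / (1 - s)) powr p = (1 - s) powr (1 - p) * x powr p"
      using assms that by (simp add: powr_divide powr_diff)
    moreover have "s * (y / s) powr p = s powr (1 - p) * y powr p"
      using assms that by (simp add: powr_divide powr_diff)
    ultimately show ?thesis using assms by simp
  qed
  \<comment> \<open>If one of the two numbers is zero, the claim says no more than that a factor
    with the negative exponent \<open>1 - p\<close> is at least 1.\<close>
  have ge1: "1 \<le> t powr (1 - p)" if "0 < t" "t < 1" for t :: real
    using that assms powr_mono'[of "1 - p" 0 t] by simp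
  show ?thesis
  proof (cases "x = 0 \<or> y = 0")
    case True
    then show ?thesis
    proof
      assume "x = 0"
      then show ?thesis using mult_right_mono[OF ge1[of s], of "y powr p"] assms by simp
    next
      assume "y = 0"
      then show ?thesis using mult_right_mono[OF ge1[of "1 - s"], of "x powr p"] assms by simp
    qed
  qed (use * assms in auto)
qed

lemma epowr_convex_combination:
  assumes "1 < p" "0 < s" "s < 1"
  shows "(x + y) epowr p \<le> ennreal ((1 - s) powr (1 - p)) * x epowr p + ennreal (s powr (1 - p)) * y epowr p"
proof (cases "x = top \<or> y = top")
  case True
  then show ?thesis using assms by (auto simp: ennreal_mult_top)
next
  case False
  then obtain a b where "x = ennreal a" "y = ennreal b" "0 \<le> a" "0 \<le> b"
    by (metis ennreal_cases)
  then show ?thesis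
    using powr_convex_combination[of p a b s] assms
    by (simp add: epowr_ennreal ennreal_leI flip: ennreal_mult ennreal_plus)
qed

text \<open>A substitute for Minkowski's inequality. As \<open>d\<close> depends on none of the
  functions, it can be fixed before \<open>f\<close> and \<open>g\<close> are constructed, and small
  error terms can be budgeted in advance.\<close>

lemma nn_integral_epowr_add_small:
  assumes p: "1 < p" and C: "0 \<le> C" and e: "0 < e"
  shows "\<exists>d>0. \<forall>f\<in>borel_measurable M. \<forall>g\<in>borel_measurable M.
    (\<integral>\<^sup>+x. f x epowr p \<partial>M) \<le> ennreal C \<longrightarrow> (\<integral>\<^sup>+x. g x epowr p \<partial>M) \<le> ennreal d \<longrightarrow>
    (\<integral>\<^sup>+x. (f x + g x) epowr p \<partial>M) \<le> ennreal (C + e)"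
proof -
  have "((\<lambda>s. (1 - s) powr (1 - p) * C) \<longlongrightarrow> (1 - 0) powr (1 - p) * C) (at_right 0)"
    by (intro tendsto_intros) auto
  then have "eventually (\<lambda>s. (1 - s) powr (1 - p) * C < C + e / 2) (at_right 0)"
    using e by (auto intro: order_tendstoD)
  moreover have "eventually (\<lambda>s. s \<in> {0<..<1::real}) (at_right 0)"
    by (rule eventually_at_right_real) simp
  ultimately have "eventually (\<lambda>s. (1 - s) powr (1 - p) * C < C + e / 2 \<and> s \<in> {0<..<1}) (at_right 0)"
    by (rule eventually_conj)
  then obtain s where s: "(1 - s) powr (1 - p) * C < C + e / 2" "0 < s" "s < 1"
    using eventually_happens' by (metis (no_types, lifting) greaterThanLessThan_iff trivial_limit_at_right_real)
  \<comment> \<open>Half of \<open>e\<close> is spent on the factor of \<open>f\<close> by the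
    choice of \<open>s\<close>; the other half pays for \<open>g\<close>, whose factor is
    \<open>s powr (1 - p)\<close>.\<close>
  define d where "d = e / 2 / s powr (1 - p)"
  have "(\<integral>\<^sup>+x. (f x + g x) epowr p \<partial>M) \<le> ennreal (C + e)"
    if [measurable]: "f \<in> borel_measurable M" "g \<in> borel_measurable M"
      and f: "(\<integral>\<^sup>+x. f x epowr p \<partial>M) \<le> ennreal C" and g: "(\<integral>\<^sup>+x. g x epowr p \<partial>M) \<le> ennreal d" for f g
  proof -
    have "(\<integral>\<^sup>+x. (f x + g x) epowr p \<partial>M) \<le>
      (\<integral>\<^sup>+x. ennreal ((1 - s) powr (1 - p)) * f x epowr p + ennreal (s powr (1 - p)) * g x epowr p \<partial>M)"
      using p s by (intro nn_integral_mono epowr_convex_combination)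
    also have "\<dots> = ennreal ((1 - s) powr (1 - p)) * (\<integral>\<^sup>+x. f x epowr p \<partial>M) + ennreal (s powr (1 - p)) * (\<integral>\<^sup>+x. g x epowr p \<partial>M)"
      by (simp add: nn_integral_add nn_integral_cmult)
    also have "\<dots> \<le> ennreal ((1 - s) powr (1 - p)) * ennreal C + ennreal (s powr (1 - p)) * ennreal d"
      by (intro add_mono mult_left_mono f g) auto
    also have "\<dots> = ennreal ((1 - s) powr (1 - p) * C + s powr (1 - p) * d)"
      using C e s by (simp add: d_def flip: ennreal_mult)
    also have "\<dots> \<le> ennreal (C + e)"
      using s by (intro ennreal_leI) (simp add: d_def)
    finally show ?thesis .
  qed
  moreover have "0 < d" using e s by (simp add: d_def)
  ultimately show ?thesis by blast
qed

lemma epowr_suminf_le: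
  assumes "0 < p"
  shows "(\<Sum>i. r i) epowr p \<le> (\<Sum>i. ennreal (2 ^ Suc i) epowr p * r i epowr p)"
proof -
  define S where "S = (SUP i. ennreal (2 ^ Suc i) * r i)"
  have "(\<Sum>i. r i) \<le> (\<Sum>i. ennreal ((1 / 2) ^ Suc i) * S)"
  proof (rule suminf_le)
    fix i
    have "r i = ennreal ((1/2) ^ Suc i) * (ennreal (2 ^ Suc i) * r i)"
      unfolding mult.assoc[symmetric] by (simp add: power_one_over flip: ennreal_mult del: power_Suc)
    also have "\<dots> \<le> ennreal ((1/2) ^ Suc i) * S"
      unfolding S_def by (intro mult_left_mono SUP_upper) auto
    finally show "r i \<le> ennreal ((1/2) ^ Suc i) * S" .
  qed auto
  also have "\<dots> = (\<Sum>i. ennreal ((1/2) ^ Suc i)) * S" by simp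
  also have "(\<Sum>i. ennreal ((1/2) ^ Suc i)) = 1"
    using power_half_series by (subst suminf_ennreal_eq) auto
  finally have "(\<Sum>i. r i) epowr p \<le> S epowr p"
    using assms by (intro epowr_mono) auto
  also have "\<dots> = (SUP i. ennreal (2 ^ Suc i) epowr p * r i epowr p)"
    unfolding S_def using assms by (simp add: epowr_SUP epowr_mult del: power_Suc)
  also have "\<dots> \<le> (\<Sum>i. ennreal (2 ^ Suc i) epowr p * r i epowr p)"
  proof (rule SUP_least)
    fix i
    show "ennreal (2 ^ Suc i) epowr p * r i epowr p \<le> (\<Sum>i. ennreal (2 ^ Suc i) epowr p * r i epowr p)"
      using sum_le_suminf[of "\<lambda>i. ennreal (2 ^ Suc i) epowr p * r i epowr p" "{i}"] by simp
  qed
  finally show ?thesis .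
qed

text \<open>
  The bound \<open>\<Sum>\<^sub>i r\<^sub>i \<le> sup\<^sub>i 2\<^sup>i\<^sup>+\<^sup>1 r\<^sub>i\<close> replaces Minkowski's inequality: functions whose energies are
  at most these weights have a sum of energy at most \<open>d\<close>.
\<close>

definition small_weight :: "real \<Rightarrow> real \<Rightarrow> nat \<Rightarrow> real" where
  "small_weight p d i = d * (1 / 2) ^ Suc i / (2 ^ Suc i) powr p"

lemma small_weight_pos: "0 < d \<Longrightarrow> 0 < small_weight p d i"
  by (simp add: small_weight_def)

lemma nn_integral_epowr_suminf_le:
  assumes p: "0 < p" and d: "0 \<le> d" and [measurable]: "\<And>i. r i \<in> borel_measurable M"
    and r: "\<And>i. (\<integral>\<^sup>+x. r i x epowr p \<partial>M) \<le> ennreal (small_weight p d i)"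
  shows "(\<integral>\<^sup>+x. (\<Sum>i. r i x) epowr p \<partial>M) \<le> ennreal d"
proof -
  have "(\<integral>\<^sup>+x. (\<Sum>i. r i x) epowr p \<partial>M) \<le> (\<integral>\<^sup>+x. (\<Sum>i. ennreal (2 ^ Suc i) epowr p * r i x epowr p) \<partial>M)"
    by (intro nn_integral_mono epowr_suminf_le p)
  also have "\<dots> = (\<Sum>i. ennreal (2 ^ Suc i) epowr p * (\<integral>\<^sup>+x. r i x epowr p \<partial>M))"
    by (simp add: nn_integral_suminf nn_integral_cmult)
  also have "\<dots> \<le> (\<Sum>i. ennreal (d * (1 / 2) ^ Suc i))"
  proof (rule suminf_le)
    fix i
    have "ennreal (2 ^ Suc i) epowr p * (\<integral>\<^sup>+x. r i x epowr p \<partial>M) \<le> ennreal (2 ^ Suc i) epowr p * ennreal (small_weight p d i)"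
      by (intro mult_left_mono r) auto
    also have "\<dots> = ennreal (d * (1 / 2) ^ Suc i)"
      using d by (simp add: epowr_ennreal small_weight_def flip: ennreal_mult del: power_Suc)
    finally show "ennreal (2 ^ Suc i) epowr p * (\<integral>\<^sup>+x. r i x epowr p \<partial>M) \<le> ennreal (d * (1 / 2) ^ Suc i)" .
  qed auto
  also have "\<dots> = ennreal d"
    using d sums_mult[OF power_half_series, of d] by (subst suminf_ennreal_eq) auto
  finally show ?thesis .
qed

text \<open>Lower semicontinuity is kept in the form of an increasing sequence of continuous
  functions: the compactness argument passes to the limit in each \<open>Q k\<close>, and the final
  test function is built from one of them.\<close>

definition lsc_approx :: "(nat \<Rightarrow> 'a::topological_space \<Rightarrow> real) \<Rightarrow> ('a \<Rightarrow> ennreal) \<Rightarrow> bool" where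
  "lsc_approx Q q \<longleftrightarrow> (\<forall>k. continuous_on UNIV (Q k)) \<and> (\<forall>k x. 0 \<le> Q k x) \<and>
     (\<forall>x. incseq (\<lambda>k. Q k x)) \<and> (\<forall>x. q x = (SUP k. ennreal (Q k x)))"

definition lsc_fun :: "('a::topological_space \<Rightarrow> ennreal) \<Rightarrow> bool" where
  "lsc_fun q \<longleftrightarrow> (\<exists>Q. lsc_approx Q q)"

lemma lsc_fun_measurable:
  assumes "lsc_fun q" shows "q \<in> borel_measurable borel"
proof -
  obtain Q where Q: "lsc_approx Q q" using assms by (auto simp: lsc_fun_def)
  have [measurable]: "\<And>k. Q k \<in> borel_measurable borel"
    using Q by (auto simp: lsc_approx_def intro: borel_measurable_continuous_onI)
  have "(\<lambda>x. SUP k. ennreal (Q k x)) \<in> borel_measurable borel" by measurable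
  moreover have "q = (\<lambda>x. SUP k. ennreal (Q k x))" using Q by (auto simp: lsc_approx_def)
  ultimately show ?thesis by simp
qed

lemma lsc_fun_continuous:
  "continuous_on UNIV f \<Longrightarrow> (\<And>x. 0 \<le> f x) \<Longrightarrow> lsc_fun (\<lambda>x. ennreal (f x))"
  unfolding lsc_fun_def lsc_approx_def by (intro exI[of _ "\<lambda>_. f"]) auto

lemma lsc_fun_add:
  assumes "lsc_fun q" "lsc_fun r" shows "lsc_fun (\<lambda>x. q x + r x)"
proof -
  obtain Q R where Q: "lsc_approx Q q" and R: "lsc_approx R r" using assms by (auto simp: lsc_fun_def)
  have "(SUP k. ennreal (Q k x + R k x)) = (SUP k. ennreal (Q k x)) + (SUP k. ennreal (R k x))" for x
    using Q R by (subst ennreal_SUP_add[symmetric]) (auto simp: lsc_approx_def incseq_def intro!: ennreal_leI)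
  then have "lsc_approx (\<lambda>k x. Q k x + R k x) (\<lambda>x. q x + r x)"
    using Q R by (auto simp: lsc_approx_def incseq_def intro!: continuous_intros add_mono)
  then show ?thesis by (auto simp: lsc_fun_def)
qed

lemma lsc_fun_mult:
  assumes f: "continuous_on UNIV f" "\<And>x. 0 \<le> f x" and "lsc_fun q"
  shows "lsc_fun (\<lambda>x. ennreal (f x) * q x)"
proof -
  obtain Q where Q: "lsc_approx Q q" using assms by (auto simp: lsc_fun_def)
  have "(SUP k. ennreal (f x * Q k x)) = ennreal (f x) * (SUP k. ennreal (Q k x))" for x
    using Q f by (simp add: ennreal_mult lsc_approx_def SUP_mult_left_ennreal)
  then have "lsc_approx (\<lambda>k x. f x * Q k x) (\<lambda>x. ennreal (f x) * q x)"
    using Q f by (auto simp: lsc_approx_def incseq_def intro!: continuous_intros mult_left_mono)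
  then show ?thesis by (auto simp: lsc_fun_def)
qed

lemma lsc_fun_epowr:
  assumes "0 < a" "lsc_fun q" shows "lsc_fun (\<lambda>x. q x epowr a)"
proof -
  obtain Q where Q: "lsc_approx Q q" using assms by (auto simp: lsc_fun_def)
  have "(SUP k. ennreal (Q k x powr a)) = q x epowr a" for x
    using Q assms by (simp add: lsc_approx_def epowr_SUP epowr_ennreal)
  moreover have "continuous_on UNIV (\<lambda>x. Q k x powr a)" for k
    using Q assms(1) by (intro continuous_on_powr') (auto simp: lsc_approx_def)
  ultimately have "lsc_approx (\<lambda>k x. Q k x powr a) (\<lambda>x. q x epowr a)"
    using Q assms by (auto simp: lsc_approx_def incseq_def intro!: powr_mono2)
  then show ?thesis by (auto simp: lsc_fun_def)
qed

lemma lsc_fun_suminf: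
  assumes "\<And>i::nat. lsc_fun (q i)" shows "lsc_fun (\<lambda>x. \<Sum>i. q i x)"
proof -
  obtain Q where Q: "\<And>i. lsc_approx (Q i) (q i)" using assms unfolding lsc_fun_def by metis
  note Q' = Q[unfolded lsc_approx_def]
  \<comment> \<open>Diagonal sums: as \<open>k\<close> grows, both the number of terms and each term
    grow, so this one sequence exhausts the double supremum.\<close>
  have eq: "(SUP k. ennreal (\<Sum>i<k. Q i k x)) = (\<Sum>i. q i x)" for x
  proof (rule antisym)
    show "(SUP k. ennreal (\<Sum>i<k. Q i k x)) \<le> (\<Sum>i. q i x)"
    proof (rule SUP_least)
      fix k
      have "ennreal (\<Sum>i<k. Q i k x) = (\<Sum>i<k. ennreal (Q i k x))" using Q' by (simp add: sum_ennreal)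
      also have "\<dots> \<le> (\<Sum>i<k. q i x)" using Q' by (intro sum_mono) (auto intro: SUP_upper)
      also have "\<dots> \<le> (\<Sum>i. q i x)" by (intro sum_le_suminf) auto
      finally show "ennreal (\<Sum>i<k. Q i k x) \<le> (\<Sum>i. q i x)" .
    qed
    show "(\<Sum>i. q i x) \<le> (SUP k. ennreal (\<Sum>i<k. Q i k x))"
    proof (rule suminf_le_const)
      fix n
      have "(\<Sum>i<n. q i x) = (\<Sum>i<n. SUP k. ennreal (Q i k x))" using Q' by simp
      also have "\<dots> = (SUP k. \<Sum>i<n. ennreal (Q i k x))"
        using Q' by (intro ennreal_SUP_sum[symmetric]) (auto simp: incseq_def intro!: ennreal_leI)
      also have "\<dots> \<le> (SUP k. ennreal (\<Sum>i<k. Q i k x))"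
      proof (rule SUP_least)
        fix k
        have "(\<Sum>i<n. ennreal (Q i k x)) \<le> (\<Sum>i<n. ennreal (Q i (max n k) x))"
          using Q' by (intro sum_mono ennreal_leI) (auto simp: incseq_def)
        also have "\<dots> \<le> (\<Sum>i<max n k. ennreal (Q i (max n k) x))"
          by (intro sum_mono2) auto
        also have "\<dots> = ennreal (\<Sum>i<max n k. Q i (max n k) x)" using Q' by (simp add: sum_ennreal)
        also have "\<dots> \<le> (SUP k. ennreal (\<Sum>i<k. Q i k x))" by (intro SUP_upper) auto
        finally show "(\<Sum>i<n. ennreal (Q i k x)) \<le> (SUP k. ennreal (\<Sum>i<k. Q i k x))" .
      qed
      finally show "(\<Sum>i<n. q i x) \<le> (SUP k. ennreal (\<Sum>i<k. Q i k x))" .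
    qed auto
  qed
  have "(\<Sum>i<k. Q i k x) \<le> (\<Sum>i<m. Q i m x)" if "k \<le> m" for k m x
  proof -
    have "(\<Sum>i<k. Q i k x) \<le> (\<Sum>i<k. Q i m x)" using Q' that by (intro sum_mono) (auto simp: incseq_def)
    also have "\<dots> \<le> (\<Sum>i<m. Q i m x)" using Q' that by (intro sum_mono2) auto
    finally show ?thesis .
  qed
  then have "lsc_approx (\<lambda>k x. \<Sum>i<k. Q i k x) (\<lambda>x. \<Sum>i. q i x)"
    using Q' eq by (auto simp: lsc_approx_def incseq_def intro!: continuous_intros sum_nonneg)
  then show ?thesis by (auto simp: lsc_fun_def)
qed

lemma lsc_fun_indicator_open:
  fixes U :: "'a::metric_space set"
  assumes "open U" shows "lsc_fun (indicator U)"
proof (cases "U = UNIV")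
  \<comment> \<open>The distance to the empty set is 0 by convention and would make the approximants
    below vanish, so the whole space is treated separately.\<close>
  case True
  then show ?thesis using lsc_fun_continuous[of "\<lambda>x. 1"] by (simp add: indicator_def)
next
  case False
  define Q where "Q k x = min 1 (real k * infdist x (- U))" for k x
  have "(SUP k. ennreal (Q k x)) = indicator U x" for x
  proof (cases "x \<in> U")
    case True
    then have "infdist x (- U) > 0"
      using assms False infdist_pos_not_in_closed[of "- U" x] by auto
    then obtain n where "1 \<le> real n * infdist x (- U)"
      by (meson less_imp_le reals_Archimedean3)
    then have "ennreal (Q n x) = 1" by (simp add: Q_def)
    then have "1 \<le> (SUP k. ennreal (Q k x))" by (metis SUP_upper UNIV_I)
    moreover have "(SUP k. ennreal (Q k x)) \<le> 1"
    proof (rule SUP_least)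
      fix k
      have "Q k x \<le> 1" unfolding Q_def by (rule min.cobounded1)
      then show "ennreal (Q k x) \<le> 1" using ennreal_leI[of "Q k x" 1] by simp
    qed
    ultimately have "(SUP k. ennreal (Q k x)) = 1" by (rule order.antisym[rotated])
    then show ?thesis using True by simp
  qed (simp add: Q_def)
  then have "lsc_approx Q (indicator U)"
    unfolding lsc_approx_def Q_def incseq_def
    by (intro conjI allI impI continuous_intros min.mono mult_right_mono)
      (simp_all add: infdist_nonneg)
  then show ?thesis by (auto simp: lsc_fun_def)
qed

text \<open>Outer regularity gives the claim for indicators. It survives countable sums, because
  errors \<open>e * (1/2) ^ Suc i\<close> add up to \<open>e\<close>, while majorants of an
  increasing sequence need not increase. Therefore \<open>H\<close> is written as a series of simple
  functions instead of a supremum.\<close>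

lemma vitali_caratheodory_L1:
  fixes N :: "'a::{second_countable_topology, complete_space} measure"
  assumes N: "sets N = sets borel" "emeasure N UNIV \<noteq> \<infinity>" and H: "H \<in> borel_measurable borel" and e: "0 < e"
  shows "\<exists>q. lsc_fun q \<and> (\<forall>x. H x \<le> q x) \<and> (\<integral>\<^sup>+x. q x \<partial>N) \<le> (\<integral>\<^sup>+x. H x \<partial>N) + ennreal e"
proof -
  have sp: "space N = UNIV" using N(1) by (metis sets_eq_imp_space_eq space_borel)
  have meas: "f \<in> borel_measurable N" if "f \<in> borel_measurable borel" for f :: "'a \<Rightarrow> ennreal"
    using that N(1) by (simp cong: measurable_cong_sets)
  define P where "P H \<longleftrightarrow> (\<forall>e>0. \<exists>q. lsc_fun q \<and> (\<forall>x. H x \<le> q x) \<and> (\<integral>\<^sup>+x. q x \<partial>N) \<le> (\<integral>\<^sup>+x. H x \<partial>N) + ennreal e)" for H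
  have P_ind: "P (indicator A)" if A: "A \<in> sets borel" for A
    unfolding P_def
  proof (intro allI impI)
    fix e :: real assume "0 < e"
    have fin: "emeasure N A \<noteq> \<infinity>"
      using emeasure_mono[of A UNIV N] N sp sets.top[of N] by (auto simp: top_unique)
    have reg: "emeasure N A = (INF U \<in> {U. A \<subseteq> U \<and> open U}. emeasure N U)"
      using outer_regular[OF N(1) _ A] N(2) sp by simp
    have "(INF U \<in> {U. A \<subseteq> U \<and> open U}. emeasure N U) < emeasure N A + ennreal e"
    proof -
      obtain r where "emeasure N A = ennreal r" "0 \<le> r" using fin by (cases "emeasure N A") auto
      then have "emeasure N A < emeasure N A + ennreal e"
        using \<open>0 < e\<close> by (simp add: ennreal_less_iff flip: ennreal_plus)
      then show ?thesis using reg by simp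
    qed
    then obtain U where U: "A \<subseteq> U" "open U" "emeasure N U < emeasure N A + ennreal e"
      by (auto simp: INF_less_iff)
    then show "\<exists>q. lsc_fun q \<and> (\<forall>x. indicator A x \<le> q x) \<and> (\<integral>\<^sup>+x. q x \<partial>N) \<le> (\<integral>\<^sup>+x. indicator A x \<partial>N) + ennreal e"
      using A N(1) by (intro exI[of _ "indicator U"]) (auto simp: lsc_fun_indicator_open split: split_indicator)
  qed
  have P_mult: "P (\<lambda>x. c * H x)" if c: "c < top" and "P H" and H: "H \<in> borel_measurable borel" for c H
  proof (cases "c = 0")
    case True
    then show ?thesis unfolding P_def using lsc_fun_continuous[of "\<lambda>x. 0"] by (auto intro!: exI[of _ "\<lambda>x. 0"])
  next
    case False
    then obtain c' where c': "c = ennreal c'" "0 < c'" using c by (cases c) auto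
    show ?thesis unfolding P_def
    proof (intro allI impI)
      fix e :: real assume e: "0 < e"
      obtain q where q: "lsc_fun q" "\<forall>x. H x \<le> q x" "(\<integral>\<^sup>+x. q x \<partial>N) \<le> (\<integral>\<^sup>+x. H x \<partial>N) + ennreal (e / c')"
        using \<open>P H\<close> e c' unfolding P_def by (meson divide_pos_pos)
      have "(\<integral>\<^sup>+x. c * q x \<partial>N) = c * (\<integral>\<^sup>+x. q x \<partial>N)"
        using q by (intro nn_integral_cmult meas lsc_fun_measurable)
      also have "\<dots> \<le> c * ((\<integral>\<^sup>+x. H x \<partial>N) + ennreal (e / c'))" using q by (intro mult_left_mono) auto
      also have "\<dots> = (\<integral>\<^sup>+x. c * H x \<partial>N) + ennreal e"
        using c' e by (simp add: distrib_left nn_integral_cmult[OF meas[OF H]] flip: ennreal_mult)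
      finally show "\<exists>q. lsc_fun q \<and> (\<forall>x. c * H x \<le> q x) \<and> (\<integral>\<^sup>+x. q x \<partial>N) \<le> (\<integral>\<^sup>+x. c * H x \<partial>N) + ennreal e"
        using q c' by (intro exI[of _ "\<lambda>x. c * q x"]) (auto intro!: lsc_fun_mult mult_left_mono)
    qed
  qed
  have P_sum: "P (\<lambda>x. \<Sum>i. H i x)" if "\<And>i. P (H i)" and H: "\<And>i. H i \<in> borel_measurable borel" for H :: "nat \<Rightarrow> 'a \<Rightarrow> ennreal"
    unfolding P_def
  proof (intro allI impI)
    fix e :: real assume e: "0 < e"
    have "\<exists>q. lsc_fun q \<and> (\<forall>x. H i x \<le> q x) \<and> (\<integral>\<^sup>+x. q x \<partial>N) \<le> (\<integral>\<^sup>+x. H i x \<partial>N) + ennreal (e * (1/2) ^ Suc i)" for i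
      using that(1)[of i] e unfolding P_def by simp
    then obtain q where q: "\<And>i. lsc_fun (q i)" "\<And>i x. H i x \<le> q i x"
        "\<And>i. (\<integral>\<^sup>+x. q i x \<partial>N) \<le> (\<integral>\<^sup>+x. H i x \<partial>N) + ennreal (e * (1/2) ^ Suc i)"
      by metis
    have "(\<integral>\<^sup>+x. (\<Sum>i. q i x) \<partial>N) = (\<Sum>i. \<integral>\<^sup>+x. q i x \<partial>N)"
      using q by (intro nn_integral_suminf meas lsc_fun_measurable)
    also have "\<dots> \<le> (\<Sum>i. (\<integral>\<^sup>+x. H i x \<partial>N) + ennreal (e * (1/2) ^ Suc i))"
      by (intro suminf_le q) auto
    also have "\<dots> = (\<Sum>i. \<integral>\<^sup>+x. H i x \<partial>N) + (\<Sum>i. ennreal (e * (1/2) ^ Suc i))"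
      by (intro suminf_add[symmetric]) auto
    also have "(\<Sum>i. ennreal (e * (1/2) ^ Suc i)) = ennreal e"
      using e sums_mult[OF power_half_series, of e] by (subst suminf_ennreal_eq) auto
    also have "(\<Sum>i. \<integral>\<^sup>+x. H i x \<partial>N) = (\<integral>\<^sup>+x. (\<Sum>i. H i x) \<partial>N)"
      by (intro nn_integral_suminf[symmetric] meas H)
    finally show "\<exists>q. lsc_fun q \<and> (\<forall>x. (\<Sum>i. H i x) \<le> q x) \<and> (\<integral>\<^sup>+x. q x \<partial>N) \<le> (\<integral>\<^sup>+x. (\<Sum>i. H i x) \<partial>N) + ennreal e"
      using q by (intro exI[of _ "\<lambda>x. \<Sum>i. q i x"]) (auto intro!: lsc_fun_suminf suminf_le)
  qed
  have P_add: "P (\<lambda>x. H x + K x)" if "P H" "P K" and H: "H \<in> borel_measurable borel" "K \<in> borel_measurable borel" for H K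
    unfolding P_def
  proof (intro allI impI)
    fix e :: real assume e: "0 < e"
    obtain q where q: "lsc_fun q" "\<forall>x. H x \<le> q x" "(\<integral>\<^sup>+x. q x \<partial>N) \<le> (\<integral>\<^sup>+x. H x \<partial>N) + ennreal (e / 2)"
      using \<open>P H\<close> e unfolding P_def by (meson half_gt_zero)
    obtain r where r: "lsc_fun r" "\<forall>x. K x \<le> r x" "(\<integral>\<^sup>+x. r x \<partial>N) \<le> (\<integral>\<^sup>+x. K x \<partial>N) + ennreal (e / 2)"
      using \<open>P K\<close> e unfolding P_def by (meson half_gt_zero)
    have "(\<integral>\<^sup>+x. q x + r x \<partial>N) = (\<integral>\<^sup>+x. q x \<partial>N) + (\<integral>\<^sup>+x. r x \<partial>N)"
      using q r by (intro nn_integral_add meas lsc_fun_measurable)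
    also have "\<dots> \<le> ((\<integral>\<^sup>+x. H x \<partial>N) + ennreal (e / 2)) + ((\<integral>\<^sup>+x. K x \<partial>N) + ennreal (e / 2))"
      using q r by (intro add_mono) auto
    also have "\<dots> = (\<integral>\<^sup>+x. H x \<partial>N) + (\<integral>\<^sup>+x. K x \<partial>N) + (ennreal (e/2) + ennreal (e / 2))"
      by (simp add: ac_simps)
    also have "ennreal (e/2) + ennreal (e / 2) = ennreal e" using e by (simp flip: ennreal_plus)
    also have "(\<integral>\<^sup>+x. H x \<partial>N) + (\<integral>\<^sup>+x. K x \<partial>N) = (\<integral>\<^sup>+x. H x + K x \<partial>N)"
      using H by (intro nn_integral_add[symmetric] meas)
    finally show "\<exists>q. lsc_fun q \<and> (\<forall>x. H x + K x \<le> q x) \<and> (\<integral>\<^sup>+x. q x \<partial>N) \<le> (\<integral>\<^sup>+x. H x + K x \<partial>N) + ennreal e"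
      using q r by (intro exI[of _ "\<lambda>x. q x + r x"]) (auto intro!: lsc_fun_add add_mono)
  qed
  have [simp]: "indicator {} = (\<lambda>x::'a. 0::ennreal)" by auto
  have P0: "P (\<lambda>x. 0)" using P_ind[of "{}"] by simp
  have P_fin: "P (\<lambda>x. \<Sum>y\<in>S. y * indicator (A y) x)"
    if "finite S" "\<And>y. y \<in> S \<Longrightarrow> A y \<in> sets borel" "\<And>y. y \<in> S \<Longrightarrow> y < top" for S A
    using that
  proof (induction S)
    case (insert y S)
    have "P (\<lambda>x. y * indicator (A y) x + (\<Sum>y\<in>S. y * indicator (A y) x))"
    proof (rule P_add)
      show "P (\<lambda>x. y * indicator (A y) x)"
        using insert.prems by (intro P_mult P_ind) auto
      show "P (\<lambda>x. \<Sum>y\<in>S. y * indicator (A y) x)" by (rule insert.IH) (auto intro: insert.prems)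
      show "(\<lambda>x. y * indicator (A y) x) \<in> borel_measurable borel"
        "(\<lambda>x. \<Sum>y\<in>S. y * indicator (A y) x) \<in> borel_measurable borel"
        using insert.prems(1)
        by (intro borel_measurable_sum borel_measurable_times_ennreal borel_measurable_indicator borel_measurable_const; simp)+
    qed
    then show ?case by (simp only: sum.insert[OF insert.hyps(1,2)])
  qed (use P0 in simp)
  have P_simple: "P f" if "simple_function borel f" "\<And>x. f x < top" for f
  proof -
    have "f = (\<lambda>x. \<Sum>y\<in>range f. y * indicator (f -` {y}) x)"
      using simple_function_indicator_representation[OF that(1)] by (intro ext) (simp only: space_borel UNIV_I Int_UNIV_right)
    moreover have "P (\<lambda>x. \<Sum>y\<in>range f. y * indicator (f -` {y}) x)"
      using that simple_functionD[OF that(1)] by (intro P_fin) auto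
    ultimately show ?thesis by simp
  qed
  obtain f where f: "\<And>i. simple_function borel (f i)" "incseq f" "\<And>i x. f i x < top" "\<And>x. (SUP i. f i x) = H x"
    using borel_measurable_implies_simple_function_sequence'[OF H] by metis
  \<comment> \<open>By monotonicity these differences telescope, and they are finite since
    \<open>f\<close> is, as \<open>P_simple\<close> requires.\<close>
  define D where "D i x = f (Suc i) x - f i x" for i x
  have D_simple: "simple_function borel (D i)" for i
    unfolding D_def by (rule simple_function_compose2[OF f(1) f(1)])
  have fm: "f i \<in> borel_measurable borel" for i using f(1) by (rule borel_measurable_simple_function)
  have part: "f 0 x + (\<Sum>i<n. D i x) = f n x" for n x
  proof (induction n)
    case (Suc n)
    have "f 0 x + (\<Sum>i<Suc n. D i x) = f n x + D n x" using Suc by (simp add: add.assoc[symmetric])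
    also have "\<dots> = f (Suc n) x"
      unfolding D_def add_diff_self_ennreal using f(2) by (auto simp: incseq_Suc_iff le_fun_def)
    finally show ?case .
  qed simp
  have "H x = f 0 x + (\<Sum>i. D i x)" for x
  proof -
    have "H x = (SUP n. f 0 x + (\<Sum>i<n. D i x))" by (simp add: part f(4))
    also have "\<dots> = f 0 x + (SUP n. \<Sum>i<n. D i x)" by (rule ennreal_SUP_add_right[symmetric]) auto
    finally show ?thesis by (simp add: suminf_eq_SUP)
  qed
  then have "H = (\<lambda>x. f 0 x + (\<Sum>i. D i x))" by auto
  moreover have "P (\<lambda>x. f 0 x + (\<Sum>i. D i x))"
  proof (intro P_add P_sum P_simple f D_simple)
    show "D i x < top" for i x unfolding D_def using f(3)[of "Suc i" x] by (simp add: diff_less_top_ennreal)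
    show "D i \<in> borel_measurable borel" for i by (intro borel_measurable_simple_function D_simple)
    then show "(\<lambda>x. \<Sum>i. D i x) \<in> borel_measurable borel" by measurable
  qed (use fm in auto)
  ultimately show ?thesis using e unfolding P_def by auto
qed

section \<open>Almost every curve\<close>

text \<open>What \<open>w dx\<close> contributes: Lebesgue measurability together with absolute
  continuity permits Borel majorants, and finite mass of balls gives finite energy to bounded
  functions of bounded support.\<close>

locale weighted_space =
  fixes M :: "'a::euclidean_space measure" and p :: real
  assumes sets_M: "sets M = sets lebesgue"
    and null_M: "\<And>N. N \<in> null_sets lborel \<Longrightarrow> emeasure M N = 0"
    and emeasure_cball_finite: "\<And>r. emeasure M (cball 0 r) < \<infinity>"
    and p: "1 < p"
begin

lemma p0: "0 < p" using p by simp

lemma space_M[simp]: "space M = UNIV"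
  using sets_eq_imp_space_eq[OF sets_M] by simp

lemma borel_sets_M[measurable (raw)]: "A \<in> sets borel \<Longrightarrow> A \<in> sets M"
  using sets_M by auto

lemma measurable_M: "f \<in> measurable borel N \<Longrightarrow> f \<in> measurable M N"
proof -
  assume f: "f \<in> measurable borel N"
  have "(\<lambda>x. x) \<in> measurable M borel" using borel_sets_M by (intro measurableI) auto
  from measurable_compose[OF this f] show ?thesis .
qed

lemma AE_lborel_imp_AE_M: "AE x in lborel. P x \<Longrightarrow> AE x in M. P x"
proof -
  assume "AE x in lborel. P x"
  then obtain N where N: "N \<in> null_sets lborel" "{x. \<not> P x} \<subseteq> N"
    by (auto elim!: AE_E simp: null_sets_def)
  then have "N \<in> null_sets M" using null_M[OF N(1)] by (auto simp: null_sets_def)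
  then show ?thesis by (rule AE_I'[of N]) (use N in auto)
qed

text \<open>A Borel function that agrees with \<open>h\<close> almost everywhere is raised to
  \<infinity> on a Borel null set. The domination must hold at every point, because line integrals
  may see null sets; the energy does not change.\<close>

lemma borel_majorant:
  assumes h: "h \<in> borel_measurable M"
  shows "\<exists>h'. h' \<in> borel_measurable borel \<and> (\<forall>x. h x \<le> (h' x :: ennreal)) \<and> (AE x in M. h' x = h x)"
proof -
  have "h \<in> borel_measurable (completion lborel)"
    using h sets_M by (simp cong: measurable_cong_sets)
  then obtain g where g: "g \<in> borel_measurable lborel" "AE x in lborel. h x = g x"
    using completion_ex_borel_measurable by blast
  then obtain N where N: "N \<in> null_sets lborel" "{x. h x \<noteq> g x} \<subseteq> N"
    by (auto elim!: AE_E simp: null_sets_def)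
  then have [measurable]: "N \<in> sets borel" by (auto simp: null_sets_def)
  have [measurable]: "g \<in> borel_measurable borel" using g by simp
  have "(\<lambda>x. if x \<in> N then \<infinity> else g x) \<in> borel_measurable borel" by measurable
  moreover have hg: "h x = g x" if "x \<notin> N" for x using N(2) that by blast
  then have "\<forall>x. h x \<le> (if x \<in> N then \<infinity> else g x)" by auto
  moreover have "AE x in lborel. x \<notin> N" using AE_not_in[OF N(1)] .
  then have "AE x in lborel. (if x \<in> N then \<infinity> else g x) = h x"
    by eventually_elim (simp add: hg)
  ultimately show ?thesis using AE_lborel_imp_AE_M by blast
qed

text \<open>Tents on growing balls, divided by the masses of these balls, have a series with small
  integral even if \<open>M\<close> is infinite. The weight makes the measure finite in
  \<open>vitali_caratheodory\<close>, controls function values in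
  \<open>cap_bounded_le_cap_open\<close> and bounds costs from below in
  \<open>hkm_cap_le_of_cap_bounded_le\<close>.\<close>

lemma exists_integrable_weight:
  assumes \<tau>: "0 < \<tau>"
  shows "\<exists>\<theta>::'a \<Rightarrow> real. continuous_on UNIV \<theta> \<and> (\<forall>x. 0 < \<theta> x \<and> \<theta> x \<le> 1) \<and>
    (\<integral>\<^sup>+x. ennreal (\<theta> x) \<partial>M) \<le> ennreal \<tau>"
proof -
  define b where "b k x = max 0 (min 1 (real k + 1 - norm x))" for k and x :: 'a
  define m where "m k = enn2real (emeasure M (cball 0 (real k + 1)))" for k
  \<comment> \<open>The factor \<open>min \<tau> 1\<close> serves both bounds, \<tau> for the
    integral and 1 for the values.\<close>
  define a where "a k = min \<tau> 1 * (1 / 2) ^ Suc k / (1 + m k)" for k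
  have m: "0 \<le> m k" "emeasure M (cball 0 (real k + 1)) = ennreal (m k)" for k
    using emeasure_cball_finite[of "real k + 1"] by (auto simp: m_def)
  have b: "0 \<le> b k x" "b k x \<le> 1" "b k x \<le> indicator (cball 0 (real k + 1)) x" for k x
    by (auto simp: b_def indicator_def)
  have a: "0 < a k" "a k \<le> (1/2) ^ Suc k" "a k * m k \<le> \<tau> * (1/2) ^ Suc k" for k
  proof -
    show "0 < a k" using \<tau> m(1)[of k] by (simp add: a_def)
    have "a k \<le> min \<tau> 1 * (1 / 2) ^ Suc k / 1"
      unfolding a_def using m(1)[of k] \<tau> by (intro divide_left_mono) auto
    also have "\<dots> \<le> 1 * (1/2) ^ Suc k" using \<tau> by (simp only: div_by_1) (intro mult_right_mono, auto)
    finally show "a k \<le> (1/2) ^ Suc k" by simp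
    have "a k * m k = min \<tau> 1 * (1 / 2) ^ Suc k * (m k / (1 + m k))" by (simp add: a_def)
    also have "\<dots> \<le> \<tau> * (1/2) ^ Suc k * 1"
      using \<tau> m(1)[of k] by (intro mult_mono) auto
    finally show "a k * m k \<le> \<tau> * (1/2) ^ Suc k" by simp
  qed
  have ab: "0 \<le> a k * b k x" "a k * b k x \<le> (1/2) ^ Suc k" for k x
    using mult_mono[OF a(2)[of k] b(2)[of k x]] a(1)[of k] b(1)[of k x] by (auto intro: mult_nonneg_nonneg)
  define \<theta> where "\<theta> x = (\<Sum>k. a k * b k x)" for x
  have s2: "summable (\<lambda>k. (1/2::real) ^ Suc k)" using power_half_series by (rule sums_summable)
  have sum: "summable (\<lambda>k. a k * b k x)" for x
    by (rule summable_comparison_test'[OF s2, of 0]) (use ab in auto)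
  have "uniform_limit UNIV (\<lambda>n x. \<Sum>k<n. a k * b k x) \<theta> sequentially"
    unfolding \<theta>_def by (rule Weierstrass_m_test[OF _ s2]) (use ab in \<open>auto simp del: power_Suc\<close>)
  then have "continuous_on UNIV \<theta>"
    by (rule uniform_limit_theorem[rotated])
      (auto intro!: always_eventually continuous_intros simp: b_def)
  moreover have "0 < \<theta> x" for x
  proof -
    obtain k where k: "norm x < real k" using reals_Archimedean2 by blast
    then have "0 < a k * b k x" using a(1)[of k] by (auto simp: b_def)
    also have "\<dots> \<le> \<theta> x" unfolding \<theta>_def using sum_le_suminf[OF sum, of "{k}"] ab by auto
    finally show ?thesis .
  qed
  moreover have "\<theta> x \<le> 1" for x
  proof -
    have "\<theta> x \<le> (\<Sum>k. (1/2) ^ Suc k)" unfolding \<theta>_def by (intro suminf_le ab sum s2)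
    then show ?thesis using power_half_series sums_unique by metis
  qed
  moreover have "(\<integral>\<^sup>+x. ennreal (\<theta> x) \<partial>M) \<le> ennreal \<tau>"
  proof -
    have [measurable]: "(\<lambda>x. ennreal (a k * b k x)) \<in> borel_measurable M" for k
      unfolding b_def by (intro measurable_M) measurable
    have "(\<integral>\<^sup>+x. ennreal (\<theta> x) \<partial>M) = (\<integral>\<^sup>+x. (\<Sum>k. ennreal (a k * b k x)) \<partial>M)"
      unfolding \<theta>_def by (intro nn_integral_cong) (use ab sum in \<open>simp add: suminf_ennreal2\<close>)
    also have "\<dots> = (\<Sum>k. \<integral>\<^sup>+x. ennreal (a k * b k x) \<partial>M)" by (rule nn_integral_suminf) measurable
    also have "\<dots> \<le> (\<Sum>k. ennreal (\<tau> * (1/2) ^ Suc k))"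
    proof (rule suminf_le)
      fix k
      have "(\<integral>\<^sup>+x. ennreal (a k * b k x) \<partial>M) \<le> (\<integral>\<^sup>+x. ennreal (a k) * indicator (cball 0 (real k + 1)) x \<partial>M)"
      proof (rule nn_integral_mono)
        fix x
        have "a k * b k x \<le> a k * indicator (cball 0 (real k + 1)) x"
          using b(3)[of k x] a(1)[of k] by (intro mult_left_mono) auto
        then show "ennreal (a k * b k x) \<le> ennreal (a k) * indicator (cball 0 (real k + 1)) x"
          by (auto simp: indicator_def split: if_splits intro: ennreal_leI ennreal_neg)
      qed
      also have "\<dots> = ennreal (a k) * ennreal (m k)"
        by (subst nn_integral_cmult_indicator) (auto simp: m)
      also have "\<dots> \<le> ennreal (\<tau> * (1/2) ^ Suc k)"
        using a[of k] m(1)[of k] by (simp add: ennreal_leI flip: ennreal_mult del: power_Suc)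
      finally show "(\<integral>\<^sup>+x. ennreal (a k * b k x) \<partial>M) \<le> ennreal (\<tau> * (1/2) ^ Suc k)" .
    qed auto
    also have "\<dots> = ennreal \<tau>"
      using \<tau> sums_mult[OF power_half_series, of \<tau>] by (subst suminf_ennreal_eq) auto
    finally show ?thesis .
  qed
  ultimately show ?thesis by blast
qed

text \<open>The finite measure with density \<theta> reduces this to
  \<open>vitali_caratheodory_L1\<close>, applied to the function \<open>H\<close> for which \<theta>
  times \<open>H\<close> is the \<open>p\<close>-th power of \<open>h'\<close>. The majorant is the
  \<open>p\<close>-th root of \<theta> times \<open>q\<close>.\<close>

lemma vitali_caratheodory:
  assumes h: "h \<in> borel_measurable M" and e: "0 < e"
  shows "\<exists>q. lsc_fun q \<and> (\<forall>x. h x \<le> q x) \<and>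
    (\<integral>\<^sup>+x. q x epowr p \<partial>M) \<le> (\<integral>\<^sup>+x. h x epowr p \<partial>M) + ennreal e"
proof -
  obtain h' where h'[measurable]: "h' \<in> borel_measurable borel" and hh: "\<And>x. h x \<le> h' x" "AE x in M. h' x = h x"
    using borel_majorant[OF h] by blast
  obtain \<theta> :: "'a \<Rightarrow> real" where \<theta>: "continuous_on UNIV \<theta>" "\<And>x. 0 < \<theta> x" "(\<integral>\<^sup>+x. ennreal (\<theta> x) \<partial>M) \<le> ennreal 1"
    using exists_integrable_weight[of 1] by auto
  have [measurable]: "\<theta> \<in> borel_measurable borel" by (rule borel_measurable_continuous_onI[OF \<theta>(1)])
  have id: "(\<lambda>x. x) \<in> measurable M borel" by (rule measurable_M) simp
  define N where "N = density (distr M borel (\<lambda>x. x)) (\<lambda>x. ennreal (\<theta> x))"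
  have N_int: "(\<integral>\<^sup>+x. f x \<partial>N) = (\<integral>\<^sup>+x. ennreal (\<theta> x) * f x \<partial>M)" if [measurable]: "f \<in> borel_measurable borel" for f
    unfolding N_def using id by (simp add: nn_integral_density nn_integral_distr)
  have sN: "sets N = sets borel" by (simp add: N_def)
  have "emeasure N UNIV = (\<integral>\<^sup>+x. 1 \<partial>N)" using sN sets_eq_imp_space_eq[OF sN] by simp
  also have "\<dots> \<le> ennreal 1" using N_int[of "\<lambda>_. 1"] \<theta>(3) by simp
  finally have fN: "emeasure N UNIV \<noteq> \<infinity>" by (auto simp: top_unique)
  define H where "H x = ennreal (1 / \<theta> x) * h' x epowr p" for x
  have Hm: "H \<in> borel_measurable borel" unfolding H_def by measurable
  have th1: "ennreal (\<theta> x) * ennreal (1 / \<theta> x) = 1" for x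
    using \<theta>(2)[of x] by (simp flip: ennreal_mult)
  have \<theta>H: "ennreal (\<theta> x) * H x = h' x epowr p" for x
    unfolding H_def mult.assoc[symmetric] th1 by simp
  obtain q where q: "lsc_fun q" "\<And>x. H x \<le> q x" "(\<integral>\<^sup>+x. q x \<partial>N) \<le> (\<integral>\<^sup>+x. H x \<partial>N) + ennreal e"
    using vitali_caratheodory_L1[OF sN fN Hm e] by blast
  define r where "r x = (ennreal (\<theta> x) * q x) epowr (1 / p)" for x
  have "lsc_fun r"
    unfolding r_def using \<theta> q p0 by (intro lsc_fun_epowr lsc_fun_mult) (auto intro: less_imp_le)
  moreover have "h x \<le> r x" for x
  proof -
    have "h' x epowr p \<le> ennreal (\<theta> x) * q x"
      unfolding \<theta>H[symmetric] by (intro mult_left_mono q) auto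
    then have "h' x \<le> r x" using p0 by (simp add: r_def epowr_le_iff)
    then show ?thesis using hh(1)[of x] by simp
  qed
  moreover have "(\<integral>\<^sup>+x. r x epowr p \<partial>M) \<le> (\<integral>\<^sup>+x. h x epowr p \<partial>M) + ennreal e"
  proof -
    have "(\<integral>\<^sup>+x. r x epowr p \<partial>M) = (\<integral>\<^sup>+x. q x \<partial>N)"
      using p0 by (simp add: N_int lsc_fun_measurable[OF q(1)] r_def epowr_epowr)
    also have "\<dots> \<le> (\<integral>\<^sup>+x. h' x epowr p \<partial>M) + ennreal e"
      using q(3) by (simp add: N_int[OF Hm] \<theta>H)
    also have "(\<integral>\<^sup>+x. h' x epowr p \<partial>M) = (\<integral>\<^sup>+x. h x epowr p \<partial>M)"
      by (rule nn_integral_cong_AE) (use hh(2) in auto)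
    finally show ?thesis .
  qed
  ultimately show ?thesis by blast
qed

lemma exists_small_multiple:
  assumes [measurable]: "r \<in> borel_measurable M" and r: "(\<integral>\<^sup>+x. r x epowr p \<partial>M) < \<infinity>" and d: "0 < d"
  shows "\<exists>c>0. (\<integral>\<^sup>+x. (ennreal c * r x) epowr p \<partial>M) \<le> ennreal d"
proof -
  obtain I where I: "(\<integral>\<^sup>+x. r x epowr p \<partial>M) = ennreal I" "0 \<le> I" using r by (cases "\<integral>\<^sup>+x. r x epowr p \<partial>M") auto
  define c where "c = (d / (1 + I)) powr (1 / p)"
  have c: "0 < c" using d I by (simp add: c_def)
  have cp: "c powr p = d / (1 + I)" using d I p0 by (simp add: c_def powr_powr)
  have "(\<integral>\<^sup>+x. (ennreal c * r x) epowr p \<partial>M) = ennreal (c powr p) * ennreal I"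
    using c p0 by (simp add: epowr_mult nn_integral_cmult I epowr_ennreal)
  also have "\<dots> = ennreal (d * (I / (1 + I)))"
    using d I by (simp add: cp flip: ennreal_mult)
  also have "\<dots> \<le> ennreal (d * 1)" using d I by (intro ennreal_leI mult_left_mono) auto
  finally show ?thesis using c by auto
qed

lemma measurable_restrict_UNIV: "f \<in> measurable (restrict_space M UNIV) N \<longleftrightarrow> f \<in> measurable M N"
proof -
  have "sets (restrict_space M UNIV) = sets M" by (simp add: sets_restrict_space)
  then show ?thesis by (simp cong: measurable_cong_sets)
qed

section \<open>The calculus of exceptional families of curves\<close>

abbreviation aec :: "(real \<Rightarrow> (real \<Rightarrow> 'a) \<Rightarrow> bool) \<Rightarrow> bool" where
  "aec P \<equiv> almost_every_curve p M UNIV P"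

text \<open>With a Borel witness, \<rho> is measurable along every curve, so that its line integrals
  are additive and homogeneous.\<close>

lemma aec_iff:
  "aec P \<longleftrightarrow> (\<exists>\<rho>::'a \<Rightarrow> ennreal. \<rho> \<in> borel_measurable borel \<and> (\<integral>\<^sup>+x. \<rho> x epowr p \<partial>M) < \<infinity> \<and>
     (\<forall>l \<gamma>. arc_length_curve UNIV l \<gamma> \<and> \<not> P l \<gamma> \<longrightarrow> line_integral l \<gamma> \<rho> = \<infinity>))" (is "_ \<longleftrightarrow> ?R")
proof
  assume "aec P"
  then obtain \<rho> where \<rho>: "\<rho> \<in> borel_measurable M" "(\<integral>\<^sup>+x. \<rho> x epowr p \<partial>M) < \<infinity>"
    "\<And>l \<gamma>. arc_length_curve UNIV l \<gamma> \<Longrightarrow> \<not> P l \<gamma> \<Longrightarrow> line_integral l \<gamma> \<rho> = \<infinity>"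
    unfolding almost_every_curve_def by (auto simp: measurable_restrict_UNIV)
  obtain \<rho>' where \<rho>': "\<rho>' \<in> borel_measurable borel" "\<And>x. \<rho> x \<le> \<rho>' x" "AE x in M. \<rho>' x = \<rho> x"
    using borel_majorant[OF \<rho>(1)] by blast
  have "(\<integral>\<^sup>+x. \<rho>' x epowr p \<partial>M) = (\<integral>\<^sup>+x. \<rho> x epowr p \<partial>M)"
    by (rule nn_integral_cong_AE) (use \<rho>'(3) in auto)
  moreover have "line_integral l \<gamma> \<rho>' = \<infinity>" if "arc_length_curve UNIV l \<gamma>" "\<not> P l \<gamma>" for l \<gamma>
    using \<rho>(3)[OF that] line_integral_mono[of l \<rho> \<gamma> \<rho>'] \<rho>'(2) by (simp add: top_unique)
  ultimately show ?R using \<rho> \<rho>'(1) by metis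
next
  assume ?R
  then show "aec P"
    unfolding almost_every_curve_def by (auto simp: measurable_restrict_UNIV intro: measurable_M)
qed

lemma aec_mono:
  "aec P \<Longrightarrow> (\<And>l \<gamma>. arc_length_curve UNIV l \<gamma> \<Longrightarrow> P l \<gamma> \<Longrightarrow> Q l \<gamma>) \<Longrightarrow> aec Q"
  unfolding almost_every_curve_def by blast

text \<open>A positive multiple keeps infinite line integrals infinite but makes the energy
  arbitrarily small. Exceptional curves can thus be absorbed into a density at negligible
  cost.\<close>

lemma aec_small:
  assumes "aec P" "0 < d"
  shows "\<exists>\<rho>::'a \<Rightarrow> ennreal. \<rho> \<in> borel_measurable borel \<and> (\<integral>\<^sup>+x. \<rho> x epowr p \<partial>M) \<le> ennreal d \<and>
     (\<forall>l \<gamma>. arc_length_curve UNIV l \<gamma> \<and> \<not> P l \<gamma> \<longrightarrow> line_integral l \<gamma> \<rho> = \<infinity>)"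
proof -
  obtain \<rho> :: "'a \<Rightarrow> ennreal" where \<rho>[measurable]: "\<rho> \<in> borel_measurable borel" and fin: "(\<integral>\<^sup>+x. \<rho> x epowr p \<partial>M) < \<infinity>"
    and bad: "\<And>l \<gamma>. arc_length_curve UNIV l \<gamma> \<Longrightarrow> \<not> P l \<gamma> \<Longrightarrow> line_integral l \<gamma> \<rho> = \<infinity>"
    using assms(1) unfolding aec_iff by blast
  obtain c where c: "0 < c" "(\<integral>\<^sup>+x. (ennreal c * \<rho> x) epowr p \<partial>M) \<le> ennreal d"
    using exists_small_multiple[OF measurable_M[OF \<rho>] fin assms(2)] by blast
  have "line_integral l \<gamma> (\<lambda>x. ennreal c * \<rho> x) = \<infinity>" if "arc_length_curve UNIV l \<gamma>" "\<not> P l \<gamma>" for l \<gamma>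
  proof -
    note [measurable] = lip1_measurable[OF lip1_clamp_curve[OF that(1)]]
    have "line_integral l \<gamma> (\<lambda>x. ennreal c * \<rho> x) = ennreal c * line_integral l \<gamma> \<rho>"
      unfolding line_integral_clamp by (simp add: mult.assoc nn_integral_cmult)
    then show ?thesis using bad[OF that] c by (simp add: ennreal_mult_top)
  qed
  then show ?thesis using c by (intro exI[of _ "\<lambda>x. ennreal c * \<rho> x"]) auto
qed

text \<open>A union of countably many exceptional families is exceptional: witnesses of energy at
  most \<open>small_weight p 1 i\<close> are summed.\<close>

lemma aec_all:
  assumes "\<And>i::nat. aec (P i)" shows "aec (\<lambda>l \<gamma>. \<forall>i. P i l \<gamma>)"
proof -
  have "\<exists>\<rho>::'a \<Rightarrow> ennreal. \<rho> \<in> borel_measurable borel \<and> (\<integral>\<^sup>+x. \<rho> x epowr p \<partial>M) \<le> ennreal (small_weight p 1 i) \<and>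
     (\<forall>l \<gamma>. arc_length_curve UNIV l \<gamma> \<and> \<not> P i l \<gamma> \<longrightarrow> line_integral l \<gamma> \<rho> = \<infinity>)" for i
    by (intro aec_small assms small_weight_pos) simp
  then obtain \<rho> :: "nat \<Rightarrow> 'a \<Rightarrow> ennreal" where \<rho>[measurable]: "\<And>i. \<rho> i \<in> borel_measurable borel"
    and int: "\<And>i. (\<integral>\<^sup>+x. \<rho> i x epowr p \<partial>M) \<le> ennreal (small_weight p 1 i)"
    and bad: "\<And>i l \<gamma>. arc_length_curve UNIV l \<gamma> \<Longrightarrow> \<not> P i l \<gamma> \<Longrightarrow> line_integral l \<gamma> (\<rho> i) = \<infinity>"
    by metis
  have "(\<integral>\<^sup>+x. (\<Sum>i. \<rho> i x) epowr p \<partial>M) \<le> ennreal 1"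
    using p0 int by (intro nn_integral_epowr_suminf_le measurable_M) auto
  then have "(\<integral>\<^sup>+x. (\<Sum>i. \<rho> i x) epowr p \<partial>M) < \<infinity>" by (simp add: order_le_less_trans)
  moreover have "line_integral l \<gamma> (\<lambda>x. \<Sum>i. \<rho> i x) = \<infinity>"
    if c: "arc_length_curve UNIV l \<gamma>" and ex: "\<not> (\<forall>i. P i l \<gamma>)" for l \<gamma>
  proof -
    obtain i where "\<not> P i l \<gamma>" using ex by blast
    then have "line_integral l \<gamma> (\<rho> i) = \<infinity>" using bad c by blast
    moreover have "line_integral l \<gamma> (\<rho> i) \<le> line_integral l \<gamma> (\<lambda>x. \<Sum>i. \<rho> i x)"
      using sum_le_suminf[of "\<lambda>i. \<rho> i _" "{i}"] by (intro line_integral_mono) auto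
    ultimately show ?thesis by (simp add: top_unique)
  qed
  ultimately show ?thesis unfolding aec_iff by (intro exI[of _ "\<lambda>x. \<Sum>i. \<rho> i x"]) auto
qed

lemma aec_conj:
  assumes "aec P" "aec Q" shows "aec (\<lambda>l \<gamma>. P l \<gamma> \<and> Q l \<gamma>)"
proof -
  have "aec (\<lambda>l \<gamma>. \<forall>i::nat. if i = 0 then P l \<gamma> else Q l \<gamma>)"
  proof (rule aec_all)
    show "aec (\<lambda>l \<gamma>. if i = 0 then P l \<gamma> else Q l \<gamma>)" for i :: nat
      using assms by (cases "i = 0") auto
  qed
  then show ?thesis by (rule aec_mono) (metis zero_neq_one)
qed

lemma aec_finite:
  assumes "f \<in> borel_measurable borel" "(\<integral>\<^sup>+x. f x epowr p \<partial>M) < \<infinity>"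
  shows "aec (\<lambda>l \<gamma>. line_integral l \<gamma> f < \<infinity>)"
  unfolding aec_iff using assms by (intro exI[of _ f]) (auto simp: not_less top_unique)

text \<open>An exceptional subcurve already has infinite integral of \<rho>, hence so has the whole
  curve, and the same witness serves.\<close>

lemma aec_subcurves:
  assumes "aec P"
  shows "aec (\<lambda>l \<gamma>. \<forall>a b. 0 \<le> a \<longrightarrow> a < b \<longrightarrow> b \<le> l \<longrightarrow> P (b - a) (\<lambda>t. \<gamma> (a + t)))"
proof -
  obtain \<rho> :: "'a \<Rightarrow> ennreal" where \<rho>[measurable]: "\<rho> \<in> borel_measurable borel" and fin: "(\<integral>\<^sup>+x. \<rho> x epowr p \<partial>M) < \<infinity>"
    and bad: "\<And>l \<gamma>. arc_length_curve UNIV l \<gamma> \<Longrightarrow> \<not> P l \<gamma> \<Longrightarrow> line_integral l \<gamma> \<rho> = \<infinity>"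
    using assms(1) unfolding aec_iff by blast
  have "line_integral l \<gamma> \<rho> = \<infinity>" if c: "arc_length_curve UNIV l \<gamma>"
    and ab: "0 \<le> a" "a < b" "b \<le> l" "\<not> P (b - a) (\<lambda>t. \<gamma> (a + t))" for l \<gamma> a b
  proof -
    have "\<infinity> = line_integral (b - a) (\<lambda>t. \<gamma> (a + t)) \<rho>"
      using bad[OF arc_length_curve_subcurve[OF c ab(1-3)] ab(4)] by simp
    also have "\<dots> = line_integral (b - a) (\<lambda>t. clamp_curve l \<gamma> (a + t)) \<rho>"
      using ab by (intro line_integral_cong) (auto simp: clamp_curve_eq)
    also have "\<dots> = (\<integral>\<^sup>+t\<in>{a..b}. \<rho> (clamp_curve l \<gamma> t) \<partial>lborel)"
      using ab by (intro line_integral_subcurve lip1_clamp_curve[OF c]) auto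
    also have "\<dots> \<le> line_integral l \<gamma> \<rho>"
      unfolding line_integral_clamp using ab by (intro nn_integral_mono) (auto split: split_indicator)
    finally show ?thesis by (simp add: top_unique)
  qed
  then show ?thesis unfolding aec_iff using fin by (intro exI[of _ \<rho>]) auto
qed

end

section \<open>Minimal weak upper gradients\<close>

text \<open>
  The sets \<open>{G \<le> H}\<close> and \<open>{H < G}\<close> are approximated from inside by compact sets \<open>C\<close> and \<open>D\<close>. An
  interval shorter than their distance misses one of them, and there one of the two bounds suffices.
\<close>

lemma increment_le_integral_min:
  fixes \<phi> :: "real \<Rightarrow> real" and G H :: "real \<Rightarrow> ennreal"
  assumes [measurable]: "G \<in> borel_measurable borel" "H \<in> borel_measurable borel" and l: "0 < l"
    and G: "(\<integral>\<^sup>+t\<in>{0..l}. G t \<partial>lborel) < \<infinity>" and H: "(\<integral>\<^sup>+t\<in>{0..l}. H t \<partial>lborel) < \<infinity>"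
    and incG: "\<And>a b. 0 \<le> a \<Longrightarrow> a < b \<Longrightarrow> b \<le> l \<Longrightarrow> ennreal \<bar>\<phi> b - \<phi> a\<bar> \<le> (\<integral>\<^sup>+t\<in>{a..b}. G t \<partial>lborel)"
    and incH: "\<And>a b. 0 \<le> a \<Longrightarrow> a < b \<Longrightarrow> b \<le> l \<Longrightarrow> ennreal \<bar>\<phi> b - \<phi> a\<bar> \<le> (\<integral>\<^sup>+t\<in>{a..b}. H t \<partial>lborel)"
  shows "ennreal \<bar>\<phi> l - \<phi> 0\<bar> \<le> (\<integral>\<^sup>+t\<in>{0..l}. min (G t) (H t) \<partial>lborel)"
proof (rule ennreal_le_epsilon)
  fix e :: real assume e: "0 < e"
  define K where "K t = (G t + H t) * indicator {0..l} t" for t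
  have Km[measurable]: "K \<in> borel_measurable borel" unfolding K_def by measurable
  have K: "integral\<^sup>N lborel K < \<infinity>"
    using G H unfolding K_def by (simp add: distrib_right nn_integral_add)
  \<comment> \<open>A finite Borel measure whose inner regularity supplies the compact sets and
    whose mass outside them bounds the loss.\<close>
  define N where "N = density lborel K"
  have sN: "sets N = sets borel" "space N = UNIV" by (simp_all add: N_def)
  have em: "emeasure N A = (\<integral>\<^sup>+t\<in>A. K t \<partial>lborel)" if "A \<in> sets borel" for A
    unfolding N_def using that by (simp add: emeasure_density)
  have fin: "emeasure N A < \<infinity>" if "A \<in> sets borel" for A
  proof -
    have "emeasure N A \<le> integral\<^sup>N lborel K"
      unfolding em[OF that] by (intro nn_integral_mono) (auto split: split_indicator)
    then show ?thesis using K by (rule order_le_less_trans)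
  qed
  have inner: "\<exists>C. C \<subseteq> A \<and> compact C \<and> emeasure N (A - C) \<le> ennreal (e / 2)" if A: "A \<in> sets borel" for A
  proof -
    have A_eq: "emeasure N A = (SUP C \<in> {C. C \<subseteq> A \<and> compact C}. emeasure N C)"
      using inner_regular[OF sN(1) _ A] fin[of UNIV] sN(2) by simp
    obtain a where a: "emeasure N A = ennreal a" "0 \<le> a" using fin[OF A] by (cases "emeasure N A") auto
    show ?thesis
    proof (cases "a = 0")
      case True
      then show ?thesis using a by (intro exI[of _ "{}"]) auto
    next
      case False
      then have "ennreal (a - e / 2) < emeasure N A" using a e by (simp add: ennreal_less_iff[OF] ennreal_lessI)
      then obtain C where C: "C \<subseteq> A" "compact C" "ennreal (a - e/2) < emeasure N C"
        unfolding A_eq by (auto simp: less_SUP_iff)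
      have CN: "C \<in> sets N" "A \<in> sets N" using C A sN by (auto simp: borel_compact)
      have fc: "emeasure N C \<noteq> \<infinity>" using fin[of C] CN sN by auto
      obtain c where c: "emeasure N C = ennreal c" "0 \<le> c" using fc by (cases "emeasure N C") auto
      have "emeasure N (A - C) = emeasure N A - emeasure N C"
        by (rule emeasure_Diff) (use C CN fc in auto)
      also have "\<dots> = ennreal (a - c)" using a c by (simp add: ennreal_minus)
      also have "\<dots> \<le> ennreal (e / 2)" 
      proof (rule ennreal_leI, cases "0 \<le> a - e / 2")
        case True
        then show "a - c \<le> e / 2" using C(3) c by (simp add: ennreal_less_iff)
      next
        case False
        then show "a - c \<le> e / 2" using c by simp
      qed
      finally show ?thesis using C by blast
    qed
  qed
  define A where "A = {t. G t \<le> H t}"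
  have [measurable]: "A \<in> sets borel" unfolding A_def by measurable
  obtain C where C: "C \<subseteq> A" "compact C" "emeasure N (A - C) \<le> ennreal (e / 2)" using inner[of A] by auto
  obtain D where D: "D \<subseteq> - A" "compact D" "emeasure N (- A - D) \<le> ennreal (e / 2)" using inner[of "- A"] by auto
  have [measurable]: "C \<in> sets borel" "D \<in> sets borel" using C D by (auto simp: borel_compact)
  obtain d where d: "0 < d" "\<And>x y. x \<in> C \<Longrightarrow> y \<in> D \<Longrightarrow> d \<le> dist x y"
  proof -
    have "C \<inter> D = {}" using C(1) D(1) by blast
    then show ?thesis
      using separate_compact_closed[of C D] C(2) D(2) that by (auto simp: compact_imp_closed)
  qed
  \<comment> \<open>\<open>J\<close> dominates \<open>G\<close> off \<open>D\<close> and
    \<open>H\<close> off \<open>C\<close>, and exceeds the minimum only on the small set outside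
    \<open>C \<union> D\<close>.\<close>
  define J where "J t = min (G t) (H t) + (G t + H t) * indicator (- (C \<union> D)) t" for t
  have [measurable]: "J \<in> borel_measurable borel" unfolding J_def by measurable
  have JC: "G t \<le> J t" if "t \<notin> D" for t
  proof (cases "t \<in> C")
    case True
    then have "G t \<le> H t" using C(1) by (auto simp: A_def)
    then show ?thesis by (simp add: J_def min_absorb1)
  next
    case False
    then show ?thesis using that by (auto simp: J_def intro: add_increasing)
  qed
  have JD: "H t \<le> J t" if "t \<notin> C" for t
  proof (cases "t \<in> D")
    case True
    then have "H t < G t" using D(1) by (auto simp: A_def)
    then show ?thesis by (simp add: J_def min_absorb2 less_imp_le)
  next
    case False
    then show ?thesis using that by (auto simp: J_def intro!: add_increasing add_increasing2)
  qed
  have Jint: "(\<integral>\<^sup>+t\<in>{0..l}. J t \<partial>lborel) \<le> (\<integral>\<^sup>+t\<in>{0..l}. min (G t) (H t) \<partial>lborel) + ennreal e"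
  proof -
    have "(\<integral>\<^sup>+t\<in>{0..l}. J t \<partial>lborel) = (\<integral>\<^sup>+t. min (G t) (H t) * indicator {0..l} t + K t * indicator (- (C \<union> D)) t \<partial>lborel)"
      by (intro nn_integral_cong) (auto simp: J_def K_def split: split_indicator)
    also have "\<dots> = (\<integral>\<^sup>+t\<in>{0..l}. min (G t) (H t) \<partial>lborel) + emeasure N (- (C \<union> D))"
      by (subst nn_integral_add) (auto simp: em)
    also have "emeasure N (- (C \<union> D)) \<le> emeasure N (A - C) + emeasure N (- A - D)"
    proof -
      have "emeasure N (- (C \<union> D)) \<le> emeasure N ((A - C) \<union> (- A - D))"
        by (rule emeasure_mono) (auto simp: sN)
      also have "\<dots> \<le> emeasure N (A - C) + emeasure N (- A - D)"
        by (rule emeasure_subadditive) (auto simp: sN)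
      finally show ?thesis .
    qed
    also have "\<dots> \<le> ennreal (e/2) + ennreal (e/2)" by (intro add_mono C D)
    also have "\<dots> = ennreal e" using e by (simp flip: ennreal_plus)
    finally show ?thesis by (simp add: add_left_mono)
  qed
  also have "\<dots> < \<infinity>"
  proof -
    have "(\<integral>\<^sup>+t\<in>{0..l}. min (G t) (H t) \<partial>lborel) \<le> (\<integral>\<^sup>+t\<in>{0..l}. G t \<partial>lborel)"
      by (intro nn_integral_mono mult_right_mono) auto
    then show ?thesis using G by (auto simp: order_le_less_trans)
  qed
  finally have Jfin: "(\<integral>\<^sup>+t\<in>{0..l}. J t \<partial>lborel) < \<infinity>" .
  define I where "I b = enn2real (\<integral>\<^sup>+t\<in>{0..b}. J t \<partial>lborel)" for b
  have Jfin': "(\<integral>\<^sup>+t\<in>{0..b}. J t \<partial>lborel) < \<infinity>" if "b \<le> l" for b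
  proof -
    have "(\<integral>\<^sup>+t\<in>{0..b}. J t \<partial>lborel) \<le> (\<integral>\<^sup>+t\<in>{0..l}. J t \<partial>lborel)"
      using that by (intro nn_integral_mono) (auto split: split_indicator)
    then show ?thesis using Jfin by (rule order_le_less_trans)
  qed
  have "\<bar>\<phi> l - \<phi> 0\<bar> \<le> I l - I 0"
  proof (rule local_increment_bound[where \<delta>="d/2"])
    fix a b assume ab: "0 \<le> a" "a \<le> b" "b \<le> l" "b - a \<le> d / 2"
    show "\<bar>\<phi> b - \<phi> a\<bar> \<le> I b - I a"
    proof (cases "a = b")
      case False
      then have "a < b" using ab by simp
      have "{a..b} \<inter> C = {} \<or> {a..b} \<inter> D = {}"
      proof (rule ccontr)
        assume "\<not> ?thesis"
        then obtain x y where "x \<in> C" "y \<in> D" "x \<in> {a..b}" "y \<in> {a..b}" by blast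
        moreover from this have "dist x y \<le> b - a" by (auto simp: dist_real_def)
        ultimately show False using d ab by fastforce
      qed
      then have "ennreal \<bar>\<phi> b - \<phi> a\<bar> \<le> (\<integral>\<^sup>+t\<in>{a..b}. J t \<partial>lborel)"
      proof
        assume "{a..b} \<inter> C = {}"
        then have "(\<integral>\<^sup>+t\<in>{a..b}. H t \<partial>lborel) \<le> (\<integral>\<^sup>+t\<in>{a..b}. J t \<partial>lborel)"
          using JD by (intro nn_integral_mono) (auto split: split_indicator simp: disjoint_iff)
        then show ?thesis using incH[of a b] ab \<open>a < b\<close> by (meson order_trans)
      next
        assume "{a..b} \<inter> D = {}"
        then have "(\<integral>\<^sup>+t\<in>{a..b}. G t \<partial>lborel) \<le> (\<integral>\<^sup>+t\<in>{a..b}. J t \<partial>lborel)"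
          using JC by (intro nn_integral_mono) (auto split: split_indicator simp: disjoint_iff)
        then show ?thesis using incG[of a b] ab \<open>a < b\<close> by (meson order_trans)
      qed
      also have "\<dots> = ennreal (I b - I a)"
        unfolding I_def using ab Jfin' by (intro enn2real_Icc_diff(1)[symmetric]) auto
      finally show ?thesis
        using enn2real_Icc_diff(2)[of J 0 a b] ab Jfin' by (simp add: I_def)
    qed simp
  qed (use d l in auto)
  then have "ennreal \<bar>\<phi> l - \<phi> 0\<bar> \<le> ennreal (I l)"
  proof (intro ennreal_leI)
    assume "\<bar>\<phi> l - \<phi> 0\<bar> \<le> I l - I 0"
    moreover have "0 \<le> I 0" by (simp add: I_def)
    ultimately show "\<bar>\<phi> l - \<phi> 0\<bar> \<le> I l" by linarith
  qed
  also have "\<dots> = (\<integral>\<^sup>+t\<in>{0..l}. J t \<partial>lborel)" using Jfin by (simp add: I_def)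
  finally show "ennreal \<bar>\<phi> l - \<phi> 0\<bar> \<le> (\<integral>\<^sup>+t\<in>{0..l}. min (G t) (H t) \<partial>lborel) + ennreal e"
    using Jint by (rule order_trans)
qed

context weighted_space
begin

abbreviation wug :: "('a \<Rightarrow> ereal) \<Rightarrow> ('a \<Rightarrow> ennreal) \<Rightarrow> bool" where
  "wug \<equiv> weak_upper_gradient p M UNIV"

lemma wug_iff: "wug u g \<longleftrightarrow> g \<in> borel_measurable M \<and>
   aec (\<lambda>l \<gamma>. endpoint_diff (u (\<gamma> 0)) (u (\<gamma> l)) \<le> line_integral l \<gamma> g)"
  by (simp add: weak_upper_gradient_def measurable_restrict_UNIV)

lemma wug_mono:
  assumes "wug u g" "\<And>x. g x \<le> h x" "h \<in> borel_measurable M"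
  shows "wug u h"
  unfolding wug_iff
  using assms by (auto simp: wug_iff intro!: line_integral_mono elim!: aec_mono order_trans)

lemma Lp_loc_cball:
  assumes "h \<in> Lp_loc p M" shows "(\<integral>\<^sup>+x\<in>cball 0 R. h x epowr p \<partial>M) < \<infinity>"
proof -
  have [measurable]: "h \<in> borel_measurable M" using assms by (simp add: Lp_loc_def)
  have "\<forall>x. \<exists>r>0. (\<integral>\<^sup>+y\<in>ball x r. h y epowr p \<partial>M) < \<infinity>" using assms by (simp add: Lp_loc_def)
  then obtain r where r: "\<And>x. 0 < r x" "\<And>x. (\<integral>\<^sup>+y\<in>ball x (r x). h y epowr p \<partial>M) < \<infinity>" by metis
  have "cball 0 R \<subseteq> (\<Union>x\<in>cball 0 R. ball x (r x))" using r(1) by force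
  then obtain F where F: "finite F" "cball 0 R \<subseteq> (\<Union>x\<in>F. ball x (r x))"
    using compactE_image[OF compact_cball, of "cball 0 R" "\<lambda>x. ball x (r x)" 0 R] by (metis open_ball)
  have [measurable]: "ball x (r x) \<in> sets M" for x by (rule borel_sets_M) simp
  have "(\<integral>\<^sup>+x\<in>cball 0 R. h x epowr p \<partial>M) \<le> (\<integral>\<^sup>+y. (\<Sum>x\<in>F. h y epowr p * indicator (ball x (r x)) y) \<partial>M)"
  proof (rule nn_integral_mono)
    fix y
    show "h y epowr p * indicator (cball 0 R) y \<le> (\<Sum>x\<in>F. h y epowr p * indicator (ball x (r x)) y)"
    proof (cases "y \<in> cball 0 R")
      case True
      then obtain x where x: "x \<in> F" "y \<in> ball x (r x)" using F by blast
      then have "h y epowr p \<le> h y epowr p * indicator (ball x (r x)) y" by simp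
      also have "\<dots> \<le> (\<Sum>x\<in>F. h y epowr p * indicator (ball x (r x)) y)"
        using x F by (intro member_le_sum) auto
      finally show ?thesis using True by simp
    qed simp
  qed
  also have "\<dots> = (\<Sum>x\<in>F. \<integral>\<^sup>+y\<in>ball x (r x). h y epowr p \<partial>M)"
    by (rule nn_integral_sum) measurable
  also have "\<dots> < \<infinity>" using r(2) F(1) by (simp add: less_top[symmetric]) 
  finally show ?thesis .
qed

text \<open>A curve is compact and lies in one of countably many balls, on each of which
  \<open>h\<close> is \<open>p\<close>-integrable.\<close>

lemma aec_finite_Lp_loc:
  assumes [measurable]: "h \<in> borel_measurable borel" and h: "h \<in> Lp_loc p M"
  shows "aec (\<lambda>l \<gamma>. line_integral l \<gamma> h < \<infinity>)"
proof -
  have [measurable]: "cball (0::'a) (real i) \<in> sets borel" for i by simp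
  have "aec (\<lambda>l \<gamma>. \<forall>i::nat. line_integral l \<gamma> (\<lambda>x. h x * indicator (cball 0 (real i)) x) < \<infinity>)"
  proof (intro aec_all aec_finite)
    fix i :: nat
    have "(\<integral>\<^sup>+x. (h x * indicator (cball 0 (real i)) x) epowr p \<partial>M) = (\<integral>\<^sup>+x\<in>cball 0 (real i). h x epowr p \<partial>M)"
      by (intro nn_integral_cong) (auto split: split_indicator)
    then show "(\<integral>\<^sup>+x. (h x * indicator (cball 0 (real i)) x) epowr p \<partial>M) < \<infinity>"
      using Lp_loc_cball[OF h] by simp
  qed measurable
  then show ?thesis
  proof (rule aec_mono)
    fix l \<gamma> assume c: "arc_length_curve UNIV l \<gamma>"
      and fin: "\<forall>i::nat. line_integral l \<gamma> (\<lambda>x. h x * indicator (cball 0 (real i)) x) < \<infinity>"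
    have "compact (\<gamma> ` {0..l})"
      using c by (intro compact_continuous_image) (auto simp: arc_length_curve_def)
    then obtain B where B: "\<And>x. x \<in> \<gamma> ` {0..l} \<Longrightarrow> norm x \<le> B"
      using compact_imp_bounded bounded_iff by metis
    obtain i :: nat where "B \<le> real i" using real_arch_simple by blast
    then have "line_integral l \<gamma> h = line_integral l \<gamma> (\<lambda>x. h x * indicator (cball 0 (real i)) x)"
      using B by (intro line_integral_cong) (force simp: indicator_def)
    then show "line_integral l \<gamma> h < \<infinity>" using fin by simp
  qed
qed

lemma endpoint_diff_finite:
  "endpoint_diff a b < \<infinity> \<Longrightarrow> \<bar>a\<bar> \<noteq> \<infinity> \<and> \<bar>b\<bar> \<noteq> \<infinity>"
  by (auto simp: endpoint_diff_def split: if_splits)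

text \<open>Along almost every curve both inequalities hold on all subcurves, with finite integrals.
  Then \<open>u\<close> is finite along the curve, since \<open>endpoint_diff\<close> is \<infinity>
  at infinite values, and \<open>increment_le_integral_min\<close> applies.\<close>

lemma wug_min:
  assumes [measurable]: "g \<in> borel_measurable borel" "h \<in> borel_measurable borel"
    and g: "wug u g" "g \<in> Lp_loc p M" and h: "wug u h" "h \<in> Lp_loc p M"
  shows "wug u (\<lambda>x. min (g x) (h x))"
  unfolding wug_iff
proof
  show "(\<lambda>x. min (g x) (h x)) \<in> borel_measurable M" by (intro measurable_M) measurable
  have sg: "aec (\<lambda>l \<gamma>. \<forall>a b. 0 \<le> a \<longrightarrow> a < b \<longrightarrow> b \<le> l \<longrightarrow>
      endpoint_diff (u (\<gamma> (a + 0))) (u (\<gamma> (a + (b - a)))) \<le> line_integral (b - a) (\<lambda>t. \<gamma> (a + t)) g)"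
    using g by (intro aec_subcurves) (simp add: wug_iff)
  have sh: "aec (\<lambda>l \<gamma>. \<forall>a b. 0 \<le> a \<longrightarrow> a < b \<longrightarrow> b \<le> l \<longrightarrow>
      endpoint_diff (u (\<gamma> (a + 0))) (u (\<gamma> (a + (b - a)))) \<le> line_integral (b - a) (\<lambda>t. \<gamma> (a + t)) h)"
    using h by (intro aec_subcurves) (simp add: wug_iff)
  show "aec (\<lambda>l \<gamma>. endpoint_diff (u (\<gamma> 0)) (u (\<gamma> l)) \<le> line_integral l \<gamma> (\<lambda>x. min (g x) (h x)))"
  proof (rule aec_mono[OF aec_conj[OF aec_conj[OF sg sh] aec_conj[OF aec_finite_Lp_loc[OF _ g(2)] aec_finite_Lp_loc[OF _ h(2)]]]])
    fix l and \<gamma> :: "real \<Rightarrow> 'a" assume c: "arc_length_curve UNIV l \<gamma>"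
    assume as: "((\<forall>a b. 0 \<le> a \<longrightarrow> a < b \<longrightarrow> b \<le> l \<longrightarrow>
      endpoint_diff (u (\<gamma> (a + 0))) (u (\<gamma> (a + (b - a)))) \<le> line_integral (b - a) (\<lambda>t. \<gamma> (a + t)) g) \<and>
      (\<forall>a b. 0 \<le> a \<longrightarrow> a < b \<longrightarrow> b \<le> l \<longrightarrow>
      endpoint_diff (u (\<gamma> (a + 0))) (u (\<gamma> (a + (b - a)))) \<le> line_integral (b - a) (\<lambda>t. \<gamma> (a + t)) h)) \<and>
      (line_integral l \<gamma> g < \<infinity> \<and> line_integral l \<gamma> h < \<infinity>)"
    have l: "0 < l" using c by (simp add: arc_length_curve_def)
    note lip = lip1_clamp_curve[OF c]
    note [measurable] = lip1_measurable[OF lip]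
    define \<gamma>' where "\<gamma>' = clamp_curve l \<gamma>"
    have [measurable]: "\<gamma>' \<in> borel_measurable borel" by (simp add: \<gamma>'_def)
    have sub: "line_integral (b - a) (\<lambda>t. \<gamma> (a + t)) f = (\<integral>\<^sup>+t\<in>{a..b}. f (\<gamma>' t) \<partial>lborel)"
      if "0 \<le> a" "a < b" "b \<le> l" and [measurable]: "f \<in> borel_measurable borel" for a b and f :: "'a \<Rightarrow> ennreal"
    proof -
      have "line_integral (b - a) (\<lambda>t. \<gamma> (a + t)) f = line_integral (b - a) (\<lambda>t. \<gamma>' (a + t)) f"
        using that by (intro line_integral_cong) (auto simp: clamp_curve_eq \<gamma>'_def)
      also have "\<dots> = (\<integral>\<^sup>+t\<in>{a..b}. f (\<gamma>' t) \<partial>lborel)"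
        using that unfolding \<gamma>'_def by (intro line_integral_subcurve lip) auto
      finally show ?thesis .
    qed
    have fin: "(\<integral>\<^sup>+t\<in>{0..l}. g (\<gamma>' t) \<partial>lborel) < \<infinity>" "(\<integral>\<^sup>+t\<in>{0..l}. h (\<gamma>' t) \<partial>lborel) < \<infinity>"
      using as by (simp_all add: line_integral_clamp \<gamma>'_def)
    have incg: "endpoint_diff (u (\<gamma> a)) (u (\<gamma> b)) \<le> (\<integral>\<^sup>+t\<in>{a..b}. g (\<gamma>' t) \<partial>lborel)"
      and inch: "endpoint_diff (u (\<gamma> a)) (u (\<gamma> b)) \<le> (\<integral>\<^sup>+t\<in>{a..b}. h (\<gamma>' t) \<partial>lborel)"
      if "0 \<le> a" "a < b" "b \<le> l" for a b
    proof -
      have "endpoint_diff (u (\<gamma> a)) (u (\<gamma> b)) \<le> line_integral (b - a) (\<lambda>t. \<gamma> (a + t)) g"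
        "endpoint_diff (u (\<gamma> a)) (u (\<gamma> b)) \<le> line_integral (b - a) (\<lambda>t. \<gamma> (a + t)) h"
        using as that by auto
      then show "endpoint_diff (u (\<gamma> a)) (u (\<gamma> b)) \<le> (\<integral>\<^sup>+t\<in>{a..b}. g (\<gamma>' t) \<partial>lborel)"
        "endpoint_diff (u (\<gamma> a)) (u (\<gamma> b)) \<le> (\<integral>\<^sup>+t\<in>{a..b}. h (\<gamma>' t) \<partial>lborel)"
        using sub[OF that, of g] sub[OF that, of h] by simp_all
    qed
    have u_fin: "\<bar>u (\<gamma> t)\<bar> \<noteq> \<infinity>" if "0 \<le> t" "t \<le> l" for t
    proof -
      have lt: "endpoint_diff (u (\<gamma> a)) (u (\<gamma> b)) < \<infinity>" if "0 \<le> a" "a < b" "b \<le> l" for a b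
      proof -
        have "(\<integral>\<^sup>+t\<in>{a..b}. g (\<gamma>' t) \<partial>lborel) \<le> (\<integral>\<^sup>+t\<in>{0..l}. g (\<gamma>' t) \<partial>lborel)"
          using that by (intro nn_integral_mono) (auto split: split_indicator)
        then show ?thesis using incg[OF that] fin(1) by (meson order_le_less_trans)
      qed
      show ?thesis
        using endpoint_diff_finite[OF lt[of 0 t]] endpoint_diff_finite[OF lt[of t l]] that l by (cases "t = 0") auto
    qed
    define \<phi> where "\<phi> t = real_of_ereal (u (\<gamma> t))" for t
    have ed: "endpoint_diff (u (\<gamma> a)) (u (\<gamma> b)) = ennreal \<bar>\<phi> b - \<phi> a\<bar>" if "0 \<le> a" "a \<le> b" "b \<le> l" for a b
      using u_fin[of a] u_fin[of b] that by (simp add: endpoint_diff_def \<phi>_def abs_minus_commute)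
    have "ennreal \<bar>\<phi> l - \<phi> 0\<bar> \<le> (\<integral>\<^sup>+t\<in>{0..l}. min (g (\<gamma>' t)) (h (\<gamma>' t)) \<partial>lborel)"
    proof (rule increment_le_integral_min[OF _ _ l fin])
      fix a b assume ab: "0 \<le> a" "a < b" "b \<le> l"
      show "ennreal \<bar>\<phi> b - \<phi> a\<bar> \<le> (\<integral>\<^sup>+t\<in>{a..b}. g (\<gamma>' t) \<partial>lborel)"
        "ennreal \<bar>\<phi> b - \<phi> a\<bar> \<le> (\<integral>\<^sup>+t\<in>{a..b}. h (\<gamma>' t) \<partial>lborel)"
        using incg[OF ab] inch[OF ab] ed[of a b] ab by auto
    qed measurable
    then show "endpoint_diff (u (\<gamma> 0)) (u (\<gamma> l)) \<le> line_integral l \<gamma> (\<lambda>x. min (g x) (h x))"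
      using ed[of 0 l] l by (simp add: line_integral_clamp \<gamma>'_def)
  qed measurable
qed

lemma Lp_imp_Lp_loc:
  assumes "g \<in> borel_measurable M" "(\<integral>\<^sup>+x. g x epowr p \<partial>M) < \<infinity>" shows "g \<in> Lp_loc p M"
  unfolding Lp_loc_def
proof (intro CollectI conjI allI assms)
  fix x
  have "(\<integral>\<^sup>+y\<in>ball x 1. g y epowr p \<partial>M) \<le> (\<integral>\<^sup>+x. g x epowr p \<partial>M)"
    by (intro nn_integral_mono) (auto split: split_indicator)
  then show "\<exists>r>0. (\<integral>\<^sup>+y\<in>ball x r. g y epowr p \<partial>M) < \<infinity>"
    using assms(2) by (intro exI[of _ 1]) (auto simp: order_le_less_trans)
qed

text \<open>Closure of \<open>S\<close> under minima turns a minimizing sequence into a decreasing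
  one, whose pointwise infimum \<open>g1\<close> has least energy. A merely locally integrable
  competitor is compared through its minimum with \<open>g1\<close>, which lies in \<open>S\<close>
  again because \<open>g1\<close> has finite energy.\<close>

lemma minimal_weak_upper_gradient_exists:
  assumes g0: "wug u g0" "(\<integral>\<^sup>+x. g0 x epowr p \<partial>M) < \<infinity>"
  shows "\<exists>g. is_minimal_weak_upper_gradient p M u g"
proof -
  define S where "S = {g. g \<in> borel_measurable borel \<and> wug u g \<and> (\<integral>\<^sup>+x. g x epowr p \<partial>M) < \<infinity>}"
  have maj: "\<exists>g'\<in>borel_measurable borel. wug u g' \<and> (\<forall>x. g x \<le> g' x) \<and> (AE x in M. g' x = g x)" if g: "wug u g" for g
  proof -
    have "g \<in> borel_measurable M" using g by (simp add: wug_iff)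
    then obtain g' where g': "g' \<in> borel_measurable borel" "\<And>x. g x \<le> g' x" "AE x in M. g' x = g x"
      using borel_majorant by blast
    moreover have "wug u g'" by (rule wug_mono[OF g g'(2) measurable_M[OF g'(1)]])
    ultimately show ?thesis by blast
  qed
  have S_ne: "S \<noteq> {}"
  proof -
    obtain g' where g': "g' \<in> borel_measurable borel" "wug u g'" "AE x in M. g' x = g0 x" using maj[OF g0(1)] by blast
    have "(\<integral>\<^sup>+x. g' x epowr p \<partial>M) = (\<integral>\<^sup>+x. g0 x epowr p \<partial>M)"
      by (rule nn_integral_cong_AE) (use g'(3) in auto)
    then have "g' \<in> S" using g' g0 by (simp add: S_def)
    then show ?thesis by blast
  qed
  have S_loc: "g \<in> Lp_loc p M" if "g \<in> S" for g
    using that by (intro Lp_imp_Lp_loc) (auto simp: S_def measurable_M)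
  have S_min: "(\<lambda>x. min (g x) (h x)) \<in> S" if g: "g \<in> S" and h: "h \<in> borel_measurable borel" "wug u h" "h \<in> Lp_loc p M" for g h
  proof -
    have "(\<integral>\<^sup>+x. min (g x) (h x) epowr p \<partial>M) \<le> (\<integral>\<^sup>+x. g x epowr p \<partial>M)"
      using p0 by (intro nn_integral_mono epowr_mono) auto
    then show ?thesis
      using g h wug_min[of g h u] S_loc[OF g] by (auto simp: S_def order_le_less_trans)
  qed
  define m where "m = (INF g\<in>S. \<integral>\<^sup>+x. g x epowr p \<partial>M)"
  have m_fin: "m < \<infinity>" using S_ne unfolding m_def S_def by (auto simp: INF_less_iff)
  have "\<exists>g\<in>S. (\<integral>\<^sup>+x. g x epowr p \<partial>M) < m + ennreal (1 / real (Suc n))" for n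
  proof -
    have "m < m + ennreal (1 / real (Suc n))"
      using m_fin by (cases m) (auto simp: ennreal_less_iff simp flip: ennreal_plus)
    then show ?thesis unfolding m_def INF_less_iff by simp
  qed
  then obtain g where g: "\<And>n. g n \<in> S" "\<And>n. (\<integral>\<^sup>+x. g n x epowr p \<partial>M) < m + ennreal (1 / real (Suc n))" by metis
  define G where "G = rec_nat (g 0) (\<lambda>n h x. min (h x) (g (Suc n) x))"
  have G0: "G 0 = g 0" and GS: "G (Suc n) = (\<lambda>x. min (G n x) (g (Suc n) x))" for n
    by (simp_all add: G_def)
  have G_S: "G n \<in> S" for n
  proof (induction n)
    case (Suc n)
    then show ?case unfolding GS using g(1)[of "Suc n"] S_loc by (intro S_min) (auto simp: S_def)
  qed (simp add: G0 g)
  have G_le: "G n x \<le> g n x" for n x by (cases n) (auto simp: G0 GS)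
  have G_dec: "decseq G" by (rule decseq_SucI) (auto simp: GS le_fun_def)
  define g1 where "g1 x = (INF n. G n x)" for x
  have Gm[measurable]: "G n \<in> borel_measurable borel" for n using G_S[of n] by (simp add: S_def)
  have g1m[measurable]: "g1 \<in> borel_measurable borel" unfolding g1_def by measurable
  have g1_int: "(\<integral>\<^sup>+x. g1 x epowr p \<partial>M) \<le> m"
  proof (rule ennreal_le_epsilon)
    fix e :: real assume "0 < e"
    then obtain n where n: "1 / real (Suc n) < e" using reals_Archimedean by (metis inverse_eq_divide)
    have "(\<integral>\<^sup>+x. g1 x epowr p \<partial>M) \<le> (\<integral>\<^sup>+x. g n x epowr p \<partial>M)"
    proof (intro nn_integral_mono epowr_mono p0)
      fix x show "g1 x \<le> g n x" unfolding g1_def using G_le[of n x] by (meson INF_lower2 UNIV_I)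
    qed
    also have "\<dots> \<le> m + ennreal (1 / real (Suc n))" using g(2)[of n] by simp
    also have "\<dots> \<le> m + ennreal e" using n by (intro add_left_mono ennreal_leI) auto
    finally show "(\<integral>\<^sup>+x. g1 x epowr p \<partial>M) \<le> m + ennreal e" .
  qed
  have "wug u g1"
    unfolding wug_iff
  proof
    show "g1 \<in> borel_measurable M" by (rule measurable_M) measurable
    have "aec (\<lambda>l \<gamma>. \<forall>n. endpoint_diff (u (\<gamma> 0)) (u (\<gamma> l)) \<le> line_integral l \<gamma> (G n))"
      by (rule aec_all) (use G_S in \<open>auto simp: S_def wug_iff\<close>)
    \<comment> \<open>Monotone convergence for a decreasing sequence needs one finite
      integral.\<close>
    moreover have "aec (\<lambda>l \<gamma>. line_integral l \<gamma> (G 0) < \<infinity>)"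
      by (rule aec_finite) (use G_S[of 0] in \<open>auto simp: S_def\<close>)
    ultimately have "aec (\<lambda>l \<gamma>. (\<forall>n. endpoint_diff (u (\<gamma> 0)) (u (\<gamma> l)) \<le> line_integral l \<gamma> (G n)) \<and> line_integral l \<gamma> (G 0) < \<infinity>)"
      by (rule aec_conj)
    then show "aec (\<lambda>l \<gamma>. endpoint_diff (u (\<gamma> 0)) (u (\<gamma> l)) \<le> line_integral l \<gamma> g1)"
    proof (rule aec_mono)
      fix l \<gamma> assume c: "arc_length_curve UNIV l \<gamma>"
        and as: "(\<forall>n. endpoint_diff (u (\<gamma> 0)) (u (\<gamma> l)) \<le> line_integral l \<gamma> (G n)) \<and> line_integral l \<gamma> (G 0) < \<infinity>"
      note [measurable] = lip1_measurable[OF lip1_clamp_curve[OF c]]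
      have "line_integral l \<gamma> g1 = (\<integral>\<^sup>+t. (INF n. G n (clamp_curve l \<gamma> t) * indicator {0..l} t) \<partial>lborel)"
        unfolding line_integral_clamp g1_def by (intro nn_integral_cong) (auto split: split_indicator)
      also have "\<dots> = (INF n. line_integral l \<gamma> (G n))"
        unfolding line_integral_clamp
      proof (rule nn_integral_monotone_convergence_INF_AE[where i=0])
        show "AE t in lborel. G (Suc i) (clamp_curve l \<gamma> t) * indicator {0..l} t \<le> G i (clamp_curve l \<gamma> t) * indicator {0..l} t" for i
          by (intro AE_I2 mult_right_mono) (auto simp: GS)
        show "(\<integral>\<^sup>+t\<in>{0..l}. G 0 (clamp_curve l \<gamma> t) \<partial>lborel) < \<infinity>"
          using as by (simp add: line_integral_clamp)
      qed measurable
      finally show "endpoint_diff (u (\<gamma> 0)) (u (\<gamma> l)) \<le> line_integral l \<gamma> g1"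
        using as by (auto intro: INF_greatest)
    qed
  qed
  then have g1_S: "g1 \<in> S" using g1_int m_fin by (auto simp: S_def order_le_less_trans)
  have m_le: "m \<le> (\<integral>\<^sup>+x. h x epowr p \<partial>M)" if "h \<in> S" for h
    unfolding m_def using that by (rule INF_lower)
  have "AE x in M. g1 x \<le> h x" if h: "wug u h" "h \<in> Lp_loc p M" for h
  proof -
    obtain h' where h'[measurable]: "h' \<in> borel_measurable borel" and h'w: "wug u h'" "AE x in M. h' x = h x"
      using maj[OF h(1)] by blast
    have "h' \<in> Lp_loc p M"
    proof -
      have "(\<integral>\<^sup>+y\<in>ball x r. h' y epowr p \<partial>M) = (\<integral>\<^sup>+y\<in>ball x r. h y epowr p \<partial>M)" for x r
        by (rule nn_integral_cong_AE) (use h'w(2) in auto)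
      then show ?thesis using h(2) measurable_M[OF h'] by (auto simp: Lp_loc_def)
    qed
    define k where "k x = min (g1 x) (h' x)" for x
    have k: "k \<in> S" unfolding k_def by (rule S_min[OF g1_S h' h'w(1)]) fact
    have km[measurable]: "k \<in> borel_measurable borel" unfolding k_def by measurable
    note [measurable] = measurable_M[OF km] measurable_M[OF g1m]
    \<comment> \<open>\<open>k\<close> is below \<open>g1\<close> but cannot have less energy, so
      the two agree almost everywhere, which says that \<open>g1 \<le> h'\<close> there.\<close>
    have le: "(\<integral>\<^sup>+x. g1 x epowr p \<partial>M) \<le> (\<integral>\<^sup>+x. k x epowr p \<partial>M)" using m_le[OF k] g1_int by simp
    have kfin: "(\<integral>\<^sup>+x. k x epowr p \<partial>M) \<noteq> \<infinity>" using k by (auto simp: S_def less_top)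
    have "(\<integral>\<^sup>+x. (g1 x epowr p - k x epowr p) \<partial>M) = (\<integral>\<^sup>+x. g1 x epowr p \<partial>M) - (\<integral>\<^sup>+x. k x epowr p \<partial>M)"
    proof (rule nn_integral_diff)
      show "AE x in M. k x epowr p \<le> g1 x epowr p"
        using p0 by (intro AE_I2 epowr_mono) (auto simp: k_def)
    qed (use kfin in auto)
    also have "\<dots> = 0" using le kfin by (simp add: diff_eq_0_iff_ennreal order_le_less_trans less_top)
    finally have "AE x in M. g1 x epowr p - k x epowr p = 0"
      by (subst (asm) nn_integral_0_iff_AE) auto
    moreover have "AE x in M. k x epowr p \<noteq> \<infinity>"
      by (rule nn_integral_noteq_infinite) (use kfin in auto)
    ultimately show ?thesis using h'w(2)
    proof eventually_elim
      case (elim x)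
      then have "g1 x epowr p \<le> k x epowr p" by (simp add: diff_eq_0_iff_ennreal)
      then have "g1 x \<le> (k x epowr p) epowr (1 / p)" using p0 by (simp add: epowr_le_iff)
      then have "g1 x \<le> k x" using p0 by (simp add: epowr_epowr)
      then show ?case using elim by (simp add: k_def)
    qed
  qed
  then have "is_minimal_weak_upper_gradient p M u g1"
    using \<open>wug u g1\<close> S_loc[OF g1_S] by (auto simp: is_minimal_weak_upper_gradient_def)
  then show ?thesis by blast
qed

lemma minimal_weak_upper_gradient:
  assumes g0: "wug u g0" "(\<integral>\<^sup>+x. g0 x epowr p \<partial>M) < \<infinity>"
  shows "wug u (minimal_weak_upper_gradient p M u)"
    and "AE x in M. minimal_weak_upper_gradient p M u x \<le> g0 x"
proof -
  have *: "is_minimal_weak_upper_gradient p M u (minimal_weak_upper_gradient p M u)"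
    unfolding minimal_weak_upper_gradient_def
    by (rule someI_ex[OF minimal_weak_upper_gradient_exists[OF g0]])
  then show "wug u (minimal_weak_upper_gradient p M u)"
    by (simp add: is_minimal_weak_upper_gradient_def)
  show "AE x in M. minimal_weak_upper_gradient p M u x \<le> g0 x"
    using * g0 by (auto simp: is_minimal_weak_upper_gradient_def wug_iff intro!: Lp_imp_Lp_loc)
qed

end

section \<open>Uniform convexity\<close>

text \<open>Write \<open>t powr p\<close> as \<open>t * exp ((p - 1) * ln t)\<close>. Strictness
  comes from \<open>1 + x < exp x\<close> for nonzero \<open>x\<close>, and
  \<open>t - 1 \<le> t * ln t\<close> removes the logarithm.\<close>

lemma powr_tangent_less:
  fixes t :: real
  assumes "1 < p" "0 \<le> t" "t \<noteq> 1"
  shows "1 + p * (t - 1) < t powr p"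
proof (cases "t = 0")
  case False
  then have t: "0 < t" using assms by simp
  have "1 + (p - 1) * ln t < exp ((p - 1) * ln t)"
  proof -
    define x where "x = (p - 1) * ln t"
    have x: "x \<noteq> 0" using assms t by (simp add: x_def ln_eq_zero_iff)
    show ?thesis
    proof (cases "0 \<le> 1 + x / 2")
      case True
      have "1 + x < 1 + x + (x / 2)\<^sup>2" using x by simp
      also have "\<dots> = (1 + x / 2)\<^sup>2" by (simp add: power2_eq_square algebra_simps)
      also have "\<dots> \<le> (exp (x / 2))\<^sup>2"
        using True exp_ge_add_one_self[of "x / 2"] by (intro power_mono) auto
      also have "\<dots> = exp x" by (simp add: exp_double[symmetric])
      finally show ?thesis by (simp add: x_def)
    next
      case False
      then have "1 + x < 0" by simp
      then have "1 + x < exp x" using exp_gt_zero less_trans by blast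
      then show ?thesis by (simp add: x_def)
    qed
  qed
  then have "t * (1 + (p - 1) * ln t) < t * exp ((p - 1) * ln t)" using t by simp
  also have "\<dots> = t powr p" using t by (simp add: powr_def algebra_simps exp_diff)
  finally have 1: "t * (1 + (p - 1) * ln t) < t powr p" .
  have "ln (1 / t) \<le> 1 / t - 1" using t by (intro ln_le_minus_one) auto
  then have "- ln t \<le> 1 / t - 1" using t by (simp add: ln_div)
  then have "t * (- ln t) \<le> t * (1 / t - 1)" using t by (intro mult_left_mono) auto
  then have "t - 1 \<le> t * ln t" using t by (simp add: algebra_simps)
  then have "(p - 1) * (t - 1) \<le> (p - 1) * (t * ln t)" using assms by (intro mult_left_mono) auto
  then show ?thesis using 1 by (simp add: algebra_simps)
qed (use assms in simp)

text \<open>The tangent at 1 is applied to \<open>x / m\<close> and \<open>y / m\<close> with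
  \<open>m\<close> the midpoint; their mean is 1, so the linear terms cancel.\<close>

lemma powr_midpoint_less:
  fixes x y :: real
  assumes p: "1 < p" and xy: "0 \<le> x" "0 \<le> y" "x \<noteq> y"
  shows "((x + y) / 2) powr p < (x powr p + y powr p) / 2"
proof -
  define m where "m = (x + y) / 2"
  have m: "0 < m" using xy by (simp add: m_def)
  have "1 + p * (x / m - 1) < (x / m) powr p" "1 + p * (y / m - 1) < (y / m) powr p"
  proof -
    have "x \<noteq> m" "y \<noteq> m" using xy by (auto simp: m_def)
    then have "x / m \<noteq> 1" "y / m \<noteq> 1" using m by auto
    then show "1 + p * (x / m - 1) < (x / m) powr p" "1 + p * (y / m - 1) < (y / m) powr p"
      using p xy m powr_tangent_less[of p "x / m"] powr_tangent_less[of p "y / m"] by simp_all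
  qed
  then have "2 + p * (x / m + y / m - 2) < (x / m) powr p + (y / m) powr p"
    by (simp add: algebra_simps)
  moreover have "x / m + y / m = 2"
  proof -
    have "x + y = 2 * m" by (simp add: m_def)
    then show ?thesis using m by (simp flip: add_divide_distrib)
  qed
  ultimately have "2 < (x powr p + y powr p) / m powr p"
    using xy m by (simp add: powr_divide add_divide_distrib)
  then show ?thesis using m by (simp add: m_def[symmetric] field_simps)
qed

text \<open>Strictness has two sources: for different norms the strict convexity of the power, for
  equal norms the strict triangle inequality, since equality there would make the vectors
  equal.\<close>

lemma norm_powr_midpoint_less:
  fixes a b :: "'v::real_inner"
  assumes p: "1 < p" and ab: "a \<noteq> b"
  shows "norm ((1/2) *\<^sub>R (a + b)) powr p < (norm a powr p + norm b powr p) / 2"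
proof (cases "norm a = norm b")
  case False
  have "norm ((1/2) *\<^sub>R (a + b)) powr p \<le> ((norm a + norm b) / 2) powr p"
    using p norm_triangle_ineq[of a b] by (intro powr_mono2) auto
  also have "\<dots> < (norm a powr p + norm b powr p) / 2"
    using False p by (intro powr_midpoint_less) auto
  finally show ?thesis .
next
  case True
  then have "norm a \<noteq> 0" using ab by auto
  then have "norm (a + b) \<noteq> norm a + norm b"
    using norm_triangle_eq[of a b] True ab by (auto simp: norm_triangle_eq)
  then have "norm (a + b) < norm a + norm b" using norm_triangle_ineq[of a b] by simp
  then have "norm ((1/2) *\<^sub>R (a + b)) powr p < norm a powr p"
    using p True by (intro powr_less_mono2) auto
  then show ?thesis using True by simp
qed

lemma norm_powr_midpoint_le:
  fixes a b :: "'v::real_inner"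
  assumes "1 < p"
  shows "norm ((1/2) *\<^sub>R (a + b)) powr p \<le> (norm a powr p + norm b powr p) / 2"
proof (cases "a = b")
  case True
  then show ?thesis by (simp flip: scaleR_2)
qed (use norm_powr_midpoint_less[OF assms, of a b] in auto)

text \<open>Both sides are homogeneous of degree \<open>p\<close> in the pair, so unit pairs
  suffice. Those with \<open>e * R z \<le> \<Delta> z\<close> form a compact set on which the
  convexity defect \<Phi> is positive, and this yields \<open>D\<close>; elsewhere the first term is
  enough. The inequality takes the role of Clarkson's inequalities for all \<open>p > 1\<close> at
  once.\<close>

lemma uniform_convexity_powr:
  assumes p: "1 < p" and e: "0 < e"
  shows "\<exists>D\<ge>0. \<forall>a b::'v::euclidean_space. norm (a - b) powr p \<le> e * (norm a powr p + norm b powr p) +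
    D * ((norm a powr p + norm b powr p) / 2 - norm ((1/2) *\<^sub>R (a + b)) powr p)"
proof -
  define R where "R z = norm (fst z) powr p + norm (snd z) powr p" for z :: "'v \<times> 'v"
  define \<Delta> where "\<Delta> z = norm (fst z - snd z) powr p" for z :: "'v \<times> 'v"
  define \<Phi> where "\<Phi> z = R z / 2 - norm ((1/2) *\<^sub>R (fst z + snd z)) powr p" for z :: "'v \<times> 'v"
  have cont: "continuous_on UNIV R" "continuous_on UNIV \<Delta>" "continuous_on UNIV \<Phi>"
    unfolding R_def[abs_def] \<Delta>_def[abs_def] \<Phi>_def[abs_def] using p
    by (intro continuous_intros continuous_on_powr'; auto)+
  have \<Phi>_ge: "0 \<le> \<Phi> z" for z
    using norm_powr_midpoint_le[OF p, of "fst z" "snd z"] by (simp add: \<Phi>_def R_def)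
  define S where "S = sphere 0 1 \<inter> {z. e * R z \<le> \<Delta> z}"
  have "compact S" unfolding S_def
    using cont by (intro compact_Int_closed compact_sphere closed_Collect_le continuous_intros) auto
  have S_pos: "0 < \<Phi> z" if "z \<in> S" for z
  proof -
    have "norm z = 1" "e * R z \<le> \<Delta> z" using that by (auto simp: S_def)
    then have "fst z \<noteq> snd z"
    proof (intro notI)
      assume eq: "fst z = snd z"
      then have "\<Delta> z = 0" by (simp add: \<Delta>_def)
      then have "e * R z \<le> 0" using \<open>e * R z \<le> \<Delta> z\<close> by simp
      then have "R z \<le> 0" using e by (simp add: mult_le_0_iff)
      then have "norm (fst z) powr p = 0" "norm (snd z) powr p = 0"
        unfolding R_def by (smt (verit) powr_ge_zero)+
      then have "z = 0" by (simp add: prod_eq_iff)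
      then show False using \<open>norm z = 1\<close> by simp
    qed
    then show ?thesis using norm_powr_midpoint_less[OF p, of "fst z" "snd z"] by (simp add: \<Phi>_def R_def)
  qed
  have "\<exists>D\<ge>0. \<forall>z\<in>S. \<Delta> z \<le> D * \<Phi> z"
  proof (cases "S = {}")
    case False
    obtain z0 where z0: "z0 \<in> S" "\<And>z. z \<in> S \<Longrightarrow> \<Phi> z0 \<le> \<Phi> z"
      using continuous_attains_inf[OF \<open>compact S\<close> False continuous_on_subset[OF cont(3)]] by auto
    obtain z1 where z1: "z1 \<in> S" "\<And>z. z \<in> S \<Longrightarrow> \<Delta> z \<le> \<Delta> z1"
      using continuous_attains_sup[OF \<open>compact S\<close> False continuous_on_subset[OF cont(2)]] by auto
    have "\<Delta> z \<le> \<Delta> z1 / \<Phi> z0 * \<Phi> z" if "z \<in> S" for z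
    proof -
      have "\<Delta> z \<le> \<Delta> z1 / \<Phi> z0 * \<Phi> z0" using z1(2)[OF that] S_pos[OF z0(1)] by simp
      also have "\<dots> \<le> \<Delta> z1 / \<Phi> z0 * \<Phi> z"
        using z0(2)[OF that] S_pos[OF z0(1)] by (intro mult_left_mono) (auto simp: \<Delta>_def)
      finally show ?thesis .
    qed
    moreover have "0 \<le> \<Delta> z1 / \<Phi> z0" using \<Phi>_ge by (simp add: \<Delta>_def)
    ultimately show ?thesis by blast
  qed auto
  then obtain D where D: "0 \<le> D" "\<And>z. z \<in> S \<Longrightarrow> \<Delta> z \<le> D * \<Phi> z" by blast
  have sph: "\<Delta> z \<le> e * R z + D * \<Phi> z" if "norm z = 1" for z
  proof (cases "z \<in> S")
    case True
    then show ?thesis using D(2)[OF True] e by (simp add: R_def add_increasing)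
  next
    case False
    then have "\<Delta> z < e * R z" using that by (simp add: S_def)
    moreover have "0 \<le> D * \<Phi> z" using D(1) \<Phi>_ge by simp
    ultimately show ?thesis by simp
  qed
  have hom: "R (r *\<^sub>R z) = r powr p * R z" "\<Delta> (r *\<^sub>R z) = r powr p * \<Delta> z" "\<Phi> (r *\<^sub>R z) = r powr p * \<Phi> z" if "0 \<le> r" for r z
  proof -
    have sc: "norm (r *\<^sub>R x) powr p = r powr p * norm x powr p" for x :: 'v
      using that by (simp add: powr_mult)
    show 1: "R (r *\<^sub>R z) = r powr p * R z" by (simp only: R_def fst_scaleR snd_scaleR sc distrib_left)
    show "\<Delta> (r *\<^sub>R z) = r powr p * \<Delta> z"
      by (simp only: \<Delta>_def fst_scaleR snd_scaleR scaleR_diff_right[symmetric] sc)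
    have "(1/2) *\<^sub>R (fst (r *\<^sub>R z) + snd (r *\<^sub>R z)) = r *\<^sub>R ((1/2) *\<^sub>R (fst z + snd z))"
      by (simp add: scaleR_add_right)
    then show "\<Phi> (r *\<^sub>R z) = r powr p * \<Phi> z"
      by (simp only: \<Phi>_def 1 sc right_diff_distrib times_divide_eq_right)
  qed
  have gen: "\<Delta> z \<le> e * R z + D * \<Phi> z" for z
  proof (cases "z = 0")
    case True
    then show ?thesis using p by (simp add: \<Delta>_def R_def \<Phi>_def)
  next
    case False
    define w where "w = (1 / norm z) *\<^sub>R z"
    have zw: "z = norm z *\<^sub>R w" "norm w = 1" using False by (simp_all add: w_def)
    have "\<Delta> z = norm z powr p * \<Delta> w" by (subst zw(1), subst hom) auto
    also have "\<dots> \<le> norm z powr p * (e * R w + D * \<Phi> w)"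
      by (intro mult_left_mono sph zw) auto
    also have "\<dots> = e * (norm z powr p * R w) + D * (norm z powr p * \<Phi> w)" by (simp add: algebra_simps)
    also have "norm z powr p * R w = R z" by (subst (2) zw(1), subst hom) auto
    also have "norm z powr p * \<Phi> w = \<Phi> z" by (subst (2) zw(1), subst hom) auto
    finally show ?thesis .
  qed
  show ?thesis
    using gen[of "(_, _)"] D(1) by (intro exI[of _ D]) (auto simp: \<Delta>_def R_def \<Phi>_def)
qed

text \<open>Integrate the pointwise inequality. The midpoint stays in \<open>A N\<close> and so has
  energy at least \<open>m - \<delta>\<close>, which leaves a defect of at most
  \<open>2 * \<delta>\<close>. As \<open>m\<close> is a supremum of infima, \<open>N\<close> is
  chosen such that the infimum over \<open>A N\<close> is almost \<open>m\<close>.\<close>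

lemma uniform_convexity_integral:
  fixes A :: "nat \<Rightarrow> ('a \<Rightarrow> 'v::euclidean_space) set" and C :: real
  assumes p: "1 < p" and C: "0 \<le> C" and \<eta>: "0 < \<eta>"
    and meas: "\<And>i f. f \<in> A i \<Longrightarrow> f \<in> borel_measurable M"
    and mid: "\<And>i f g. f \<in> A i \<Longrightarrow> g \<in> A i \<Longrightarrow> (\<lambda>x. (1/2) *\<^sub>R (f x + g x)) \<in> A i"
    and m: "ennreal m = (SUP i. INF f\<in>A i. \<integral>\<^sup>+x. ennreal (norm (f x) powr p) \<partial>M)" "0 \<le> m"
  shows "\<exists>N. \<exists>\<delta>>0. \<forall>f\<in>A N. \<forall>g\<in>A N. (\<integral>\<^sup>+x. ennreal (norm (f x) powr p) \<partial>M) \<le> ennreal (m + \<delta>) \<longrightarrow>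
     (\<integral>\<^sup>+x. ennreal (norm (g x) powr p) \<partial>M) \<le> ennreal (m + \<delta>) \<longrightarrow>
     (\<integral>\<^sup>+x. ennreal (norm (f x - g x) powr p) \<partial>M) \<le> ennreal \<eta>"
proof -
  define E where "E f = (\<integral>\<^sup>+x. ennreal (norm (f x) powr p) \<partial>M)" for f :: "'a \<Rightarrow> 'v"
  \<comment> \<open>\<open>e0\<close> makes the first error at most half of \<eta>. The constant
    \<open>D\<close> depends on \<open>e0\<close>, and \<delta> is then taken small against
    \<open>D\<close> for the other half.\<close>
  define e0 where "e0 = \<eta> / (4 * (m + 1))"
  have e0: "0 < e0" using \<eta> m(2) by (simp add: e0_def)
  obtain D where D: "0 \<le> D" "\<And>a b::'v. norm (a - b) powr p \<le> e0 * (norm a powr p + norm b powr p) +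
    D * ((norm a powr p + norm b powr p) / 2 - norm ((1/2) *\<^sub>R (a + b)) powr p)"
    using uniform_convexity_powr[OF p e0] by blast
  define \<delta> where "\<delta> = min 1 (\<eta> / (4 * (D + 1)))"
  have \<delta>: "0 < \<delta>" "\<delta> \<le> 1" "D * (2 * \<delta>) \<le> \<eta> / 2"
  proof -
    show "0 < \<delta>" "\<delta> \<le> 1" using \<eta> D(1) by (auto simp: \<delta>_def)
    have "D * (2 * \<delta>) \<le> D * (2 * (\<eta> / (4 * (D + 1))))"
      using D(1) by (intro mult_left_mono) (auto simp: \<delta>_def)
    also have "\<dots> = (D / (D + 1)) * (\<eta> / 2)" using D(1) by (simp add: field_simps)
    also have "\<dots> \<le> 1 * (\<eta> / 2)" using D(1) \<eta> by (intro mult_right_mono) auto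
    finally show "D * (2 * \<delta>) \<le> \<eta> / 2" by simp
  qed
  have "\<exists>N. ennreal (m - \<delta>) \<le> (INF f\<in>A N. E f)"
  proof (cases "0 < m")
    case True
    then have "ennreal (m - \<delta>) < ennreal m" using \<delta> by (intro ennreal_lessI) auto
    then show ?thesis using m(1) unfolding E_def by (auto simp: less_SUP_iff intro: less_imp_le)
  next
    \<comment> \<open>Here \<open>m = 0\<close>, and the lower bound
      \<open>ennreal (m - \<delta>)\<close> is truncated to 0.\<close>
    case False
    then show ?thesis using m \<delta> by (simp add: ennreal_neg)
  qed
  then obtain N where N: "\<And>f. f \<in> A N \<Longrightarrow> ennreal (m - \<delta>) \<le> E f" by (auto simp: le_INF_iff)
  have "E (\<lambda>x. f x - g x) \<le> ennreal \<eta>" if f: "f \<in> A N" and g: "g \<in> A N" and Ef: "E f \<le> ennreal (m + \<delta>)" and Eg: "E g \<le> ennreal (m + \<delta>)" for f g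
  proof -
    note [measurable] = meas[OF f] meas[OF g]
    define h where "h x = (1/2) *\<^sub>R (f x + g x)" for x
    have h: "h \<in> A N" unfolding h_def using mid[OF f g] by simp
    have [measurable]: "h \<in> borel_measurable M" by (rule meas[OF h])
    have pw: "norm (f x - g x) powr p + D * norm (h x) powr p \<le> (e0 + D / 2) * (norm (f x) powr p + norm (g x) powr p)" for x
      using D(2)[of "f x" "g x"] by (simp add: h_def algebra_simps add_divide_distrib)
    have "E (\<lambda>x. f x - g x) + ennreal D * E h = (\<integral>\<^sup>+x. ennreal (norm (f x - g x) powr p + D * norm (h x) powr p) \<partial>M)"
      unfolding E_def using D(1) by (simp add: nn_integral_add nn_integral_cmult ennreal_mult)
    also have "\<dots> \<le> (\<integral>\<^sup>+x. ennreal ((e0 + D / 2) * (norm (f x) powr p + norm (g x) powr p)) \<partial>M)"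
      by (intro nn_integral_mono ennreal_leI pw)
    also have "\<dots> = ennreal (e0 + D / 2) * (E f + E g)"
      unfolding E_def using D(1) e0 by (simp add: ennreal_mult nn_integral_add nn_integral_cmult)
    also have "\<dots> \<le> ennreal (e0 + D / 2) * (ennreal (m + \<delta>) + ennreal (m + \<delta>))"
      by (intro mult_left_mono add_mono Ef Eg) auto
    also have "\<dots> = ennreal ((e0 + D / 2) * (2 * (m + \<delta>)))"
      using D(1) e0 m(2) \<delta> by (simp flip: ennreal_mult ennreal_plus)
    finally have main: "E (\<lambda>x. f x - g x) + ennreal D * E h \<le> ennreal ((e0 + D / 2) * (2 * (m + \<delta>)))" .
    have "ennreal D * ennreal (m - \<delta>) \<le> ennreal D * E h" by (intro mult_left_mono N h) auto
    then have main2: "E (\<lambda>x. f x - g x) + ennreal (D * (m - \<delta>)) \<le> ennreal ((e0 + D / 2) * (2 * (m + \<delta>)))"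
      using main D(1) by (simp add: ennreal_mult'[symmetric]) (meson add_left_mono order_trans)
    then have "E (\<lambda>x. f x - g x) < \<infinity>"
      by (metis ennreal_add_eq_top ennreal_neq_top infinity_ennreal_def less_top top_unique)
    then obtain r where r: "E (\<lambda>x. f x - g x) = ennreal r" "0 \<le> r" by (cases "E (\<lambda>x. f x - g x)") auto
    have rle: "r + D * (m - \<delta>) \<le> (e0 + D / 2) * (2 * (m + \<delta>))"
    proof (cases "0 \<le> D * (m - \<delta>)")
      case True
      moreover have "0 \<le> (e0 + D / 2) * (2 * (m + \<delta>))" using D(1) e0 m(2) \<delta> by simp
      ultimately show ?thesis using main2 r by (simp flip: ennreal_plus)
    next
      case False
      moreover have "0 \<le> (e0 + D / 2) * (2 * (m + \<delta>))" using D(1) e0 m(2) \<delta> by simp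
      ultimately show ?thesis using main2 r by (simp add: ennreal_neg)
    qed
    have "r \<le> 2 * e0 * (m + \<delta>) + D * (2 * \<delta>)" using rle by (simp add: algebra_simps)
    also have "\<dots> \<le> 2 * e0 * (m + 1) + \<eta> / 2" using \<delta> e0 by (intro add_mono mult_left_mono) auto
    also have "\<dots> = \<eta>" using m(2) by (simp add: e0_def field_simps)
    finally show ?thesis using r by (simp add: ennreal_leI)
  qed
  then show ?thesis using \<delta>(1) unfolding E_def by blast
qed

text \<open>The infima over the shrinking sets increase to some \<open>m \<le> C\<close>, and
  near-minimizers far out are close to each other. Hence all differences together cost at most
  \<open>e\<close>, while \<open>f 0\<close> plus the sum of the differences dominates every
  \<open>f i\<close>. The factor \<open>K\<close> leaves room for the constants of a cutoff.\<close>

lemma fast_cauchy_minimizing_sequence: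
  fixes A :: "nat \<Rightarrow> ('a \<Rightarrow> 'v::euclidean_space) set" and C K :: real
  assumes p: "1 < p" and C: "0 \<le> C" and K: "0 \<le> K" and e: "0 < e"
    and meas: "\<And>i f. f \<in> A i \<Longrightarrow> f \<in> borel_measurable M"
    and dec: "\<And>i. A (Suc i) \<subseteq> A i"
    and mid: "\<And>i f g. f \<in> A i \<Longrightarrow> g \<in> A i \<Longrightarrow> (\<lambda>x. (1/2) *\<^sub>R (f x + g x)) \<in> A i"
    and bound: "\<And>i d. 0 < d \<Longrightarrow> \<exists>f\<in>A i. (\<integral>\<^sup>+x. ennreal (norm (f x) powr p) \<partial>M) \<le> ennreal (C + d)"
  shows "\<exists>f. (\<forall>i. f i \<in> A i) \<and>
    (\<integral>\<^sup>+x. (ennreal (norm (f 0 x)) + (\<Sum>i. ennreal (K * norm (f (Suc i) x - f i x)))) epowr p \<partial>M) \<le> ennreal (C + e)"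
proof -
  define E where "E f = (\<integral>\<^sup>+x. ennreal (norm (f x) powr p) \<partial>M)" for f :: "'a \<Rightarrow> 'v"
  have inf_le: "(INF f\<in>A i. E f) \<le> ennreal C" for i
  proof (rule ennreal_le_epsilon)
    fix d :: real assume "0 < d"
    then obtain f where f: "f \<in> A i" "E f \<le> ennreal (C + d)" using bound[of d i] by (auto simp: E_def)
    have "(INF f\<in>A i. E f) \<le> E f" using f(1) by (rule INF_lower)
    also have "\<dots> \<le> ennreal C + ennreal d" using f(2) C \<open>0 < d\<close> by simp
    finally show "(INF f\<in>A i. E f) \<le> ennreal C + ennreal d" .
  qed
  then have sup_le: "(SUP i. INF f\<in>A i. E f) \<le> ennreal C" by (rule SUP_least)
  define s where "s = (SUP i. INF f\<in>A i. E f)"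
  have "s \<le> ennreal C" using sup_le by (simp add: s_def)
  then have "s < top" by (rule order_le_less_trans) simp
  define m where "m = enn2real s"
  have m: "ennreal m = (SUP i. INF f\<in>A i. E f)" "0 \<le> m"
    using \<open>s < top\<close> by (simp_all add: m_def flip: s_def)
  have "ennreal m \<le> ennreal C" unfolding m(1) by (rule sup_le)
  then have mC: "m \<le> C" using C by simp
  obtain d where d: "0 < d" "\<And>f g. f \<in> borel_measurable M \<Longrightarrow> g \<in> borel_measurable M \<Longrightarrow>
    (\<integral>\<^sup>+x. f x epowr p \<partial>M) \<le> ennreal (C + e / 2) \<Longrightarrow> (\<integral>\<^sup>+x. g x epowr p \<partial>M) \<le> ennreal d \<Longrightarrow>
    (\<integral>\<^sup>+x. (f x + g x) epowr p \<partial>M) \<le> ennreal (C + e / 2 + e / 2)"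
    using nn_integral_epowr_add_small[OF p, of "C + e/2" "e/2" M] C e by auto
  \<comment> \<open>The tolerance is divided by \<open>(K + 1) powr p\<close> because the
    differences get multiplied by \<open>K\<close>; the summand 1 prevents a division by
    zero.\<close>
  define \<eta> where "\<eta> i = small_weight p d i / (K + 1) powr p" for i
  have \<eta>: "0 < \<eta> i" for i using small_weight_pos[OF d(1), of p i] K by (simp add: \<eta>_def)
  have "\<exists>N. \<exists>\<delta>>0. \<forall>f\<in>A N. \<forall>g\<in>A N. E f \<le> ennreal (m + \<delta>) \<longrightarrow> E g \<le> ennreal (m + \<delta>) \<longrightarrow> E (\<lambda>x. f x - g x) \<le> ennreal (\<eta> i)" for i
    unfolding E_def
  proof (rule uniform_convexity_integral[where A=A and C=C and m=m and M=M and p=p and \<eta>="\<eta> i"])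
    show "f \<in> borel_measurable M" if "f \<in> A i" for i f using that by (rule meas)
    show "(\<lambda>x. (1/2) *\<^sub>R (f x + g x)) \<in> A i" if "f \<in> A i" "g \<in> A i" for i f g using that by (rule mid)
    show "ennreal m = (SUP i. INF f\<in>A i. \<integral>\<^sup>+x. ennreal (norm (f x) powr p) \<partial>M)"
      by (rule m(1)[unfolded E_def])
    show "1 < p" "0 \<le> C" "0 < \<eta> i" "0 \<le> m" by (fact p C \<eta> m(2))+
  qed
  moreover define Q where "Q i N \<delta> \<longleftrightarrow> \<delta> > 0 \<and> (\<forall>f\<in>A N. \<forall>g\<in>A N. E f \<le> ennreal (m + \<delta>) \<longrightarrow> E g \<le> ennreal (m + \<delta>) \<longrightarrow> E (\<lambda>x. f x - g x) \<le> ennreal (\<eta> i))" for i N \<delta>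
  ultimately have "\<forall>i. \<exists>N \<delta>. Q i N \<delta>" by auto
  then obtain N \<delta> where Q: "\<And>i. Q i (N i) (\<delta> i)" by metis
  have N: "0 < \<delta> i" "f \<in> A (N i) \<Longrightarrow> g \<in> A (N i) \<Longrightarrow> E f \<le> ennreal (m + \<delta> i) \<Longrightarrow> E g \<le> ennreal (m + \<delta> i) \<Longrightarrow> E (\<lambda>x. f x - g x) \<le> ennreal (\<eta> i)" for i f g
    using Q[of i] unfolding Q_def by blast+
  \<comment> \<open>\<open>N'\<close> and \<open>\<delta>'\<close> are cumulative, so that both
    \<open>f i\<close> and \<open>f (Suc i)\<close> meet the requirements of stage
    \<open>i\<close>.\<close>
  define N' where "N' i = i + (\<Sum>j\<le>i. N j)" for i
  define \<delta>' where "\<delta>' i = min (e / 2) (Min (\<delta> ` {..i}))" for i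
  have \<delta>': "0 < \<delta>' i" "\<delta>' i \<le> e / 2" for i using N(1) e by (auto simp: \<delta>'_def)
  have \<delta>'_le: "\<delta>' i \<le> \<delta> j" if "j \<le> i" for i j
    unfolding \<delta>'_def using that by (intro min.coboundedI2 Min_le) auto
  have N'_ge: "N j \<le> N' i" if "j \<le> i" for i j
    unfolding N'_def using member_le_sum[of j "{..i}" N] that by auto
  have anti: "A j \<subseteq> A i" if "i \<le> j" for i j using dec that by (rule lift_Suc_antimono_le)
  have "\<exists>f\<in>A (N' i). E f \<le> ennreal (m + \<delta>' i)" for i
  proof -
    have "(INF f\<in>A (N' i). E f) \<le> ennreal m" unfolding m(1) by (rule SUP_upper) simp
    also have "\<dots> < ennreal (m + \<delta>' i)" using m(2) \<delta>'(1)[of i] by (intro ennreal_lessI) auto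
    finally show ?thesis by (auto simp: INF_less_iff intro: less_imp_le)
  qed
  then obtain f where f: "\<And>i. f i \<in> A (N' i)" "\<And>i. E (f i) \<le> ennreal (m + \<delta>' i)" by metis
  have fm[measurable]: "f i \<in> borel_measurable M" for i by (rule meas[OF f(1)])
  have fA: "f i \<in> A i" for i using f(1)[of i] anti[of i "N' i"] by (auto simp: N'_def)
  have diff: "E (\<lambda>x. f (Suc i) x - f i x) \<le> ennreal (\<eta> i)" for i
  proof (rule N(2))
    show "f (Suc i) \<in> A (N i)" "f i \<in> A (N i)"
      using f(1)[of i] f(1)[of "Suc i"] anti[OF N'_ge[of i i]] anti[OF N'_ge[of i "Suc i"]] by auto
    show "E (f (Suc i)) \<le> ennreal (m + \<delta> i)" "E (f i) \<le> ennreal (m + \<delta> i)"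
      using f(2)[of i] f(2)[of "Suc i"] \<delta>'_le[of i i] \<delta>'_le[of i "Suc i"]
      by (auto elim!: order_trans intro!: ennreal_leI)
  qed
  have "(\<integral>\<^sup>+x. (ennreal (norm (f 0 x)) + (\<Sum>i. ennreal (K * norm (f (Suc i) x - f i x)))) epowr p \<partial>M) \<le> ennreal (C + e / 2 + e / 2)"
  proof (rule d(2))
    have "E (f 0) \<le> ennreal (C + e / 2)"
      using f(2)[of 0] mC \<delta>'(2)[of 0] by (auto elim!: order_trans intro!: ennreal_leI)
    then show "(\<integral>\<^sup>+x. ennreal (norm (f 0 x)) epowr p \<partial>M) \<le> ennreal (C + e / 2)"
      by (simp add: E_def epowr_ennreal)
    show "(\<integral>\<^sup>+x. (\<Sum>i. ennreal (K * norm (f (Suc i) x - f i x))) epowr p \<partial>M) \<le> ennreal d"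
    proof (rule nn_integral_epowr_suminf_le)
      fix i
      have "(\<integral>\<^sup>+x. ennreal (K * norm (f (Suc i) x - f i x)) epowr p \<partial>M)
        = (\<integral>\<^sup>+x. ennreal (K powr p) * ennreal (norm (f (Suc i) x - f i x) powr p) \<partial>M)"
        using K p by (intro nn_integral_cong) (simp add: epowr_ennreal epowr_mult ennreal_mult)
      also have "\<dots> = ennreal (K powr p) * E (\<lambda>x. f (Suc i) x - f i x)"
        unfolding E_def by (rule nn_integral_cmult) measurable
      also have "\<dots> \<le> ennreal ((K + 1) powr p) * ennreal (\<eta> i)"
        using K p by (intro mult_mono diff ennreal_leI powr_mono2) auto
      also have "\<dots> = ennreal (small_weight p d i)"
        using K \<eta>[of i] by (simp add: \<eta>_def flip: ennreal_mult)
      finally show "(\<integral>\<^sup>+x. ennreal (K * norm (f (Suc i) x - f i x)) epowr p \<partial>M) \<le> ennreal (small_weight p d i)" .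
    qed (use p d in auto)
  qed measurable
  moreover have "C + e / 2 + e / 2 = C + e" by simp
  ultimately show ?thesis using fA by (intro exI[of _ f]) (simp only: simp_thms)
qed

section \<open>Paths leaving an open set\<close>

lemma lip1I: "(\<And>s t. s \<le> t \<Longrightarrow> dist (\<gamma> s) (\<gamma> t) \<le> t - s) \<Longrightarrow> lip1 \<gamma>"
  unfolding lip1_def
  by (metis abs_minus_commute abs_of_nonneg diff_ge_0_iff_ge dist_commute linear)

lemma lip1D: "lip1 \<gamma> \<Longrightarrow> dist (\<gamma> s) (\<gamma> t) \<le> \<bar>s - t\<bar>"
  by (simp add: lip1_def)

lemma first_exit:
  fixes \<gamma> :: "real \<Rightarrow> 'a::metric_space"
  assumes c: "continuous_on {0..L} \<gamma>" and U: "open U" and "0 \<le> L" "\<gamma> 0 \<in> U" "\<gamma> L \<notin> U"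
  shows "\<exists>t. 0 < t \<and> t \<le> L \<and> \<gamma> t \<notin> U \<and> (\<forall>s. 0 \<le> s \<longrightarrow> s < t \<longrightarrow> \<gamma> s \<in> U)"
proof -
  define S where "S = {0..L} \<inter> \<gamma> -` (- U)"
  have cl: "closed S" unfolding S_def using U by (intro continuous_closed_preimage[OF c]) auto
  have ne: "S \<noteq> {}" using assms by (auto simp: S_def intro!: exI[of _ L])
  have bd: "bdd_below S" by (auto simp: S_def)
  define t where "t = Inf S"
  have t: "t \<in> S" unfolding t_def using closed_contains_Inf[OF ne bd cl] .
  have "\<gamma> s \<in> U" if "0 \<le> s" "s < t" for s
  proof (rule ccontr)
    assume "\<gamma> s \<notin> U"
    then have "s \<in> S" using that t by (auto simp: S_def)
    then have "t \<le> s" unfolding t_def using bd by (rule cInf_lower)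
    then show False using that by simp
  qed
  moreover have "t \<noteq> 0" using t assms by (auto simp: S_def)
  ultimately show ?thesis using t by (intro exI[of _ t]) (auto simp: S_def)
qed

text \<open>Before its first exit a path lies in \<open>U\<close>, where the cost per unit of time
  is at least \<open>c\<close>, so exit times are at most \<open>a / c\<close>. Arzela-Ascoli gives
  a limit path, which leaves \<open>U\<close> because the complement is closed, and Fatou's lemma
  bounds its cost. The density \<open>Q k\<close> changes along the sequence and builds up to the
  full \<open>q\<close> in the limit.\<close>

lemma exit_paths_compactness:
  fixes U :: "'a::euclidean_space set"
  assumes U: "open U" and Q: "lsc_approx Q q" and c: "0 < c" "\<And>y. y \<in> U \<Longrightarrow> c \<le> Q 0 y"
    and X: "\<And>k. X k \<in> U" "X \<longlonglongrightarrow> x" "x \<in> U"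
    and \<gamma>: "\<And>k. lip1 (\<gamma> k)" "\<And>k. \<gamma> k 0 = X k" "\<And>k. 0 \<le> L k" "\<And>k. \<gamma> k (L k) \<notin> U"
    and a: "0 \<le> a" "\<And>k::nat. (\<integral>\<^sup>+t\<in>{0..L k}. ennreal (Q k (\<gamma> k t)) \<partial>lborel) \<le> ennreal a"
  shows "\<exists>\<eta> \<tau>. lip1 \<eta> \<and> 0 \<le> \<tau> \<and> \<eta> 0 = x \<and> \<eta> \<tau> \<notin> U \<and> (\<integral>\<^sup>+t\<in>{0..\<tau>}. q (\<eta> t) \<partial>lborel) \<le> ennreal a"
proof -
  note Q' = Q[unfolded lsc_approx_def]
  have Qmono: "Q k y \<le> Q m y" if "k \<le> m" for k m y using Q' that by (auto simp: incseq_def)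
  have Qm[measurable]: "Q k \<in> borel_measurable borel" for k
    using Q' by (auto intro: borel_measurable_continuous_onI)
  note [measurable] = lip1_measurable[OF \<gamma>(1)]
  have "\<exists>t. 0 < t \<and> t \<le> L k \<and> \<gamma> k t \<notin> U \<and> (\<forall>s. 0 \<le> s \<longrightarrow> s < t \<longrightarrow> \<gamma> k s \<in> U)" for k
    using \<gamma> X by (intro first_exit U lip1_continuous) auto
  then obtain T where T: "\<And>k. 0 < T k" "\<And>k. T k \<le> L k" "\<And>k. \<gamma> k (T k) \<notin> U"
    "\<And>k s. 0 \<le> s \<Longrightarrow> s < T k \<Longrightarrow> \<gamma> k s \<in> U" by metis
  define B where "B = a / c"
  have B: "0 \<le> B" using a c by (simp add: B_def)
  have int_T: "(\<integral>\<^sup>+t\<in>{0..T k}. ennreal (Q k (\<gamma> k t)) \<partial>lborel) \<le> ennreal a" for k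
  proof -
    have "(\<integral>\<^sup>+t\<in>{0..T k}. ennreal (Q k (\<gamma> k t)) \<partial>lborel) \<le> (\<integral>\<^sup>+t\<in>{0..L k}. ennreal (Q k (\<gamma> k t)) \<partial>lborel)"
      using T(2)[of k] by (intro nn_integral_mono) (auto split: split_indicator)
    then show ?thesis using a(2)[of k] by (rule order_trans)
  qed
  have T_le: "T k \<le> B" for k
  proof -
    have "ennreal (c * T k) = (\<integral>\<^sup>+t. ennreal c * indicator {0..<T k} t \<partial>lborel)"
      using T(1)[of k] c by (simp add: nn_integral_cmult_indicator ennreal_mult)
    also have "\<dots> \<le> (\<integral>\<^sup>+t\<in>{0..T k}. ennreal (Q k (\<gamma> k t)) \<partial>lborel)"
    proof (rule nn_integral_mono)
      fix t
      show "ennreal c * indicator {0..<T k} t \<le> ennreal (Q k (\<gamma> k t)) * indicator {0..T k} t"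
      proof (cases "t \<in> {0..<T k}")
        case True
        then have "c \<le> Q k (\<gamma> k t)" using c(2)[OF T(4)[of t k]] Qmono[of 0 k "\<gamma> k t"] by auto
        then show ?thesis using True by (auto intro: ennreal_leI)
      qed simp
    qed
    also have "\<dots> \<le> ennreal a" by (rule int_T)
    finally have "c * T k \<le> a" using a by simp
    then show ?thesis using c by (simp add: B_def field_simps)
  qed
  have "bounded (range X)" using X(2) by (rule convergent_imp_bounded)
  then obtain b where b: "\<And>k. norm (X k) \<le> b" by (auto simp: bounded_iff)
  obtain g \<kappa> where g: "continuous_on {0..B} g" "strict_mono (\<kappa> :: nat \<Rightarrow> nat)"
    "\<And>e. 0 < e \<Longrightarrow> \<exists>N. \<forall>n t. n \<ge> N \<and> t \<in> {0..B} \<longrightarrow> norm (\<gamma> (\<kappa> n) t - g t) < e"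
  proof (rule Arzela_Ascoli[of "{0..B}" \<gamma> "b + B"])
    show "norm (\<gamma> n t) \<le> b + B" if "t \<in> {0..B}" for n t
    proof -
      have "norm (\<gamma> n t) \<le> norm (\<gamma> n 0) + dist (\<gamma> n 0) (\<gamma> n t)"
        using norm_triangle_ineq2[of "\<gamma> n t" "\<gamma> n 0"] by (simp add: dist_norm norm_minus_commute)
      also have "\<dots> \<le> b + B" using b[of n] \<gamma>(2)[of n] lip1D[OF \<gamma>(1)[of n], of 0 t] that by simp
      finally show ?thesis .
    qed
    show "\<exists>d. 0 < d \<and> (\<forall>n y. y \<in> {0..B} \<and> norm (t - y) < d \<longrightarrow> norm (\<gamma> n t - \<gamma> n y) < e)"
      if "t \<in> {0..B}" "0 < e" for t e
      using that lip1D[OF \<gamma>(1)] by (intro exI[of _ e]) (auto simp: dist_norm intro: le_less_trans)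
  qed (auto simp: that)
  have "compact {0..B}" by simp
  moreover have "\<forall>n. T (\<kappa> n) \<in> {0..B}" using T_le T(1) by (auto intro: less_imp_le)
  ultimately obtain \<tau> r where \<tau>: "\<tau> \<in> {0..B}" "strict_mono r" "((\<lambda>n. T (\<kappa> n)) \<circ> r) \<longlonglongrightarrow> \<tau>"
    unfolding compact_def by (metis (no_types, lifting))
  define \<mu> where "\<mu> n = \<kappa> (r n)" for n
  have \<mu>: "strict_mono \<mu>" unfolding \<mu>_def using strict_mono_compose[OF g(2) \<tau>(2)] by simp
  have T_lim: "(\<lambda>n. T (\<mu> n)) \<longlonglongrightarrow> \<tau>" using \<tau>(3) by (simp add: \<mu>_def o_def)
  have g_lim: "(\<lambda>n. \<gamma> (\<mu> n) t) \<longlonglongrightarrow> g t" if t: "t \<in> {0..B}" for t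
    unfolding lim_sequentially
  proof (intro allI impI)
    fix e :: real assume "0 < e"
    then obtain N where N: "\<And>n. n \<ge> N \<Longrightarrow> norm (\<gamma> (\<kappa> n) t - g t) < e" using g(3)[of e] t by blast
    have "dist (\<gamma> (\<mu> n) t) (g t) < e" if "n \<ge> N" for n
      using N[of "r n"] seq_suble[OF \<tau>(2), of n] that by (simp add: \<mu>_def dist_norm)
    then show "\<exists>N. \<forall>n\<ge>N. dist (\<gamma> (\<mu> n) t) (g t) < e" by blast
  qed
  have g_lip: "dist (g s) (g t) \<le> t - s" if "s \<in> {0..B}" "t \<in> {0..B}" "s \<le> t" for s t
  proof (rule tendsto_upperbound[OF tendsto_dist[OF g_lim[OF that(1)] g_lim[OF that(2)]]])
    show "\<forall>\<^sub>F n in sequentially. dist (\<gamma> (\<mu> n) s) (\<gamma> (\<mu> n) t) \<le> t - s"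
      using lip1D[OF \<gamma>(1), of _ s t] that by (intro always_eventually) auto
  qed auto
  define \<eta> where "\<eta> t = g (max 0 (min B t))" for t
  have \<eta>: "\<eta> t = g t" if "t \<in> {0..B}" for t using that by (simp add: \<eta>_def)
  have "lip1 \<eta>"
  proof (rule lip1I)
    fix s t :: real assume "s \<le> t"
    then show "dist (\<eta> s) (\<eta> t) \<le> t - s"
      unfolding \<eta>_def using B
      by (intro order_trans[OF g_lip]) (auto simp: max_def min_def)
  qed
  moreover have "\<eta> 0 = x"
  proof -
    have "(\<lambda>n. \<gamma> (\<mu> n) 0) \<longlonglongrightarrow> x"
      using LIMSEQ_subseq_LIMSEQ[OF X(2) \<mu>] by (simp add: \<gamma>(2) o_def)
    then have "g 0 = x" using g_lim[of 0] B LIMSEQ_unique by auto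
    then show ?thesis using \<eta>[of 0] B by simp
  qed
  moreover have "\<eta> \<tau> \<notin> U"
  proof -
    have lim: "(\<lambda>n. \<gamma> (\<mu> n) (T (\<mu> n))) \<longlonglongrightarrow> g \<tau>"
    proof (rule Lim_transform[OF g_lim[OF \<tau>(1)]])
      have "(\<lambda>n. T (\<mu> n) - \<tau>) \<longlonglongrightarrow> 0" using T_lim by (simp add: LIM_zero_iff)
      then have lim0: "(\<lambda>n. \<bar>T (\<mu> n) - \<tau>\<bar>) \<longlonglongrightarrow> 0" by (rule tendsto_rabs_zero)
      have "norm (\<gamma> (\<mu> n) (T (\<mu> n)) - \<gamma> (\<mu> n) \<tau>) \<le> \<bar>T (\<mu> n) - \<tau>\<bar>" for n
        using lip1D[OF \<gamma>(1), of "\<mu> n" "T (\<mu> n)" \<tau>] by (simp add: dist_norm)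
      then show "(\<lambda>n. \<gamma> (\<mu> n) (T (\<mu> n)) - \<gamma> (\<mu> n) \<tau>) \<longlonglongrightarrow> 0"
        by (intro Lim_null_comparison[OF _ lim0] always_eventually allI)
    qed
    have "g \<tau> \<in> - U"
      by (intro closed_sequentially[OF _ _ lim]) (simp_all add: closed_Compl U T(3))
    then show ?thesis using \<eta>[OF \<tau>(1)] by simp
  qed
  moreover have "(\<integral>\<^sup>+t\<in>{0..\<tau>}. q (\<eta> t) \<partial>lborel) \<le> ennreal a"
  proof -
    \<comment> \<open>For fixed \<open>k\<close>, eventually \<open>k \<le> \<mu> n\<close> and
      \<open>t < T (\<mu> n)\<close>, so \<open>Q k\<close> along the limit path is at most the
      lower limit of these functions; the supremum over \<open>k\<close> gives
      \<open>q\<close>.\<close>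
    define f where "f n t = ennreal (Q (\<mu> n) (\<gamma> (\<mu> n) t)) * indicator {0..T (\<mu> n)} t" for n t
    have [measurable]: "f n \<in> borel_measurable lborel" for n unfolding f_def by measurable
    have "(\<integral>\<^sup>+t\<in>{0..\<tau>}. q (\<eta> t) \<partial>lborel) \<le> (\<integral>\<^sup>+t. liminf (\<lambda>n. f n t) \<partial>lborel)"
    proof (rule nn_integral_mono_AE)
      \<comment> \<open>The parameter \<tau> is left out, as the exit times may approach it from
        below.\<close>
      show "AE t in lborel. q (\<eta> t) * indicator {0..\<tau>} t \<le> liminf (\<lambda>n. f n t)"
        using AE_lborel_singleton[of \<tau>]
      proof eventually_elim
        case (elim t)
        show ?case
        proof (cases "t \<in> {0..\<tau>}")
          case True
          then have t: "0 \<le> t" "t < \<tau>" "t \<in> {0..B}" using elim \<tau>(1) by auto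
          have "ennreal (Q k (\<eta> t)) \<le> liminf (\<lambda>n. f n t)" for k
          proof -
            have "(\<lambda>n. ennreal (Q k (\<gamma> (\<mu> n) t))) \<longlonglongrightarrow> ennreal (Q k (g t))"
            proof (rule tendsto_ennrealI, rule isCont_tendsto_compose[OF _ g_lim[OF t(3)]])
              show "isCont (Q k) (g t)" using Q' by (simp add: continuous_on_eq_continuous_at)
            qed
            then have lim: "liminf (\<lambda>n. ennreal (Q k (\<gamma> (\<mu> n) t))) = ennreal (Q k (\<eta> t))"
              using \<eta>[OF t(3)] by (simp add: lim_imp_Liminf)
            have "\<forall>\<^sub>F n in sequentially. t < T (\<mu> n)" using T_lim t(2) by (rule order_tendstoD)
            moreover have "\<forall>\<^sub>F n in sequentially. k \<le> \<mu> n"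
              using eventually_ge_at_top[of k] by eventually_elim (meson \<mu> order_trans seq_suble)
            ultimately have "\<forall>\<^sub>F n in sequentially. ennreal (Q k (\<gamma> (\<mu> n) t)) \<le> f n t"
              by eventually_elim (use t Qmono in \<open>auto simp: f_def intro: ennreal_leI\<close>)
            then show ?thesis unfolding lim[symmetric] by (rule Liminf_mono)
          qed
          then show ?thesis using True Q' by (auto intro: SUP_least)
        qed simp
      qed
    qed
    also have "\<dots> \<le> liminf (\<lambda>n. \<integral>\<^sup>+t. f n t \<partial>lborel)" by (rule nn_integral_liminf) measurable
    also have "\<dots> \<le> liminf (\<lambda>n. ennreal a)"
      by (rule Liminf_mono) (use int_T in \<open>auto simp: f_def\<close>)
    also have "\<dots> = ennreal a" by (simp add: Liminf_const)
    finally show ?thesis .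
  qed
  ultimately show ?thesis using \<tau>(1) by (intro exI[of _ \<eta>] exI[of _ \<tau>]) auto
qed

section \<open>The weighted distance to the complement of an open set\<close>

definition exit_paths :: "'a::metric_space set \<Rightarrow> 'a \<Rightarrow> ((real \<Rightarrow> 'a) \<times> real) set" where
  "exit_paths U x = {(\<gamma>, L). lip1 \<gamma> \<and> 0 \<le> L \<and> \<gamma> 0 = x \<and> \<gamma> L \<notin> U}"

text \<open>The distance from \<open>x\<close> to the complement of \<open>U\<close> in the metric
  \<open>f ds\<close>. The infimum is taken in the reals, so it is meaningful only for a nonempty
  set of paths, which \<open>U \<noteq> UNIV\<close> ensures.\<close>

definition exit_cost :: "('a::metric_space \<Rightarrow> real) \<Rightarrow> 'a set \<Rightarrow> 'a \<Rightarrow> real" where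
  "exit_cost f U x = (INF z\<in>exit_paths U x. integral {0..snd z} (\<lambda>t. f (fst z t)))"

lemma integrable_along_lip1:
  fixes f :: "'a::metric_space \<Rightarrow> real"
  assumes "continuous_on UNIV f" "lip1 \<gamma>"
  shows "(\<lambda>t. f (\<gamma> t)) integrable_on {a..b}"
  by (rule integrable_continuous_interval, rule continuous_on_compose2[OF assms(1) lip1_continuous[OF assms(2)] subset_UNIV])

context
  fixes f :: "'a::euclidean_space \<Rightarrow> real" and U :: "'a set"
  assumes f: "continuous_on UNIV f" "\<And>x. 0 \<le> f x" and U: "U \<noteq> UNIV"
begin

lemma exit_paths_nonempty: "exit_paths U x \<noteq> {}"
proof -
  obtain y where y: "y \<notin> U" using U by auto
  show ?thesis
  proof (cases "x = y")
    case True
    then have "(\<lambda>_. y, 0) \<in> exit_paths U x" using y by (simp add: exit_paths_def lip1_def)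
    then show ?thesis by blast
  next
    case False
    define d where "d = dist x y"
    have d: "0 < d" "norm (y - x) = d" using False by (auto simp: d_def dist_norm norm_minus_commute)
    define \<gamma> where "\<gamma> t = x + (t / d) *\<^sub>R (y - x)" for t
    have "lip1 \<gamma>"
    proof (rule lip1I)
      fix s t :: real assume "s \<le> t"
      have "\<gamma> t - \<gamma> s = ((t - s) / d) *\<^sub>R (y - x)"
        by (simp add: \<gamma>_def scaleR_diff_left diff_divide_distrib)
      then have "norm (\<gamma> t - \<gamma> s) = \<bar>(t - s) / d\<bar> * d" by (simp only: norm_scaleR d(2))
      then show "dist (\<gamma> s) (\<gamma> t) \<le> t - s"
        using d(1) \<open>s \<le> t\<close> by (simp add: dist_norm norm_minus_commute)
    qed
    moreover have "\<gamma> 0 = x" "\<gamma> d = y" using d(1) by (auto simp: \<gamma>_def)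
    ultimately have "(\<gamma>, d) \<in> exit_paths U x" using y d(1) by (simp add: exit_paths_def)
    then show ?thesis by blast
  qed
qed

lemma exit_cost_bdd: "bdd_below ((\<lambda>z. integral {0..snd z} (\<lambda>t. f (fst z t))) ` exit_paths U x)"
  using f by (intro bdd_belowI2[of _ 0] integral_nonneg integrable_along_lip1) (auto simp: exit_paths_def)

lemma exit_cost_lower: "(\<gamma>, L) \<in> exit_paths U x \<Longrightarrow> exit_cost f U x \<le> integral {0..L} (\<lambda>t. f (\<gamma> t))"
  unfolding exit_cost_def using cINF_lower[OF exit_cost_bdd, of "(\<gamma>, L)" x] by simp

lemma exit_cost_greatest:
  "(\<And>\<gamma> L. (\<gamma>, L) \<in> exit_paths U x \<Longrightarrow> a \<le> integral {0..L} (\<lambda>t. f (\<gamma> t))) \<Longrightarrow> a \<le> exit_cost f U x"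
  unfolding exit_cost_def using exit_paths_nonempty by (intro cINF_greatest) auto

lemma exit_cost_nonneg: "0 \<le> exit_cost f U x"
  using f by (intro exit_cost_greatest integral_nonneg integrable_along_lip1) (auto simp: exit_paths_def)

lemma exit_cost_outside:
  assumes "x \<notin> U" shows "exit_cost f U x = 0"
proof -
  have "(\<lambda>_. x, 0) \<in> exit_paths U x" using assms by (auto simp: exit_paths_def lip1_def)
  from exit_cost_lower[OF this] show ?thesis using exit_cost_nonneg[of x] by simp
qed

text \<open>An exit path of \<open>y\<close> is preceded by the segment from \<open>x\<close> to
  \<open>y\<close>, run at unit speed. This makes the exit cost locally Lipschitz with constant
  \<open>f\<close>.\<close>

lemma exit_cost_segment_le:
  assumes B: "\<And>z. z \<in> closed_segment x y \<Longrightarrow> f z \<le> B"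
  shows "exit_cost f U x \<le> exit_cost f U y + B * dist x y"
proof (cases "x = y")
  case False
  define d where "d = dist x y"
  have d: "0 < d" using False by (simp add: d_def)
  have "exit_cost f U x - B * d \<le> exit_cost f U y"
  proof (rule exit_cost_greatest)
    fix \<gamma> L assume "(\<gamma>, L) \<in> exit_paths U y"
    then have \<gamma>: "lip1 \<gamma>" "0 \<le> L" "\<gamma> 0 = y" "\<gamma> L \<notin> U" by (auto simp: exit_paths_def)
    \<comment> \<open>\<sigma> runs from \<open>x\<close> to \<open>y\<close> during
      \<open>{0..d}\<close> and rests there afterwards, while the second summand of \<eta> is zero
      until time \<open>d\<close>; their sum concatenates the two paths without a case
      distinction.\<close>
    define \<sigma> where "\<sigma> t = x + (max 0 (min d t) / d) *\<^sub>R (y - x)" for t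
    define \<eta> where "\<eta> t = \<sigma> t + (\<gamma> (max 0 (t - d)) - y)" for t
    have \<sigma>_lip: "dist (\<sigma> s) (\<sigma> t) = max 0 (min d t) - max 0 (min d s)" if "s \<le> t" for s t
    proof -
      have "\<sigma> t - \<sigma> s = ((max 0 (min d t) - max 0 (min d s)) / d) *\<^sub>R (y - x)"
        by (simp add: \<sigma>_def scaleR_diff_left diff_divide_distrib)
      moreover have "norm (y - x) = d" by (simp add: d_def dist_norm norm_minus_commute)
      ultimately have "norm (\<sigma> t - \<sigma> s) = \<bar>(max 0 (min d t) - max 0 (min d s)) / d\<bar> * d"
        by (simp only: norm_scaleR)
      then have "dist (\<sigma> s) (\<sigma> t) = \<bar>(max 0 (min d t) - max 0 (min d s)) / d\<bar> * d"
        by (simp add: dist_norm norm_minus_commute)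
      also have "\<dots> = \<bar>max 0 (min d t) - max 0 (min d s)\<bar>" using d by simp
      finally show ?thesis using that by (auto simp: max_def min_def)
    qed
    have lip: "lip1 \<eta>"
    proof (rule lip1I)
      fix s t :: real assume st: "s \<le> t"
      have "dist (\<eta> s) (\<eta> t) \<le> dist (\<sigma> s) (\<sigma> t) + dist (\<gamma> (max 0 (s - d))) (\<gamma> (max 0 (t - d)))"
        unfolding \<eta>_def dist_norm
        using norm_triangle_ineq[of "\<sigma> s - \<sigma> t" "\<gamma> (max 0 (s - d)) - \<gamma> (max 0 (t - d))"]
        by (simp add: algebra_simps)
      also have "\<dots> \<le> (max 0 (min d t) - max 0 (min d s)) + \<bar>max 0 (s - d) - max 0 (t - d)\<bar>"
        using \<sigma>_lip[OF st] lip1D[OF \<gamma>(1)] by (intro add_mono) auto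
      also have "\<dots> \<le> t - s" using st d by (auto simp: max_def min_def)
      finally show "dist (\<eta> s) (\<eta> t) \<le> t - s" .
    qed
    have \<eta>1: "\<eta> t = \<sigma> t" if "t \<le> d" for t using that \<gamma>(3) by (simp add: \<eta>_def)
    have \<eta>2: "\<eta> t = \<gamma> (t - d)" if "d \<le> t" for t using that d by (simp add: \<eta>_def \<sigma>_def)
    have "(\<eta>, d + L) \<in> exit_paths U x"
      using lip \<gamma> d \<eta>1[of 0] \<eta>2[of "d + L"] by (auto simp: exit_paths_def \<sigma>_def)
    then have "exit_cost f U x \<le> integral {0..d + L} (\<lambda>t. f (\<eta> t))" by (rule exit_cost_lower)
    also have "\<dots> = integral {0..d} (\<lambda>t. f (\<eta> t)) + integral {d..d + L} (\<lambda>t. f (\<eta> t))"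
      using d \<gamma>(2) f(1) lip
      by (intro Henstock_Kurzweil_Integration.integral_combine[symmetric] integrable_along_lip1) auto
    also have "integral {0..d} (\<lambda>t. f (\<eta> t)) \<le> integral {0..d} (\<lambda>t. B)"
    proof (rule integral_le)
      show "f (\<eta> t) \<le> B" if t: "t \<in> {0..d}" for t
      proof (rule B)
        have "\<sigma> t = (1 - t / d) *\<^sub>R x + (t / d) *\<^sub>R y"
          using t by (simp add: \<sigma>_def algebra_simps)
        then show "\<eta> t \<in> closed_segment x y"
          using t d \<eta>1[of t] by (auto simp: in_segment intro!: exI[of _ "t / d"])
      qed
    qed (auto intro: integrable_along_lip1 f lip)
    also have "integral {0..d} (\<lambda>t. B) = B * d" using d by simp
    also have "integral {d..d + L} (\<lambda>t. f (\<eta> t)) = integral {0..L} (\<lambda>t. f (\<gamma> t))"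
    proof -
      have "integral {d..d + L} (\<lambda>t. f (\<eta> t)) = integral {d..d + L} (\<lambda>t. f (\<gamma> (t - d)))"
        by (intro Henstock_Kurzweil_Integration.integral_cong) (auto simp: \<eta>2)
      also have "\<dots> = integral {0..L} (\<lambda>t. f (\<gamma> t))"
        using integral_shift_Icc_real[of 0 L "\<lambda>t. f (\<gamma> (t - d))" d] by (simp add: add.commute o_def)
      finally show ?thesis .
    qed
    finally show "exit_cost f U x - B * d \<le> integral {0..L} (\<lambda>t. f (\<gamma> t))" by simp
  qed
  then show ?thesis by (simp add: d_def)
qed simp

end

section \<open>Mollification\<close>

text \<open>Up to linear combinations this family is closed under differentiation, see
  \<open>DERIV_flat_exp\<close>, so smoothness of all orders reduces to first derivatives.\<close>

definition flat_exp :: "nat \<Rightarrow> real \<Rightarrow> real" where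
  "flat_exp m t = (if t \<le> 0 then 0 else exp (- 1 / t) / t ^ m)"

lemma flat_exp_nonneg: "0 \<le> flat_exp m t"
  by (simp add: flat_exp_def)

text \<open>With \<open>n = m + 2\<close>, \<open>exp (1 / t)\<close> is at least
  \<open>(1 / (n * t)) ^ n\<close>; dividing its reciprocal by \<open>t ^ m\<close> leaves a square,
  enough for a vanishing derivative at 0.\<close>

lemma flat_exp_le_square: "flat_exp m t \<le> real (m + 2) ^ (m + 2) * t\<^sup>2"
proof (cases "t \<le> 0")
  case False
  define n where "n = m + 2"
  have t: "0 < t" "0 < real n" using False by (auto simp: n_def)
  have "(1 / (real n * t)) ^ n \<le> (1 + (1 / t) / real n) ^ n"
    using t by (intro power_mono) (auto simp: mult.commute)
  also have "\<dots> \<le> exp (1 / t)"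
    using t by (intro exp_ge_one_plus_x_over_n_power_n) (auto simp: n_def intro: order_trans[of _ 0])
  finally have "1 / (real n * t) ^ n \<le> exp (1 / t)" by (simp add: power_one_over)
  then have "exp (- 1 / t) \<le> (real n * t) ^ n"
    using t by (simp add: exp_minus field_simps)
  then have "exp (- 1 / t) / t ^ m \<le> (real n * t) ^ n / t ^ m" using t by (intro divide_right_mono) auto
  also have "\<dots> = real n ^ n * t\<^sup>2" using t by (simp add: n_def power_mult_distrib power_add power2_eq_square)
  finally show ?thesis using False by (simp add: flat_exp_def n_def)
qed (simp add: flat_exp_def)

lemma DERIV_flat_exp:
  "(flat_exp m has_real_derivative flat_exp (m + 2) t - real m * flat_exp (m + 1) t) (at t)"
proof -
  consider "t < 0" | "t = 0" | "0 < t" by linarith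
  then show ?thesis
  proof cases
    case 1
    have "((\<lambda>_. 0) has_real_derivative flat_exp (m + 2) t - real m * flat_exp (m + 1) t) (at t)"
      using 1 by (simp add: flat_exp_def)
    then show ?thesis
      by (rule has_field_derivative_transform_within_open[of _ _ _ "{..<0}"]) (use 1 in \<open>auto simp: flat_exp_def\<close>)
  next
    case 2
    define c where "c = real (m + 2) ^ (m + 2)"
    have "((\<lambda>h. c * \<bar>h\<bar>) \<longlongrightarrow> c * \<bar>0\<bar>) (at 0)" by (intro tendsto_intros)
    then have l0: "((\<lambda>h. c * \<bar>h\<bar>) \<longlongrightarrow> 0) (at 0)" by simp
    have bd: "norm (flat_exp m h / h) \<le> c * \<bar>h\<bar>" for h
    proof (cases "h = 0")
      case False
      have "norm (flat_exp m h / h) \<le> (c * h\<^sup>2) / \<bar>h\<bar>"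
        using flat_exp_le_square[of m h] flat_exp_nonneg[of m h]
        by (auto simp: c_def abs_divide intro!: divide_right_mono)
      also have "h\<^sup>2 = \<bar>h\<bar> * \<bar>h\<bar>" by (simp add: power2_eq_square)
      also have "c * (\<bar>h\<bar> * \<bar>h\<bar>) / \<bar>h\<bar> = c * \<bar>h\<bar>" using False by (simp del: abs_mult_self_eq)
      finally show ?thesis .
    qed simp
    have "((\<lambda>h. flat_exp m h / h) \<longlongrightarrow> 0) (at 0)"
      by (rule Lim_null_comparison[OF _ l0]) (use bd in \<open>auto intro: always_eventually\<close>)
    then show ?thesis using 2 by (simp add: DERIV_def flat_exp_def)
  next
    case 3
    have "((\<lambda>t. exp (- 1 / t) / t ^ m) has_real_derivative exp (- 1 / t) * (1 / t\<^sup>2) / t ^ m - real m * (exp (-1 / t) / t ^ (m + 1))) (at t)"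
      using 3 by (auto intro!: derivative_eq_intros simp: field_simps power2_eq_square)
        (cases m; simp add: field_simps)
    moreover have "exp (- 1 / t) * (1 / t\<^sup>2) / t ^ m = flat_exp (m + 2) t"
      using 3 by (simp add: flat_exp_def power_add power2_eq_square)
    moreover have "exp (- 1 / t) / t ^ (m + 1) = flat_exp (m + 1) t" using 3 by (simp add: flat_exp_def)
    ultimately have "((\<lambda>t. exp (- 1 / t) / t ^ m) has_real_derivative flat_exp (m + 2) t - real m * flat_exp (m + 1) t) (at t)" by (simp only:)
    then show ?thesis
      by (rule has_field_derivative_transform_within_open[of _ _ _ "{0<..}"]) (use 3 in \<open>auto simp: flat_exp_def\<close>)
  qed
qed

text \<open>An algebra that contains the bump functions and is closed under partial derivatives, so
  that \<open>Ck_smooth\<close> of every order follows by one induction.\<close>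

inductive_set smooth_alg :: "('a::euclidean_space \<Rightarrow> real) set" where
  const: "(\<lambda>x. c) \<in> smooth_alg"
| coord: "(\<lambda>x. x \<bullet> i) \<in> smooth_alg"
| flat: "(\<lambda>x. flat_exp m (a - x \<bullet> x)) \<in> smooth_alg"
| add: "f \<in> smooth_alg \<Longrightarrow> g \<in> smooth_alg \<Longrightarrow> (\<lambda>x. f x + g x) \<in> smooth_alg"
| mult: "f \<in> smooth_alg \<Longrightarrow> g \<in> smooth_alg \<Longrightarrow> (\<lambda>x. f x * g x) \<in> smooth_alg"

lemma smooth_alg_derivative:
  "f \<in> smooth_alg \<Longrightarrow> \<exists>D. (\<forall>i\<in>Basis. D i \<in> smooth_alg) \<and>
     (\<forall>x::'a::euclidean_space. (f has_derivative (\<lambda>h. \<Sum>i\<in>Basis. (h \<bullet> i) * D i x)) (at x))"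
proof (induction rule: smooth_alg.induct)
  case (const c)
  show ?case by (rule exI[of _ "\<lambda>_ _. 0"]) (auto intro: smooth_alg.const)
next
  case (coord j)
  have "((\<lambda>x. x \<bullet> j) has_derivative (\<lambda>h. h \<bullet> j)) (at x)" for x :: 'a
    by (auto intro!: derivative_eq_intros)
  moreover have "(\<lambda>h. h \<bullet> j) = (\<lambda>h. \<Sum>i\<in>Basis. (h \<bullet> i) * (j \<bullet> i))"
    by (intro ext euclidean_inner)
  ultimately show ?case
    by (intro exI[of _ "\<lambda>i x. j \<bullet> i"]) (auto intro: smooth_alg.const)
next
  case (flat m a)
  define D where "D i x = (flat_exp (m + 2) (a - x \<bullet> x) + (- real m) * flat_exp (m + 1) (a - x \<bullet> x)) * ((-2) * (x \<bullet> i))" for i x :: 'a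
  have "D i \<in> smooth_alg" for i unfolding D_def by (intro smooth_alg.intros)
  moreover have "((\<lambda>x. flat_exp m (a - x \<bullet> x)) has_derivative (\<lambda>h. \<Sum>i\<in>Basis. (h \<bullet> i) * D i x)) (at x)" for x
  proof -
    have "((\<lambda>x. a - x \<bullet> x) has_derivative (\<lambda>h. - 2 * (x \<bullet> h))) (at x)"
      by (auto intro!: derivative_eq_intros simp: inner_commute)
    from has_derivative_compose[OF this DERIV_flat_exp[unfolded has_field_derivative_def, of m]]
    have "((\<lambda>x. flat_exp m (a - x \<bullet> x)) has_derivative
        (\<lambda>h. (flat_exp (m + 2) (a - x \<bullet> x) - real m * flat_exp (m + 1) (a - x \<bullet> x)) * (- 2 * (x \<bullet> h)))) (at x)" .
    moreover have "(flat_exp (m + 2) (a - x \<bullet> x) - real m * flat_exp (m + 1) (a - x \<bullet> x)) * (- 2 * (x \<bullet> h)) = (\<Sum>i\<in>Basis. (h \<bullet> i) * D i x)" for h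
      unfolding D_def euclidean_inner[of x h] sum_distrib_left by (intro sum.cong) auto
    ultimately show ?thesis by simp
  qed
  ultimately show ?case by (intro exI[of _ D]) auto
next
  case (add f g)
  obtain D E where D: "\<forall>i\<in>Basis. D i \<in> smooth_alg" "\<And>x. (f has_derivative (\<lambda>h. \<Sum>i\<in>Basis. (h \<bullet> i) * D i x)) (at x)"
    and E: "\<forall>i\<in>Basis. E i \<in> smooth_alg" "\<And>x. (g has_derivative (\<lambda>h. \<Sum>i\<in>Basis. (h \<bullet> i) * E i x)) (at x)"
    using add.IH by blast
  have "((\<lambda>x. f x + g x) has_derivative (\<lambda>h. \<Sum>i\<in>Basis. (h \<bullet> i) * (D i x + E i x))) (at x)" for x
    using has_derivative_add[OF D(2) E(2), of x] by (simp add: distrib_left sum.distrib)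
  then show ?case using D E by (intro exI[of _ "\<lambda>i x. D i x + E i x"]) (auto intro: smooth_alg.add)
next
  case (mult f g)
  obtain D E where D: "\<forall>i\<in>Basis. D i \<in> smooth_alg" "\<And>x. (f has_derivative (\<lambda>h. \<Sum>i\<in>Basis. (h \<bullet> i) * D i x)) (at x)"
    and E: "\<forall>i\<in>Basis. E i \<in> smooth_alg" "\<And>x. (g has_derivative (\<lambda>h. \<Sum>i\<in>Basis. (h \<bullet> i) * E i x)) (at x)"
    using mult.IH by blast
  have "((\<lambda>x. f x * g x) has_derivative (\<lambda>h. \<Sum>i\<in>Basis. (h \<bullet> i) * (f x * E i x + D i x * g x))) (at x)" for x
    using has_derivative_mult[OF D(2) E(2), of x]
    by (simp add: distrib_left sum.distrib sum_distrib_left sum_distrib_right ac_simps)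
  then show ?case using D E mult.hyps
    by (intro exI[of _ "\<lambda>i x. f x * E i x + D i x * g x"]) (auto intro!: smooth_alg.add smooth_alg.mult)
qed

lemma partial_derivative_eq:
  assumes "(f has_derivative (\<lambda>h. \<Sum>i\<in>Basis. (h \<bullet> i) * D i)) (at x)" "j \<in> Basis"
  shows "partial_derivative j f x = D j"
proof -
  have "partial_derivative j f x = (\<Sum>i\<in>Basis. (j \<bullet> i) * D i)"
    unfolding partial_derivative_def frechet_derivative_at[OF assms(1), symmetric] ..
  also have "\<dots> = (\<Sum>i\<in>Basis. if i = j then D i else 0)"
    using assms(2) by (intro sum.cong) (auto simp: inner_Basis)
  finally show ?thesis using assms(2) by simp
qed

lemma Ck_smooth_smooth_alg: "f \<in> smooth_alg \<Longrightarrow> Ck_smooth k f"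
proof (induction k arbitrary: f)
  case 0
  obtain D where "\<And>x. (f has_derivative (\<lambda>h. \<Sum>i\<in>Basis. (h \<bullet> i) * D i x)) (at x)"
    using smooth_alg_derivative[OF 0] by blast
  then show ?case by (auto intro!: continuous_at_imp_continuous_on has_derivative_continuous)
next
  case (Suc k)
  obtain D where D: "\<forall>i\<in>Basis. D i \<in> smooth_alg" "\<And>x. (f has_derivative (\<lambda>h. \<Sum>i\<in>Basis. (h \<bullet> i) * D i x)) (at x)"
    using smooth_alg_derivative[OF Suc.prems] by blast
  have "partial_derivative i f = D i" if "i \<in> Basis" for i
    using partial_derivative_eq[OF D(2) that] by auto
  then show ?case using D Suc.IH by (auto simp: differentiable_on_def differentiable_def)
qed

definition bump :: "real \<Rightarrow> 'a::euclidean_space \<Rightarrow> real" where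
  "bump r x = flat_exp 0 (r\<^sup>2 - x \<bullet> x)"

lemma bump_Ck_smooth: "Ck_smooth k (bump r)"
proof -
  have "bump r \<in> smooth_alg" unfolding bump_def[abs_def] by (rule smooth_alg.flat)
  then show ?thesis by (rule Ck_smooth_smooth_alg)
qed

lemma bump_nonneg: "0 \<le> bump r x"
  by (simp add: bump_def flat_exp_nonneg)

lemma bump_eq_0: "0 \<le> r \<Longrightarrow> r \<le> norm x \<Longrightarrow> bump r x = 0"
  using power_mono[of r "norm x" 2] by (simp add: bump_def flat_exp_def power2_norm_eq_inner)

lemma bump_pos:
  assumes "norm x < r" shows "0 < bump r x"
proof -
  have "(norm x)\<^sup>2 < r\<^sup>2" using assms by (intro power_strict_mono) auto
  then show ?thesis by (simp add: bump_def flat_exp_def power2_norm_eq_inner)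
qed

lemma has_derivative_grad:
  assumes "f differentiable (at x)" shows "(f has_derivative (\<lambda>h. h \<bullet> grad f x)) (at x)"
  using GDERIV_grad[OF assms] by (simp add: gderiv_def)

text \<open>Integrating over a fixed box suits differentiation under the integral sign; in the
  application the box contains the support of \<open>v\<close>.\<close>

definition convolve :: "'a::euclidean_space \<Rightarrow> 'a \<Rightarrow> ('a \<Rightarrow> real) \<Rightarrow> ('a \<Rightarrow> real) \<Rightarrow> 'a \<Rightarrow> real" where
  "convolve a b v \<phi> x = integral (cbox a b) (\<lambda>t. v t * \<phi> (x - t))"

lemma convolve_has_derivative:
  assumes v: "continuous_on UNIV v" and \<phi>: "Ck_smooth 1 \<phi>"
  shows "(convolve a b v \<phi> has_derivative (\<lambda>h. \<Sum>i\<in>Basis. (h \<bullet> i) * convolve a b v (partial_derivative i \<phi>) x)) (at x)"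
proof -
  note c = Ck_smooth_1_continuous[OF \<phi>]
  have d: "\<phi> differentiable (at x)" for x using \<phi> by (auto simp: differentiable_on_def)
  \<comment> \<open>The Leibniz rule asks for the derivative as a continuous family of bounded
    linear maps, here multiples of the inner product with the gradient of \<phi>.\<close>
  define fx where "fx x t = v t *\<^sub>R blinfun_inner_left (grad \<phi> (x - t))" for x t
  have c1: "continuous_on S (\<lambda>t. v t * \<phi> (x - t))" for x S
    by (intro continuous_intros continuous_on_subset[OF v] continuous_on_compose2[OF c(1)]) auto
  have c2: "continuous_on S (\<lambda>t. v t *\<^sub>R grad \<phi> (x - t))" for x S
    by (intro continuous_intros continuous_on_subset[OF v] continuous_on_compose2[OF c(2)]) auto
  have c3: "continuous_on S (\<lambda>t. fx x t)" for x S
    unfolding fx_def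
    by (intro continuous_intros continuous_on_subset[OF v]
        bounded_linear.continuous_on[OF bounded_linear_blinfun_inner_left] continuous_on_compose2[OF c(2)]) auto
  have "((\<lambda>x. integral (cbox a b) (\<lambda>t. v t * \<phi> (x - t))) has_derivative blinfun_apply (integral (cbox a b) (fx x))) (at x within UNIV)"
  proof (rule leibniz_rule)
    fix y t
    have "((\<lambda>x. \<phi> (x - t)) has_derivative (\<lambda>h. h \<bullet> grad \<phi> (y - t))) (at y)"
    proof -
      have "((\<lambda>x. x - t) has_derivative (\<lambda>h. h)) (at y)" by (auto intro!: derivative_eq_intros)
      from has_derivative_compose[OF this has_derivative_grad[OF d]] show ?thesis .
    qed
    then have "((\<lambda>x. v t * \<phi> (x - t)) has_derivative (\<lambda>h. v t * (h \<bullet> grad \<phi> (y - t)))) (at y)"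
      by (rule has_derivative_mult_right)
    then show "((\<lambda>x. v t * \<phi> (x - t)) has_derivative blinfun_apply (fx y t)) (at y within UNIV)"
    proof -
      assume "((\<lambda>x. v t * \<phi> (x - t)) has_derivative (\<lambda>h. v t * (h \<bullet> grad \<phi> (y - t)))) (at y)"
      moreover have "blinfun_apply (fx y t) = (\<lambda>h. v t * (h \<bullet> grad \<phi> (y - t)))"
        by (intro ext) (simp add: fx_def blinfun.scaleR_left)
      ultimately show ?thesis by simp
    qed
  next
    show "continuous_on (UNIV \<times> cbox a b) (\<lambda>(x, t). fx x t)"
      unfolding fx_def case_prod_beta
      by (intro continuous_intros continuous_on_compose2[OF v]
          bounded_linear.continuous_on[OF bounded_linear_blinfun_inner_left] continuous_on_compose2[OF c(2)]) auto
  qed (auto intro!: integrable_continuous c1)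
  moreover have "blinfun_apply (integral (cbox a b) (fx x)) = (\<lambda>h. \<Sum>i\<in>Basis. (h \<bullet> i) * convolve a b v (partial_derivative i \<phi>) x)"
  proof
    fix h
    have "blinfun_apply (integral (cbox a b) (fx x)) h = integral (cbox a b) (\<lambda>t. blinfun_apply (fx x t) h)"
      using integral_linear[OF integrable_continuous[OF c3] blinfun.bounded_linear_left[of h]] 
      by (simp add: o_def)
    also have "\<dots> = integral (cbox a b) (\<lambda>t. \<Sum>i\<in>Basis. (h \<bullet> i) * (v t * partial_derivative i \<phi> (x - t)))"
      by (intro Henstock_Kurzweil_Integration.integral_cong)
        (simp add: fx_def blinfun.scaleR_left grad_def inner_sum_right sum_distrib_left ac_simps)
    also have "\<dots> = (\<Sum>i\<in>Basis. integral (cbox a b) (\<lambda>t. (h \<bullet> i) * (v t * partial_derivative i \<phi> (x - t))))"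
    proof (rule Henstock_Kurzweil_Integration.integral_sum)
      fix i :: 'a assume "i \<in> Basis"
      then have "continuous_on UNIV (partial_derivative i \<phi>)" using \<phi> by simp
      then have cp: "continuous_on UNIV (\<lambda>t. partial_derivative i \<phi> (x - t))"
        by (rule continuous_on_compose2) (auto intro!: continuous_intros)
      show "(\<lambda>t. (h \<bullet> i) * (v t * partial_derivative i \<phi> (x - t))) integrable_on cbox a b"
        by (intro integrable_continuous continuous_on_mult continuous_on_const continuous_on_subset[OF v] continuous_on_subset[OF cp] subset_UNIV)
    qed simp
    finally show "blinfun_apply (integral (cbox a b) (fx x)) h = (\<Sum>i\<in>Basis. (h \<bullet> i) * convolve a b v (partial_derivative i \<phi>) x)"
      by (simp add: convolve_def)
  qed
  ultimately show ?thesis by (simp add: convolve_def[abs_def])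
qed

lemma convolve_Ck_smooth:
  assumes "continuous_on UNIV v" "\<And>k. Ck_smooth k \<phi>"
  shows "Ck_smooth k (convolve a b v \<phi>)"
  using assms(2)
proof (induction k arbitrary: \<phi>)
  case 0
  show ?case
    using has_derivative_continuous[OF convolve_has_derivative[OF assms(1) 0[of 1]]]
    by (auto intro!: continuous_at_imp_continuous_on)
next
  case (Suc k)
  note d = convolve_has_derivative[OF assms(1) Suc.prems[of 1], of a b]
  have "partial_derivative i (convolve a b v \<phi>) = convolve a b v (partial_derivative i \<phi>)" if "i \<in> Basis" for i
    using partial_derivative_eq[OF d that] by auto
  moreover have "Ck_smooth k (convolve a b v (partial_derivative i \<phi>))" if "i \<in> Basis" for i
    by (rule Suc.IH) (use Suc.prems[of "Suc _"] that in auto)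
  ultimately show ?case using d by (auto simp: differentiable_on_def differentiable_def)
qed

lemma continuous_support_integrable:
  fixes f :: "'a::euclidean_space \<Rightarrow> real"
  assumes c: "continuous_on UNIV f" and s: "\<And>t. t \<notin> cbox a b \<Longrightarrow> f t = 0"
  shows "integrable lborel f" and "integral (cbox a b) f = integral\<^sup>L lborel f"
proof -
  have eq: "(\<lambda>x. indicator (cbox a b) x *\<^sub>R f x) = f" by (intro ext) (auto simp: indicator_def s)
  have "integrable lborel (\<lambda>x. indicator (cbox a b) x *\<^sub>R f x)"
    by (intro borel_integrable_compact continuous_on_subset[OF c]) auto
  then show "integrable lborel f" unfolding eq .
  then show "integral (cbox a b) f = integral\<^sup>L lborel f"
    using set_borel_integral_eq_integral(2)[of "cbox a b" f] eq
    by (simp add: set_integrable_def set_lebesgue_integral_def)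
qed

lemma lborel_integral_reflect:
  fixes f :: "'a::euclidean_space \<Rightarrow> real"
  assumes [measurable]: "f \<in> borel_measurable borel"
  shows "integral\<^sup>L lborel f = (LINT z|lborel. f (x - z))"
proof -
  have "lborel = distr lborel borel (\<lambda>z. x + (-1) *\<^sub>R z)"
    using lborel_affine[of "-1" x] by (simp add: density_1)
  then have "integral\<^sup>L lborel f = integral\<^sup>L (distr lborel borel (\<lambda>z. x + (-1) *\<^sub>R z)) f" by simp
  also have "\<dots> = (LINT z|lborel. f (x - z))" by (subst integral_distr) auto
  finally show ?thesis .
qed

text \<open>Difference quotients in the direction of the gradient \<open>g\<close> itself tend to
  \<open>g \<bullet> g\<close>, whence \<open>norm g * norm g \<le> B * norm g\<close>.\<close>

lemma norm_grad_le:
  assumes d: "u differentiable (at x)" and r: "0 < r" and B: "\<And>y. dist x y < r \<Longrightarrow> \<bar>u y - u x\<bar> \<le> B * dist x y" "0 \<le> B"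
  shows "norm (grad u x) \<le> B"
proof (cases "grad u x = 0")
  case False
  define g where "g = grad u x"
  have "((\<lambda>t. u (x + t *\<^sub>R g)) has_derivative (\<lambda>t. (t *\<^sub>R g) \<bullet> g)) (at 0)"
  proof -
    have "(u has_derivative (\<lambda>h. h \<bullet> g)) (at (x + 0 *\<^sub>R g))"
      using has_derivative_grad[OF d] by (simp add: g_def)
    moreover have "((\<lambda>t. x + t *\<^sub>R g) has_derivative (\<lambda>t. t *\<^sub>R g)) (at 0)"
      by (auto intro!: derivative_eq_intros)
    ultimately show ?thesis using has_derivative_compose by blast
  qed
  then have "((\<lambda>t. u (x + t *\<^sub>R g)) has_real_derivative (g \<bullet> g)) (at 0)"
    by (simp add: has_field_derivative_def mult_commute_abs)
  then have "((\<lambda>t. (u (x + t *\<^sub>R g) - u x) / t) \<longlongrightarrow> g \<bullet> g) (at 0)" by (simp add: DERIV_def)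
  then have lim: "((\<lambda>t. \<bar>(u (x + t *\<^sub>R g) - u x) / t\<bar>) \<longlongrightarrow> \<bar>g \<bullet> g\<bar>) (at 0)" by (rule tendsto_rabs)
  have "\<bar>g \<bullet> g\<bar> \<le> B * norm g"
  proof (rule tendsto_upperbound[OF lim])
    have "eventually (\<lambda>t. dist t 0 < r / norm g) (at (0::real))"
      using r False by (auto simp: eventually_at g_def intro!: exI[of _ "r / norm g"])
    then show "eventually (\<lambda>t. \<bar>(u (x + t *\<^sub>R g) - u x) / t\<bar> \<le> B * norm g) (at 0)"
      using eventually_neq_at_within[of 0 0 UNIV]
    proof eventually_elim
      case (elim t)
      then have "dist x (x + t *\<^sub>R g) < r" using False by (simp add: dist_norm g_def field_simps)
      then have "\<bar>u (x + t *\<^sub>R g) - u x\<bar> \<le> B * (\<bar>t\<bar> * norm g)"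
        using B(1)[of "x + t *\<^sub>R g"] by (simp add: dist_norm)
      then show ?case using elim by (simp add: abs_divide divide_le_eq ac_simps)
    qed
  qed simp
  then have "norm g * norm g \<le> B * norm g" by (simp flip: power2_norm_eq_inner power2_eq_square)
  then show ?thesis using False by (simp add: g_def)
qed (use B in simp)

text \<open>Increments of the mollified function are averages of increments of translates of
  \<open>v\<close>, taken along segments within distance \<open>2 * r\<close> of \<open>x\<close>,
  where \<open>f\<close> exceeds \<open>f x\<close> by at most \<open>e\<close>. As uniform
  continuity is available on compact sets only, this is argued in the ball \<open>W\<close>; far
  away the translates involved vanish.\<close>

lemma smooth_approximation:
  fixes v f :: "'a::euclidean_space \<Rightarrow> real"
  assumes U: "open U" and K: "compact K" "K \<subseteq> U" and v: "continuous_on UNIV v" "\<And>x. x \<notin> K \<Longrightarrow> v x = 0"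
    and f: "continuous_on UNIV f" "\<And>x. 0 \<le> f x"
    and lip: "\<And>x y B. (\<And>z. z \<in> closed_segment x y \<Longrightarrow> f z \<le> B) \<Longrightarrow> \<bar>v x - v y\<bar> \<le> B * dist x y"
    and e: "0 < e"
  shows "\<exists>u\<in>test_functions U. (\<forall>x. \<bar>u x - v x\<bar> \<le> e) \<and> (\<forall>x. norm (grad u x) \<le> f x + e)"
proof -
  obtain R where R: "0 < R" "K \<subseteq> ball 0 R"
    using compact_imp_bounded[OF K(1)] bounded_subset_ballD by blast
  obtain d1 where d1: "0 < d1" "(\<Union>x\<in>K. cball x d1) \<subseteq> U"
    using compact_subset_open_imp_cball_epsilon_subset[OF K(1) U K(2)] by blast
  define W where "W = cball (0::'a) (R + 3)"
  have "compact W" by (simp add: W_def)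
  have "uniformly_continuous_on W f"
    using f(1) \<open>compact W\<close> by (intro compact_uniformly_continuous) (auto intro: continuous_on_subset)
  then obtain d2 where d2: "0 < d2" "\<And>x y. x \<in> W \<Longrightarrow> y \<in> W \<Longrightarrow> dist y x < d2 \<Longrightarrow> dist (f y) (f x) < e"
    using e unfolding uniformly_continuous_on_def by metis
  have "uniformly_continuous_on W v"
    using v(1) \<open>compact W\<close> by (intro compact_uniformly_continuous) (auto intro: continuous_on_subset)
  then obtain d3 where d3: "0 < d3" "\<And>x y. x \<in> W \<Longrightarrow> y \<in> W \<Longrightarrow> dist y x < d3 \<Longrightarrow> dist (v y) (v x) < e"
    using e unfolding uniformly_continuous_on_def by metis
  \<comment> \<open>\<open>r < d1\<close> keeps the support in \<open>U\<close>,
    \<open>r < d3\<close> controls the values, \<open>2 * r < d2\<close> controls \<open>f\<close>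
    along translated segments, and the bound by 1 keeps the points involved in
    \<open>W\<close>.\<close>
  define r where "r = min (min d1 1) (min (d2 / 2) (d3 / 2)) / 2"
  have r: "0 < r" "r < d1" "2 * r \<le> 1" "2 * r < d2" "r < d3" "r < 1" using d1 d2 d3 by (auto simp: r_def)
  obtain a b where ab: "cball 0 (R + 5) \<subseteq> cbox a (b::'a)"
    using bounded_subset_cbox_symmetric[of "cball (0::'a) (R + 5)"] by blast
  have bc: "continuous_on UNIV (bump r :: 'a \<Rightarrow> real)" using bump_Ck_smooth[of 0 r] by simp
  have bs: "bump r z = 0" if "z \<notin> cbox a b" for z :: 'a
  proof (rule bump_eq_0)
    have "z \<notin> cball 0 (R + 5)" using that ab by blast
    then show "r \<le> norm z" using r R by simp
  qed (use r in simp)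
  define I where "I = integral\<^sup>L lborel (bump r :: 'a \<Rightarrow> real)"
  note bi = continuous_support_integrable[OF bc bs]
  have "0 < I"
  proof -
    have "I \<noteq> 0"
    proof
      assume "I = 0"
      then have "AE z in lborel. bump r (z::'a) = 0"
        using integral_nonneg_eq_0_iff_AE[OF bi(1)] by (simp add: I_def bump_nonneg)
      moreover have "z \<notin> ball 0 r" if "bump r z = 0" for z :: 'a
        using bump_pos[of z r] that by (cases "norm z < r") auto
      ultimately have "AE z in lborel. z \<notin> ball (0::'a) r" by (auto elim!: eventually_mono)
      then have "ball (0::'a) r \<in> null_sets lborel" by (subst AE_iff_null_sets) auto
      then have "measure lborel (ball (0::'a) r) = 0" by (simp add: null_sets_def measure_def)
      then show False using content_ball_pos[OF r(1), of "0::'a"] by simp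
    qed
    moreover have "0 \<le> I" unfolding I_def by (intro Bochner_Integration.integral_nonneg) (auto simp: bump_nonneg)
    ultimately show ?thesis by simp
  qed
  define \<phi> where "\<phi> z = (1 / I) * bump r z" for z :: 'a
  have \<phi>_smooth: "Ck_smooth k \<phi>" for k unfolding \<phi>_def by (intro Ck_smooth_cmult bump_Ck_smooth)
  have \<phi>_nonneg: "0 \<le> \<phi> z" for z using \<open>0 < I\<close> by (simp add: \<phi>_def bump_nonneg)
  have \<phi>_0: "\<phi> z = 0" if "r \<le> norm z" for z using that r by (simp add: \<phi>_def bump_eq_0)
  have \<phi>_c: "continuous_on UNIV \<phi>" using \<phi>_smooth[of 0] by simp
  have \<phi>_s: "\<phi> z = 0" if "z \<notin> cbox a b" for z using bs[OF that] by (simp add: \<phi>_def)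
  note \<phi>_int = continuous_support_integrable[OF \<phi>_c \<phi>_s]
  have \<phi>_1: "integral\<^sup>L lborel \<phi> = 1" using \<open>0 < I\<close> by (simp add: \<phi>_def[abs_def] I_def)
  define u where "u = convolve a b v \<phi>"
  have v_s: "v z = 0" if "z \<notin> cbox a b" for z
  proof (rule v(2))
    show "z \<notin> K"
    proof
      assume "z \<in> K"
      then have "z \<in> cball 0 (R + 5)" using R(2) by (auto simp: subset_iff)
      then show False using ab that by blast
    qed
  qed
  have vc: "continuous_on UNIV (\<lambda>t. v (g t))" if "continuous_on UNIV g" for g :: "'a \<Rightarrow> 'a"
    by (rule continuous_on_compose2[OF v(1) that]) auto
  have int_shift: "integrable lborel (\<lambda>z. v (x - z) * \<phi> z)" for x
    by (rule continuous_support_integrable(1)[of _ a b]) (auto intro!: continuous_intros vc \<phi>_c simp: \<phi>_s)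
  have u_eq: "u x = (LINT z|lborel. v (x - z) * \<phi> z)" for x
  proof -
    have c: "continuous_on UNIV (\<lambda>t. v t * \<phi> (x - t))"
      by (intro continuous_intros v(1) continuous_on_compose2[OF \<phi>_c]) auto
    have "u x = integral\<^sup>L lborel (\<lambda>t. v t * \<phi> (x - t))"
      unfolding u_def convolve_def by (rule continuous_support_integrable(2)[OF c]) (simp add: v_s)
    also have "\<dots> = (LINT z|lborel. v (x - z) * \<phi> (x - (x - z)))"
      by (rule lborel_integral_reflect) (rule borel_measurable_continuous_onI[OF c])
    finally show ?thesis by simp
  qed
  have u_smooth: "Ck_smooth k u" for k unfolding u_def by (rule convolve_Ck_smooth[OF v(1) \<phi>_smooth])
  have u_supp: "\<exists>t\<in>K. dist t x \<le> r" if "u x \<noteq> 0" for x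
  proof (rule ccontr)
    assume "\<not> ?thesis"
    then have far: "r < dist t x" if "t \<in> K" for t using that by (meson not_less)
    have "v (x - z) * \<phi> z = 0" for z
    proof (cases "x - z \<in> K")
      case True
      then have "r \<le> norm z" using far[of "x - z"] by (simp add: dist_norm)
      then show ?thesis by (simp add: \<phi>_0)
    next
      case False
      then show ?thesis by (simp add: v(2))
    qed
    then have "(\<lambda>z. v (x - z) * \<phi> z) = (\<lambda>z. 0)" by (intro ext)
    then have "u x = 0" unfolding u_eq by (simp only: Bochner_Integration.integral_zero)
    then show False using that by simp
  qed
  define Kr where "Kr = (\<Union>x\<in>K. cball x r)"
  have Kr_eq: "Kr = (\<lambda>(x, y). x + y) ` (K \<times> cball 0 r)"
  proof -
    have "x \<in> (\<lambda>(x, y). x + y) ` (K \<times> cball 0 r)" if "t \<in> K" "dist t x \<le> r" for x t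
      by (rule image_eqI[of _ _ "(t, x - t)"]) (use that in \<open>auto simp: dist_norm norm_minus_commute\<close>)
    then show ?thesis by (auto simp: Kr_def dist_norm)
  qed
  have "compact Kr" unfolding Kr_eq
    by (intro compact_continuous_image compact_Times K compact_cball) (auto intro!: continuous_intros simp: case_prod_beta)
  have "{x. u x \<noteq> 0} \<subseteq> Kr" using u_supp by (auto simp: Kr_def)
  then have cl: "closure {x. u x \<noteq> 0} \<subseteq> Kr"
    using \<open>compact Kr\<close> by (intro closure_minimal compact_imp_closed)
  have "Kr \<subseteq> U" using d1(2) r(2) by (force simp: Kr_def)
  have "compact (closure {x. u x \<noteq> 0})"
    using compact_Int_closed[OF \<open>compact Kr\<close> closed_closure, of "{x. u x \<noteq> 0}"] cl by (simp add: inf.absorb2)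
  then have "u \<in> test_functions U"
    using u_smooth cl \<open>Kr \<subseteq> U\<close> by (auto simp: test_functions_def)
  moreover have "\<bar>u x - v x\<bar> \<le> e" for x
  proof -
    have near: "\<bar>v (x - z) - v x\<bar> * \<phi> z \<le> e * \<phi> z" for z
    proof (cases "norm z < r")
      case True
      have "\<bar>v (x - z) - v x\<bar> \<le> e"
      proof (cases "norm x \<le> R + 2")
        case True
        then have "x \<in> W" "x - z \<in> W"
          using \<open>norm z < r\<close> r norm_triangle_ineq4[of x z] by (auto simp: W_def)
        then show ?thesis using d3(2)[of x "x - z"] \<open>norm z < r\<close> r by (simp add: dist_norm)
      next
        case False
        then have "R \<le> norm x" "R \<le> norm (x - z)"
          using \<open>norm z < r\<close> r norm_triangle_ineq2[of x z] by auto
        then have "x \<notin> K" "x - z \<notin> K" using R(2) by (auto simp: subset_iff)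
        then show ?thesis using v(2) e by simp
      qed
      then show ?thesis by (intro mult_right_mono \<phi>_nonneg)
    qed (simp add: \<phi>_0)
    have i2: "integrable lborel (\<lambda>z. v x * \<phi> z)" using \<phi>_int(1) by simp
    have "u x - v x = (LINT z|lborel. v (x - z) * \<phi> z) - (LINT z|lborel. v x * \<phi> z)"
      by (simp add: u_eq \<phi>_1)
    also have "\<dots> = (LINT z|lborel. (v (x - z) - v x) * \<phi> z)"
      unfolding left_diff_distrib by (rule Bochner_Integration.integral_diff[OF int_shift i2, symmetric])
    finally have "\<bar>u x - v x\<bar> \<le> (LINT z|lborel. norm ((v (x - z) - v x) * \<phi> z))"
      using integral_norm_bound[of lborel "\<lambda>z. (v (x - z) - v x) * \<phi> z"] by simp
    also have "\<dots> \<le> (LINT z|lborel. e * \<phi> z)"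
    proof (rule integral_mono)
      have "integrable lborel (\<lambda>z. (v (x - z) - v x) * \<phi> z)"
        using Bochner_Integration.integrable_diff[OF int_shift[of x] i2] by (simp add: left_diff_distrib)
      then show "integrable lborel (\<lambda>z. norm ((v (x - z) - v x) * \<phi> z))" by (rule integrable_norm)
    qed (use near \<phi>_int \<phi>_nonneg in \<open>auto simp: abs_mult\<close>)
    also have "\<dots> = e" by (simp add: \<phi>_1)
    finally show ?thesis .
  qed
  moreover have "norm (grad u x) \<le> f x + e" for x
  proof (rule norm_grad_le[where r=r])
    show "u differentiable (at x)" using u_smooth[of 1] by (auto simp: differentiable_on_def)
    show "0 \<le> f x + e" using f(2)[of x] e by simp
    fix y assume y: "dist x y < r"
    have near: "\<bar>v (y - z) - v (x - z)\<bar> * \<phi> z \<le> ((f x + e) * dist x y) * \<phi> z" for z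
    proof (cases "norm z < r")
      case True
      have "\<bar>v (y - z) - v (x - z)\<bar> \<le> (f x + e) * dist x y"
      proof (cases "norm x \<le> R + 1")
        case True
        have "\<bar>v (y - z) - v (x - z)\<bar> \<le> (f x + e) * dist (y - z) (x - z)"
        proof (rule lip)
          fix s assume "s \<in> closed_segment (y - z) (x - z)"
          moreover have "closed_segment (y - z) (x - z) \<subseteq> ball x (2 * r)"
          proof (rule closed_segment_subset)
            show "y - z \<in> ball x (2 * r)"
              using y \<open>norm z < r\<close> norm_triangle_ineq[of "x - y" z] by (simp add: dist_norm algebra_simps)
            show "x - z \<in> ball x (2 * r)" using \<open>norm z < r\<close> r by (simp add: dist_norm)
          qed simp
          ultimately have s: "dist x s < 2 * r" by auto
          then have "x \<in> W" "s \<in> W"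
            using True r norm_triangle_ineq2[of s x] by (auto simp: W_def dist_norm norm_minus_commute)
          then show "f s \<le> f x + e" using d2(2)[of x s] s r by (auto simp: dist_real_def dist_commute)
        qed
        then show ?thesis by (simp add: dist_norm norm_minus_commute)
      next
        case False
        have "R \<le> norm (x - z)" using False \<open>norm z < r\<close> r norm_triangle_ineq2[of x z] by simp
        moreover have "R \<le> norm (y - z)"
          using False \<open>norm z < r\<close> r y norm_triangle_ineq2[of y z] norm_triangle_ineq2[of x y]
            norm_triangle_ineq2[of x "x - y"] by (simp add: dist_norm)
        ultimately have "x - z \<notin> K" "y - z \<notin> K" using R(2) by (auto simp: subset_iff)
        then show ?thesis using v(2) f(2)[of x] e by simp
      qed
      then show ?thesis by (intro mult_right_mono \<phi>_nonneg)
    qed (simp add: \<phi>_0)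
    have "u y - u x = (LINT z|lborel. (v (y - z) - v (x - z)) * \<phi> z)"
      unfolding u_eq left_diff_distrib by (rule Bochner_Integration.integral_diff[OF int_shift int_shift, symmetric])
    then have "\<bar>u y - u x\<bar> \<le> (LINT z|lborel. norm ((v (y - z) - v (x - z)) * \<phi> z))"
      using integral_norm_bound[of lborel "\<lambda>z. (v (y - z) - v (x - z)) * \<phi> z"] by simp
    also have "\<dots> \<le> (LINT z|lborel. ((f x + e) * dist x y) * \<phi> z)"
    proof (rule integral_mono)
      have "integrable lborel (\<lambda>z. (v (y - z) - v (x - z)) * \<phi> z)"
        using Bochner_Integration.integrable_diff[OF int_shift[of y] int_shift[of x]] by (simp add: left_diff_distrib)
      then show "integrable lborel (\<lambda>z. norm ((v (y - z) - v (x - z)) * \<phi> z))" by (rule integrable_norm)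
    qed (use near \<phi>_int \<phi>_nonneg in \<open>auto simp: abs_mult\<close>)
    also have "\<dots> = (f x + e) * dist x y" by (simp add: \<phi>_1)
    finally show "\<bar>u y - u x\<bar> \<le> (f x + e) * dist x y" .
  qed (use r in auto)
  ultimately show ?thesis by blast
qed

section \<open>Smooth functions along curves\<close>

lemma C1_gradI:
  assumes "\<And>x. (u has_derivative (\<lambda>h. h \<bullet> g x)) (at x)" "continuous_on UNIV g"
  shows "Ck_smooth 1 u" "grad u x = g x"
proof -
  have "(u has_derivative (\<lambda>h. \<Sum>i\<in>Basis. (h \<bullet> i) * (g x \<bullet> i))) (at x)" for x
    using assms(1)[of x] by (simp flip: euclidean_inner)
  from partial_derivative_eq[OF this] have pd: "partial_derivative i u x = g x \<bullet> i" if "i \<in> Basis" for i x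
    using that by simp
  have "continuous_on UNIV (partial_derivative i u)" if "i \<in> Basis" for i
  proof -
    have "continuous_on UNIV (\<lambda>x. g x \<bullet> i)" by (intro continuous_intros assms)
    then show ?thesis using pd[OF that] by simp
  qed
  then show "Ck_smooth 1 u" using assms(1) by (auto simp: differentiable_on_def differentiable_def)
  show "grad u x = g x" by (simp add: grad_def pd euclidean_representation)
qed

lemma C1D:
  assumes "Ck_smooth 1 u"
  shows "(u has_derivative (\<lambda>h. h \<bullet> grad u x)) (at x)" "continuous_on UNIV (grad u)" "continuous_on UNIV u"
proof -
  have "u differentiable (at x)" using assms by (auto simp: differentiable_on_def)
  then show "(u has_derivative (\<lambda>h. h \<bullet> grad u x)) (at x)" by (rule has_derivative_grad)
qed (use Ck_smooth_1_continuous[OF assms] in auto)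

lemma C1_add:
  assumes "Ck_smooth 1 u" "Ck_smooth 1 v"
  shows "Ck_smooth 1 (\<lambda>x. a * u x + b * v x)" "grad (\<lambda>x. a * u x + b * v x) x = a *\<^sub>R grad u x + b *\<^sub>R grad v x"
proof -
  have d: "((\<lambda>x. a * u x + b * v x) has_derivative (\<lambda>h. h \<bullet> (a *\<^sub>R grad u x + b *\<^sub>R grad v x))) (at x)" for x
    using has_derivative_add[OF has_derivative_mult_right[OF C1D(1)[OF assms(1)], of a] has_derivative_mult_right[OF C1D(1)[OF assms(2)], of b], of x]
    by (simp add: inner_add_right)
  have c: "continuous_on UNIV (\<lambda>x. a *\<^sub>R grad u x + b *\<^sub>R grad v x)"
    by (intro continuous_intros C1D assms)
  show "Ck_smooth 1 (\<lambda>x. a * u x + b * v x)" by (rule C1_gradI(1)[OF d c])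
  show "grad (\<lambda>x. a * u x + b * v x) x = a *\<^sub>R grad u x + b *\<^sub>R grad v x" by (rule C1_gradI(2)[OF d c])
qed

lemma C1_mult:
  assumes "Ck_smooth 1 u" "Ck_smooth 1 v"
  shows "Ck_smooth 1 (\<lambda>x. u x * v x)" "grad (\<lambda>x. u x * v x) x = u x *\<^sub>R grad v x + v x *\<^sub>R grad u x"
proof -
  have d: "((\<lambda>x. u x * v x) has_derivative (\<lambda>h. h \<bullet> (u x *\<^sub>R grad v x + v x *\<^sub>R grad u x))) (at x)" for x
    using has_derivative_mult[OF C1D(1)[OF assms(1)] C1D(1)[OF assms(2)], of x]
    by (simp add: inner_add_right mult.commute)
  have c: "continuous_on UNIV (\<lambda>x. u x *\<^sub>R grad v x + v x *\<^sub>R grad u x)"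
    by (intro continuous_intros C1D assms)
  show "Ck_smooth 1 (\<lambda>x. u x * v x)" by (rule C1_gradI(1)[OF d c])
  show "grad (\<lambda>x. u x * v x) x = u x *\<^sub>R grad v x + v x *\<^sub>R grad u x" by (rule C1_gradI(2)[OF d c])
qed

text \<open>For positive \<open>k\<close> and \<open>s\<close> a smooth truncation, bounded by
  \<open>k * s * (pi / 2)\<close> and of slope at most \<open>k\<close>. A minimum with a constant
  would leave the continuously differentiable functions.\<close>

lemma C1_arctan:
  assumes u: "Ck_smooth 1 u" and s: "s \<noteq> 0"
  shows "Ck_smooth 1 (\<lambda>x. k * s * arctan (u x / s))"
    "grad (\<lambda>x. k * s * arctan (u x / s)) x = (k / (1 + (u x / s)\<^sup>2)) *\<^sub>R grad u x"
proof -
  have d: "((\<lambda>x. k * s * arctan (u x / s)) has_derivative (\<lambda>h. h \<bullet> ((k / (1 + (u x / s)\<^sup>2)) *\<^sub>R grad u x))) (at x)" for x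
  proof -
    have "((\<lambda>t. k * s * arctan (t / s)) has_real_derivative k / (1 + (u x / s)\<^sup>2)) (at (u x))"
      using s by (auto intro!: derivative_eq_intros simp: divide_inverse)
    from has_derivative_compose[OF C1D(1)[OF u] this[unfolded has_field_derivative_def]]
    show ?thesis by (simp add: ac_simps)
  qed
  have "1 + (u x / s)\<^sup>2 \<noteq> 0" for x by (metis add_nonneg_eq_0_iff zero_le_one zero_le_power2 zero_neq_one)
  then have c: "continuous_on UNIV (\<lambda>x. (k / (1 + (u x / s)\<^sup>2)) *\<^sub>R grad u x)"
    using s by (intro continuous_intros C1D u) auto
  show "Ck_smooth 1 (\<lambda>x. k * s * arctan (u x / s))" by (rule C1_gradI(1)[OF d c])
  show "grad (\<lambda>x. k * s * arctan (u x / s)) x = (k / (1 + (u x / s)\<^sup>2)) *\<^sub>R grad u x" by (rule C1_gradI(2)[OF d c])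
qed

lemma grad_outside_support:
  assumes "x \<notin> closure {x. u x \<noteq> 0}" shows "grad u x = 0"
proof -
  have "((\<lambda>_. 0) has_derivative (\<lambda>h. 0)) (at x)" by simp
  then have "(u has_derivative (\<lambda>h. 0)) (at x)"
  proof (rule has_derivative_transform_within_open[of _ _ _ _ "- closure {x. u x \<noteq> 0}"])
    show "0 = u y" if "y \<in> - closure {x. u x \<noteq> 0}" for y
    proof (rule ccontr)
      assume "0 \<noteq> u y"
      then have "y \<in> {x. u x \<noteq> 0}" by simp
      then have "y \<in> closure {x. u x \<noteq> 0}" by (rule subsetD[OF closure_subset])
      then show False using that by simp
    qed
  qed (use assms in auto)
  then have "(u has_derivative (\<lambda>h. \<Sum>i\<in>Basis. (h \<bullet> i) * 0)) (at x)" by simp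
  from partial_derivative_eq[OF this] show ?thesis by (simp add: grad_def)
qed

text \<open>As \<gamma> is merely Lipschitz, \<open>v\<close> need not be differentiable along it.
  On pieces so short that the gradient varies by less than \<open>e\<close>, the mean value
  inequality is applied in a ball, and \<open>local_increment_bound\<close> adds up the
  pieces.\<close>

lemma C1_increment_le_integral:
  fixes v :: "'a::euclidean_space \<Rightarrow> real"
  assumes v: "Ck_smooth 1 v" and \<gamma>: "lip1 \<gamma>" and l: "0 \<le> l"
  shows "\<bar>v (\<gamma> l) - v (\<gamma> 0)\<bar> \<le> integral {0..l} (\<lambda>t. norm (grad v (\<gamma> t)))"
proof (rule field_le_epsilon)
  fix e' :: real assume "0 < e'"
  define e where "e = e' / (2 * (l + 1))"
  have e: "0 < e" using \<open>0 < e'\<close> l by (simp add: e_def)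
  define W where "W = cball (\<gamma> 0) (l + 1)"
  have "uniformly_continuous_on W (grad v)"
    unfolding W_def by (intro compact_uniformly_continuous continuous_on_subset[OF C1D(2)[OF v]]) auto
  then obtain d where d: "0 < d" "\<And>x y. x \<in> W \<Longrightarrow> y \<in> W \<Longrightarrow> dist y x < d \<Longrightarrow> dist (grad v y) (grad v x) < e"
    using e unfolding uniformly_continuous_on_def by metis
  define r where "r = min (d / 2) 1"
  have r: "0 < r" "r < d" "r \<le> 1" using d by (auto simp: r_def)
  define h where "h t = norm (grad v (\<gamma> t))" for t
  have gc: "continuous_on UNIV (\<lambda>x. norm (grad v x))" by (intro continuous_intros C1D v)
  have int_h: "h integrable_on {a..b}" for a b
    unfolding h_def by (rule integrable_along_lip1[OF gc \<gamma>])
  have "\<bar>v (\<gamma> l) - v (\<gamma> 0)\<bar> \<le> (integral {0..l} h + 2 * e * l) - (integral {0..0} h + 2 * e * 0)"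
  proof (rule local_increment_bound[where \<delta>=r and F="\<lambda>t. v (\<gamma> t)" and I="\<lambda>t. integral {0..t} h + 2 * e * t"])
    fix a b assume ab: "0 \<le> a" "a \<le> b" "b \<le> l" "b - a \<le> r"
    have inW: "\<gamma> a \<in> W" "cball (\<gamma> a) r \<subseteq> W"
    proof -
      have "dist (\<gamma> 0) (\<gamma> a) \<le> l" using lip1D[OF \<gamma>, of 0 a] ab by simp
      then show "\<gamma> a \<in> W" by (simp add: W_def)
      show "cball (\<gamma> a) r \<subseteq> W"
      proof
        fix y assume "y \<in> cball (\<gamma> a) r"
        then show "y \<in> W" using dist_triangle[of "\<gamma> 0" y "\<gamma> a"] \<open>dist (\<gamma> 0) (\<gamma> a) \<le> l\<close> r by (simp add: W_def)
      qed
    qed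
    have bnd: "norm (grad v y) \<le> h a + e" if "y \<in> cball (\<gamma> a) r" for y
    proof -
      have "dist (grad v y) (grad v (\<gamma> a)) < e" using d(2)[of "\<gamma> a" y] inW that r by (auto simp: dist_commute)
      then show ?thesis using norm_triangle_ineq2[of "grad v y" "grad v (\<gamma> a)"] by (simp add: h_def dist_norm)
    qed
    have in_ball: "\<gamma> t \<in> cball (\<gamma> a) r" if "a \<le> t" "t \<le> b" for t
      using lip1D[OF \<gamma>, of a t] ab that by simp
    have "norm (v (\<gamma> b) - v (\<gamma> a)) \<le> (h a + e) * norm (\<gamma> b - \<gamma> a)"
    proof (rule differentiable_bound[of "cball (\<gamma> a) r" v "\<lambda>x h. h \<bullet> grad v x"])
      show "(v has_derivative (\<lambda>h. h \<bullet> grad v y)) (at y within cball (\<gamma> a) r)" for y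
        by (rule has_derivative_at_withinI[OF C1D(1)[OF v]])
      show "onorm (\<lambda>h. h \<bullet> grad v y) \<le> h a + e" if "y \<in> cball (\<gamma> a) r" for y
      proof (rule onorm_bound)
        show "0 \<le> h a + e" using e by (simp add: h_def)
        fix k
        have "norm (k \<bullet> grad v y) \<le> norm (grad v y) * norm k"
          using Cauchy_Schwarz_ineq2[of k "grad v y"] by (simp add: mult.commute)
        also have "\<dots> \<le> (h a + e) * norm k" by (intro mult_right_mono bnd that) auto
        finally show "norm (k \<bullet> grad v y) \<le> (h a + e) * norm k" .
      qed
      show "\<gamma> b \<in> cball (\<gamma> a) r" "\<gamma> a \<in> cball (\<gamma> a) r" using in_ball[of a] in_ball[of b] ab by auto
    qed auto
    also have "\<dots> \<le> (h a + e) * (b - a)"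
      using lip1D[OF \<gamma>, of b a] ab e by (intro mult_left_mono) (auto simp: dist_norm h_def)
    also have "\<dots> = integral {a..b} (\<lambda>_. h a - e) + 2 * e * (b - a)" using ab by (simp add: algebra_simps)
    also have "integral {a..b} (\<lambda>_. h a - e) \<le> integral {a..b} h"
    proof (rule integral_le)
      show "h a - e \<le> h t" if "t \<in> {a..b}" for t
      proof -
        have "\<gamma> t \<in> cball (\<gamma> a) r" using in_ball that by auto
        moreover from this have "\<gamma> t \<in> W" using inW(2) by blast
        ultimately have "dist (grad v (\<gamma> t)) (grad v (\<gamma> a)) < e" using d(2)[of "\<gamma> a" "\<gamma> t"] inW r by (auto simp: dist_commute)
        then show ?thesis using norm_triangle_ineq3[of "grad v (\<gamma> t)" "grad v (\<gamma> a)"] by (simp add: h_def dist_norm)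
      qed
    qed (auto intro: int_h)
    also have "integral {a..b} h = integral {0..b} h - integral {0..a} h"
      using Henstock_Kurzweil_Integration.integral_combine[of 0 a b h] ab int_h by simp
    finally show "\<bar>v (\<gamma> b) - v (\<gamma> a)\<bar> \<le> (integral {0..b} h + 2 * e * b) - (integral {0..a} h + 2 * e * a)"
      by (simp add: algebra_simps)
  qed (use r l in auto)
  moreover have "2 * e * l \<le> e'" using l \<open>0 < e'\<close> by (simp add: e_def field_simps)
  ultimately show "\<bar>v (\<gamma> l) - v (\<gamma> 0)\<bar> \<le> integral {0..l} (\<lambda>t. norm (grad v (\<gamma> t))) + e'"
    unfolding h_def[abs_def] by simp
qed

text \<open>Allowing both orders of the end points provides the two inequalities that
  \<open>endpoint_diff_le\<close> asks for.\<close>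

lemma C1_increment_le_line_integral:
  fixes v :: "'a::euclidean_space \<Rightarrow> real"
  assumes v: "Ck_smooth 1 v" and c: "arc_length_curve UNIV l \<gamma>"
    and xy: "(x = \<gamma> 0 \<and> y = \<gamma> l) \<or> (x = \<gamma> l \<and> y = \<gamma> 0)"
  shows "ennreal \<bar>v y\<bar> \<le> ennreal \<bar>v x\<bar> + line_integral l \<gamma> (\<lambda>x. ennreal (norm (grad v x)))"
proof -
  have l: "0 < l" using c by (simp add: arc_length_curve_def)
  define \<eta> where "\<eta> = clamp_curve l \<gamma>"
  have lip: "lip1 \<eta>" unfolding \<eta>_def by (rule lip1_clamp_curve[OF c])
  have eq: "\<eta> 0 = \<gamma> 0" "\<eta> l = \<gamma> l" using l by (auto simp: \<eta>_def clamp_curve_eq)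
  have gc: "continuous_on UNIV (\<lambda>x. norm (grad v x))" by (intro continuous_intros C1D v)
  have "continuous_on UNIV (\<lambda>t. norm (grad v (\<eta> t)))"
    by (rule continuous_on_compose2[OF gc lip1_continuous[OF lip]]) auto
  then have "line_integral l \<gamma> (\<lambda>x. ennreal (norm (grad v x))) = ennreal (integral {0..l} (\<lambda>t. norm (grad v (\<eta> t))))"
    unfolding line_integral_clamp \<eta>_def[symmetric] by (rule nn_integral_Icc_continuous) auto
  moreover have "\<bar>v y\<bar> \<le> \<bar>v x\<bar> + integral {0..l} (\<lambda>t. norm (grad v (\<eta> t)))"
    using C1_increment_le_integral[OF v lip, of l] l xy eq by auto
  moreover have "0 \<le> integral {0..l} (\<lambda>t. norm (grad v (\<eta> t)))"
    by (intro integral_nonneg integrable_along_lip1[OF gc lip]) auto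
  ultimately show ?thesis by (simp add: ennreal_leI flip: ennreal_plus)
qed

text \<open>A bump is divided by its minimum on the inner ball, so the cutoff is at least 1 there
  rather than equal to 1. Its size \<open>S\<close> is later absorbed by the factor \<open>K\<close>
  of the minimizing sequence.\<close>

lemma cutoff_exists:
  assumes "0 < R"
  shows "\<exists>(\<eta>::'a::euclidean_space \<Rightarrow> real) S. Ck_smooth 1 \<eta> \<and> (\<forall>x. 0 \<le> \<eta> x \<and> \<eta> x \<le> S \<and> norm (grad \<eta> x) \<le> S) \<and>
    (\<forall>x. norm x \<le> R \<longrightarrow> 1 \<le> \<eta> x) \<and> (\<forall>x. 2 * R < norm x \<longrightarrow> \<eta> x = 0 \<and> grad \<eta> x = 0)"
proof -
  define b where "b = (bump (2 * R) :: 'a \<Rightarrow> real)"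
  have b: "Ck_smooth 1 b" unfolding b_def by (rule bump_Ck_smooth)
  have ne: "cball (0::'a) R \<noteq> {}" using assms by simp
  have bc: "continuous_on S b" for S using C1D(3)[OF b] continuous_on_subset by blast
  obtain x0 where x0: "x0 \<in> cball 0 R" "\<And>x. x \<in> cball 0 R \<Longrightarrow> b x0 \<le> b x"
    using continuous_attains_inf[OF compact_cball ne bc] by blast
  define m where "m = b x0"
  have m: "0 < m" using x0(1) assms bump_pos[of x0 "2 * R"] by (simp add: m_def b_def)
  \<comment> \<open>The zero summand brings the multiple into the form of
    \<open>C1_add\<close>.\<close>
  define \<eta> where "\<eta> x = (1 / m) * b x + 0 * b x" for x
  have \<eta>: "Ck_smooth 1 \<eta>" unfolding \<eta>_def by (rule C1_add[OF b b])
  have "{x. \<eta> x \<noteq> 0} \<subseteq> cball 0 (2 * R)"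
    using assms bump_eq_0[of "2 * R"] by (force simp: \<eta>_def b_def)
  then have cl: "closure {x. \<eta> x \<noteq> 0} \<subseteq> cball 0 (2 * R)" by (intro closure_minimal) auto
  have out: "\<eta> x = 0 \<and> grad \<eta> x = 0" if "2 * R < norm x" for x
  proof
    have "x \<notin> closure {x. \<eta> x \<noteq> 0}" using cl that by auto
    then show "grad \<eta> x = 0" by (rule grad_outside_support)
    show "\<eta> x = 0" using that assms bump_eq_0[of "2 * R" x] by (simp add: \<eta>_def b_def)
  qed
  have "compact ((\<lambda>x. \<eta> x) ` cball 0 (2 * R))" "compact ((\<lambda>x. norm (grad \<eta> x)) ` cball 0 (2 * R))"
    by (intro compact_continuous_image continuous_intros continuous_on_subset[OF C1D(2)[OF \<eta>]] continuous_on_subset[OF C1D(3)[OF \<eta>]]; simp)+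
  then have "bounded ((\<lambda>x. \<eta> x) ` cball 0 (2 * R))" "bounded ((\<lambda>x. norm (grad \<eta> x)) ` cball 0 (2 * R))"
    by (auto intro: compact_imp_bounded)
  then obtain S1 S2 where S12: "\<forall>y\<in>(\<lambda>x. \<eta> x) ` cball 0 (2 * R). norm y \<le> S1"
    "\<forall>y\<in>(\<lambda>x. norm (grad \<eta> x)) ` cball 0 (2 * R). norm y \<le> S2"
    unfolding bounded_iff by blast
  have S: "\<bar>\<eta> x\<bar> \<le> S1" "norm (grad \<eta> x) \<le> S2" if "norm x \<le> 2 * R" for x
    using bspec[OF S12(1), of "\<eta> x"] bspec[OF S12(2), of "norm (grad \<eta> x)"] that by auto
  define S where "S = max 0 (max S1 S2)"
  have "0 \<le> \<eta> x \<and> \<eta> x \<le> S \<and> norm (grad \<eta> x) \<le> S" for x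
  proof (cases "norm x \<le> 2 * R")
    case True
    then show ?thesis using S[of x] m by (auto simp: S_def \<eta>_def b_def bump_nonneg)
  next
    case False
    then show ?thesis using out[of x] by (auto simp: S_def)
  qed
  moreover have "1 \<le> \<eta> x" if "norm x \<le> R" for x
    using x0(2)[of x] that m by (simp add: \<eta>_def m_def)
  ultimately show ?thesis using \<eta> out by (intro exI[of _ \<eta>] exI[of _ S]) auto
qed

lemma endpoint_diff_le:
  assumes "0 \<le> a" "0 \<le> b" "ennreal a \<le> ennreal b + D" "ennreal b \<le> ennreal a + D"
  shows "endpoint_diff (ereal a) (ereal b) \<le> D"
proof (cases D)
  case (real r)
  then have "\<bar>a - b\<bar> \<le> r" using assms by (auto simp flip: ennreal_plus)
  then show ?thesis using real by (simp add: endpoint_diff_def ennreal_leI)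
qed simp

section \<open>The Newtonian capacity is at most the variational capacity\<close>

context weighted_space
begin

text \<open>Each compact subset of \<open>G\<close> has its own test function, and a limit would be
  determined only almost everywhere. The series \<open>W\<close> of absolute differences is instead
  at least 1 at every point of \<open>E\<close>; cut off at 1, it is a Newtonian competitor with
  upper gradient \<open>H\<close>.\<close>

lemma cap_bounded_le_cap_open:
  fixes E G \<Omega> :: "'a set"
  assumes \<Omega>: "open \<Omega>" and G: "open G" "G \<subseteq> \<Omega>" and E: "E \<subseteq> G" "bounded E"
  shows "cap_bounded p M E \<Omega> \<le> cap_open p M G \<Omega>"
proof (cases "cap_open p M G \<Omega> = top")
  case False
  define C where "C = enn2real (cap_open p M G \<Omega>)"
  have C: "cap_open p M G \<Omega> = ennreal C" "0 \<le> C" using False by (auto simp: C_def less_top)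
  have "cap_bounded p M E \<Omega> \<le> ennreal C"
  proof (rule ennreal_le_epsilon)
    fix e :: real assume e: "0 < e"
    obtain K where K: "\<And>n. compact (K n)" "\<And>n. K n \<subseteq> G" "\<And>n. K n \<subseteq> interior (K (Suc n))" "\<Union>(range K) = G"
      using open_Union_compact_subsets[OF G(1)] by metis
    have K_mono: "K m \<subseteq> K n" if "m \<le> n" for m n
      using that by (rule lift_Suc_mono_le[rotated]) (meson K(3) interior_subset order_trans)
    have test: "\<exists>v\<in>test_functions \<Omega>. (\<forall>x\<in>K i. 1 \<le> v x) \<and> (\<integral>\<^sup>+x. ennreal (norm (grad v x) powr p) \<partial>M) \<le> ennreal (C + d)"
      if d: "0 < d" for i d
    proof -
      have "cap_compact p M (K i) \<Omega> \<le> cap_open p M G \<Omega>"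
        unfolding cap_open_def using K by (intro SUP_upper) auto
      also have "\<dots> < ennreal (C + d)" using C d by (simp add: ennreal_lessI)
      finally obtain v where v: "v \<in> test_functions \<Omega>" "\<forall>x\<in>K i. 1 \<le> v x"
          "(\<integral>\<^sup>+x\<in>\<Omega>. ennreal (norm (grad v x) powr p) \<partial>M) < ennreal (C + d)"
        unfolding cap_compact_def by (auto simp: INF_less_iff)
      have "(\<integral>\<^sup>+x. ennreal (norm (grad v x) powr p) \<partial>M) = (\<integral>\<^sup>+x\<in>\<Omega>. ennreal (norm (grad v x) powr p) \<partial>M)"
      proof (rule nn_integral_cong)
        fix x
        have "grad v x = 0" if "x \<notin> \<Omega>"
          using v(1) that by (intro grad_outside_support) (auto simp: test_functions_def)
        then show "ennreal (norm (grad v x) powr p) = ennreal (norm (grad v x) powr p) * indicator \<Omega> x"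
          by (auto simp: indicator_def)
      qed
      then show ?thesis using v by (auto intro: less_imp_le)
    qed
    \<comment> \<open>The budget: the test functions cost \<open>C + e / 8\<close>, truncation
      raises this to \<open>C + e / 4\<close>, the second component to \<open>C + e / 2\<close>, and
      the fast Cauchy sequence takes the remaining \<open>e / 2\<close>.\<close>
    obtain d1 where d1: "0 < d1" "\<And>f g. f \<in> borel_measurable M \<Longrightarrow> g \<in> borel_measurable M \<Longrightarrow>
      (\<integral>\<^sup>+x. f x epowr p \<partial>M) \<le> ennreal (C + e / 4) \<Longrightarrow> (\<integral>\<^sup>+x. g x epowr p \<partial>M) \<le> ennreal d1 \<Longrightarrow>
      (\<integral>\<^sup>+x. (f x + g x) epowr p \<partial>M) \<le> ennreal (C + e / 4 + e / 4)"
      using nn_integral_epowr_add_small[OF p, of "C + e/4" "e/4" M] C e by auto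
    \<comment> \<open>\<open>s * arctan (1 / s)\<close> tends to 1 as \<open>s\<close> grows, hence
      so does \<open>k\<close>, and the slope of the truncation costs little.\<close>
    have "((\<lambda>s::real. (1 / (s * arctan (1 / s))) powr p * (C + e / 8)) \<longlongrightarrow> 1 powr p * (C + e / 8)) at_top"
    proof (intro tendsto_intros)
      show "((\<lambda>s::real. 1 / (s * arctan (1 / s))) \<longlongrightarrow> 1) at_top" by real_asymp
    qed simp
    then have "eventually (\<lambda>s::real. (1 / (s * arctan (1 / s))) powr p * (C + e / 8) < C + e / 4) at_top"
      using e by (intro order_tendstoD) auto
    then have "eventually (\<lambda>s::real. (1 / (s * arctan (1 / s))) powr p * (C + e / 8) < C + e / 4 \<and> 0 < s) at_top"
      using eventually_gt_at_top[of 0] by eventually_elim auto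
    then obtain s :: real where s: "(1 / (s * arctan (1 / s))) powr p * (C + e / 8) < C + e / 4" "0 < s"
      using eventually_happens' trivial_limit_at_top_linorder by blast
    \<comment> \<open>Normalized so that the truncation sends 1 to 1 and preserves the lower bound 1
      on \<open>K i\<close>.\<close>
    define k where "k = 1 / (s * arctan (1 / s))"
    have at: "0 < arctan (1 / s)" using s(2) by simp
    have k: "0 < k" "k * s * arctan (1 / s) = 1" using s(2) at by (simp_all add: k_def)
    define B where "B = k * s * (pi / 2)"
    have B: "0 < B" using k s by (simp add: B_def)
    \<comment> \<open>Since \<theta> is at most 1, its \<open>p\<close>-th power is at most
      \<theta>, so this bound on the mass makes the energy of \<theta> times \<open>B\<close> at
      most \<open>d1\<close>.\<close>
    obtain \<theta> :: "'a \<Rightarrow> real" where \<theta>: "continuous_on UNIV \<theta>" "\<And>x. 0 < \<theta> x" "\<And>x. \<theta> x \<le> 1"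
        "(\<integral>\<^sup>+x. ennreal (\<theta> x) \<partial>M) \<le> ennreal (d1 / B powr p)"
      using exists_integrable_weight[of "d1 / B powr p"] d1 B by auto
    have \<theta>B: "(\<integral>\<^sup>+x. ennreal (\<theta> x * B) epowr p \<partial>M) \<le> ennreal d1"
    proof -
      have [measurable]: "\<theta> \<in> borel_measurable M" by (intro borel_measurable_continuous_onI[OF \<theta>(1), THEN measurable_M])
      have "(\<integral>\<^sup>+x. ennreal (\<theta> x * B) epowr p \<partial>M) \<le> (\<integral>\<^sup>+x. ennreal (B powr p) * ennreal (\<theta> x) \<partial>M)"
      proof (rule nn_integral_mono)
        fix x
        have "\<theta> x powr p \<le> \<theta> x powr 1" using \<theta>(2,3)[of x] p by (intro powr_mono') auto
        then have "(\<theta> x * B) powr p \<le> B powr p * \<theta> x"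
          using \<theta>(2)[of x] B by (simp add: powr_mult mult.commute mult_left_mono)
        then show "ennreal (\<theta> x * B) epowr p \<le> ennreal (B powr p) * ennreal (\<theta> x)"
          using \<theta>(2)[of x] B by (simp add: epowr_ennreal ennreal_leI less_imp_le flip: ennreal_mult)
      qed
      also have "\<dots> = ennreal (B powr p) * (\<integral>\<^sup>+x. ennreal (\<theta> x) \<partial>M)" by (rule nn_integral_cmult) measurable
      also have "\<dots> \<le> ennreal (B powr p) * ennreal (d1 / B powr p)" by (intro mult_left_mono \<theta>) auto
      also have "\<dots> = ennreal d1" using B d1 by (simp flip: ennreal_mult)
      finally show ?thesis .
    qed
    define adm where "adm i u \<longleftrightarrow> Ck_smooth 1 u \<and> (\<forall>x. x \<notin> \<Omega> \<longrightarrow> u x = 0) \<and> bounded {x. u x \<noteq> 0} \<and>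
      (\<forall>x\<in>K i. 1 \<le> u x) \<and> (\<forall>x. \<bar>u x\<bar> \<le> B)" for i and u :: "'a \<Rightarrow> real"
    \<comment> \<open>The second component makes fast Cauchy sequences also Cauchy in \<open>L\<^sup>p\<close> on bounded sets. It
        costs little energy since the competitors are bounded by \<open>B\<close>, owing to the truncation
        by \<open>k * s * arctan (v / s)\<close>, whose derivative is at most \<open>k\<close> and close to \<open>1\<close>.\<close>
    define pr where "pr u x = (grad u x, \<theta> x * u x)" for u x
    define A where "A i = pr ` {u. adm i u}" for i
    have pr_cont: "continuous_on UNIV (pr u)" if "Ck_smooth 1 u" for u
      unfolding pr_def by (intro continuous_intros C1D that \<theta>)
    have pr_diff: "pr u x - pr v x = (grad u x - grad v x, \<theta> x * (u x - v x))" for u v x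
      by (simp add: pr_def right_diff_distrib)
    have "\<exists>f. (\<forall>i. f i \<in> A i) \<and>
      (\<integral>\<^sup>+x. (ennreal (norm (f 0 x)) + (\<Sum>i. ennreal (KK * norm (f (Suc i) x - f i x)))) epowr p \<partial>M) \<le> ennreal ((C + e / 2) + e / 2)"
      if KK: "0 \<le> KK" for KK
    proof (rule fast_cauchy_minimizing_sequence[OF p _ KK])
      show "f \<in> borel_measurable M" if "f \<in> A i" for f i
        using that by (auto simp: A_def adm_def intro!: measurable_M borel_measurable_continuous_onI pr_cont)
      show "A (Suc i) \<subseteq> A i" for i
      proof -
        have "K i \<subseteq> K (Suc i)" by (rule K_mono) simp
        then have b: "\<forall>x\<in>K (Suc i). 1 \<le> u x \<Longrightarrow> \<forall>x\<in>K i. 1 \<le> u x" for u :: "'a \<Rightarrow> real" by blast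
        have "adm (Suc i) u \<Longrightarrow> adm i u" for u
          unfolding adm_def by (elim conjE, intro conjI) (assumption | erule b)+
        then show ?thesis unfolding A_def by (intro image_mono Collect_mono) blast
      qed
      show "(\<lambda>x. (1/2) *\<^sub>R (f x + g x)) \<in> A i" if fg: "f \<in> A i" "g \<in> A i" for f g i
      proof -
        obtain u v where u: "f = pr u" "adm i u" and v: "g = pr v" "adm i v" using fg by (auto simp: A_def)
        define w where "w x = (1/2) * u x + (1/2) * v x" for x
        have uv: "Ck_smooth 1 u" "Ck_smooth 1 v" using u v by (auto simp: adm_def)
        note w_C1 = C1_add[OF uv, of "1/2" "1/2", folded w_def]
        have "bounded {x. w x \<noteq> 0}"
          by (rule bounded_subset[of "{x. u x \<noteq> 0} \<union> {x. v x \<noteq> 0}"]) (use u v in \<open>auto simp: adm_def w_def\<close>)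
        moreover have "1 \<le> w x" if "x \<in> K i" for x
        proof -
          have "1 \<le> u x" "1 \<le> v x" using u v that by (auto simp: adm_def)
          then show ?thesis by (simp add: w_def)
        qed
        moreover have "\<bar>w x\<bar> \<le> B" for x
        proof -
          have "\<bar>u x\<bar> \<le> B" "\<bar>v x\<bar> \<le> B" using u v by (auto simp: adm_def)
          then show ?thesis by (simp add: w_def abs_le_iff)
        qed
        moreover have "w x = 0" if "x \<notin> \<Omega>" for x using u v that by (auto simp: adm_def w_def)
        ultimately have "adm i w" using w_C1(1) by (simp add: adm_def)
        moreover have "(\<lambda>x. (1/2) *\<^sub>R (f x + g x)) = pr w"
          by (intro ext) (simp add: u v pr_def w_C1(2) w_def scaleR_add_right algebra_simps)
        ultimately show ?thesis by (auto simp: A_def)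
      qed
      show "\<exists>f\<in>A i. (\<integral>\<^sup>+x. ennreal (norm (f x) powr p) \<partial>M) \<le> ennreal (C + e / 2 + d)" if d: "0 < d" for i d
      proof -
        obtain v where v: "v \<in> test_functions \<Omega>" "\<And>x. x \<in> K i \<Longrightarrow> 1 \<le> v x"
          "(\<integral>\<^sup>+x. ennreal (norm (grad v x) powr p) \<partial>M) \<le> ennreal (C + e / 8)"
          using test[of "e/8" i] e by auto
        have v1: "Ck_smooth 1 v" using v(1) by (simp add: test_functions_def del: One_nat_def)
        define u where "u x = k * s * arctan (v x / s)" for x
        have "s \<noteq> 0" using s(2) by simp
        note u_C1 = C1_arctan[OF v1 this, of k, folded u_def]
        have "u x = 0" if "v x = 0" for x using that by (simp add: u_def)
        then have "{x. u x \<noteq> 0} \<subseteq> closure {x. v x \<noteq> 0}" using closure_subset[of "{x. v x \<noteq> 0}"] by auto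
        then have "bounded {x. u x \<noteq> 0}" "\<And>x. x \<notin> \<Omega> \<Longrightarrow> u x = 0"
          using v(1) by (auto simp: test_functions_def intro: bounded_subset compact_imp_bounded)
        moreover have "1 \<le> u x" if "x \<in> K i" for x
        proof -
          have "arctan (1 / s) \<le> arctan (v x / s)" using v(2)[OF that] s(2) by (simp add: arctan_le_iff divide_right_mono)
          then have "k * s * arctan (1 / s) \<le> k * s * arctan (v x / s)" using k s by (intro mult_left_mono) auto
          then show ?thesis using k by (simp add: u_def)
        qed
        moreover have "\<bar>u x\<bar> \<le> B" for x
        proof -
          have "\<bar>arctan (v x / s)\<bar> \<le> pi / 2" unfolding abs_le_iff using arctan_lbound[of "v x / s"] arctan_ubound[of "v x / s"] by linarith
          then have "k * s * \<bar>arctan (v x / s)\<bar> \<le> k * s * (pi / 2)" using k s by (intro mult_left_mono) auto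
          then show ?thesis using k s by (simp add: u_def B_def abs_mult)
        qed
        ultimately have "adm i u" using u_C1(1) by (auto simp: adm_def)
        moreover have "(\<integral>\<^sup>+x. ennreal (norm (pr u x) powr p) \<partial>M) \<le> ennreal (C + e / 2 + d)"
        proof -
          have gm[measurable]: "(\<lambda>x. norm (grad v x)) \<in> borel_measurable M"
            by (intro measurable_M borel_measurable_continuous_onI continuous_intros C1D v1)
          have [measurable]: "\<theta> \<in> borel_measurable M" by (intro measurable_M borel_measurable_continuous_onI \<theta>)
          have "(\<integral>\<^sup>+x. ennreal (norm (pr u x) powr p) \<partial>M) \<le> (\<integral>\<^sup>+x. (ennreal (k * norm (grad v x)) + ennreal (\<theta> x * B)) epowr p \<partial>M)"
          proof (rule nn_integral_mono)
            fix x
            have "norm (pr u x) \<le> norm (grad u x) + \<bar>\<theta> x * u x\<bar>"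
              unfolding pr_def using norm_Pair_le[of "grad u x" "\<theta> x * u x"] by simp
            also have "norm (grad u x) \<le> k * norm (grad v x)"
            proof -
              have "k / (1 + (v x / s)\<^sup>2) \<le> k / 1" using k by (intro divide_left_mono) (auto simp: add_pos_nonneg)
              then have "k / (1 + (v x / s)\<^sup>2) * norm (grad v x) \<le> k * norm (grad v x)" by (intro mult_right_mono) auto
              moreover have "0 \<le> k / (1 + (v x / s)\<^sup>2)" using k by simp
              ultimately show ?thesis using k(1) by (simp add: u_C1(2))
            qed
            also have "\<bar>\<theta> x * u x\<bar> \<le> \<theta> x * B"
              using \<theta>(2)[of x] \<open>\<bar>u x\<bar> \<le> B\<close> by (simp add: abs_mult mult_left_mono)
            finally have "ennreal (norm (pr u x)) \<le> ennreal (k * norm (grad v x)) + ennreal (\<theta> x * B)"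
              using k B \<theta>(2)[of x] by (simp add: ennreal_leI flip: ennreal_plus)
            then have "ennreal (norm (pr u x)) epowr p \<le> (ennreal (k * norm (grad v x)) + ennreal (\<theta> x * B)) epowr p"
              by (rule epowr_mono[OF p0])
            then show "ennreal (norm (pr u x) powr p) \<le> (ennreal (k * norm (grad v x)) + ennreal (\<theta> x * B)) epowr p"
              by (simp add: epowr_ennreal)
          qed
          also have "\<dots> \<le> ennreal (C + e / 4 + e / 4)"
          proof (rule d1(2))
            have "(\<integral>\<^sup>+x. ennreal (k * norm (grad v x)) epowr p \<partial>M) = (\<integral>\<^sup>+x. ennreal (k powr p) * ennreal (norm (grad v x) powr p) \<partial>M)"
              using k by (intro nn_integral_cong) (simp add: epowr_ennreal powr_mult flip: ennreal_mult)
            also have "\<dots> = ennreal (k powr p) * (\<integral>\<^sup>+x. ennreal (norm (grad v x) powr p) \<partial>M)"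
              by (rule nn_integral_cmult) measurable
            also have "\<dots> \<le> ennreal (k powr p) * ennreal (C + e / 8)" by (intro mult_left_mono v) auto
            also have "\<dots> = ennreal (k powr p * (C + e / 8))" using C e by (intro ennreal_mult[symmetric]) auto
            also have "\<dots> \<le> ennreal (C + e / 4)" using s(1) by (intro ennreal_leI) (simp add: k_def)
            finally show "(\<integral>\<^sup>+x. ennreal (k * norm (grad v x)) epowr p \<partial>M) \<le> ennreal (C + e / 4)" .
          qed (use \<theta>B in auto)
          also have "\<dots> \<le> ennreal (C + e / 2 + d)" using d by (intro ennreal_leI) auto
          finally show ?thesis .
        qed
        ultimately show ?thesis by (auto simp: A_def)
      qed
    qed (use C e in auto)
    note seq = this
    obtain R where R: "0 < R" "E \<subseteq> ball 0 R" using bounded_subset_ballD[OF E(2)] by blast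
    obtain \<eta> :: "'a \<Rightarrow> real" and S where \<eta>: "Ck_smooth 1 \<eta>" "\<And>x. 0 \<le> \<eta> x" "\<And>x. \<eta> x \<le> S" "\<And>x. norm (grad \<eta> x) \<le> S"
      "\<And>x. norm x \<le> R \<Longrightarrow> 1 \<le> \<eta> x" "\<And>x. 2 * R < norm x \<Longrightarrow> \<eta> x = 0" "\<And>x. 2 * R < norm x \<Longrightarrow> grad \<eta> x = 0"
      using cutoff_exists[OF R(1)] by blast
    have S: "0 \<le> S" using \<eta>(2,3)[of 0] by simp
    have "cball (0::'a) (2 * R) \<noteq> {}" using R by simp
    then obtain x0 where x0: "\<And>x. x \<in> cball 0 (2 * R) \<Longrightarrow> \<theta> x0 \<le> \<theta> x"
      using continuous_attains_inf[OF compact_cball _ continuous_on_subset[OF \<theta>(1)]] by blast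
    define c where "c = \<theta> x0"
    have c: "0 < c" using \<theta>(2) by (simp add: c_def)
    \<comment> \<open>\<open>S\<close> bounds the cutoff and its gradient. As \<open>c\<close> is
      the minimum of \<theta> where the cutoff lives, the second component of a difference controls
      \<open>D i\<close> up to the factor \<open>1 / c\<close>.\<close>
    define KK where "KK = S + S / c"
    have KK: "0 \<le> KK" using S c by (simp add: KK_def)
    obtain f where f: "\<And>i. f i \<in> A i" and f_int: "(\<integral>\<^sup>+x. (ennreal (norm (f 0 x)) + (\<Sum>i. ennreal (KK * norm (f (Suc i) x - f i x)))) epowr p \<partial>M) \<le> ennreal ((C + e / 2) + e / 2)"
      using seq[OF KK] by blast
    have "\<exists>u. f i = pr u \<and> adm i u" for i using f[of i] by (auto simp: A_def)
    then obtain u where u: "\<And>i. f i = pr (u i)" "\<And>i. adm i (u i)" by metis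
    have u_C1: "Ck_smooth 1 (u i)" for i using u(2) by (auto simp: adm_def)
    define D where "D i x = 1 * u (Suc i) x + (-1) * u i x" for i x
    have D_C1: "Ck_smooth 1 (D i)" and D_grad: "grad (D i) x = grad (u (Suc i)) x - grad (u i) x" for i x
      using C1_add[OF u_C1[of "Suc i"] u_C1[of i], of 1 "-1"] by (simp_all add: D_def[abs_def])
    define T where "T i x = \<eta> x * D i x" for i x
    have T_C1: "Ck_smooth 1 (T i)" and T_grad: "grad (T i) x = \<eta> x *\<^sub>R grad (D i) x + D i x *\<^sub>R grad \<eta> x" for i x
      using C1_mult[OF \<eta>(1) D_C1[of i]] by (simp_all add: T_def[abs_def])
    have T_bound: "norm (grad (T i) x) \<le> KK * norm (f (Suc i) x - f i x)" for i x
    proof -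
      define z where "z = f (Suc i) x - f i x"
      have z: "z = (grad (D i) x, \<theta> x * D i x)" by (simp add: z_def u(1) pr_diff D_grad) (simp add: D_def)
      have 1: "norm (grad (D i) x) \<le> norm z" unfolding z by (rule norm_fst_le)
      have 2: "\<theta> x * \<bar>D i x\<bar> \<le> norm z" unfolding z using norm_snd_le[of "\<theta> x * D i x" "grad (D i) x"] \<theta>(2)[of x] by (simp add: abs_mult)
      have "norm (grad (T i) x) \<le> norm (\<eta> x *\<^sub>R grad (D i) x) + norm (D i x *\<^sub>R grad \<eta> x)"
        unfolding T_grad by (rule norm_triangle_ineq)
      also have "norm (\<eta> x *\<^sub>R grad (D i) x) \<le> S * norm z"
        using \<eta>(2,3)[of x] 1 by (auto intro!: mult_mono)
      also have "norm (D i x *\<^sub>R grad \<eta> x) \<le> S / c * norm z"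
      proof (cases "norm x \<le> 2 * R")
        case True
        then have "c \<le> \<theta> x" using x0[of x] by (simp add: c_def)
        then have "c * \<bar>D i x\<bar> \<le> norm z" using 2 mult_right_mono[of c "\<theta> x" "\<bar>D i x\<bar>"] by simp
        then have "\<bar>D i x\<bar> \<le> norm z / c" using c by (simp add: field_simps)
        then have "\<bar>D i x\<bar> * norm (grad \<eta> x) \<le> (norm z / c) * S" using \<eta>(4)[of x] c by (intro mult_mono) auto
        then show ?thesis by (simp add: mult.commute)
      next
        case False
        then show ?thesis using \<eta>(7)[of x] S c by simp
      qed
      finally show ?thesis by (simp add: KK_def z_def algebra_simps)
    qed
    define H where "H x = ennreal (norm (f 0 x)) + (\<Sum>i. ennreal (KK * norm (f (Suc i) x - f i x)))" for x
    have fm[measurable]: "f i \<in> borel_measurable borel" for i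
      unfolding u(1) by (intro borel_measurable_continuous_onI pr_cont u_C1)
    have Hm[measurable]: "H \<in> borel_measurable borel" unfolding H_def by measurable
    have H_int: "(\<integral>\<^sup>+x. H x epowr p \<partial>M) \<le> ennreal (C + e)"
    proof -
      have "(C + e / 2) + e / 2 = C + e" by simp
      then show ?thesis using f_int by (simp only: H_def)
    qed
    \<comment> \<open>All summands vanish off \<Omega> and outside one common bounded set, and so
      does \<open>W\<close>. It may take the value \<infinity>, which the truncation
      \<open>w\<close> removes.\<close>
    define W where "W x = ennreal \<bar>u 0 x\<bar> + (\<Sum>i. ennreal \<bar>T i x\<bar>)" for x
    have Tm[measurable]: "T i \<in> borel_measurable borel" for i by (intro borel_measurable_continuous_onI C1D T_C1)
    have um[measurable]: "u i \<in> borel_measurable borel" for i by (intro borel_measurable_continuous_onI C1D u_C1)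
    have Wm[measurable]: "W \<in> borel_measurable borel" unfolding W_def by measurable
    have W_curve: "W y \<le> W x + line_integral l \<gamma> H"
      if cv: "arc_length_curve UNIV l \<gamma>" and xy: "(x = \<gamma> 0 \<and> y = \<gamma> l) \<or> (x = \<gamma> l \<and> y = \<gamma> 0)" for x y l \<gamma>
    proof -
      note [measurable] = lip1_measurable[OF lip1_clamp_curve[OF cv]]
      have 0: "ennreal \<bar>u 0 y\<bar> \<le> ennreal \<bar>u 0 x\<bar> + line_integral l \<gamma> (\<lambda>x. ennreal (norm (f 0 x)))"
      proof -
        have "line_integral l \<gamma> (\<lambda>x. ennreal (norm (grad (u 0) x))) \<le> line_integral l \<gamma> (\<lambda>x. ennreal (norm (f 0 x)))"
          by (intro line_integral_mono ennreal_leI) (simp add: u(1) pr_def norm_fst_le)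
        then show ?thesis using C1_increment_le_line_integral[OF u_C1[of 0] cv xy]
          by (meson add_left_mono order_trans)
      qed
      have i: "ennreal \<bar>T i y\<bar> \<le> ennreal \<bar>T i x\<bar> + line_integral l \<gamma> (\<lambda>x. ennreal (KK * norm (f (Suc i) x - f i x)))" for i
      proof -
        have "line_integral l \<gamma> (\<lambda>x. ennreal (norm (grad (T i) x))) \<le> line_integral l \<gamma> (\<lambda>x. ennreal (KK * norm (f (Suc i) x - f i x)))"
          by (intro line_integral_mono ennreal_leI T_bound)
        then show ?thesis using C1_increment_le_line_integral[OF T_C1[of i] cv xy]
          by (meson add_left_mono order_trans)
      qed
      have "W y \<le> (ennreal \<bar>u 0 x\<bar> + line_integral l \<gamma> (\<lambda>x. ennreal (norm (f 0 x)))) +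
        (\<Sum>i. ennreal \<bar>T i x\<bar> + line_integral l \<gamma> (\<lambda>x. ennreal (KK * norm (f (Suc i) x - f i x))))"
        unfolding W_def by (intro add_mono 0 suminf_le i) auto
      also have "\<dots> = W x + (line_integral l \<gamma> (\<lambda>x. ennreal (norm (f 0 x))) +
         (\<Sum>i. line_integral l \<gamma> (\<lambda>x. ennreal (KK * norm (f (Suc i) x - f i x)))))"
        unfolding W_def by (subst suminf_add[symmetric]) (auto simp: ac_simps)
      also have "line_integral l \<gamma> (\<lambda>x. ennreal (norm (f 0 x))) +
         (\<Sum>i. line_integral l \<gamma> (\<lambda>x. ennreal (KK * norm (f (Suc i) x - f i x)))) = line_integral l \<gamma> H"
        unfolding line_integral_clamp H_def
        by (subst nn_integral_suminf[symmetric], measurable, subst nn_integral_add[symmetric], measurable)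
          (auto intro!: nn_integral_cong simp: distrib_right)
      finally show ?thesis .
    qed
    define w where "w x = enn2real (min 1 (W x))" for x
    have w: "ennreal (w x) = min 1 (W x)" "0 \<le> w x" "w x \<le> 1" for x
    proof -
      have lt: "min 1 (W x) < top" by (simp add: min_less_iff_disj)
      then show eq: "ennreal (w x) = min 1 (W x)" by (simp add: w_def)
      show "0 \<le> w x" by (simp add: w_def)
      have "ennreal (w x) \<le> ennreal 1" unfolding eq by simp
      then show "w x \<le> 1" by (simp add: ennreal_le_iff2)
    qed
    have wm[measurable]: "w \<in> borel_measurable borel" unfolding w_def by measurable
    have wug: "wug (\<lambda>x. ereal (w x)) H"
      unfolding wug_iff
    proof
      show "H \<in> borel_measurable M" by (rule measurable_M) measurable
      have "endpoint_diff (ereal (w (\<gamma> 0))) (ereal (w (\<gamma> l))) \<le> line_integral l \<gamma> H"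
        if cv: "arc_length_curve UNIV l \<gamma>" for l \<gamma>
      proof (rule endpoint_diff_le)
        have *: "ennreal (w y) \<le> ennreal (w x) + line_integral l \<gamma> H"
          if "W y \<le> W x + line_integral l \<gamma> H" for x y
        proof (cases "W x \<le> 1")
          case True
          have "min 1 (W y) \<le> W y" by (rule min.cobounded2)
          also have "\<dots> \<le> min 1 (W x) + line_integral l \<gamma> H" using that True by (simp add: min_absorb2)
          finally show ?thesis unfolding w(1) .
        next
          case False
          have "min 1 (W y) \<le> 1" by (rule min.cobounded1)
          also have "1 \<le> min 1 (W x) + line_integral l \<gamma> H" using False by (simp add: min_absorb1)
          finally show ?thesis unfolding w(1) .
        qed
        show "ennreal (w (\<gamma> 0)) \<le> ennreal (w (\<gamma> l)) + line_integral l \<gamma> H"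
          "ennreal (w (\<gamma> l)) \<le> ennreal (w (\<gamma> 0)) + line_integral l \<gamma> H"
          by (intro * W_curve cv; simp)+
      qed (use w in auto)
      \<comment> \<open>The inequality holds along every curve, so zero is a witness for the empty
        exceptional family.\<close>
      then show "aec (\<lambda>l \<gamma>. endpoint_diff (ereal (w (\<gamma> 0))) (ereal (w (\<gamma> l))) \<le> line_integral l \<gamma> H)"
        unfolding aec_iff by (intro exI[of _ "\<lambda>_. 0"]) auto
    qed
    have W_zero: "W x = 0" if "u 0 x = 0" "\<And>i. T i x = 0" for x using that by (simp add: W_def)
    have "indicator E x \<le> ereal (w x) \<and> ereal (w x) \<le> indicator \<Omega> x" for x
    proof
      show "ereal (w x) \<le> indicator \<Omega> x"
      proof (cases "x \<in> \<Omega>")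
        case False
        then have "W x = 0" using u(2) by (intro W_zero) (auto simp: adm_def T_def D_def)
        then show ?thesis using False by (simp add: w_def)
      qed (use w in simp)
      show "indicator E x \<le> ereal (w x)"
      proof (cases "x \<in> E")
        case True
        then have eta1: "1 \<le> \<eta> x" using R \<eta>(5)[of x] by (auto simp: subset_iff)
        obtain m where m: "x \<in> K m" using True E K(4) by blast
        have "1 \<le> u m x" using u(2)[of m] m by (auto simp: adm_def)
        \<comment> \<open>Telescoping; as the cutoff is at least 1 on \<open>E\<close>, replacing
          \<open>D i\<close> by \<open>T i\<close> only enlarges the sum.\<close>
        moreover have "\<bar>u n x\<bar> \<le> \<bar>u 0 x\<bar> + (\<Sum>i<n. \<bar>T i x\<bar>)" for n
        proof (induction n)
          case (Suc n)
          have "\<bar>u (Suc n) x\<bar> \<le> \<bar>u n x\<bar> + \<bar>D n x\<bar>" by (simp add: D_def)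
          also have "\<bar>D n x\<bar> \<le> \<bar>T n x\<bar>"
            using eta1 mult_right_mono[of 1 "\<eta> x" "\<bar>D n x\<bar>"] by (simp add: T_def abs_mult)
          finally show ?case using Suc by simp
        qed simp
        ultimately have "1 \<le> \<bar>u 0 x\<bar> + (\<Sum>i<m. \<bar>T i x\<bar>)" by (smt (verit) )
        then have "ennreal 1 \<le> ennreal (\<bar>u 0 x\<bar> + (\<Sum>i<m. \<bar>T i x\<bar>))" by (rule ennreal_leI)
        also have "\<dots> = ennreal \<bar>u 0 x\<bar> + (\<Sum>i<m. ennreal \<bar>T i x\<bar>)" by (simp add: sum_nonneg)
        also have "\<dots> \<le> W x" unfolding W_def by (intro add_left_mono sum_le_suminf) auto
        finally have "min 1 (W x) = 1" by (simp add: min_absorb1)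
        then have "w x = 1" by (simp add: w_def)
        then show ?thesis using True by simp
      qed (use w in simp)
    qed
    moreover have "(\<lambda>x. ereal (w x)) \<in> newtonian_space p M"
      unfolding newtonian_space_def
    proof (intro CollectI conjI)
      show "(\<lambda>x. ereal (w x)) \<in> borel_measurable M"
        by (intro measurable_M) measurable
      have "bounded ({x. u 0 x \<noteq> 0} \<union> cball 0 (2 * R))" using u(2)[of 0] by (simp add: adm_def)
      then obtain r where r: "{x. u 0 x \<noteq> 0} \<union> cball 0 (2 * R) \<subseteq> cball 0 r"
        by (meson ball_subset_cball bounded_subset_ballD order_trans)
      have "(\<integral>\<^sup>+x. e2ennreal \<bar>ereal (w x)\<bar> epowr p \<partial>M) \<le> (\<integral>\<^sup>+x. indicator (cball 0 r) x \<partial>M)"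
      proof (rule nn_integral_mono)
        fix x
        show "e2ennreal \<bar>ereal (w x)\<bar> epowr p \<le> indicator (cball 0 r) x"
        proof (cases "x \<in> cball 0 r")
          case True
          have "ennreal (w x) epowr p \<le> 1 epowr p" by (intro epowr_mono p0) (simp add: w(1))
          also have "\<dots> = 1" using epowr_ennreal[of 1 p] by simp
          finally show ?thesis using True w(2)[of x] by (simp add: e2ennreal_ereal)
        next
          case False
          then have "x \<notin> {x. u 0 x \<noteq> 0} \<union> cball 0 (2 * R)" using r by blast
          then have "u 0 x = 0" "2 * R < norm x" by auto
          then have "W x = 0" by (intro W_zero) (simp_all add: T_def \<eta>(6))
          then have "w x = 0" by (simp add: w_def)
          then show ?thesis by (simp add: e2ennreal_ereal)
        qed
      qed
      also have "\<dots> < \<infinity>" using emeasure_cball_finite[of r] by simp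
      finally have "(\<integral>\<^sup>+x. e2ennreal \<bar>ereal (w x)\<bar> epowr p \<partial>M) < \<infinity>" .
      moreover have "(INF g\<in>{g. wug (\<lambda>x. ereal (w x)) g}. \<integral>\<^sup>+x. g x epowr p \<partial>M) \<le> (\<integral>\<^sup>+x. H x epowr p \<partial>M)"
        using wug by (intro INF_lower) simp
      moreover have "(\<integral>\<^sup>+x. H x epowr p \<partial>M) < \<infinity>" using H_int by (rule order_le_less_trans) simp
      ultimately show "(\<integral>\<^sup>+x. e2ennreal \<bar>ereal (w x)\<bar> epowr p \<partial>M) + (INF g\<in>{g. wug (\<lambda>x. ereal (w x)) g}. \<integral>\<^sup>+x. g x epowr p \<partial>M) < \<infinity>"
        by (simp add: order_le_less_trans)
    qed
    ultimately have "cap_bounded p M E \<Omega> \<le> (\<integral>\<^sup>+x\<in>\<Omega>. minimal_weak_upper_gradient p M (\<lambda>x. ereal (w x)) x epowr p \<partial>M)"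
      unfolding cap_bounded_def by (intro INF_lower) simp
    also have "\<dots> \<le> (\<integral>\<^sup>+x. H x epowr p \<partial>M)"
    proof (rule nn_integral_mono_AE)
      have "(\<integral>\<^sup>+x. H x epowr p \<partial>M) < \<infinity>" using H_int by (rule order_le_less_trans) simp
      from minimal_weak_upper_gradient(2)[OF wug this]
      show "AE x in M. minimal_weak_upper_gradient p M (\<lambda>x. ereal (w x)) x epowr p * indicator \<Omega> x \<le> H x epowr p"
        by eventually_elim (auto simp: indicator_def intro: epowr_mono p0)
    qed
    also have "\<dots> \<le> ennreal C + ennreal e" using H_int C e by (simp add: ennreal_plus)
    finally show "cap_bounded p M E \<Omega> \<le> ennreal C + ennreal e" .
  qed
  then show ?thesis using C by simp
qed simp

end

section \<open>The variational capacity is at most the Newtonian capacity\<close>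

lemma test_functions_mono: "U \<subseteq> V \<Longrightarrow> test_functions U \<subseteq> test_functions V"
  by (auto simp: test_functions_def)

lemma lsc_approx_subseq:
  assumes Q: "lsc_approx Q q" and r: "strict_mono r"
  shows "lsc_approx (\<lambda>k. Q (r k)) q"
proof -
  note Q' = Q[unfolded lsc_approx_def]
  have "(SUP k. ennreal (Q (r k) x)) = (SUP k. ennreal (Q k x))" for x
  proof (rule antisym)
    show "(SUP k. ennreal (Q k x)) \<le> (SUP k. ennreal (Q (r k) x))"
    proof (rule SUP_least)
      fix k
      have "ennreal (Q k x) \<le> ennreal (Q (r k) x)"
        using Q' seq_suble[OF r, of k] by (intro ennreal_leI) (auto simp: incseq_def)
      also have "\<dots> \<le> (SUP k. ennreal (Q (r k) x))" by (rule SUP_upper) simp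
      finally show "ennreal (Q k x) \<le> (SUP k. ennreal (Q (r k) x))" .
    qed
    show "(SUP k. ennreal (Q (r k) x)) \<le> (SUP k. ennreal (Q k x))"
      by (rule SUP_least) (rule SUP_upper, simp)
  qed
  then show ?thesis
    using Q' r by (auto simp: lsc_approx_def incseq_def strict_mono_less_eq)
qed

text \<open>Otherwise every \<open>k\<close> would have a path of \<open>Q k\<close>-cost at most
  \<open>a\<close>, and compactness would give a limit path of \<open>q\<close>-cost at most
  \<open>a\<close>. Thus one continuous function below \<open>q\<close> serves all of
  \<open>K\<close>.\<close>

lemma exit_paths_integral_uniform:
  fixes U :: "'a::euclidean_space set"
  assumes U: "open U" and K: "compact K" "K \<subseteq> U" and Q: "lsc_approx Q q"
    and c: "0 < c" "\<And>y. y \<in> U \<Longrightarrow> c \<le> Q 0 y" and a: "0 \<le> a"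
    and big: "\<And>x \<gamma> L. x \<in> K \<Longrightarrow> (\<gamma>, L) \<in> exit_paths U x \<Longrightarrow> ennreal a < (\<integral>\<^sup>+t\<in>{0..L}. q (\<gamma> t) \<partial>lborel)"
  shows "\<exists>k. \<forall>x\<in>K. \<forall>(\<gamma>, L)\<in>exit_paths U x. ennreal a < (\<integral>\<^sup>+t\<in>{0..L}. ennreal (Q k (\<gamma> t)) \<partial>lborel)"
proof (rule ccontr)
  assume "\<not> ?thesis"
  then have "\<forall>k. \<exists>x \<gamma> L. x \<in> K \<and> (\<gamma>, L) \<in> exit_paths U x \<and> (\<integral>\<^sup>+t\<in>{0..L}. ennreal (Q k (\<gamma> t)) \<partial>lborel) \<le> ennreal a"
    by (auto simp: not_less Bex_def Ball_def case_prod_beta)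
  then obtain X \<gamma> L where X: "\<And>k. X k \<in> K" "\<And>k. (\<gamma> k, L k) \<in> exit_paths U (X k)"
    "\<And>k. (\<integral>\<^sup>+t\<in>{0..L k}. ennreal (Q k (\<gamma> k t)) \<partial>lborel) \<le> ennreal a" by metis
  obtain x r where r: "x \<in> K" "strict_mono (r :: nat \<Rightarrow> nat)" "(X \<circ> r) \<longlonglongrightarrow> x"
    using K(1) X(1) unfolding compact_def by metis
  note Q' = Q[unfolded lsc_approx_def]
  have "\<exists>\<eta> \<tau>. lip1 \<eta> \<and> 0 \<le> \<tau> \<and> \<eta> 0 = x \<and> \<eta> \<tau> \<notin> U \<and> (\<integral>\<^sup>+t\<in>{0..\<tau>}. q (\<eta> t) \<partial>lborel) \<le> ennreal a"
  proof (rule exit_paths_compactness[OF U lsc_approx_subseq[OF Q r(2)] c(1), of "X \<circ> r" x "\<lambda>k. \<gamma> (r k)" "\<lambda>k. L (r k)"])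
    show "c \<le> Q (r 0) y" if "y \<in> U" for y
    proof -
      have "Q 0 y \<le> Q (r 0) y" using Q' by (auto simp: incseq_def)
      then show ?thesis using c(2)[OF that] by simp
    qed
  qed (use X r K a in \<open>auto simp: exit_paths_def\<close>)
  then obtain \<eta> \<tau> where "(\<eta>, \<tau>) \<in> exit_paths U x" "(\<integral>\<^sup>+t\<in>{0..\<tau>}. q (\<eta> t) \<partial>lborel) \<le> ennreal a"
    by (auto simp: exit_paths_def)
  with big[OF r(1)] show False by (meson not_less)
qed

text \<open>Points with a cheap exit path form a relatively closed set: cheap paths from converging
  points have a limit path that is as cheap.\<close>

lemma open_exit_paths_integral:
  fixes U :: "'a::euclidean_space set"
  assumes U: "open U" and Q: "lsc_approx Q q"
    and c: "0 < c" "\<And>y. y \<in> U \<Longrightarrow> c \<le> Q 0 y" and a: "0 \<le> a"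
  shows "open {x \<in> U. \<forall>(\<gamma>, L)\<in>exit_paths U x. ennreal a < (\<integral>\<^sup>+t\<in>{0..L}. q (\<gamma> t) \<partial>lborel)}" (is "open ?G")
proof -
  note Q' = Q[unfolded lsc_approx_def]
  have "closed (- ?G)"
    unfolding closed_sequential_limits
  proof (intro allI impI, elim conjE)
    fix X x assume X: "\<forall>n::nat. X n \<in> - ?G" "X \<longlonglongrightarrow> x"
    show "x \<in> - ?G"
    proof (cases "x \<in> U")
      case True
      then obtain N where N: "\<And>n. n \<ge> N \<Longrightarrow> X n \<in> U"
        using topological_tendstoD[OF X(2) U] by (auto simp: eventually_sequentially)
      have "\<exists>\<gamma> L. (\<gamma>, L) \<in> exit_paths U (X (n + N)) \<and> (\<integral>\<^sup>+t\<in>{0..L}. q (\<gamma> t) \<partial>lborel) \<le> ennreal a" for n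
        using X(1)[rule_format, of "n + N"] N[of "n + N"] by (auto simp: not_less) blast
      then obtain \<gamma> L where \<gamma>: "\<And>n. (\<gamma> n, L n) \<in> exit_paths U (X (n + N))"
        "\<And>n. (\<integral>\<^sup>+t\<in>{0..L n}. q (\<gamma> n t) \<partial>lborel) \<le> ennreal a" by metis
      have "\<exists>\<eta> \<tau>. lip1 \<eta> \<and> 0 \<le> \<tau> \<and> \<eta> 0 = x \<and> \<eta> \<tau> \<notin> U \<and> (\<integral>\<^sup>+t\<in>{0..\<tau>}. q (\<eta> t) \<partial>lborel) \<le> ennreal a"
      proof (rule exit_paths_compactness[OF U Q c, of "\<lambda>n. X (n + N)" x \<gamma> L])
        show "(\<lambda>n. X (n + N)) \<longlonglongrightarrow> x" using X(2) by (rule LIMSEQ_ignore_initial_segment)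
        show "(\<integral>\<^sup>+t\<in>{0..L k}. ennreal (Q k (\<gamma> k t)) \<partial>lborel) \<le> ennreal a" for k
        proof -
          have "(\<integral>\<^sup>+t\<in>{0..L k}. ennreal (Q k (\<gamma> k t)) \<partial>lborel) \<le> (\<integral>\<^sup>+t\<in>{0..L k}. q (\<gamma> k t) \<partial>lborel)"
            using Q' by (intro nn_integral_mono mult_right_mono) (auto intro: SUP_upper)
          then show ?thesis using \<gamma>(2)[of k] by (rule order_trans)
        qed
      qed (use \<gamma> True N a in \<open>auto simp: exit_paths_def\<close>)
      then obtain \<eta> \<tau> where "(\<eta>, \<tau>) \<in> exit_paths U x" "(\<integral>\<^sup>+t\<in>{0..\<tau>}. q (\<eta> t) \<partial>lborel) \<le> ennreal a"
        by (auto simp: exit_paths_def)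
      then show ?thesis by (auto simp: not_less[symmetric])
    qed simp
  qed
  then show ?thesis by (simp add: closed_def)
qed

text \<open>Admissibility speaks of arc length curves, whereas exit paths may move slowly.
  \<open>lip1_reparametrization\<close> bridges the gap for the continuous \<open>Q k\<close>, and
  monotone convergence passes to \<open>q\<close>.\<close>

lemma exit_paths_integral_ge:
  fixes U :: "'a::metric_space set"
  assumes Q: "lsc_approx Q q" and x: "x \<in> U"
    and adm: "\<And>l \<gamma>. arc_length_curve UNIV l \<gamma> \<Longrightarrow> \<gamma> 0 = x \<Longrightarrow> \<gamma> l \<notin> U \<Longrightarrow> 1 \<le> line_integral l \<gamma> q"
    and path: "(\<gamma>, L) \<in> exit_paths U x"
  shows "1 \<le> (\<integral>\<^sup>+t\<in>{0..L}. q (\<gamma> t) \<partial>lborel)"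
proof -
  note Q' = Q[unfolded lsc_approx_def]
  have \<gamma>: "lip1 \<gamma>" "0 \<le> L" "\<gamma> 0 = x" "\<gamma> L \<notin> U" using path by (auto simp: exit_paths_def)
  then have "\<gamma> 0 \<noteq> \<gamma> L" using x by auto
  from lip1_reparametrization[OF \<gamma>(1,2) this] obtain l \<eta> where \<eta>: "arc_length_curve UNIV l \<eta>" "\<eta> 0 = x" "\<eta> l \<notin> U"
    and le: "\<And>f::'a \<Rightarrow> real. continuous_on UNIV f \<Longrightarrow> (\<And>x. 0 \<le> f x) \<Longrightarrow>
       line_integral l \<eta> (\<lambda>x. ennreal (f x)) \<le> (\<integral>\<^sup>+t\<in>{0..L}. ennreal (f (\<gamma> t)) \<partial>lborel)"
    using \<gamma> by metis
  note [measurable] = lip1_measurable[OF lip1_clamp_curve[OF \<eta>(1)]]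
  have [measurable]: "Q k \<in> borel_measurable borel" for k using Q' by (auto intro: borel_measurable_continuous_onI)
  have "1 \<le> line_integral l \<eta> q" by (rule adm[OF \<eta>])
  also have "\<dots> = (\<integral>\<^sup>+t. (SUP k. ennreal (Q k (clamp_curve l \<eta> t)) * indicator {0..l} t) \<partial>lborel)"
    unfolding line_integral_clamp using Q' by (intro nn_integral_cong) (auto split: split_indicator)
  also have "\<dots> = (SUP k. \<integral>\<^sup>+t. ennreal (Q k (clamp_curve l \<eta> t)) * indicator {0..l} t \<partial>lborel)"
    by (rule nn_integral_monotone_convergence_SUP)
      (use Q' in \<open>auto simp: incseq_def le_fun_def intro!: mult_right_mono ennreal_leI\<close>)
  also have "\<dots> \<le> (\<integral>\<^sup>+t\<in>{0..L}. q (\<gamma> t) \<partial>lborel)"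
  proof (rule SUP_least)
    fix k
    have "(\<integral>\<^sup>+t. ennreal (Q k (clamp_curve l \<eta> t)) * indicator {0..l} t \<partial>lborel) = line_integral l \<eta> (\<lambda>x. ennreal (Q k x))"
      by (simp add: line_integral_clamp)
    also have "\<dots> \<le> (\<integral>\<^sup>+t\<in>{0..L}. ennreal (Q k (\<gamma> t)) \<partial>lborel)" using Q' by (intro le) auto
    also have "\<dots> \<le> (\<integral>\<^sup>+t\<in>{0..L}. q (\<gamma> t) \<partial>lborel)"
      using Q' by (intro nn_integral_mono mult_right_mono) (auto intro: SUP_upper)
    finally show "(\<integral>\<^sup>+t. ennreal (Q k (clamp_curve l \<eta> t)) * indicator {0..l} t \<partial>lborel) \<le> (\<integral>\<^sup>+t\<in>{0..L}. q (\<gamma> t) \<partial>lborel)" .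
  qed
  finally show ?thesis .
qed

lemma grad_cmult: "Ck_smooth 1 u \<Longrightarrow> grad (\<lambda>x. c * u x) x = c *\<^sub>R grad u x"
  by (simp add: grad_def partial_derivative_cmult scaleR_sum_right)

lemma exit_cost_continuous:
  fixes f :: "'a::euclidean_space \<Rightarrow> real"
  assumes f: "continuous_on UNIV f" "\<And>x. 0 \<le> f x" and U: "U \<noteq> UNIV"
  shows "continuous_on UNIV (exit_cost f U)"
proof (intro continuous_at_imp_continuous_on ballI)
  fix x :: 'a
  have "compact (f ` cball x 1)"
    by (intro compact_continuous_image continuous_on_subset[OF f(1)]) auto
  then obtain B where B0: "\<forall>y\<in>f ` cball x 1. norm y \<le> B" using compact_imp_bounded bounded_iff by blast
  have B: "f y \<le> B" if "y \<in> cball x 1" for y using bspec[OF B0 imageI[OF that]] by simp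
  have "\<bar>exit_cost f U y - exit_cost f U x\<bar> \<le> B * dist x y" if "y \<in> cball x 1" for y
  proof -
    have "closed_segment x y \<subseteq> cball x 1" using that by (intro closed_segment_subset) auto
    then have "exit_cost f U x \<le> exit_cost f U y + B * dist x y" "exit_cost f U y \<le> exit_cost f U x + B * dist y x"
      using B by (intro exit_cost_segment_le f U; auto simp: closed_segment_commute)+
    then show ?thesis by (simp add: dist_commute abs_le_iff)
  qed
  then have ev: "eventually (\<lambda>y. norm (exit_cost f U y - exit_cost f U x) \<le> B * dist x y) (at x)"
    unfolding eventually_at by (intro exI[of _ 1]) (auto simp: dist_commute)
  have "((\<lambda>y. B * dist x y) \<longlongrightarrow> B * dist x x) (at x)" by (intro tendsto_intros)
  then have "((\<lambda>y. B * dist x y) \<longlongrightarrow> 0) (at x)" by simp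
  from Lim_null_comparison[OF ev this] have "(exit_cost f U \<longlongrightarrow> exit_cost f U x) (at x)" by (simp add: LIM_zero_iff)
  then show "isCont (exit_cost f U) x" by (simp add: isCont_def)
qed

section \<open>Test functions for compact sets from exit costs\<close>

context weighted_space
begin

text \<open>The exit cost \<open>v\<close> of a continuous \<open>f \<le> q\<close> is at least
  \<open>a\<close> on \<open>K\<close>, vanishes off \<open>U\<close> and has slope at most
  \<open>f\<close>. It is lowered by \<delta> to obtain compact support in \<open>U\<close>,
  mollified, and divided by \<open>a - e\<close>.\<close>

lemma cap_compact_le_exit_paths:
  fixes U \<Omega> K :: "'a set" and C a e :: real
  assumes U: "open U" "bounded U" "U \<subseteq> \<Omega>" and K: "compact K" "K \<subseteq> U" and Q: "lsc_approx Q q"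
    and c: "0 < c" "\<And>y. y \<in> U \<Longrightarrow> c \<le> Q 0 y" and C: "0 \<le> C" "(\<integral>\<^sup>+x. q x epowr p \<partial>M) \<le> ennreal C"
    and e: "0 < e" "e < a"
    and big: "\<And>x \<gamma> L. x \<in> K \<Longrightarrow> (\<gamma>, L) \<in> exit_paths U x \<Longrightarrow> ennreal a < (\<integral>\<^sup>+t\<in>{0..L}. q (\<gamma> t) \<partial>lborel)"
  shows "cap_compact p M K \<Omega> \<le> ennreal ((C + e) * (1 / (a - e)) powr p)"
proof -
  note Q' = Q[unfolded lsc_approx_def]
  have qm[measurable]: "q \<in> borel_measurable borel"
    using Q by (intro lsc_fun_measurable) (auto simp: lsc_fun_def)
  obtain k where k: "\<And>x \<gamma> L. x \<in> K \<Longrightarrow> (\<gamma>, L) \<in> exit_paths U x \<Longrightarrow> ennreal a < (\<integral>\<^sup>+t\<in>{0..L}. ennreal (Q k (\<gamma> t)) \<partial>lborel)"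
    using exit_paths_integral_uniform[OF U(1) K Q c _ big] e by fastforce
  define f where "f = Q k"
  have f: "continuous_on UNIV f" "\<And>x. 0 \<le> f x" "\<And>x. ennreal (f x) \<le> q x"
    using Q' by (auto simp: f_def intro: SUP_upper)
  have U_ne: "U \<noteq> UNIV" using U(2) not_bounded_UNIV by metis
  define v where "v = exit_cost f U"
  have v_cont: "continuous_on UNIV v" unfolding v_def by (rule exit_cost_continuous[OF f(1,2) U_ne])
  have v_nonneg: "0 \<le> v x" for x unfolding v_def by (rule exit_cost_nonneg[OF f(1,2) U_ne])
  have v_out: "v x = 0" if "x \<notin> U" for x unfolding v_def by (rule exit_cost_outside[OF f(1,2) U_ne that])
  have v_seg: "v x \<le> v y + B * dist x y" if "\<And>z. z \<in> closed_segment x y \<Longrightarrow> f z \<le> B" for x y B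
    unfolding v_def by (rule exit_cost_segment_le[OF f(1,2) U_ne that])
  have v_K: "a \<le> v x" if x: "x \<in> K" for x
    unfolding v_def
  proof (rule exit_cost_greatest[OF f(1,2) U_ne])
    fix \<gamma> L assume path: "(\<gamma>, L) \<in> exit_paths U x"
    then have \<gamma>: "lip1 \<gamma>" by (simp add: exit_paths_def)
    have "continuous_on UNIV (\<lambda>t. f (\<gamma> t))"
      by (rule continuous_on_compose2[OF f(1) lip1_continuous[OF \<gamma>]]) auto
    then have "ennreal a < ennreal (integral {0..L} (\<lambda>t. f (\<gamma> t)))"
      using k[OF x path] f(2) by (simp add: nn_integral_Icc_continuous flip: f_def)
    then show "a \<le> integral {0..L} (\<lambda>t. f (\<gamma> t))" using e by (simp add: ennreal_less_iff)
  qed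
  obtain R where R: "U \<subseteq> cball 0 R" using U(2) by (meson ball_subset_cball bounded_subset_ballD order_trans)
  obtain d where d: "0 < d" "\<And>f g. f \<in> borel_measurable M \<Longrightarrow> g \<in> borel_measurable M \<Longrightarrow>
      (\<integral>\<^sup>+x. f x epowr p \<partial>M) \<le> ennreal C \<Longrightarrow> (\<integral>\<^sup>+x. g x epowr p \<partial>M) \<le> ennreal d \<Longrightarrow>
      (\<integral>\<^sup>+x. (f x + g x) epowr p \<partial>M) \<le> ennreal (C + e)"
    using nn_integral_epowr_add_small[OF p C(1) e(1), of M] by auto
  have im: "(\<lambda>x. indicator U x :: ennreal) \<in> borel_measurable M" using U(1) by (intro measurable_M) auto
  have ifin: "(\<integral>\<^sup>+x. (indicator U x :: ennreal) epowr p \<partial>M) < \<infinity>"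
  proof -
    have "(\<integral>\<^sup>+x. (indicator U x :: ennreal) epowr p \<partial>M) \<le> (\<integral>\<^sup>+x. indicator (cball 0 R) x \<partial>M)"
    proof (rule nn_integral_mono)
      fix x
      show "(indicator U x :: ennreal) epowr p \<le> indicator (cball 0 R) x"
        using R epowr_ennreal[of 1 p] by (auto split: split_indicator)
    qed
    also have "\<dots> < \<infinity>" using emeasure_cball_finite[of R] by simp
    finally show ?thesis .
  qed
  \<comment> \<open>Mollification adds \<delta> to the gradient bound, but only on the bounded set
    \<open>U\<close>, so a small multiple of its indicator accounts for the energy.\<close>
  obtain \<delta>0 where \<delta>0: "0 < \<delta>0" "(\<integral>\<^sup>+x. (ennreal \<delta>0 * indicator U x) epowr p \<partial>M) \<le> ennreal d"
    using exists_small_multiple[OF im ifin d(1)] by blast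
  have im2: "(\<lambda>x. ennreal \<delta>0 * indicator U x) \<in> borel_measurable M"
    by (rule borel_measurable_times_ennreal[OF borel_measurable_const im])
  \<comment> \<open>Up to \<delta> is lost twice, by lowering \<open>v\<close> and by mollifying, so
    \<open>2 * \<delta> \<le> e\<close> leaves at least \<open>a - e\<close> on
    \<open>K\<close>.\<close>
  define \<delta> where "\<delta> = min \<delta>0 (e / 2)"
  have \<delta>: "0 < \<delta>" "\<delta> \<le> \<delta>0" "2 * \<delta> \<le> e" using \<delta>0 e by (auto simp: \<delta>_def)
  define w where "w x = max (v x - \<delta>) 0" for x
  define S where "S = {x. \<delta> \<le> v x}"
  have S: "compact S" "S \<subseteq> U"
  proof -
    show "S \<subseteq> U" using v_out \<delta>(1) by (force simp: S_def)
    then have "bounded S" using U(2) bounded_subset by blast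
    moreover have "closed S" unfolding S_def using v_cont by (intro closed_Collect_le continuous_intros)
    ultimately show "compact S" by (simp add: compact_eq_bounded_closed)
  qed
  have "\<exists>u\<in>test_functions U. (\<forall>x. \<bar>u x - w x\<bar> \<le> \<delta>) \<and> (\<forall>x. norm (grad u x) \<le> f x + \<delta>)"
  proof (rule smooth_approximation[OF U(1) S _ _ f(1,2) _ \<delta>(1)])
    show "continuous_on UNIV w" unfolding w_def by (intro continuous_intros v_cont)
    show "w x = 0" if "x \<notin> S" for x using that by (simp add: S_def w_def)
    show "\<bar>w x - w y\<bar> \<le> B * dist x y" if "\<And>z. z \<in> closed_segment x y \<Longrightarrow> f z \<le> B" for x y B
      using v_seg[of x y B] v_seg[of y x B] that by (auto simp: w_def closed_segment_commute dist_commute)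
  qed
  then obtain u where u: "u \<in> test_functions U" "\<And>x. \<bar>u x - w x\<bar> \<le> \<delta>" "\<And>x. norm (grad u x) \<le> f x + \<delta>" by blast
  have u1: "Ck_smooth 1 u" using u(1) by (simp add: test_functions_def del: One_nat_def)
  define b where "b = 1 / (a - e)"
  have b: "0 < b" using e by (simp add: b_def)
  have u_K: "1 \<le> b * u x" if "x \<in> K" for x
  proof -
    have "a - e \<le> u x" using v_K[OF that] u(2)[of x] \<delta> by (auto simp: w_def)
    then show ?thesis using e by (simp add: b_def field_simps)
  qed
  have "(\<lambda>x. b * u x) \<in> test_functions \<Omega>"
    using subsetD[OF test_functions_mono[OF U(3)] u(1)] b by (auto simp: test_functions_def Ck_smooth_cmult)
  then have "cap_compact p M K \<Omega> \<le> (\<integral>\<^sup>+x\<in>\<Omega>. ennreal (norm (grad (\<lambda>x. b * u x) x) powr p) \<partial>M)"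
    unfolding cap_compact_def using u_K by (intro INF_lower) auto
  also have "\<dots> \<le> (\<integral>\<^sup>+x. ennreal (b powr p) * (q x + ennreal \<delta>0 * indicator U x) epowr p \<partial>M)"
  proof (rule nn_integral_mono)
    fix x
    show "ennreal (norm (grad (\<lambda>x. b * u x) x) powr p) * indicator \<Omega> x \<le> ennreal (b powr p) * (q x + ennreal \<delta>0 * indicator U x) epowr p"
    proof (cases "x \<in> U")
      case True
      have "ennreal (norm (grad u x)) \<le> ennreal (f x) + ennreal \<delta>"
        using u(3)[of x] f(2)[of x] \<delta> by (simp add: ennreal_leI flip: ennreal_plus)
      also have "\<dots> \<le> q x + ennreal \<delta>0" by (intro add_mono f ennreal_leI \<delta>)
      finally have "ennreal (norm (grad u x)) epowr p \<le> (q x + ennreal \<delta>0) epowr p" by (rule epowr_mono[OF p0])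
      then have "ennreal (b powr p) * ennreal (norm (grad u x) powr p) \<le> ennreal (b powr p) * (q x + ennreal \<delta>0) epowr p"
        by (intro mult_left_mono) (auto simp: epowr_ennreal)
      moreover have "ennreal (norm (grad (\<lambda>x. b * u x) x) powr p) = ennreal (b powr p) * ennreal (norm (grad u x) powr p)"
        using b by (simp add: grad_cmult[OF u1] powr_mult flip: ennreal_mult)
      ultimately show ?thesis using True U(3) by (auto simp: indicator_def)
    next
      case False
      have "grad u x = 0"
        using u(1) False by (intro grad_outside_support) (auto simp: test_functions_def)
      then show ?thesis using p0 by (simp add: grad_cmult[OF u1])
    qed
  qed
  also have "\<dots> = ennreal (b powr p) * (\<integral>\<^sup>+x. (q x + ennreal \<delta>0 * indicator U x) epowr p \<partial>M)"
    by (intro nn_integral_cmult epowr_measurable borel_measurable_add im2 measurable_M[OF qm])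
  also have "\<dots> \<le> ennreal (b powr p) * ennreal (C + e)"
  proof (rule mult_left_mono)
    show "(\<integral>\<^sup>+x. (q x + ennreal \<delta>0 * indicator U x) epowr p \<partial>M) \<le> ennreal (C + e)"
      by (rule d(2)[OF measurable_M[OF qm] im2 C(2) \<delta>0(2)])
  qed simp
  also have "\<dots> = ennreal ((C + e) * (1 / (a - e)) powr p)"
    using C e by (subst ennreal_mult[symmetric]) (auto simp: b_def mult.commute)
  finally show ?thesis .
qed

end

section \<open>From a Newtonian competitor to an admissible density\<close>

context weighted_space
begin

text \<open>A finite integral leaves infinite values only for a null set of parameters. Real-valued
  densities are wanted because uniform convexity is stated for functions with values in a Euclidean
  space.\<close>

lemma line_integral_enn2real:
  assumes c: "arc_length_curve UNIV l \<gamma>" and f: "f \<in> borel_measurable borel" and fin: "line_integral l \<gamma> f < \<infinity>"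
  shows "line_integral l \<gamma> (\<lambda>x. ennreal (enn2real (f x))) = line_integral l \<gamma> f"
proof -
  note [measurable] = lip1_measurable[OF lip1_clamp_curve[OF c]] f
  have "AE t in lborel. f (clamp_curve l \<gamma> t) * indicator {0..l} t \<noteq> \<infinity>"
    using fin unfolding line_integral_clamp by (intro nn_integral_noteq_infinite) auto
  then show ?thesis
    unfolding line_integral_clamp
    by (intro nn_integral_cong_AE) (auto elim!: eventually_mono simp: less_top split: split_indicator split_indicator_asm)
qed

text \<open>The curve is followed only to its first exit from
  \<open>\<Omega> \<inter> ball x\<^sub>0 R\<close>. Until then it stays in \<Omega>, the set on
  which the energy of the gradient is measured. The ball makes the domain of exit bounded, as
  compactly supported test functions require.\<close>

lemma newtonian_competitor_gives_admissible:
  fixes E \<Omega> :: "'a set" and x\<^sub>0 :: 'a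
  assumes \<Omega>: "open \<Omega>" and u: "u \<in> newtonian_space p M"
    and bd: "\<And>x. indicator E x \<le> u x" "\<And>x. u x \<le> indicator \<Omega> x"
    and E: "E \<subseteq> ball x\<^sub>0 r" and r: "0 < r" and C: "0 \<le> C"
    and int: "(\<integral>\<^sup>+x\<in>\<Omega>. minimal_weak_upper_gradient p M u x epowr p \<partial>M) \<le> ennreal C" and d: "0 < d"
  shows "\<exists>f::'a \<Rightarrow> real. \<exists>R. f \<in> borel_measurable borel \<and> (\<forall>x. 0 \<le> f x) \<and>
    (\<integral>\<^sup>+x. ennreal (norm (f x) powr p) \<partial>M) \<le> ennreal (C + d) \<and>
    aec (\<lambda>l \<gamma>. \<gamma> 0 \<in> E \<longrightarrow> \<gamma> l \<notin> \<Omega> \<inter> ball x\<^sub>0 R \<longrightarrow> 1 \<le> line_integral l \<gamma> (\<lambda>x. ennreal (f x)))"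
proof -
  have um: "u \<in> borel_measurable M" using u by (simp add: newtonian_space_def)
  have "(\<integral>\<^sup>+x. e2ennreal \<bar>u x\<bar> epowr p \<partial>M) + (INF g\<in>{g. wug u g}. \<integral>\<^sup>+x. g x epowr p \<partial>M) < \<infinity>"
    using u by (simp add: newtonian_space_def)
  then have u_fin: "(\<integral>\<^sup>+x. e2ennreal \<bar>u x\<bar> epowr p \<partial>M) < \<infinity>"
    and inf_fin: "(INF g\<in>{g. wug u g}. \<integral>\<^sup>+x. g x epowr p \<partial>M) < \<infinity>" by auto
  obtain g0 where g0: "wug u g0" "(\<integral>\<^sup>+x. g0 x epowr p \<partial>M) < \<infinity>"
    using inf_fin by (auto simp: INF_less_iff)
  define g where "g = minimal_weak_upper_gradient p M u"
  have g: "wug u g" unfolding g_def by (rule minimal_weak_upper_gradient(1)[OF g0])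
  then have gm[measurable]: "g \<in> borel_measurable M" and g_aec: "aec (\<lambda>l \<gamma>. endpoint_diff (u (\<gamma> 0)) (u (\<gamma> l)) \<le> line_integral l \<gamma> g)"
    by (auto simp: wug_iff)
  have [measurable]: "\<Omega> \<in> sets M" using \<Omega> by (intro borel_sets_M) simp
  have gO: "(\<integral>\<^sup>+x. (g x * indicator \<Omega> x) epowr p \<partial>M) \<le> ennreal C"
  proof -
    have "(\<integral>\<^sup>+x. (g x * indicator \<Omega> x) epowr p \<partial>M) = (\<integral>\<^sup>+x\<in>\<Omega>. g x epowr p \<partial>M)"
      by (intro nn_integral_cong) (auto split: split_indicator)
    then show ?thesis using int by (simp add: g_def)
  qed
  \<comment> \<open>\<open>d\<close> is split into three parts: for the witness \<rho> of the
    exceptional curves, for the semicontinuous majorant \<open>q\<close>, and for the majorant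
    \<open>q2\<close> of the cutoff term.\<close>
  obtain d1 where d1: "0 < d1" "\<And>f h. f \<in> borel_measurable M \<Longrightarrow> h \<in> borel_measurable M \<Longrightarrow>
      (\<integral>\<^sup>+x. f x epowr p \<partial>M) \<le> ennreal C \<Longrightarrow> (\<integral>\<^sup>+x. h x epowr p \<partial>M) \<le> ennreal d1 \<Longrightarrow>
      (\<integral>\<^sup>+x. (f x + h x) epowr p \<partial>M) \<le> ennreal (C + d / 3)"
    using nn_integral_epowr_add_small[OF p C, of "d / 3" M] d by auto
  obtain d2 where d2: "0 < d2" "\<And>f h. f \<in> borel_measurable M \<Longrightarrow> h \<in> borel_measurable M \<Longrightarrow>
      (\<integral>\<^sup>+x. f x epowr p \<partial>M) \<le> ennreal (C + d / 3 + d / 3) \<Longrightarrow> (\<integral>\<^sup>+x. h x epowr p \<partial>M) \<le> ennreal d2 \<Longrightarrow>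
      (\<integral>\<^sup>+x. (f x + h x) epowr p \<partial>M) \<le> ennreal (C + d / 3 + d / 3 + d / 3)"
    using nn_integral_epowr_add_small[OF p, of "C + d/3 + d/3" "d / 3" M] C d by auto
  obtain \<rho> :: "'a \<Rightarrow> ennreal" where \<rho>[measurable]: "\<rho> \<in> borel_measurable borel" and \<rho>_int: "(\<integral>\<^sup>+x. \<rho> x epowr p \<partial>M) \<le> ennreal d1"
    and \<rho>_bad: "\<And>l \<gamma>. arc_length_curve UNIV l \<gamma> \<Longrightarrow> \<not> endpoint_diff (u (\<gamma> 0)) (u (\<gamma> l)) \<le> line_integral l \<gamma> g \<Longrightarrow> line_integral l \<gamma> \<rho> = \<infinity>"
    using aec_small[OF g_aec d1(1)] by blast
  have \<rho>M: "\<rho> \<in> borel_measurable M" by (rule measurable_M[OF \<rho>])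
  have hm: "(\<lambda>x. g x * indicator \<Omega> x + \<rho> x) \<in> borel_measurable M" using \<rho>M by measurable
  have h_int: "(\<integral>\<^sup>+x. (g x * indicator \<Omega> x + \<rho> x) epowr p \<partial>M) \<le> ennreal (C + d / 3)"
    by (rule d1(2)[OF _ \<rho>M gO \<rho>_int]) measurable
  have "0 < d / 3" using d by simp
  from vitali_caratheodory[OF hm this] obtain q where q: "lsc_fun q" "\<And>x. g x * indicator \<Omega> x + \<rho> x \<le> q x"
    "(\<integral>\<^sup>+x. q x epowr p \<partial>M) \<le> (\<integral>\<^sup>+x. (g x * indicator \<Omega> x + \<rho> x) epowr p \<partial>M) + ennreal (d / 3)" by blast
  have qm[measurable]: "q \<in> borel_measurable borel" by (rule lsc_fun_measurable[OF q(1)])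
  have q_int: "(\<integral>\<^sup>+x. q x epowr p \<partial>M) \<le> ennreal (C + d / 3 + d / 3)"
  proof -
    have "(\<integral>\<^sup>+x. q x epowr p \<partial>M) \<le> ennreal (C + d / 3) + ennreal (d / 3)"
      using q(3) h_int by (meson add_right_mono order_trans)
    also have "\<dots> = ennreal (C + d / 3 + d / 3)" using C d by (intro ennreal_plus[symmetric]) auto
    finally show ?thesis .
  qed
  define \<phi> where "\<phi> x = real_of_ereal (u x)" for x
  have \<phi>: "u x = ereal (\<phi> x)" "0 \<le> \<phi> x" "\<phi> x \<le> 1" for x
  proof -
    have "0 \<le> u x" "u x \<le> 1"
      using order_trans[OF _ bd(1)[of x], of 0] order_trans[OF bd(2)[of x], of 1] by (auto simp: indicator_def split: if_splits)
    then show "u x = ereal (\<phi> x)" "0 \<le> \<phi> x" "\<phi> x \<le> 1"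
      unfolding \<phi>_def by (cases "u x"; simp add: one_ereal_def zero_ereal_def)+
  qed
  have \<phi>_E: "\<phi> x = 1" if "x \<in> E" for x using bd(1)[of x] that \<phi>(1,3)[of x] by (simp add: one_ereal_def)
  have \<phi>_out: "\<phi> x = 0" if "x \<notin> \<Omega>" for x using bd(2)[of x] that \<phi>(1,2)[of x] by (simp add: zero_ereal_def)
  have \<phi>m: "(\<lambda>x. ennreal (\<phi> x)) \<in> borel_measurable M" unfolding \<phi>_def using um by measurable
  have "(\<integral>\<^sup>+x. ennreal (\<phi> x) epowr p \<partial>M) < \<infinity>"
    using u_fin \<phi>(2) by (simp add: \<phi>(1) e2ennreal_ereal)
  then obtain c where c: "0 < c" "(\<integral>\<^sup>+x. (ennreal c * ennreal (\<phi> x)) epowr p \<partial>M) \<le> ennreal (d2 / 2)"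
    using exists_small_multiple[OF \<phi>m, of "d2 / 2"] d2(1) by auto
  \<comment> \<open>The product of \<open>u\<close> with the cutoff of slope \<open>c\<close> between the balls of radii \<open>r\<close> and \<open>R\<close> vanishes
      outside \<open>\<Omega> \<inter> ball x\<^sub>0 R\<close>; the function \<open>q2\<close> majorizes the contribution of the cutoff.\<close>
  define R where "R = r + 1 / c"
  have R: "r < R" "1 / (R - r) = c" "0 < R - r" using c by (auto simp: R_def)
  have "0 < d2 / 2" using d2 by simp
  from vitali_caratheodory[OF borel_measurable_times_ennreal[OF borel_measurable_const \<phi>m] this, of "ennreal c"]
  obtain q2 where q2: "lsc_fun q2" "\<And>x. ennreal c * ennreal (\<phi> x) \<le> q2 x"
    "(\<integral>\<^sup>+x. q2 x epowr p \<partial>M) \<le> (\<integral>\<^sup>+x. (ennreal c * ennreal (\<phi> x)) epowr p \<partial>M) + ennreal (d2 / 2)" by blast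
  have q2m[measurable]: "q2 \<in> borel_measurable borel" by (rule lsc_fun_measurable[OF q2(1)])
  have q2_int: "(\<integral>\<^sup>+x. q2 x epowr p \<partial>M) \<le> ennreal d2"
  proof -
    have "(\<integral>\<^sup>+x. q2 x epowr p \<partial>M) \<le> ennreal (d2 / 2) + ennreal (d2 / 2)"
      using q2(3) c(2) by (meson add_right_mono order_trans)
    also have "\<dots> = ennreal d2" using d2 by (simp flip: ennreal_plus)
    finally show ?thesis .
  qed
  define F where "F x = q x + q2 x" for x
  have Fm[measurable]: "F \<in> borel_measurable borel" unfolding F_def by measurable
  have F_int: "(\<integral>\<^sup>+x. F x epowr p \<partial>M) \<le> ennreal (C + d)"
  proof -
    have "(\<integral>\<^sup>+x. F x epowr p \<partial>M) \<le> ennreal (C + d / 3 + d / 3 + d / 3)"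
      unfolding F_def by (rule d2(2)[OF measurable_M[OF qm] measurable_M[OF q2m] q_int q2_int])
    also have "\<dots> = ennreal (C + d)" by (rule arg_cong[of _ _ ennreal]) simp
    finally show ?thesis .
  qed
  have adm: "1 \<le> line_integral l \<gamma> F"
    if cv: "arc_length_curve UNIV l \<gamma>" and start: "\<gamma> 0 \<in> E" and final: "\<gamma> l \<notin> \<Omega> \<inter> ball x\<^sub>0 R" for l \<gamma>
  proof (rule ccontr)
    assume "\<not> 1 \<le> line_integral l \<gamma> F"
    then have lt1: "line_integral l \<gamma> F < 1" by simp
    have l: "0 < l" using cv by (simp add: arc_length_curve_def)
    have "\<gamma> 0 \<in> \<Omega>" using \<phi>_E[OF start] \<phi>_out[of "\<gamma> 0"] by auto
    moreover have "\<gamma> 0 \<in> ball x\<^sub>0 R" using E start R(1) by (auto simp: subset_iff)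
    ultimately have "\<gamma> 0 \<in> \<Omega> \<inter> ball x\<^sub>0 R" by simp
    moreover have "continuous_on {0..l} \<gamma>" using cv by (simp add: arc_length_curve_def)
    ultimately obtain \<tau> where \<tau>: "0 < \<tau>" "\<tau> \<le> l" "\<gamma> \<tau> \<notin> \<Omega> \<inter> ball x\<^sub>0 R" "\<And>s. 0 \<le> s \<Longrightarrow> s < \<tau> \<Longrightarrow> \<gamma> s \<in> \<Omega> \<inter> ball x\<^sub>0 R"
      using first_exit[of l \<gamma> "\<Omega> \<inter> ball x\<^sub>0 R"] final \<Omega> l by (auto simp: less_imp_le)
    define \<gamma>' where "\<gamma>' = clamp_curve l \<gamma>"
    have lip: "lip1 \<gamma>'" unfolding \<gamma>'_def by (rule lip1_clamp_curve[OF cv])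
    note [measurable] = lip1_measurable[OF lip]
    have \<gamma>': "\<gamma>' t = \<gamma> t" if "0 \<le> t" "t \<le> l" for t using that by (simp add: \<gamma>'_def clamp_curve_eq)
    have F_sub: "(\<integral>\<^sup>+t\<in>{a..b}. F (\<gamma>' t) \<partial>lborel) < 1" if "0 \<le> a" "b \<le> l" for a b
    proof -
      have "(\<integral>\<^sup>+t\<in>{a..b}. F (\<gamma>' t) \<partial>lborel) \<le> line_integral l \<gamma> F"
        unfolding line_integral_clamp \<gamma>'_def using that by (intro nn_integral_mono) (auto split: split_indicator)
      then show ?thesis using lt1 by (rule order_le_less_trans)
    qed
    have q_le: "(\<integral>\<^sup>+t\<in>{a..b}. q (\<gamma>' t) \<partial>lborel) \<le> (\<integral>\<^sup>+t\<in>{a..b}. F (\<gamma>' t) \<partial>lborel)"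
      and q2_le: "(\<integral>\<^sup>+t\<in>{a..b}. q2 (\<gamma>' t) \<partial>lborel) \<le> (\<integral>\<^sup>+t\<in>{a..b}. F (\<gamma>' t) \<partial>lborel)" for a b
      by (auto intro!: nn_integral_mono mult_right_mono simp: F_def)
    have q_fin: "(\<integral>\<^sup>+t\<in>{a..b}. q (\<gamma>' t) \<partial>lborel) < \<infinity>" and q2_fin: "(\<integral>\<^sup>+t\<in>{a..b}. q2 (\<gamma>' t) \<partial>lborel) < \<infinity>"
      if "0 \<le> a" "b \<le> l" for a b
      using order_le_less_trans[OF order_trans[OF q_le less_imp_le[OF F_sub[OF that]]], of top]
        order_le_less_trans[OF order_trans[OF q2_le less_imp_le[OF F_sub[OF that]]], of top] by auto
    define I where "I t = enn2real (\<integral>\<^sup>+s\<in>{0..t}. q (\<gamma>' s) \<partial>lborel)" for t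
    define I2 where "I2 t = enn2real (\<integral>\<^sup>+s\<in>{0..t}. q2 (\<gamma>' s) \<partial>lborel)" for t
    have I_diff: "(\<integral>\<^sup>+t\<in>{a..b}. q (\<gamma>' t) \<partial>lborel) = ennreal (I b - I a)" "I a \<le> I b" 
      and I2_diff: "(\<integral>\<^sup>+t\<in>{a..b}. q2 (\<gamma>' t) \<partial>lborel) = ennreal (I2 b - I2 a)" "I2 a \<le> I2 b" 
      if "0 \<le> a" "a \<le> b" "b \<le> l" for a b
      unfolding I_def I2_def using that q_fin[of 0 b] q2_fin[of 0 b]
      by (auto intro!: enn2real_Icc_diff(1)[symmetric] enn2real_Icc_diff(2))
    have inc: "\<bar>\<phi> (\<gamma> b) - \<phi> (\<gamma> a)\<bar> \<le> I b - I a" if ab: "0 \<le> a" "a \<le> b" "b \<le> \<tau>" for a b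
    proof (cases "a = b")
      case False
      then have ab': "0 \<le> a" "a < b" "b \<le> l" using ab \<tau> by auto
      have sub: "line_integral (b - a) (\<lambda>t. \<gamma> (a + t)) f = (\<integral>\<^sup>+t\<in>{a..b}. f (\<gamma>' t) \<partial>lborel)"
        if [measurable]: "f \<in> borel_measurable borel" for f :: "'a \<Rightarrow> ennreal"
      proof -
        have "line_integral (b - a) (\<lambda>t. \<gamma> (a + t)) f = line_integral (b - a) (\<lambda>t. \<gamma>' (a + t)) f"
          using ab' by (intro line_integral_cong) (auto simp: \<gamma>')
        also have "\<dots> = (\<integral>\<^sup>+t\<in>{a..b}. f (\<gamma>' t) \<partial>lborel)"
          using ab' by (intro line_integral_subcurve lip) auto
        finally show ?thesis .
      qed
      have "endpoint_diff (u (\<gamma> a)) (u (\<gamma> b)) \<le> (\<integral>\<^sup>+t\<in>{a..b}. q (\<gamma>' t) \<partial>lborel)"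
      proof (cases "endpoint_diff (u (\<gamma> (a + 0))) (u (\<gamma> (a + (b - a)))) \<le> line_integral (b - a) (\<lambda>t. \<gamma> (a + t)) g")
        case True
        then have "endpoint_diff (u (\<gamma> a)) (u (\<gamma> b)) \<le> line_integral (b - a) (\<lambda>t. \<gamma> (a + t)) g" by simp
        also have "\<dots> \<le> line_integral (b - a) (\<lambda>t. \<gamma> (a + t)) q"
          unfolding line_integral_lborel
        proof (rule nn_integral_mono_AE)
          \<comment> \<open>The end point is left out: at the exit time the curve may be outside
            \<Omega>, where \<open>q\<close> need not dominate \<open>g\<close>.\<close>
          show "AE t in lborel. g (\<gamma> (a + t)) * indicator {0..b - a} t \<le> q (\<gamma> (a + t)) * indicator {0..b - a} t"
            using AE_lborel_singleton[of "b - a"]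
          proof eventually_elim
            case (elim t)
            show ?case
            proof (cases "t \<in> {0..b - a}")
              case True
              then have "\<gamma> (a + t) \<in> \<Omega>" using \<tau>(4)[of "a + t"] ab elim by auto
              then have "g (\<gamma> (a + t)) \<le> q (\<gamma> (a + t))"
                using order_trans[OF _ q(2)[of "\<gamma> (a + t)"], of "g (\<gamma> (a + t))"] by (simp add: add_increasing2)
              then show ?thesis using True by simp
            qed simp
          qed
        qed
        finally show ?thesis using sub[OF qm] by simp
      next
        case False
        have "\<infinity> = line_integral (b - a) (\<lambda>t. \<gamma> (a + t)) \<rho>"
          using \<rho>_bad[OF arc_length_curve_subcurve[OF cv ab'] False] by simp
        also have "\<dots> \<le> line_integral (b - a) (\<lambda>t. \<gamma> (a + t)) q"
          using q(2) by (intro line_integral_mono) (metis add_increasing order_refl order_trans zero_le)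
        also have "\<dots> = (\<integral>\<^sup>+t\<in>{a..b}. q (\<gamma>' t) \<partial>lborel)" by (rule sub[OF qm])
        finally show ?thesis by (simp add: top_unique)
      qed
      then have "ennreal \<bar>\<phi> (\<gamma> b) - \<phi> (\<gamma> a)\<bar> \<le> ennreal (I b - I a)"
        using I_diff(1)[of a b] ab' by (simp add: endpoint_diff_def \<phi>(1) abs_minus_commute)
      then show ?thesis using I_diff(2)[of a b] ab' by simp
    qed simp
    define \<eta> where "\<eta> t = max 0 (min 1 ((R - dist x\<^sub>0 (\<gamma> t)) * c))" for t
    have eta: "0 \<le> \<eta> t" "\<eta> t \<le> 1" for t by (auto simp: \<eta>_def)
    have eta_lip: "\<bar>\<eta> b - \<eta> a\<bar> \<le> (b - a) * c" if ab: "0 \<le> a" "a \<le> b" "b \<le> l" for a b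
    proof -
      have "\<bar>dist x\<^sub>0 (\<gamma> b) - dist x\<^sub>0 (\<gamma> a)\<bar> \<le> dist (\<gamma> a) (\<gamma> b)"
        using dist_triangle[of x\<^sub>0 "\<gamma> b" "\<gamma> a"] dist_triangle[of x\<^sub>0 "\<gamma> a" "\<gamma> b"] by (simp add: dist_commute abs_le_iff)
      also have "\<dots> \<le> b - a" using arc_length_curve_dist[OF cv ab] .
      finally have "\<bar>dist x\<^sub>0 (\<gamma> b) - dist x\<^sub>0 (\<gamma> a)\<bar> * c \<le> (b - a) * c" using c by (intro mult_right_mono) auto
      then have "\<bar>(R - dist x\<^sub>0 (\<gamma> b)) * c - (R - dist x\<^sub>0 (\<gamma> a)) * c\<bar> \<le> (b - a) * c"
        using c by (simp add: abs_mult[symmetric, of _ c, simplified] left_diff_distrib[symmetric] abs_mult abs_minus_commute)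
      then show ?thesis unfolding \<eta>_def by (auto simp: max_def min_def abs_le_iff)
    qed
    define G where "G t = \<phi> (\<gamma> t) * \<eta> t" for t
    have G0: "G 0 = 1"
    proof -
      have "dist x\<^sub>0 (\<gamma> 0) \<le> r" using E start by (auto simp: subset_iff less_imp_le)
      then have "(R - r) * c \<le> (R - dist x\<^sub>0 (\<gamma> 0)) * c" using c by (intro mult_right_mono) auto
      moreover have "(R - r) * c = 1" using c by (simp add: R_def)
      ultimately have "\<eta> 0 = 1" by (simp add: \<eta>_def)
      then show ?thesis using \<phi>_E[OF start] by (simp add: G_def)
    qed
    have G1: "G \<tau> = 0"
    proof (cases "\<gamma> \<tau> \<in> \<Omega>")
      case True
      then have "R \<le> dist x\<^sub>0 (\<gamma> \<tau>)" using \<tau>(3) by auto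
      then have "(R - dist x\<^sub>0 (\<gamma> \<tau>)) * c \<le> 0" using c by (intro mult_nonpos_nonneg) auto
      then show ?thesis by (simp add: G_def \<eta>_def)
    qed (simp add: G_def \<phi>_out)
    \<comment> \<open>The product rule on short intervals: \<phi> at time \<open>a\<close> exceeds
      \<phi> at time \<open>t\<close> by at most \<open>J\<close>, so on an interval of length at
      most \<open>\<delta> / c\<close> the term from the slope of the cutoff is at most
      \<open>J2\<close> plus \<delta> times \<open>J\<close>. The factor disappears as \<delta>
      tends to 0.\<close>
    have key: "1 \<le> (1 + \<delta>) * I \<tau> + I2 \<tau>" if \<delta>: "0 < \<delta>" for \<delta>
    proof -
      have "\<bar>G \<tau> - G 0\<bar> \<le> ((1 + \<delta>) * I \<tau> + I2 \<tau>) - ((1 + \<delta>) * I 0 + I2 0)"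
      proof (rule local_increment_bound[where \<delta>="\<delta> / c" and I="\<lambda>t. (1 + \<delta>) * I t + I2 t"])
        fix a b assume ab: "0 \<le> a" "a \<le> b" "b \<le> \<tau>" "b - a \<le> \<delta> / c"
        then have abl: "b \<le> l" using \<tau> by simp
        define J where "J = I b - I a"
        define J2 where "J2 = I2 b - I2 a"
        have J: "0 \<le> J" "0 \<le> J2" using I_diff(2)[of a b] I2_diff(2)[of a b] ab abl by (auto simp: J_def J2_def)
        have "c * \<phi> (\<gamma> a) * (b - a) \<le> J2 + c * J * (b - a)"
        proof -
          have "ennreal (c * \<phi> (\<gamma> a) * (b - a)) = (\<integral>\<^sup>+t. ennreal (c * \<phi> (\<gamma> a)) * indicator {a..b} t \<partial>lborel)"
            using ab c \<phi>(2) by (simp add: nn_integral_cmult_indicator ennreal_mult)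
          also have "\<dots> \<le> (\<integral>\<^sup>+t. q2 (\<gamma>' t) * indicator {a..b} t + ennreal (c * J) * indicator {a..b} t \<partial>lborel)"
          proof (rule nn_integral_mono)
            fix t
            show "ennreal (c * \<phi> (\<gamma> a)) * indicator {a..b} t \<le> q2 (\<gamma>' t) * indicator {a..b} t + ennreal (c * J) * indicator {a..b} t"
            proof (cases "t \<in> {a..b}")
              case True
              then have "\<phi> (\<gamma> a) \<le> \<phi> (\<gamma> t) + J"
                using inc[of a t] I_diff(2)[of t b] ab abl unfolding J_def by auto
              then have "c * \<phi> (\<gamma> a) \<le> c * \<phi> (\<gamma> t) + c * J" using c mult_left_mono[of "\<phi> (\<gamma> a)" "\<phi> (\<gamma> t) + J" c] by (simp add: distrib_left)
              then have "ennreal (c * \<phi> (\<gamma> a)) \<le> ennreal (c * \<phi> (\<gamma> t) + c * J)" by (rule ennreal_leI)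
              also have "\<dots> = ennreal c * ennreal (\<phi> (\<gamma> t)) + ennreal (c * J)"
                using c \<phi>(2) J by (simp add: ennreal_mult)
              also have "\<dots> \<le> q2 (\<gamma> t) + ennreal (c * J)" by (intro add_right_mono q2)
              finally show ?thesis using True ab abl by (simp add: \<gamma>')
            qed simp
          qed
          also have "\<dots> = (\<integral>\<^sup>+t\<in>{a..b}. q2 (\<gamma>' t) \<partial>lborel) + ennreal (c * J) * ennreal (b - a)"
            using ab by (subst nn_integral_add) (auto simp: nn_integral_cmult_indicator)
          also have "\<dots> = ennreal J2 + ennreal (c * J * (b - a))"
            using I2_diff(1)[of a b] ab abl c J by (simp add: J2_def ennreal_mult)
          also have "\<dots> = ennreal (J2 + c * J * (b - a))" using J c ab by (intro ennreal_plus[symmetric]) auto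
          finally show ?thesis using J c ab by (subst (asm) ennreal_le_iff) auto
        qed
        moreover have "c * J * (b - a) \<le> \<delta> * J"
        proof -
          have "c * (b - a) \<le> \<delta>" using ab(4) c by (simp add: field_simps)
          then have "c * (b - a) * J \<le> \<delta> * J" using J by (intro mult_right_mono)
          then show ?thesis by (simp add: ac_simps)
        qed
        ultimately have *: "\<phi> (\<gamma> a) * ((b - a) * c) \<le> J2 + \<delta> * J" by (simp add: ac_simps)
        have "G b - G a = (\<phi> (\<gamma> b) - \<phi> (\<gamma> a)) * \<eta> b + \<phi> (\<gamma> a) * (\<eta> b - \<eta> a)"
          by (simp add: G_def algebra_simps)
        then have "\<bar>G b - G a\<bar> \<le> \<bar>\<phi> (\<gamma> b) - \<phi> (\<gamma> a)\<bar> * \<eta> b + \<phi> (\<gamma> a) * \<bar>\<eta> b - \<eta> a\<bar>"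
          using eta(1)[of b] \<phi>(2)[of "\<gamma> a"] by (metis abs_mult abs_of_nonneg abs_triangle_ineq)
        also have "\<dots> \<le> J * 1 + \<phi> (\<gamma> a) * ((b - a) * c)"
          using inc[of a b] eta[of b] eta_lip[of a b] \<phi>(2) J ab abl
          by (intro add_mono mult_mono mult_left_mono) (auto simp: J_def)
        also have "\<dots> \<le> J + (J2 + \<delta> * J)" using * by simp
        finally show "\<bar>G b - G a\<bar> \<le> ((1 + \<delta>) * I b + I2 b) - ((1 + \<delta>) * I a + I2 a)"
          by (simp add: J_def J2_def algebra_simps)
      qed (use \<delta> c \<tau> in auto)
      moreover have "0 \<le> I 0" "0 \<le> I2 0" by (auto simp: I_def I2_def)
      moreover have "0 \<le> (1 + \<delta>) * I 0" using \<delta> \<open>0 \<le> I 0\<close> by simp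
      ultimately show ?thesis using G0 G1 by simp
    qed
    have "1 \<le> I \<tau> + I2 \<tau>"
    proof (rule field_le_epsilon)
      fix e :: real assume e: "0 < e"
      have I0: "0 \<le> I \<tau>" by (simp add: I_def)
      have "1 \<le> (1 + e / (I \<tau> + 1)) * I \<tau> + I2 \<tau>" using e I0 by (intro key) (simp add: add_nonneg_pos)
      also have "\<dots> = I \<tau> + I2 \<tau> + e * (I \<tau> / (I \<tau> + 1))" by (simp add: algebra_simps)
      also have "e * (I \<tau> / (I \<tau> + 1)) \<le> e * 1" using e I0 by (intro mult_left_mono) auto
      finally show "1 \<le> I \<tau> + I2 \<tau> + e" by simp
    qed
    then have "ennreal 1 \<le> ennreal (I \<tau> + I2 \<tau>)" by (rule ennreal_leI)
    also have "\<dots> = (\<integral>\<^sup>+t\<in>{0..\<tau>}. q (\<gamma>' t) \<partial>lborel) + (\<integral>\<^sup>+t\<in>{0..\<tau>}. q2 (\<gamma>' t) \<partial>lborel)"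
      using q_fin[of 0 \<tau>] q2_fin[of 0 \<tau>] \<tau> by (simp add: I_def I2_def ennreal_plus)
    also have "\<dots> = (\<integral>\<^sup>+t\<in>{0..\<tau>}. F (\<gamma>' t) \<partial>lborel)"
      unfolding F_def by (subst nn_integral_add[symmetric]) (auto simp: distrib_right)
    also have "\<dots> < 1" using F_sub[of 0 \<tau>] \<tau> by simp
    finally show False by simp
  qed
  have FM: "F \<in> borel_measurable M" by (rule measurable_M[OF Fm])
  have F_fin: "(\<integral>\<^sup>+x. F x epowr p \<partial>M) < \<infinity>" using F_int by (rule order_le_less_trans) simp
  define f where "f x = enn2real (F x)" for x
  have "f \<in> borel_measurable borel" unfolding f_def by measurable
  moreover have "0 \<le> f x" for x by (simp add: f_def)
  moreover have "(\<integral>\<^sup>+x. ennreal (norm (f x) powr p) \<partial>M) \<le> ennreal (C + d)"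
  proof -
    have "(\<integral>\<^sup>+x. ennreal (norm (f x) powr p) \<partial>M) \<le> (\<integral>\<^sup>+x. F x epowr p \<partial>M)"
      by (intro nn_integral_mono) (auto simp: f_def ennreal_powr_def)
    then show ?thesis using F_int by (rule order_trans)
  qed
  moreover have "aec (\<lambda>l \<gamma>. \<gamma> 0 \<in> E \<longrightarrow> \<gamma> l \<notin> \<Omega> \<inter> ball x\<^sub>0 R \<longrightarrow> 1 \<le> line_integral l \<gamma> (\<lambda>x. ennreal (f x)))"
    using aec_finite[OF Fm F_fin]
  proof (rule aec_mono)
    fix l \<gamma> assume cv: "arc_length_curve UNIV l \<gamma>" and fin: "line_integral l \<gamma> F < \<infinity>"
    show "\<gamma> 0 \<in> E \<longrightarrow> \<gamma> l \<notin> \<Omega> \<inter> ball x\<^sub>0 R \<longrightarrow> 1 \<le> line_integral l \<gamma> (\<lambda>x. ennreal (f x))"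
      using adm[OF cv] line_integral_enn2real[OF cv Fm fin] by (simp add: f_def)
  qed
  ultimately show ?thesis by blast
qed

end

section \<open>Exhaustion of unbounded sets and comparison of the capacities\<close>

context weighted_space
begin

text \<open>The given competitors serve one bounded part of \<open>E\<close> each, and their exit
  radii may grow with the part. Densities admissible for \<open>E' i\<close> form shrinking sets
  closed under midpoints, so one function \<open>H\<close> of almost the same energy dominates
  suitable densities for all \<open>i\<close> at once.\<close>

lemma hkm_cap_le_of_cap_bounded_le:
  fixes E \<Omega> :: "'a set" and x\<^sub>0 :: 'a
  assumes \<Omega>: "open \<Omega>" and E: "E \<subseteq> \<Omega>" and C: "0 \<le> C"
    and cap: "\<And>i::nat. cap_bounded p M (E \<inter> ball x\<^sub>0 (real i)) \<Omega> \<le> ennreal C"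
  shows "hkm_cap p M E \<Omega> \<le> ennreal C"
proof -
  \<comment> \<open>\<open>Suc i\<close> makes the radius positive, as
    \<open>newtonian_competitor_gives_admissible\<close> requires.\<close>
  define E' where "E' i = E \<inter> ball x\<^sub>0 (real (Suc i))" for i
  define adm where "adm i R f \<longleftrightarrow> aec (\<lambda>l \<gamma>. \<gamma> 0 \<in> E' i \<longrightarrow> \<gamma> l \<notin> \<Omega> \<inter> ball x\<^sub>0 R \<longrightarrow> 1 \<le> line_integral l \<gamma> (\<lambda>x. ennreal (f x)))"
    for i R and f :: "'a \<Rightarrow> real"
  \<comment> \<open>The radius is existential because each competitor brings its own; for a midpoint
    the larger of the two works.\<close>
  define A where "A i = {f. f \<in> borel_measurable borel \<and> (\<forall>x. 0 \<le> f x) \<and> (\<exists>R. adm i R f)}" for i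
  have adm_mono: "adm i' R' f" if "adm i R f" "i' \<le> i" "R \<le> R'" for i i' R R' f
    using that(1) unfolding adm_def
  proof (rule aec_mono, intro impI)
    fix l \<gamma> assume "\<gamma> 0 \<in> E' i \<longrightarrow> \<gamma> l \<notin> \<Omega> \<inter> ball x\<^sub>0 R \<longrightarrow> 1 \<le> line_integral l \<gamma> (\<lambda>x. ennreal (f x))"
      and "\<gamma> 0 \<in> E' i'" "\<gamma> l \<notin> \<Omega> \<inter> ball x\<^sub>0 R'"
    moreover have "\<gamma> 0 \<in> E' i" using \<open>\<gamma> 0 \<in> E' i'\<close> that(2) by (auto simp: E'_def)
    moreover have "\<gamma> l \<notin> \<Omega> \<inter> ball x\<^sub>0 R" using \<open>\<gamma> l \<notin> \<Omega> \<inter> ball x\<^sub>0 R'\<close> that(3) by auto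
    ultimately show "1 \<le> line_integral l \<gamma> (\<lambda>x. ennreal (f x))" by blast
  qed
  have seq: "\<exists>f. (\<forall>i. f i \<in> A i) \<and>
    (\<integral>\<^sup>+x. (ennreal (norm (f 0 x)) + (\<Sum>i. ennreal (1 * norm (f (Suc i) x - f i x)))) epowr p \<partial>M) \<le> ennreal (C + e)"
    if e: "0 < e" for e
  proof (rule fast_cauchy_minimizing_sequence[OF p C _ e])
    show "f \<in> borel_measurable M" if "f \<in> A i" for f i using that by (auto simp: A_def intro: measurable_M)
    show "A (Suc i) \<subseteq> A i" for i unfolding A_def using adm_mono[of "Suc i" _ _ i] by fastforce
    show "(\<lambda>x. (1/2) *\<^sub>R (f x + g x)) \<in> A i" if fg: "f \<in> A i" "g \<in> A i" for f g i
    proof -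
      obtain R R' where f: "f \<in> borel_measurable borel" "\<And>x. 0 \<le> f x" "adm i R f"
        and g: "g \<in> borel_measurable borel" "\<And>x. 0 \<le> g x" "adm i R' g" using fg by (auto simp: A_def)
      note [measurable] = f(1) g(1)
      have f': "adm i (max R R') f" and g': "adm i (max R R') g"
        using adm_mono[OF f(3), of i "max R R'"] adm_mono[OF g(3), of i "max R R'"] by auto
      have "adm i (max R R') (\<lambda>x. (1/2) *\<^sub>R (f x + g x))"
        using aec_conj[OF f'[unfolded adm_def] g'[unfolded adm_def]] unfolding adm_def
      proof (rule aec_mono, intro impI)
        fix l \<gamma> assume cv: "arc_length_curve UNIV l \<gamma>"
          and "(\<gamma> 0 \<in> E' i \<longrightarrow> \<gamma> l \<notin> \<Omega> \<inter> ball x\<^sub>0 (max R R') \<longrightarrow> 1 \<le> line_integral l \<gamma> (\<lambda>x. ennreal (f x))) \<and>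
            (\<gamma> 0 \<in> E' i \<longrightarrow> \<gamma> l \<notin> \<Omega> \<inter> ball x\<^sub>0 (max R R') \<longrightarrow> 1 \<le> line_integral l \<gamma> (\<lambda>x. ennreal (g x)))"
          and "\<gamma> 0 \<in> E' i" "\<gamma> l \<notin> \<Omega> \<inter> ball x\<^sub>0 (max R R')"
        then have ge: "1 \<le> line_integral l \<gamma> (\<lambda>x. ennreal (f x))" "1 \<le> line_integral l \<gamma> (\<lambda>x. ennreal (g x))" by blast+
        note [measurable] = lip1_measurable[OF lip1_clamp_curve[OF cv]]
        have "1 = ennreal (1/2 * 2)" by simp
        also have "\<dots> = ennreal (1/2) * ennreal 2" by (rule ennreal_mult) auto
        also have "ennreal 2 = 1 + 1" by (metis ennreal_1 ennreal_plus one_add_one zero_le_one)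
        also have "ennreal (1/2) * (1 + 1) \<le> ennreal (1/2) * (line_integral l \<gamma> (\<lambda>x. ennreal (f x)) + line_integral l \<gamma> (\<lambda>x. ennreal (g x)))"
          by (intro mult_left_mono add_mono ge) auto
        also have "\<dots> = (\<integral>\<^sup>+t. ennreal (1/2) * (ennreal (f (clamp_curve l \<gamma> t)) * indicator {0..l} t + ennreal (g (clamp_curve l \<gamma> t)) * indicator {0..l} t) \<partial>lborel)"
          unfolding line_integral_clamp by (simp add: nn_integral_cmult nn_integral_add)
        also have "\<dots> = line_integral l \<gamma> (\<lambda>x. ennreal ((1/2) *\<^sub>R (f x + g x)))"
          unfolding line_integral_clamp
        proof (rule nn_integral_cong)
          fix t
          have "ennreal ((1/2) *\<^sub>R (f (clamp_curve l \<gamma> t) + g (clamp_curve l \<gamma> t))) = ennreal (1/2) * (ennreal (f (clamp_curve l \<gamma> t)) + ennreal (g (clamp_curve l \<gamma> t)))"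
            unfolding real_scaleR_def ennreal_plus[OF f(2) g(2), symmetric]
            by (rule ennreal_mult) (use f(2) g(2) in \<open>auto intro: add_nonneg_nonneg\<close>)
          then show "ennreal (1/2) * (ennreal (f (clamp_curve l \<gamma> t)) * indicator {0..l} t + ennreal (g (clamp_curve l \<gamma> t)) * indicator {0..l} t) =
              ennreal ((1/2) *\<^sub>R (f (clamp_curve l \<gamma> t) + g (clamp_curve l \<gamma> t))) * indicator {0..l} t"
            by (simp split: split_indicator)
        qed
        finally show "1 \<le> line_integral l \<gamma> (\<lambda>x. ennreal ((1/2) *\<^sub>R (f x + g x)))" .
      qed
      moreover have "(\<lambda>x. (1/2) *\<^sub>R (f x + g x)) \<in> borel_measurable borel" by measurable
      ultimately show ?thesis using f(2) g(2) by (auto simp: A_def)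
    qed
    show "\<exists>f\<in>A i. (\<integral>\<^sup>+x. ennreal (norm (f x) powr p) \<partial>M) \<le> ennreal (C + d)" if d: "0 < d" for i d
    proof -
      have "cap_bounded p M (E' i) \<Omega> < ennreal (C + d / 2)"
        unfolding E'_def using C d by (intro order_le_less_trans[OF cap] ennreal_lessI) auto
      then obtain u where u: "u \<in> newtonian_space p M" "\<And>x. indicator (E' i) x \<le> u x" "\<And>x. u x \<le> indicator \<Omega> x"
        "(\<integral>\<^sup>+x\<in>\<Omega>. minimal_weak_upper_gradient p M u x epowr p \<partial>M) < ennreal (C + d / 2)"
        unfolding cap_bounded_def by (auto simp: INF_less_iff)
      have "E' i \<subseteq> ball x\<^sub>0 (real (Suc i))" by (auto simp: E'_def)
      from newtonian_competitor_gives_admissible[OF \<Omega> u(1,2,3) this _ _ less_imp_le[OF u(4)], of "d / 2"]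
      obtain f R where "f \<in> borel_measurable borel" "\<forall>x. 0 \<le> f x" "(\<integral>\<^sup>+x. ennreal (norm (f x) powr p) \<partial>M) \<le> ennreal (C + d / 2 + d / 2)"
        "adm i R f" using C d unfolding adm_def by auto
      moreover have "C + d / 2 + d / 2 = C + d" by simp
      ultimately show ?thesis unfolding A_def by (intro bexI[of _ f]) auto
    qed
  qed simp
  \<comment> \<open>Origin of the bound: \<open>C + e\<close> for \<open>H\<close>, one
    \<open>e\<close> each for the exceptional curves, the semicontinuous majorant and the weight
    \<theta>, and one more for the test function. The cost threshold is \<open>1 - e\<close>, and
    the test function keeps at least \<open>1 - e - e\<close> of it.\<close>
  have main: "hkm_cap p M E \<Omega> \<le> ennreal ((C + 4 * e + e) * (1 / (1 - e - e)) powr p)" if e: "0 < e" "e < 1 / 4" for e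
  proof -
    obtain f where f: "\<And>i. f i \<in> A i" and f_int:
      "(\<integral>\<^sup>+x. (ennreal (norm (f 0 x)) + (\<Sum>i. ennreal (1 * norm (f (Suc i) x - f i x)))) epowr p \<partial>M) \<le> ennreal (C + e)"
      using seq[OF e(1)] by blast
    have f': "f i \<in> borel_measurable borel" "0 \<le> f i x" for i x using f[of i] by (auto simp: A_def)
    note [measurable] = f'(1)
    define H where "H x = ennreal (norm (f 0 x)) + (\<Sum>i. ennreal (1 * norm (f (Suc i) x - f i x)))" for x
    have Hm[measurable]: "H \<in> borel_measurable borel" unfolding H_def by measurable
    have f_le: "ennreal (f i x) \<le> H x" for i x
    proof -
      have "norm (f i x) \<le> norm (f 0 x) + (\<Sum>j<i. 1 * norm (f (Suc j) x - f j x))"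
      proof (induction i)
        case (Suc i)
        have "norm (f (Suc i) x) \<le> norm (f i x) + norm (f (Suc i) x - f i x)"
          using norm_triangle_ineq[of "f i x" "f (Suc i) x - f i x"] by simp
        then show ?case using Suc by simp
      qed simp
      then have "ennreal (f i x) \<le> ennreal (norm (f 0 x) + (\<Sum>j<i. 1 * norm (f (Suc j) x - f j x)))"
        using f'(2)[of i x] by (intro ennreal_leI) simp
      also have "\<dots> = ennreal (norm (f 0 x)) + (\<Sum>j<i. ennreal (1 * norm (f (Suc j) x - f j x)))"
        by (subst ennreal_plus) (auto intro: sum_nonneg)
      also have "\<dots> \<le> H x" unfolding H_def by (intro add_left_mono sum_le_suminf) auto
      finally show ?thesis .
    qed
    have "\<exists>R. adm i R (f i)" for i using f[of i] by (simp add: A_def)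
    then obtain R where R: "\<And>i. adm i (R i) (f i)" by metis
    \<comment> \<open>At least \<open>R i\<close>, for admissibility, and at least
      \<open>Suc i\<close>, for \<open>E' i \<subseteq> U i\<close>; cumulative, so that the sets
      \<open>U i\<close> increase.\<close>
    define R' where "R' i = real (Suc i) + (\<Sum>j\<le>i. \<bar>R j\<bar>)" for i
    have R'_ge: "R i \<le> R' i" "real (Suc i) \<le> R' i" for i
      using member_le_sum[of i "{..i}" "\<lambda>j. \<bar>R j\<bar>"] sum_nonneg[of "{..i}" "\<lambda>j. \<bar>R j\<bar>"] by (auto simp: R'_def)
    have R'_mono: "R' i \<le> R' j" if "i \<le> j" for i j
      unfolding R'_def using that by (intro add_mono sum_mono2) auto
    define U where "U i = \<Omega> \<inter> ball x\<^sub>0 (R' i)" for i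
    have U: "open (U i)" "bounded (U i)" "U i \<subseteq> \<Omega>" for i using \<Omega> by (auto simp: U_def bounded_Int)
    have U_mono: "U i \<subseteq> U j" if "i \<le> j" for i j using R'_mono[OF that] by (auto simp: U_def)
    have "aec (\<lambda>l \<gamma>. \<forall>i. \<gamma> 0 \<in> E' i \<longrightarrow> \<gamma> l \<notin> U i \<longrightarrow> 1 \<le> line_integral l \<gamma> (\<lambda>x. ennreal (f i x)))"
      unfolding U_def by (rule aec_all) (use adm_mono[OF R _ R'_ge(1)] in \<open>auto simp: adm_def\<close>)
    then have adm_H: "aec (\<lambda>l \<gamma>. \<forall>i. \<gamma> 0 \<in> E' i \<longrightarrow> \<gamma> l \<notin> U i \<longrightarrow> 1 \<le> line_integral l \<gamma> H)"
    proof (rule aec_mono, intro allI impI)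
      fix l \<gamma> i assume "\<forall>i. \<gamma> 0 \<in> E' i \<longrightarrow> \<gamma> l \<notin> U i \<longrightarrow> 1 \<le> line_integral l \<gamma> (\<lambda>x. ennreal (f i x))" "\<gamma> 0 \<in> E' i" "\<gamma> l \<notin> U i"
      then have "1 \<le> line_integral l \<gamma> (\<lambda>x. ennreal (f i x))" by blast
      also have "\<dots> \<le> line_integral l \<gamma> H" by (intro line_integral_mono f_le)
      finally show "1 \<le> line_integral l \<gamma> H" .
    qed
    obtain d1 where d1: "0 < d1" "\<And>f h. f \<in> borel_measurable M \<Longrightarrow> h \<in> borel_measurable M \<Longrightarrow>
        (\<integral>\<^sup>+x. f x epowr p \<partial>M) \<le> ennreal (C + e) \<Longrightarrow> (\<integral>\<^sup>+x. h x epowr p \<partial>M) \<le> ennreal d1 \<Longrightarrow>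
        (\<integral>\<^sup>+x. (f x + h x) epowr p \<partial>M) \<le> ennreal (C + e + e)"
      using nn_integral_epowr_add_small[OF p, of "C + e" e M] C e by auto
    obtain \<rho> :: "'a \<Rightarrow> ennreal" where \<rho>[measurable]: "\<rho> \<in> borel_measurable borel" and \<rho>_int: "(\<integral>\<^sup>+x. \<rho> x epowr p \<partial>M) \<le> ennreal d1"
      and \<rho>_bad: "\<And>l \<gamma>. arc_length_curve UNIV l \<gamma> \<Longrightarrow> \<not> (\<forall>i. \<gamma> 0 \<in> E' i \<longrightarrow> \<gamma> l \<notin> U i \<longrightarrow> 1 \<le> line_integral l \<gamma> H) \<Longrightarrow> line_integral l \<gamma> \<rho> = \<infinity>"
      using aec_small[OF adm_H d1(1)] by blast
    have "(\<integral>\<^sup>+x. (H x + \<rho> x) epowr p \<partial>M) \<le> ennreal (C + e + e)"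
      by (rule d1(2)[OF measurable_M[OF Hm] measurable_M[OF \<rho>] f_int[folded H_def] \<rho>_int])
    moreover have "(\<lambda>x. H x + \<rho> x) \<in> borel_measurable M" by (intro measurable_M) measurable
    from vitali_caratheodory[OF this e(1)] obtain q0 where q0: "lsc_fun q0" "\<And>x. H x + \<rho> x \<le> q0 x"
      "(\<integral>\<^sup>+x. q0 x epowr p \<partial>M) \<le> (\<integral>\<^sup>+x. (H x + \<rho> x) epowr p \<partial>M) + ennreal e" by blast
    ultimately have q0_int: "(\<integral>\<^sup>+x. q0 x epowr p \<partial>M) \<le> ennreal (C + 3 * e)"
    proof -
      assume "(\<integral>\<^sup>+x. (H x + \<rho> x) epowr p \<partial>M) \<le> ennreal (C + e + e)"
      then have "(\<integral>\<^sup>+x. q0 x epowr p \<partial>M) \<le> ennreal (C + e + e) + ennreal e"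
        using q0(3) by (meson add_right_mono order_trans)
      also have "\<dots> = ennreal (C + 3 * e)" using C e by (subst ennreal_plus[symmetric]) auto
      finally show ?thesis .
    qed
    have q0m: "q0 \<in> borel_measurable M" by (rule measurable_M[OF lsc_fun_measurable[OF q0(1)]])
    obtain d2 where d2: "0 < d2" "\<And>f h. f \<in> borel_measurable M \<Longrightarrow> h \<in> borel_measurable M \<Longrightarrow>
        (\<integral>\<^sup>+x. f x epowr p \<partial>M) \<le> ennreal (C + 3 * e) \<Longrightarrow> (\<integral>\<^sup>+x. h x epowr p \<partial>M) \<le> ennreal d2 \<Longrightarrow>
        (\<integral>\<^sup>+x. (f x + h x) epowr p \<partial>M) \<le> ennreal (C + 3 * e + e)"
      using nn_integral_epowr_add_small[OF p, of "C + 3 * e" e M] C e by auto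
    obtain \<theta> :: "'a \<Rightarrow> real" where \<theta>: "continuous_on UNIV \<theta>" "\<And>x. 0 < \<theta> x" "\<And>x. \<theta> x \<le> 1" "(\<integral>\<^sup>+x. ennreal (\<theta> x) \<partial>M) \<le> ennreal d2"
      using exists_integrable_weight[OF d2(1)] by blast
    have \<theta>m: "(\<lambda>x. ennreal (\<theta> x)) \<in> borel_measurable M"
      using borel_measurable_continuous_onI[OF \<theta>(1)] by (intro measurable_M) measurable
    have \<theta>_int: "(\<integral>\<^sup>+x. ennreal (\<theta> x) epowr p \<partial>M) \<le> ennreal d2"
    proof -
      have "(\<integral>\<^sup>+x. ennreal (\<theta> x) epowr p \<partial>M) \<le> (\<integral>\<^sup>+x. ennreal (\<theta> x) \<partial>M)"
      proof (rule nn_integral_mono)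
        fix x
        have "\<theta> x powr p \<le> \<theta> x powr 1" using \<theta>(2,3)[of x] p by (intro powr_mono') auto
        then show "ennreal (\<theta> x) epowr p \<le> ennreal (\<theta> x)"
          using \<theta>(2)[of x] by (simp add: epowr_ennreal ennreal_leI less_imp_le)
      qed
      then show ?thesis using \<theta>(4) by (rule order_trans)
    qed
    \<comment> \<open>\<theta> has a positive minimum on a closed ball around each bounded
      \<open>U i\<close>, which bounds the lengths of cheap paths there, and its energy is
      negligible.\<close>
    define q where "q x = q0 x + ennreal (\<theta> x)" for x
    have q_int: "(\<integral>\<^sup>+x. q x epowr p \<partial>M) \<le> ennreal (C + 4 * e)"
    proof -
      have "(\<integral>\<^sup>+x. q x epowr p \<partial>M) \<le> ennreal (C + 3 * e + e)"
        unfolding q_def by (rule d2(2)[OF q0m \<theta>m q0_int \<theta>_int])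
      also have "\<dots> = ennreal (C + 4 * e)" by (rule arg_cong[of _ _ ennreal]) simp
      finally show ?thesis .
    qed
    obtain Q0 where Q0: "lsc_approx Q0 q0" using q0(1) by (auto simp: lsc_fun_def)
    define Q where "Q k x = Q0 k x + \<theta> x" for k x
    have Q: "lsc_approx Q q"
    proof -
      have "(SUP k. ennreal (Q0 k x + \<theta> x)) = (SUP k. ennreal (Q0 k x)) + ennreal (\<theta> x)" for x
        using Q0 \<theta>(2)[of x] by (subst ennreal_SUP_add_left[symmetric]) (auto simp: lsc_approx_def less_imp_le)
      then show ?thesis
        using Q0 \<theta> by (auto simp: lsc_approx_def Q_def q_def incseq_def intro!: continuous_intros add_nonneg_nonneg intro: less_imp_le)
    qed
    have Q_lower: "\<exists>c>0. \<forall>y\<in>U i. c \<le> Q 0 y" for i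
    proof -
      have "cball x\<^sub>0 (R' i) \<noteq> {}" using R'_ge(2)[of i] by (auto simp: not_less)
      then obtain y0 where y0: "\<And>y. y \<in> cball x\<^sub>0 (R' i) \<Longrightarrow> \<theta> y0 \<le> \<theta> y"
        using continuous_attains_inf[OF compact_cball _ continuous_on_subset[OF \<theta>(1)]] by blast
      have "\<theta> y0 \<le> Q 0 y" if "y \<in> U i" for y
        using y0[of y] that Q0 by (auto simp: U_def Q_def lsc_approx_def add_increasing)
      then show ?thesis using \<theta>(2) by blast
    qed
    have q_adm: "1 \<le> line_integral l \<gamma> q"
      if cv: "arc_length_curve UNIV l \<gamma>" "\<gamma> 0 \<in> E' i" "\<gamma> l \<notin> U i" for l \<gamma> i
    proof -
      have le: "H x \<le> q x" "\<rho> x \<le> q x" for x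
        using q0(2)[of x] order_trans[OF _ q0(2)[of x], of "H x"] order_trans[OF _ q0(2)[of x], of "\<rho> x"]
        by (auto simp: q_def add_increasing add_increasing2)
      show ?thesis
      proof (cases "\<forall>i. \<gamma> 0 \<in> E' i \<longrightarrow> \<gamma> l \<notin> U i \<longrightarrow> 1 \<le> line_integral l \<gamma> H")
        case True
        then have "1 \<le> line_integral l \<gamma> H" using cv by blast
        also have "\<dots> \<le> line_integral l \<gamma> q" by (intro line_integral_mono le)
        finally show ?thesis .
      next
        case False
        have "line_integral l \<gamma> \<rho> \<le> line_integral l \<gamma> q" by (intro line_integral_mono le)
        then show ?thesis using \<rho>_bad[OF cv(1) False] by (simp add: top_unique)
      qed
    qed
    define a where "a = 1 - e"
    \<comment> \<open>On \<open>E' i\<close> all costs are at least 1; the strictly smaller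
      threshold \<open>a\<close> leaves room for an open neighbourhood.\<close>
    define G where "G i = {x \<in> U i. \<forall>(\<gamma>, L)\<in>exit_paths (U i) x. ennreal a < (\<integral>\<^sup>+t\<in>{0..L}. q (\<gamma> t) \<partial>lborel)}" for i
    have G_open: "open (G i)" for i
    proof -
      obtain c where "0 < c" "\<And>y. y \<in> U i \<Longrightarrow> c \<le> Q 0 y" using Q_lower[of i] by blast
      then show ?thesis unfolding G_def using e by (intro open_exit_paths_integral[OF U(1) Q]) (auto simp: a_def)
    qed
    have E_G: "E' i \<subseteq> G i" for i
    proof
      fix x assume x: "x \<in> E' i"
      then have xU: "x \<in> U i" using E R'_ge(2)[of i] by (auto simp: E'_def U_def)
      have "ennreal a < (\<integral>\<^sup>+t\<in>{0..L}. q (\<gamma> t) \<partial>lborel)" if path: "(\<gamma>, L) \<in> exit_paths (U i) x" for \<gamma> L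
      proof -
        have "ennreal a < ennreal 1" using e by (intro ennreal_lessI) (auto simp: a_def)
        also have "\<dots> \<le> (\<integral>\<^sup>+t\<in>{0..L}. q (\<gamma> t) \<partial>lborel)"
          using exit_paths_integral_ge[OF Q xU _ path] q_adm x by auto
        finally show ?thesis .
      qed
      then show "x \<in> G i" using xU by (auto simp: G_def)
    qed
    have G_mono: "G i \<subseteq> G j" if "i \<le> j" for i j
    proof
      fix x assume x: "x \<in> G i"
      have "exit_paths (U j) x \<subseteq> exit_paths (U i) x" using U_mono[OF that] by (auto simp: exit_paths_def)
      then show "x \<in> G j" using x U_mono[OF that] by (fastforce simp: G_def)
    qed
    \<comment> \<open>The sets \<open>G i\<close> increase, since leaving a larger
      \<open>U j\<close> means leaving \<open>U i\<close>. A compact subset of their union therefore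
      lies in a single \<open>G m\<close> and is treated inside the bounded set
      \<open>U m\<close>.\<close>
    define G' where "G' = (\<Union>i. G i)"
    have "cap_open p M G' \<Omega> \<le> ennreal ((C + 4 * e + e) * (1 / (a - e)) powr p)"
      unfolding cap_open_def
    proof (rule SUP_least)
      fix K assume "K \<in> {K. compact K \<and> K \<subseteq> G'}"
      then have K: "compact K" "K \<subseteq> (\<Union>i\<in>UNIV. G i)" by (auto simp: G'_def)
      obtain T where T: "finite T" "K \<subseteq> (\<Union>i\<in>T. G i)"
        using compactE_image[OF K(1) _ K(2)] G_open by metis
      obtain m where m: "\<And>i. i \<in> T \<Longrightarrow> i \<le> m" using finite_nat_set_iff_bounded_le T(1) by auto
      have KG: "K \<subseteq> G m" using T(2) G_mono m by blast
      then have KU: "K \<subseteq> U m" by (auto simp: G_def)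
      obtain c where c: "0 < c" "\<And>y. y \<in> U m \<Longrightarrow> c \<le> Q 0 y" using Q_lower[of m] by blast
      show "cap_compact p M K \<Omega> \<le> ennreal ((C + 4 * e + e) * (1 / (a - e)) powr p)"
      proof (rule cap_compact_le_exit_paths[OF U K(1) KU Q c _ q_int e(1)])
        show "ennreal a < (\<integral>\<^sup>+t\<in>{0..L}. q (\<gamma> t) \<partial>lborel)" if "x \<in> K" "(\<gamma>, L) \<in> exit_paths (U m) x" for x \<gamma> L
          using KG that by (auto simp: G_def)
      qed (use C e in \<open>auto simp: a_def\<close>)
    qed
    moreover have "hkm_cap p M E \<Omega> \<le> cap_open p M G' \<Omega>"
      unfolding hkm_cap_def
    proof (intro INF_lower CollectI conjI)
      show "open G'" unfolding G'_def using G_open by blast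
      show "G' \<subseteq> \<Omega>" unfolding G'_def G_def using U(3) by blast
      show "E \<subseteq> G'"
      proof
        fix x assume x: "x \<in> E"
        obtain n :: nat where "dist x\<^sub>0 x < real n" using reals_Archimedean2 by blast
        then have "x \<in> E' n" using x by (simp add: E'_def)
        then show "x \<in> G'" using E_G by (auto simp: G'_def)
      qed
    qed
    ultimately show ?thesis unfolding a_def by (rule order_trans[rotated])
  qed
  have "((\<lambda>e. ennreal ((C + 4 * e + e) * (1 / (1 - e - e)) powr p)) \<longlongrightarrow> ennreal ((C + 4 * 0 + 0) * (1 / (1 - 0 - 0)) powr p)) (at_right 0)"
    by (intro tendsto_ennrealI tendsto_intros) auto
  then have "((\<lambda>e. ennreal ((C + 4 * e + e) * (1 / (1 - e - e)) powr p)) \<longlongrightarrow> ennreal C) (at_right 0)" by simp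
  then show ?thesis
  proof (rule tendsto_lowerbound)
    show "\<forall>\<^sub>F e in at_right 0. hkm_cap p M E \<Omega> \<le> ennreal ((C + 4 * e + e) * (1 / (1 - e - e)) powr p)"
      using main by (intro eventually_at_rightI[of 0 "1/4"]) auto
  qed simp
qed

lemma cap_bounded_mono:
  fixes E F \<Omega> :: "'a set"
  assumes "E \<subseteq> F" shows "cap_bounded p M E \<Omega> \<le> cap_bounded p M F \<Omega>"
  unfolding cap_bounded_def
proof (rule INF_superset_mono)
  have "(indicator E x :: ereal) \<le> indicator F x" for x using assms by (auto simp: indicator_def)
  then show "{u \<in> newtonian_space p M. \<forall>x. indicator F x \<le> u x \<and> u x \<le> indicator \<Omega> x}
      \<subseteq> {u \<in> newtonian_space p M. \<forall>x. indicator E x \<le> u x \<and> u x \<le> indicator \<Omega> x}"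
    by (auto intro: order_trans)
qed simp

text \<open>For bounded \<open>E\<close> too, the lower bound runs through the truncations
  \<open>s i\<close>, which never exceed the Newtonian capacity. For unbounded \<open>E\<close>,
  monotonicity turns the limit into a supremum.\<close>

lemma newtonian_cap_eq_hkm_cap:
  fixes E \<Omega> :: "'a set"
  assumes \<Omega>: "open \<Omega>" and E: "E \<subseteq> \<Omega>"
  shows "newtonian_cap p M x\<^sub>0 E \<Omega> = hkm_cap p M E \<Omega>"
proof -
  have le: "cap_bounded p M F \<Omega> \<le> hkm_cap p M E \<Omega>" if F: "F \<subseteq> E" "bounded F" for F
    unfolding hkm_cap_def using F
    by (intro INF_greatest cap_bounded_le_cap_open \<Omega>) auto
  define s where "s i = cap_bounded p M (E \<inter> ball x\<^sub>0 (real i)) \<Omega>" for i :: nat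
  have s_mono: "s i \<le> s j" if "i \<le> j" for i j
    unfolding s_def using that by (intro cap_bounded_mono) auto
  have "s \<longlonglongrightarrow> (SUP i. s i)" by (rule LIMSEQ_SUP) (use s_mono in \<open>auto simp: incseq_def\<close>)
  then have lim: "lim s = (SUP i. s i)" by (rule limI)
  have le': "newtonian_cap p M x\<^sub>0 E \<Omega> \<le> hkm_cap p M E \<Omega>"
  proof (cases "bounded E")
    case True
    then show ?thesis using le[of E] by (simp add: newtonian_cap_def)
  next
    case False
    have "(SUP i. s i) \<le> hkm_cap p M E \<Omega>"
      unfolding s_def by (intro SUP_least le) (auto simp: bounded_Int)
    then show ?thesis using False lim by (simp add: newtonian_cap_def s_def[abs_def])
  qed
  have ge: "s i \<le> newtonian_cap p M x\<^sub>0 E \<Omega>" for i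
  proof (cases "bounded E")
    case True
    then show ?thesis by (auto simp: newtonian_cap_def s_def intro: cap_bounded_mono)
  next
    case False
    then have "newtonian_cap p M x\<^sub>0 E \<Omega> = (SUP i. s i)" using lim by (simp add: newtonian_cap_def s_def[abs_def])
    then show ?thesis by (simp add: SUP_upper)
  qed
  have "hkm_cap p M E \<Omega> \<le> newtonian_cap p M x\<^sub>0 E \<Omega>"
  proof (cases "newtonian_cap p M x\<^sub>0 E \<Omega> = top")
    case False
    define C where "C = enn2real (newtonian_cap p M x\<^sub>0 E \<Omega>)"
    have C: "newtonian_cap p M x\<^sub>0 E \<Omega> = ennreal C" "0 \<le> C" using False by (auto simp: C_def less_top)
    have "hkm_cap p M E \<Omega> \<le> ennreal C"
      by (rule hkm_cap_le_of_cap_bounded_le[OF \<Omega> E C(2), of x\<^sub>0]) (use ge in \<open>simp add: s_def C(1)\<close>)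
    then show ?thesis by (simp add: C(1))
  qed simp
  then show ?thesis using le' by (rule order.antisym[rotated])
qed

end

lemma weighted_space_weighted_measure:
  fixes w :: "'a::euclidean_space \<Rightarrow> ennreal"
  assumes p: "1 < p" and w: "weight w"
  shows "weighted_space (weighted_measure w) p"
proof
  have wm: "w \<in> borel_measurable lebesgue" using w by (simp add: weight_def)
  show "sets (weighted_measure w) = sets lebesgue" by (simp add: weighted_measure_def)
  show "emeasure (weighted_measure w) N = 0" if "N \<in> null_sets lborel" for N
  proof -
    have N: "N \<in> null_sets lebesgue" using that by (rule null_sets_completionI)
    have "AE x in lebesgue. w x * indicator N x = 0"
      using AE_not_in[OF N] by eventually_elim simp
    then have "(\<integral>\<^sup>+x. w x * indicator N x \<partial>lebesgue) = (\<integral>\<^sup>+x. 0 \<partial>(lebesgue :: 'a measure))"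
      by (rule nn_integral_cong_AE)
    then show ?thesis
      using N wm by (simp add: weighted_measure_def emeasure_density null_setsD2)
  qed
  show "emeasure (weighted_measure w) (cball 0 r) < \<infinity>" for r
    using w by (simp add: weighted_measure_def emeasure_density weight_def)
  show "1 < p" by fact
qed

theorem proposition7p2:
  fixes p :: real and w :: "real ^ 'n \<Rightarrow> ennreal" and E \<Omega> :: "(real ^ 'n) set" and x\<^sub>0 :: "real ^ 'n"
  assumes "1 < p"
    and "p_admissible p w"
    and "open \<Omega>" and "\<Omega> \<noteq> {}"
    and "E \<subseteq> \<Omega>"
  shows "newtonian_cap p (weighted_measure w) x\<^sub>0 E \<Omega> = hkm_cap p (weighted_measure w) E \<Omega>"
proof -
  interpret weighted_space "weighted_measure w" p
    using assms(1,2) by (intro weighted_space_weighted_measure) (auto simp: p_admissible_def)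
  show ?thesis by (rule newtonian_cap_eq_hkm_cap) fact+
qed

end
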